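(* Let $(B\subseteq A,\Omega^\bullet,\Omega^{(\bullet,\bullet)},\sigma)$ be a CQH-Hermitian space and let $\mathcal{F}$ be a covariant Hermitian holomorphic module over $B$ with finite-dimensional anti-holomorphic cohomology groups $H^{(0,k)}_{\overline{\partial}_{\mathcal{F}}}$. If $D^+_{\overline{\partial}_{\mathcal{F}}}$ is a Fredholm operator, then its index equals the anti-holomorphic Euler characteristic: $$\mathrm{index}\big(D^+_{\overline{\partial}_{\mathcal{F}}}\big)=\chi_{\overline{\partial}_{\mathcal{F}}}:=\sum_{k\in\mathbb{Z}_{\ge0}}(-1)^k\dim\big(H^{(0,k)}_{\overline{\partial}_{\mathcal{F}}}\big).$$
   Context: All algebras are unital over $\mathbb{C}$. A differential calculus (dc) over an algebra $B$ is a differential graded algebra $(\Omega^\bullet=\bigoplus_{k\ge 0}\Omega^k,\mathrm{d})$ (product $\wedge$) with $\Omega^0=B$, generated as an algebra by the elements $a,\mathrm{d}b$, $a,b\in B$; it has total degree $m$ if $\Omega^m\ne 0$ and $\Omega^k=0$ for $k>m$. For $B$ a $*$-algebra, a $*$-dc is a dc such that $*$ extends to a conjugate-linear involution of $\Omega^\bullet$ with $\mathrm{d}(\omega^* )=(\mathrm{d}\omega)^*$ and $(\omega\wedge\nu)^*=(-1)^{kl}\nu^*\wedge\omega^*$ for $\omega\in\Omega^k$, $\nu\in\Omega^l$. A complex structure is a $\mathbb{Z}^2_{\ge0}$-algebra grading $\Omega^{(\bullet,\bullet)}$ with $\Omega^k=\bigoplus_{a+b=k}\Omega^{(a,b)}$,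 $(\Omega^{(a,b)})^*=\Omega^{(b,a)}$, such that $\mathrm{d}=\partial+\overline{\partial}$ with $\partial$ of degree $(1,0)$ and $\overline{\partial}$ of degree $(0,1)$. Hermitian structure $(\Omega^{(\bullet,\bullet)},\sigma)$ on a $*$-dc of total degree $2n$: a complex structure and a central real ($\sigma^*=\sigma$) form $\sigma\in\Omega^{(1,1)}$ such that, for $L_\sigma(\omega):=\sigma\wedge\omega$, the maps $L_\sigma^{n-k}:\Omega^k\to\Omega^{2n-k}$, $k=0,\dots,n-1$, are isomorphisms. Primitive forms: $P^k:=\{\alpha\in\Omega^k: L_\sigma^{n-k+1}(\alpha)=0\}$ for $k\le n$, $P^k:=0$ for $k>n$; one has $\Omega^k=\bigoplus_j L_\sigma^j(P^{k-2j})$. The Hodge map $\ast_\sigma$ is determined by $\ast_\sigma(L_\sigma^j(\alpha))=(-1)^{k(k+1)/2}\mathbf{i}^{a-b}\frac{j!}{(n-j-k)!}L_\sigma^{n-j-k}(\alpha)$ for $\alpha\in P^k\cap\Omega^{(a,b)}$, $a+b=k$. The metric is the sesquilinear form (conjugate-linear in the first variable) $g_\sigma:\Omega^\bullet\times\Omega^\bullet\to B$, $g_\sigma(\omega,\nu)=\ast_\sigma(\ast_\sigma(\omega^* )\wedge\nu)$ for $\omega,\nu$ of equal degree, zero for different degrees. $B_{>0}$ is the set of non-zero elements of the form $\sum_i b_i^*b_i$; the structure is positive definite if $g_\sigma(\omega,\omega)\in B_{>0}$ for all $\omega\neq0$. A CQGA is a cosemisimple Hopf $*$-algebra whose Haar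 functional $\mathbf{h}$ is a state. A quantum homogeneous $A$-space is a left coideal subalgebra $B\subseteq A$ with $A$ faithfully flat as right $B$-module and $B^+A=AB^+$, $B^+:=\ker(\varepsilon)\cap B$; put $\pi_B(A):=A/B^+A$. A CQGA-homogeneous space is a quantum homogeneous space $B\subseteq A$ with $A,\pi_B(A)$ CQGAs, $B$ a $*$-subalgebra, and $\pi_B:A\to\pi_B(A)$ a Hopf $*$-map. ${}^A_B\mathrm{mod}_0$ is the category of left relative Hopf modules (left $A$-comodules and left $B$-modules, compatibly) finitely generated over $B$, with right $B$-action $fb=f_{(-2)}bS(f_{(-1)})f_{(0)}$ (i.e. under $\mathcal{F}\cong A\,\square_{\pi_B}(\mathcal{F}/B^+\mathcal{F})$, $f\mapsto f_{(-1)}\otimes[f_{(0)}]$, right multiplication by $b$ on $A$). A CQH-Hermitian space is a quadruple $(B\subseteq A,\Omega^\bullet,\Omega^{(\bullet,\bullet)},\sigma)$ with $B\subseteq A$ a CQGA-homogeneous space, $\Omega^\bullet$ a left $A$-covariant $*$-dc over $B$ (an object of ${}^A_B\mathrm{mod}_0$, $\mathrm d$ a comodule map), and $(\Omega^{(\bullet,\bullet)},\sigma)$ a positive definite Hermitian structure which is covariant (the bigrading is one of objects of ${}^A_B\mathrm{mod}_0$, $\sigma$ is coinvariant) and $\int$-closed: for $\int:=\mathbf{h}\circ\ast_\sigma:\Omega^{2n}\to\mathbb{C}$ one has $\int\circ\,\mathrm{d}=0$ on $\Omega^{2n-1}$. Modules. For a $B$-bimodule $\mathcal{F}$, $\mathcal{F}^\vee$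 is the bimodule of right $B$-module maps $\mathcal{F}\to B$ and $\overline{\mathcal{F}}$ the conjugate bimodule ($b\overline{f}=\overline{fb^*}$, $\overline{f}b=\overline{b^*f}$). A weak Hermitian module is a pair $(\mathcal{F},h_{\mathcal{F}})$ with $h_{\mathcal{F}}:\overline{\mathcal{F}}\to\mathcal{F}^\vee$ a bimodule isomorphism such that $h'_{\mathcal{F}}(f,k):=h_{\mathcal{F}}(\overline{f})(k)$ satisfies $h'_{\mathcal{F}}(f,k)=h'_{\mathcal{F}}(k,f)^*$ and $h'_{\mathcal{F}}(f,f)\in B_{>0}$ for $f\ne0$. It is an Hermitian module if $g_{\mathcal{F}}(\omega\otimes f,\nu\otimes k):=h'_{\mathcal{F}}(f,g_\sigma(\omega,\nu)k)$ makes $\Omega^\bullet\otimes_B\mathcal{F}$ a weak Hermitian module; covariant if $\mathcal{F}\in{}^A_B\mathrm{mod}_0$ and $h_{\mathcal{F}}$ is a morphism there. $L^2(\Omega^\bullet\otimes_B\mathcal{F})$ is the completion for the inner product $\langle-,-\rangle_{\mathcal{F}}:=\mathbf{h}\circ g_{\mathcal{F}}$, and similarly for its subspaces. A holomorphic module is a finitely generated projective left $B$-module $\mathcal{F}$ with a linear map $\overline{\partial}_{\mathcal{F}}:\mathcal{F}\to\Omega^{(0,1)}\otimes_B\mathcal{F}$, $\overline{\partial}_{\mathcal{F}}(bf)=\overline{\partial}b\otimes f+b\,\overline{\partial}_{\mathcal{F}}f$, whose extension $\overline{\partial}_{\mathcal{F}}(\omega\otimes f)=\overline{\partial}\omega\otimes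 f+(-1)^{|\omega|}\omega\wedge\overline{\partial}_{\mathcal{F}}f$ to $\Omega^\bullet\otimes_B\mathcal{F}$ satisfies $\overline{\partial}_{\mathcal{F}}^2=0$; covariant if $\mathcal{F}\in{}^A_B\mathrm{mod}_0$ and $\overline{\partial}_{\mathcal{F}}$ is a comodule map. A covariant Hermitian holomorphic module is both a covariant Hermitian and a covariant holomorphic module. $H^{(0,k)}_{\overline{\partial}_{\mathcal{F}}}$ is the $k$-th cohomology of $(\Omega^{(0,\bullet)}\otimes_B\mathcal{F},\overline{\partial}_{\mathcal{F}})$. With $\overline{\partial}_{\mathcal{F}}^\dagger$ the adjoint for $\langle-,-\rangle_{\mathcal{F}}$, $D_{\overline{\partial}_{\mathcal{F}}}:=\overline{\partial}_{\mathcal{F}}+\overline{\partial}_{\mathcal{F}}^\dagger$, also denoting its closure. $\Omega^{(0,\bullet)}_{\mathrm{even}}$, $\Omega^{(0,\bullet)}_{\mathrm{odd}}$ are the sums of $\Omega^{(0,k)}$ over even, resp. odd, $k$, and $D^+_{\overline{\partial}_{\mathcal{F}}}$ is the restriction $\mathrm{dom}(D_{\overline{\partial}_{\mathcal{F}}})\cap L^2(\Omega^{(0,\bullet)}_{\mathrm{even}}\otimes_B\mathcal{F})\to L^2(\Omega^{(0,\bullet)}_{\mathrm{odd}}\otimes_B\mathcal{F})$ of $D_{\overline{\partial}_{\mathcal{F}}}$. A densely defined closed operator $T$ is Fredholm if $\ker T$ and $\mathrm{coker}\,T$ are finite-dimensional; $\mathrm{index}(T)=\dim\ker T-\dim\mathrm{coker}\,T$.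 *)

theory Defs
  imports "HOL-Analysis.Analysis" "HOL-Library.Multiset"
begin

section \<open>Complex vector spaces, algebras and Hilbert spaces\<close>

class scaleC =
  fixes scaleC :: "complex \<Rightarrow> 'a \<Rightarrow> 'a" (infixr "*\<^sub>C" 75)

class complex_vector = scaleC + ab_group_add +
  assumes scaleC_add_right: "c *\<^sub>C (x + y) = c *\<^sub>C x + c *\<^sub>C y"
    and scaleC_add_left: "(c + c') *\<^sub>C x = c *\<^sub>C x + c' *\<^sub>C x"
    and scaleC_scaleC: "c *\<^sub>C c' *\<^sub>C x = (c * c') *\<^sub>C x"
    and scaleC_one: "1 *\<^sub>C x = x"

global_interpretation cvec: vector_space "scaleC :: complex \<Rightarrow> 'a \<Rightarrow> 'a::complex_vector"
  by standard (simp_all add: scaleC_add_right scaleC_add_left scaleC_scaleC scaleC_one)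

abbreviation clinear :: "('a::complex_vector \<Rightarrow> 'b::complex_vector) \<Rightarrow> bool"
  where "clinear \<equiv> Vector_Spaces.linear scaleC scaleC"

abbreviation cfunctional :: "('a::complex_vector \<Rightarrow> complex) \<Rightarrow> bool"
  where "cfunctional \<equiv> Vector_Spaces.linear scaleC (*)"

class complex_algebra_1 = complex_vector + ring_1 +
  assumes mult_scaleC_left: "(c *\<^sub>C x) * y = c *\<^sub>C (x * y)"
    and mult_scaleC_right: "x * (c *\<^sub>C y) = c *\<^sub>C (x * y)"

class complex_star_algebra = complex_algebra_1 +
  fixes star :: "'a \<Rightarrow> 'a" ("_\<^sup>\<star>" [1000] 999)
  assumes star_star: "(x\<^sup>\<star>)\<^sup>\<star> = x"
    and star_add: "(x + y)\<^sup>\<star> = x\<^sup>\<star> + y\<^sup>\<star>"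
    and star_scaleC: "(c *\<^sub>C x)\<^sup>\<star> = cnj c *\<^sub>C x\<^sup>\<star>"
    and star_mult: "(x * y)\<^sup>\<star> = y\<^sup>\<star> * x\<^sup>\<star>"

class complex_hilbert_space = complex_vector + banach +
  fixes cinner :: "'a \<Rightarrow> 'a \<Rightarrow> complex"
  assumes scaleR_scaleC: "r *\<^sub>R x = complex_of_real r *\<^sub>C x"
    and cinner_add_right: "cinner x (y + z) = cinner x y + cinner x z"
    and cinner_scaleC_right: "cinner x (c *\<^sub>C y) = c * cinner x y"
    and cinner_commute: "cinner x y = cnj (cinner y x)"
    and norm_eq_sqrt_cinner: "norm x = sqrt (Re (cinner x x))"

definition algebra_map :: "('a::complex_algebra_1 \<Rightarrow> 'b::complex_algebra_1) \<Rightarrow> bool"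
  where "algebra_map f \<longleftrightarrow> clinear f \<and> f 1 = 1 \<and> (\<forall>x y. f (x * y) = f x * f y)"

inductive_set algebra_generated :: "'a::complex_algebra_1 set \<Rightarrow> 'a set" for G where
  gen: "x \<in> G \<Longrightarrow> x \<in> algebra_generated G"
| one: "1 \<in> algebra_generated G"
| add: "x \<in> algebra_generated G \<Longrightarrow> y \<in> algebra_generated G \<Longrightarrow> x + y \<in> algebra_generated G"
| scale: "x \<in> algebra_generated G \<Longrightarrow> c *\<^sub>C x \<in> algebra_generated G"
| mult: "x \<in> algebra_generated G \<Longrightarrow> y \<in> algebra_generated G \<Longrightarrow> x * y \<in> algebra_generated G"

definition positive_elements :: "'b::complex_star_algebra set"
  where "positive_elements = {b. b \<noteq> 0 \<and> (\<exists>bs. b = (\<Sum>x\<leftarrow>bs. x\<^sup>\<star> * x))}"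

definition decomposes :: "'i set \<Rightarrow> ('i \<Rightarrow> 'a::complex_vector set) \<Rightarrow> 'a \<Rightarrow> ('i \<Rightarrow> 'a) \<Rightarrow> bool"
  where "decomposes I V x f \<longleftrightarrow>
    (\<forall>i\<in>I. f i \<in> V i) \<and> (\<forall>i. i \<notin> I \<longrightarrow> f i = 0) \<and> finite {i. f i \<noteq> 0} \<and> x = (\<Sum>i | f i \<noteq> 0. f i)"

definition is_direct_sum :: "'i set \<Rightarrow> ('i \<Rightarrow> 'a::complex_vector set) \<Rightarrow> 'a set \<Rightarrow> bool"
  where "is_direct_sum I V W \<longleftrightarrow>
    (\<forall>i\<in>I. cvec.subspace (V i)) \<and> W = {x. \<exists>f. decomposes I V x f} \<and>
    (\<forall>x\<in>W. \<exists>!f. decomposes I V x f)"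

definition finite_dimensional :: "'a::complex_vector set \<Rightarrow> bool"
  where "finite_dimensional V \<longleftrightarrow> (\<exists>S. finite S \<and> V \<subseteq> cvec.span S)"

text \<open>\<open>S\<close> represents a basis of the quotient \<open>V / W\<close>.\<close>

definition quotient_basis :: "'a::complex_vector set \<Rightarrow> 'a set \<Rightarrow> 'a set \<Rightarrow> bool"
  where "quotient_basis S V W \<longleftrightarrow> S \<subseteq> V \<and>
    (\<forall>v\<in>V. \<exists>!c. (\<forall>s. s \<notin> S \<longrightarrow> c s = 0) \<and> finite {s. c s \<noteq> 0} \<and>
       v - (\<Sum>s | c s \<noteq> 0. c s *\<^sub>C s) \<in> W)"

definition finite_dimensional_quotient :: "'a::complex_vector set \<Rightarrow> 'a set \<Rightarrow> bool"
  where "finite_dimensional_quotient V W \<longleftrightarrow> (\<exists>S. finite S \<and> quotient_basis S V W)"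

definition quotient_dim :: "'a::complex_vector set \<Rightarrow> 'a set \<Rightarrow> nat"
  where "quotient_dim V W =
    (if finite_dimensional_quotient V W then card (SOME S. quotient_basis S V W) else 0)"


section \<open>Tensor products\<close>

text \<open>
  For a right module \<open>M\<close> (a whole type, with action \<open>ra\<close>) and a left module with carrier \<open>N\<close>,
  addition \<open>addN\<close> and action \<open>la\<close>, the tensor product is the free commutative monoid on pairs,
  i.e. finite multisets, modulo the congruence below.  The quotient is a group because
  \<open>(m, n) + (-m, n)\<close> is identified with \<open>(0, n)\<close>, hence with the empty sum; the relations
  \<open>m \<otimes> 0 = 0\<close> follow.
\<close>

inductive tensor_eq :: "('m::ab_group_add \<Rightarrow> 'r \<Rightarrow> 'm) \<Rightarrow> 'n set \<Rightarrow> ('n \<Rightarrow> 'n \<Rightarrow> 'n) \<Rightarrow> ('r \<Rightarrow> 'n \<Rightarrow> 'n)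
    \<Rightarrow> ('m \<times> 'n) multiset \<Rightarrow> ('m \<times> 'n) multiset \<Rightarrow> bool"
  for ra N addN la where
  refl: "tensor_eq ra N addN la X X"
| sym: "tensor_eq ra N addN la X Y \<Longrightarrow> tensor_eq ra N addN la Y X"
| trans: "tensor_eq ra N addN la X Y \<Longrightarrow> tensor_eq ra N addN la Y Z \<Longrightarrow> tensor_eq ra N addN la X Z"
| cong: "tensor_eq ra N addN la X Y \<Longrightarrow> tensor_eq ra N addN la (X + Z) (Y + Z)"
| zero: "n \<in> N \<Longrightarrow> tensor_eq ra N addN la {#(0, n)#} {#}"
| add_left: "n \<in> N \<Longrightarrow> tensor_eq ra N addN la {#(m + m', n)#} {#(m, n), (m', n)#}"
| add_right: "n \<in> N \<Longrightarrow> n' \<in> N \<Longrightarrow>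
    tensor_eq ra N addN la {#(m, addN n n')#} {#(m, n), (m, n')#}"
| balance: "n \<in> N \<Longrightarrow> tensor_eq ra N addN la {#(ra m r, n)#} {#(m, la r n)#}"

definition balanced :: "('m::ab_group_add \<Rightarrow> 'r \<Rightarrow> 'm) \<Rightarrow> ('r \<Rightarrow> 'n::ab_group_add \<Rightarrow> 'n)
    \<Rightarrow> ('m \<Rightarrow> 'n \<Rightarrow> 't::ab_group_add) \<Rightarrow> bool"
  where "balanced ra la t \<longleftrightarrow>
    (\<forall>m m' n. t (m + m') n = t m n + t m' n) \<and>
    (\<forall>m n n'. t m (n + n') = t m n + t m n') \<and>
    (\<forall>m r n. t (ra m r) n = t m (la r n))"

abbreviation tensor_sum :: "('m \<Rightarrow> 'n \<Rightarrow> 't::comm_monoid_add) \<Rightarrow> ('m \<times> 'n) multiset \<Rightarrow> 't"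
  where "tensor_sum t X \<equiv> (\<Sum>(m, n)\<in>#X. t m n)"

text \<open>\<open>t\<close> exhibits its target type as the tensor product over the ring \<open>'r\<close> of the right
  module \<open>'m\<close> and the left module \<open>'n\<close>.\<close>

definition is_tensor_product :: "('m::ab_group_add \<Rightarrow> 'r \<Rightarrow> 'm) \<Rightarrow> ('r \<Rightarrow> 'n::ab_group_add \<Rightarrow> 'n)
    \<Rightarrow> ('m \<Rightarrow> 'n \<Rightarrow> 't::ab_group_add) \<Rightarrow> bool"
  where "is_tensor_product ra la t \<longleftrightarrow> balanced ra la t \<and>
    (\<forall>z. \<exists>X. tensor_sum t X = z) \<and>
    (\<forall>X Y. tensor_sum t X = tensor_sum t Y \<longrightarrow> tensor_eq ra UNIV (+) la X Y)"

text \<open>The additive map with \<open>t m n \<mapsto> \<phi> m n\<close>; independent of the chosen representative whenever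
  \<open>t\<close> is a tensor product and \<open>\<phi>\<close> is balanced (see \<open>tensor_lift_apply\<close> and \<open>tensor_lift_add\<close>).\<close>

definition tensor_lift :: "('m \<Rightarrow> 'n \<Rightarrow> 't::comm_monoid_add) \<Rightarrow> ('m \<Rightarrow> 'n \<Rightarrow> 'p::comm_monoid_add)
    \<Rightarrow> 't \<Rightarrow> 'p"
  where "tensor_lift t \<phi> z = tensor_sum \<phi> (SOME X. tensor_sum t X = z)"

lemma tensor_eq_tensor_sum:
  assumes "balanced ra la \<phi>" and "tensor_eq ra UNIV (+) la X Y"
  shows "tensor_sum \<phi> X = tensor_sum \<phi> Y"
  using assms(2)
proof induction
  case (zero n)
  have "\<phi> (0 + 0) n = \<phi> 0 n + \<phi> 0 n"
    using assms(1) unfolding balanced_def by blast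
  then show ?case by simp
qed (use assms(1) in \<open>auto simp: balanced_def\<close>)

lemma tensor_lift_tensor_sum:
  assumes "is_tensor_product ra la t" and "balanced ra la \<phi>"
  shows "tensor_lift t \<phi> (tensor_sum t X) = tensor_sum \<phi> X"
proof -
  have "tensor_sum t (SOME Y. tensor_sum t Y = tensor_sum t X) = tensor_sum t X"
    by (rule someI) simp
  then show ?thesis
    using assms tensor_eq_tensor_sum unfolding tensor_lift_def is_tensor_product_def by blast
qed

lemma tensor_lift_apply:
  assumes "is_tensor_product ra la t" and "balanced ra la \<phi>"
  shows "tensor_lift t \<phi> (t m n) = \<phi> m n"
  using tensor_lift_tensor_sum[OF assms, of "{#(m, n)#}"] by simp

lemma tensor_lift_add:
  assumes "is_tensor_product ra la t" and "balanced ra la \<phi>"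
  shows "tensor_lift t \<phi> (x + y) = tensor_lift t \<phi> x + tensor_lift t \<phi> y"
proof -
  obtain X Y where XY: "x = tensor_sum t X" "y = tensor_sum t Y"
    using assms(1) unfolding is_tensor_product_def by metis
  then have "x + y = tensor_sum t (X + Y)" by simp
  then show ?thesis
    using tensor_lift_tensor_sum[OF assms] XY by (metis image_mset_union sum_mset.union)
qed

subsection \<open>The tensor product over the complex numbers\<close>

abbreviation ctensor_eq ::
    "('a::complex_vector \<times> 'b::complex_vector) multiset \<Rightarrow> ('a \<times> 'b) multiset \<Rightarrow> bool"
  where "ctensor_eq \<equiv> tensor_eq (\<lambda>m c. c *\<^sub>C m) UNIV (+) (*\<^sub>C)"

quotient_type (overloaded) ('a, 'b) ctensor =
  "('a::complex_vector \<times> 'b::complex_vector) multiset" / ctensor_eq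
  by (intro equivpI reflpI sympI transpI) (blast intro: tensor_eq.intros)+

lemma ctensor_eq_add:
  assumes "ctensor_eq X X'" "ctensor_eq Y Y'"
  shows "ctensor_eq (X + Y) (X' + Y')"
  by (metis add.commute assms tensor_eq.cong tensor_eq.trans)

lemma ctensor_eq_image:
  assumes "ctensor_eq X Y" and "\<And>x y. f (x + y) = f x + f y" and "\<And>c x. f (c *\<^sub>C x) = c *\<^sub>C f x"
  shows "ctensor_eq (image_mset (map_prod f id) X) (image_mset (map_prod f id) Y)"
  using assms(1)
proof induction
  case (zero n)
  have "f (0 + 0) = f 0 + f 0" using assms(2) by blast
  then have "f 0 = 0" by simp
  then show ?case by (simp add: tensor_eq.zero)
next
  case (add_left n m m')
  then show ?case by (simp add: assms(2) tensor_eq.add_left)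
next
  case (add_right n n' m)
  then show ?case by (simp add: tensor_eq.add_right)
next
  case (balance n m r)
  then show ?case using tensor_eq.balance[of n UNIV "\<lambda>m c. c *\<^sub>C m" "(+)" "(*\<^sub>C)" "f m" r]
    by (simp add: assms(3))
qed (auto intro: tensor_eq.intros)

lemma ctensor_eq_cancel: "ctensor_eq (image_mset (map_prod uminus id) X + X) {#}"
proof (induction X)
  case empty
  show ?case by (simp add: tensor_eq.refl)
next
  case (add x X)
  obtain a b where x: "x = (a, b)" by fastforce
  have "ctensor_eq {#(-a, b), (a, b)#} {#(-a + a, b)#}"
    by (rule tensor_eq.sym, rule tensor_eq.add_left) simp
  then have "ctensor_eq {#(-a, b), (a, b)#} {#}"
    using tensor_eq.zero[of b UNIV] tensor_eq.trans by fastforce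
  from ctensor_eq_add[OF add.IH this] show ?case
    by (simp add: x add_mset_commute)
qed

instantiation ctensor :: (complex_vector, complex_vector) complex_vector
begin

lift_definition zero_ctensor :: "('a, 'b) ctensor" is "{#}" .

lift_definition plus_ctensor :: "('a, 'b) ctensor \<Rightarrow> ('a, 'b) ctensor \<Rightarrow> ('a, 'b) ctensor"
  is "(+)" by (rule ctensor_eq_add)

lift_definition uminus_ctensor :: "('a, 'b) ctensor \<Rightarrow> ('a, 'b) ctensor"
  is "image_mset (map_prod uminus id)" by (rule ctensor_eq_image) auto

definition minus_ctensor :: "('a, 'b) ctensor \<Rightarrow> ('a, 'b) ctensor \<Rightarrow> ('a, 'b) ctensor"
  where "minus_ctensor x y = x + (- y)"

lift_definition scaleC_ctensor :: "complex \<Rightarrow> ('a, 'b) ctensor \<Rightarrow> ('a, 'b) ctensor"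
  is "\<lambda>c. image_mset (map_prod (scaleC c) id)"
  by (rule ctensor_eq_image) (auto simp: scaleC_add_right scaleC_scaleC mult.commute)

instance
proof
  fix x y z :: "('a, 'b) ctensor" and c c' :: complex
  show "x + y + z = x + (y + z)"
    by transfer (simp add: add.assoc tensor_eq.refl)
  show "x + y = y + x"
    by transfer (simp add: add.commute tensor_eq.refl)
  show "0 + x = x"
    by transfer (simp add: tensor_eq.refl)
  show "- x + x = 0"
    by transfer (rule ctensor_eq_cancel)
  show "x - y = x + - y"
    by (rule minus_ctensor_def)
  show "c *\<^sub>C (x + y) = c *\<^sub>C x + c *\<^sub>C y"
    by transfer (simp add: tensor_eq.refl)
  show "(c + c') *\<^sub>C x = c *\<^sub>C x + c' *\<^sub>C x"
  proof transfer
    fix c c' and X :: "('a \<times> 'b) multiset"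
    show "ctensor_eq (image_mset (map_prod (scaleC (c + c')) id) X)
      (image_mset (map_prod (scaleC c) id) X + image_mset (map_prod (scaleC c') id) X)"
    proof (induction X)
      case empty
      show ?case by (simp add: tensor_eq.refl)
    next
      case (add x X)
      obtain a b where x: "x = (a, b)" by fastforce
      have "ctensor_eq {#((c + c') *\<^sub>C a, b)#} {#(c *\<^sub>C a, b), (c' *\<^sub>C a, b)#}"
        unfolding scaleC_add_left by (rule tensor_eq.add_left) simp
      from ctensor_eq_add[OF add.IH this] show ?case
        by (simp add: x add_mset_commute)
    qed
  qed
  show "c *\<^sub>C c' *\<^sub>C x = (c * c') *\<^sub>C x"
    by transfer
      (simp add: multiset.map_comp map_prod.comp comp_def scaleC_scaleC map_prod_def split_def
        tensor_eq.refl)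
  show "1 *\<^sub>C x = x"
    by transfer (simp add: scaleC_one map_prod_def split_def tensor_eq.refl)
qed

end

lift_definition ctens :: "'a::complex_vector \<Rightarrow> 'b::complex_vector \<Rightarrow> ('a, 'b) ctensor" (infixr "\<otimes>" 76)
  is "\<lambda>a b. {#(a, b)#}" .

lemma tensor_sum_ctens: "tensor_sum (\<otimes>) X = abs_ctensor X"
proof (induction X)
  case empty
  show ?case by (simp add: zero_ctensor.abs_eq)
next
  case (add x X)
  obtain a b where x: "x = (a, b)" by fastforce
  have "tensor_sum (\<otimes>) (add_mset x X) = abs_ctensor {#x#} + abs_ctensor X"
    unfolding add.IH[symmetric] by (simp add: x) (simp add: ctens.abs_eq)
  also have "\<dots> = abs_ctensor (add_mset x X)"
    by (simp add: plus_ctensor.abs_eq)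
  finally show ?case .
qed

lemma is_tensor_product_ctens: "is_tensor_product (\<lambda>m c. c *\<^sub>C m) (*\<^sub>C) (\<otimes>)"
  unfolding is_tensor_product_def balanced_def tensor_sum_ctens
proof (intro conjI allI impI)
  fix m m' :: 'a and n n' :: 'b and r
  show "(m + m') \<otimes> n = m \<otimes> n + m' \<otimes> n"
    by (transfer, subst add_mset_add_single[symmetric], subst add_mset_commute,
        rule tensor_eq.add_left) simp_all
  show "m \<otimes> (n + n') = m \<otimes> n + m \<otimes> n'"
    by (transfer, subst add_mset_add_single[symmetric], subst add_mset_commute,
        rule tensor_eq.add_right) simp_all
  show "(r *\<^sub>C m) \<otimes> n = m \<otimes> (r *\<^sub>C n)"
    by (transfer, use tensor_eq.balance[of _ UNIV "\<lambda>m c. c *\<^sub>C m" "(+)" "(*\<^sub>C)"] in simp)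
next
  fix z :: "('a, 'b) ctensor"
  show "\<exists>X. abs_ctensor X = z"
    by (metis Quotient3_abs_rep Quotient3_ctensor)
next
  fix X Y :: "('a \<times> 'b) multiset"
  assume "abs_ctensor X = abs_ctensor Y"
  then show "ctensor_eq X Y" by (simp add: ctensor.abs_eq_iff)
qed

lemma scaleC_ctens: "c *\<^sub>C (a \<otimes> b) = (c *\<^sub>C a) \<otimes> b"
  by transfer (simp add: tensor_eq.refl)

abbreviation ctensor_lift ::
    "('a::complex_vector \<Rightarrow> 'b::complex_vector \<Rightarrow> 'p::comm_monoid_add) \<Rightarrow> ('a, 'b) ctensor \<Rightarrow> 'p"
  where "ctensor_lift \<equiv> tensor_lift (\<otimes>)"

abbreviation ctensor_map :: "('a::complex_vector \<Rightarrow> 'c::complex_vector)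
    \<Rightarrow> ('b::complex_vector \<Rightarrow> 'e::complex_vector) \<Rightarrow> ('a, 'b) ctensor \<Rightarrow> ('c, 'e) ctensor"
  where "ctensor_map f g \<equiv> ctensor_lift (\<lambda>a b. f a \<otimes> g b)"


section \<open>Hopf *-algebras and compact quantum group algebras\<close>

record (overloaded) 'a cqga_data =
  comult :: "'a::complex_vector \<Rightarrow> ('a, 'a) ctensor"
  counit :: "'a \<Rightarrow> complex"
  antipode :: "'a \<Rightarrow> 'a"
  haar :: "'a \<Rightarrow> complex"

locale hopf_star_algebra =
  fixes H :: "'a::complex_star_algebra cqga_data"
  assumes comult_linear: "clinear (comult H)"
    and counit_linear: "cfunctional (counit H)"
    and antipode_linear: "clinear (antipode H)"
    and coassociative:
      "ctensor_lift (\<lambda>a b. ctensor_lift (\<lambda>a1 a2. a1 \<otimes> a2 \<otimes> b) (comult H a)) (comult H x)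
       = ctensor_lift (\<lambda>a b. a \<otimes> comult H b) (comult H x)"
    and counit_left: "ctensor_lift (\<lambda>a b. counit H a *\<^sub>C b) (comult H x) = x"
    and counit_right: "ctensor_lift (\<lambda>a b. counit H b *\<^sub>C a) (comult H x) = x"
    and comult_one: "comult H 1 = 1 \<otimes> 1"
    and comult_mult: "comult H (x * y) =
      ctensor_lift (\<lambda>a b. ctensor_lift (\<lambda>a' b'. (a * a') \<otimes> (b * b')) (comult H y)) (comult H x)"
    and counit_one: "counit H 1 = 1"
    and counit_mult: "counit H (x * y) = counit H x * counit H y"
    and antipode_left: "ctensor_lift (\<lambda>a b. antipode H a * b) (comult H x) = counit H x *\<^sub>C 1"
    and antipode_right: "ctensor_lift (\<lambda>a b. a * antipode H b) (comult H x) = counit H x *\<^sub>C 1"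
    and comult_star: "comult H (x\<^sup>\<star>) = ctensor_map star star (comult H x)"
    and counit_star: "counit H (x\<^sup>\<star>) = cnj (counit H x)"

definition subcoalgebra :: "'a::complex_vector cqga_data \<Rightarrow> 'a set \<Rightarrow> bool"
  where "subcoalgebra H C \<longleftrightarrow>
    cvec.subspace C \<and> (\<forall>c\<in>C. comult H c \<in> cvec.span {x \<otimes> y |x y. x \<in> C \<and> y \<in> C})"

definition simple_subcoalgebra :: "'a::complex_vector cqga_data \<Rightarrow> 'a set \<Rightarrow> bool"
  where "simple_subcoalgebra H C \<longleftrightarrow> subcoalgebra H C \<and> C \<noteq> {0} \<and>
    (\<forall>D. subcoalgebra H D \<longrightarrow> D \<subseteq> C \<longrightarrow> D = {0} \<or> D = C)"

text \<open>A compact quantum group algebra; \<open>haar\<close> is the (unique) normalised bi-invariant functional.\<close>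

locale cqga = hopf_star_algebra H for H :: "'a::complex_star_algebra cqga_data" +
  assumes cosemisimple: "cvec.span (\<Union> {C. simple_subcoalgebra H C}) = UNIV"
    and haar_linear: "cfunctional (haar H)"
    and haar_one: "haar H 1 = 1"
    and haar_right_invariant: "ctensor_lift (\<lambda>a b. haar H a *\<^sub>C b) (comult H x) = haar H x *\<^sub>C 1"
    and haar_left_invariant: "ctensor_lift (\<lambda>a b. haar H b *\<^sub>C a) (comult H x) = haar H x *\<^sub>C 1"
    and haar_state: "haar H (x\<^sup>\<star> * x) \<in> \<real>\<^sub>\<ge>\<^sub>0"

definition hopf_star_map :: "'a::complex_star_algebra cqga_data \<Rightarrow> 'c::complex_star_algebra cqga_data
    \<Rightarrow> ('a \<Rightarrow> 'c) \<Rightarrow> bool"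
  where "hopf_star_map H K p \<longleftrightarrow> algebra_map p \<and>
    (\<forall>x. comult K (p x) = ctensor_map p p (comult H x)) \<and> (\<forall>x. counit K (p x) = counit H x) \<and>
    (\<forall>x. antipode K (p x) = p (antipode H x)) \<and> (\<forall>x. p (x\<^sup>\<star>) = (p x)\<^sup>\<star>)"


section \<open>Faithful flatness\<close>

definition left_module_on ::
    "'u set \<Rightarrow> 'u \<Rightarrow> ('u \<Rightarrow> 'u \<Rightarrow> 'u) \<Rightarrow> ('r::ring_1 \<Rightarrow> 'u \<Rightarrow> 'u) \<Rightarrow> bool"
  where "left_module_on N z p la \<longleftrightarrow>
    z \<in> N \<and> (\<forall>x\<in>N. \<forall>y\<in>N. p x y \<in> N) \<and>
    (\<forall>x\<in>N. \<forall>y\<in>N. \<forall>w\<in>N. p (p x y) w = p x (p y w)) \<and> (\<forall>x\<in>N. \<forall>y\<in>N. p x y = p y x) \<and>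
    (\<forall>x\<in>N. p z x = x) \<and> (\<forall>x\<in>N. \<exists>y\<in>N. p y x = z) \<and>
    (\<forall>r. \<forall>x\<in>N. la r x \<in> N) \<and> (\<forall>r. \<forall>x\<in>N. \<forall>y\<in>N. la r (p x y) = p (la r x) (la r y)) \<and>
    (\<forall>r s. \<forall>x\<in>N. la (r + s) x = p (la r x) (la s x)) \<and>
    (\<forall>r s. \<forall>x\<in>N. la (r * s) x = la r (la s x)) \<and> (\<forall>x\<in>N. la 1 x = x)"

definition module_map_on :: "'u set \<Rightarrow> ('u \<Rightarrow> 'u \<Rightarrow> 'u) \<Rightarrow> ('r \<Rightarrow> 'u \<Rightarrow> 'u) \<Rightarrow>
    'v set \<Rightarrow> ('v \<Rightarrow> 'v \<Rightarrow> 'v) \<Rightarrow> ('r \<Rightarrow> 'v \<Rightarrow> 'v) \<Rightarrow> ('u \<Rightarrow> 'v) \<Rightarrow> bool"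
  where "module_map_on N p la N' p' la' f \<longleftrightarrow>
    (\<forall>x\<in>N. f x \<in> N') \<and> (\<forall>x\<in>N. \<forall>y\<in>N. f (p x y) = p' (f x) (f y)) \<and>
    (\<forall>r. \<forall>x\<in>N. f (la r x) = la' r (f x))"

text \<open>
  A sequence of left modules is exact if and only if it is exact after tensoring.  HOL cannot
  quantify over all modules, so the modules range over those with carrier in \<open>(nat \<Rightarrow> 'r) set\<close>.
  Up to isomorphism these include all countably generated modules (as quotients of the free
  module of countable rank, whose elements are cosets), and (faithful) flatness over a ring
  is already detected by finitely generated modules.
\<close>

definition faithfully_flat :: "('m::ab_group_add \<Rightarrow> 'r::ring_1 \<Rightarrow> 'm) \<Rightarrow> bool"
  where "faithfully_flat ra \<longleftrightarrow>
    (\<forall>(N1 :: (nat \<Rightarrow> 'r) set set) z1 p1 la1 (N2 :: (nat \<Rightarrow> 'r) set set) z2 p2 la2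
      (N3 :: (nat \<Rightarrow> 'r) set set) z3 p3 la3 f g.
      left_module_on N1 z1 p1 la1 \<and> left_module_on N2 z2 p2 la2 \<and> left_module_on N3 z3 p3 la3 \<and>
      module_map_on N1 p1 la1 N2 p2 la2 f \<and> module_map_on N2 p2 la2 N3 p3 la3 g \<longrightarrow>
      ((\<forall>y\<in>N2. g y = z3 \<longleftrightarrow> (\<exists>x\<in>N1. y = f x)) \<longleftrightarrow>
       (\<forall>Y. set_mset Y \<subseteq> UNIV \<times> N2 \<longrightarrow>
         (tensor_eq ra N3 p3 la3 (image_mset (map_prod id g) Y) {#} \<longleftrightarrow>
          (\<exists>X. set_mset X \<subseteq> UNIV \<times> N1 \<and>
            tensor_eq ra N2 p2 la2 Y (image_mset (map_prod id f) X))))))"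


section \<open>Homogeneous spaces\<close>

text \<open>
  The subalgebra \<open>B \<subseteq> A\<close> is a type \<open>'b\<close> with its inclusion \<open>\<iota>\<close>, and \<open>\<pi>\<^sub>B(A) = A / B\<^sup>+A\<close> is a type \<open>'q\<close>
  with a surjection \<open>\<pi>\<close> whose kernel is \<open>B\<^sup>+A\<close>.
\<close>

definition augmentation_ideal :: "'a::complex_vector cqga_data \<Rightarrow> ('b \<Rightarrow> 'a) \<Rightarrow> 'b set"
  where "augmentation_ideal H \<iota> = {b. counit H (\<iota> b) = 0}"

locale quantum_homogeneous_space = hopf_star_algebra H
  for H :: "'a::complex_star_algebra cqga_data" +
  fixes \<iota> :: "'b::complex_algebra_1 \<Rightarrow> 'a"
  assumes incl_algebra_map: "algebra_map \<iota>"
    and incl_inj: "inj \<iota>"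
    and left_coideal: "comult H (\<iota> b) \<in> range (ctensor_map id \<iota>)"
    and incl_faithfully_flat: "faithfully_flat (\<lambda>a b. a * \<iota> b)"
    and augmentation_commutes:
      "cvec.span {\<iota> b * a |b a. b \<in> augmentation_ideal H \<iota>}
       = cvec.span {a * \<iota> b |a b. b \<in> augmentation_ideal H \<iota>}"

locale cqga_homogeneous_space = cqga H + quantum_homogeneous_space H \<iota> + quotient: cqga K
  for H :: "'a::complex_star_algebra cqga_data" and K :: "'q::complex_star_algebra cqga_data"
    and \<iota> :: "'b::complex_star_algebra \<Rightarrow> 'a" +
  fixes \<pi> :: "'a \<Rightarrow> 'q"
  assumes incl_star: "\<iota> (b\<^sup>\<star>) = (\<iota> b)\<^sup>\<star>"
    and proj_surj: "surj \<pi>"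
    and proj_kernel: "{a. \<pi> a = 0} = cvec.span {\<iota> b * a |b a. b \<in> augmentation_ideal H \<iota>}"
    and proj_hopf_star_map: "hopf_star_map H K \<pi>"

text \<open>The restriction of the comultiplication to a left coaction \<open>B \<rightarrow> A \<otimes> B\<close>.\<close>

definition base_coaction ::
    "'a::complex_vector cqga_data \<Rightarrow> ('b::complex_vector \<Rightarrow> 'a) \<Rightarrow> 'b \<Rightarrow> ('a, 'b) ctensor"
  where "base_coaction H \<iota> b = (THE z. ctensor_map id \<iota> z = comult H (\<iota> b))"


section \<open>Relative Hopf modules\<close>

definition bimodule :: "('b::complex_algebra_1 \<Rightarrow> 'm::complex_vector \<Rightarrow> 'm) \<Rightarrow> ('m \<Rightarrow> 'b \<Rightarrow> 'm) \<Rightarrow> bool"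
  where "bimodule la ra \<longleftrightarrow>
    (\<forall>b. clinear (la b)) \<and> (\<forall>m. clinear (\<lambda>b. la b m)) \<and>
    (\<forall>b. clinear (\<lambda>m. ra m b)) \<and> (\<forall>m. clinear (ra m)) \<and>
    (\<forall>m. la 1 m = m) \<and> (\<forall>b c m. la (b * c) m = la b (la c m)) \<and>
    (\<forall>m. ra m 1 = m) \<and> (\<forall>b c m. ra m (b * c) = ra (ra m b) c) \<and>
    (\<forall>b c m. ra (la b m) c = la b (ra m c))"

definition finitely_generated :: "('b::complex_algebra_1 \<Rightarrow> 'm::complex_vector \<Rightarrow> 'm) \<Rightarrow> bool"
  where "finitely_generated la \<longleftrightarrow> (\<exists>G. finite G \<and> (\<forall>m. \<exists>c. m = (\<Sum>e\<in>G. la (c e) e)))"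

text \<open>A retract of the free left module of rank \<open>N\<close>: \<open>e\<close> is the image of the standard basis and
  \<open>s\<close> the section.\<close>

definition finitely_generated_projective ::
    "('b::complex_algebra_1 \<Rightarrow> 'm::complex_vector \<Rightarrow> 'm) \<Rightarrow> bool"
  where "finitely_generated_projective la \<longleftrightarrow>
    (\<exists>(N::nat) e s. (\<forall>i<N. (\<forall>x y. s (x + y) i = s x i + s y i) \<and> (\<forall>b x. s (la b x) i = b * s x i)) \<and>
      (\<forall>x. x = (\<Sum>i<N. la (s x i) (e i))))"

definition left_comodule ::
    "'a::complex_vector cqga_data \<Rightarrow> ('m::complex_vector \<Rightarrow> ('a, 'm) ctensor) \<Rightarrow> bool"
  where "left_comodule H \<delta> \<longleftrightarrow> clinear \<delta> \<and>
    (\<forall>x. ctensor_lift (\<lambda>a m. ctensor_lift (\<lambda>a1 a2. a1 \<otimes> a2 \<otimes> m) (comult H a)) (\<delta> x)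
       = ctensor_lift (\<lambda>a m. a \<otimes> \<delta> m) (\<delta> x)) \<and>
    (\<forall>x. ctensor_lift (\<lambda>a m. counit H a *\<^sub>C m) (\<delta> x) = x)"

text \<open>
  The objects of the category of finitely generated relative Hopf modules carrying the right
  action \<open>f b = f\<^sub>(\<^sub>-\<^sub>2\<^sub>) b S(f\<^sub>(\<^sub>-\<^sub>1\<^sub>)) f\<^sub>(\<^sub>0\<^sub>)\<close>.  The element \<open>f\<^sub>(\<^sub>-\<^sub>2\<^sub>) b S(f\<^sub>(\<^sub>-\<^sub>1\<^sub>)) \<otimes> f\<^sub>(\<^sub>0\<^sub>)\<close> of \<open>A \<otimes> F\<close> lies
  in \<open>B \<otimes> F\<close>, where the left action can be applied to it; \<open>z\<close> is this element of \<open>B \<otimes> F\<close>.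
\<close>

definition relative_hopf_module :: "'a::complex_algebra_1 cqga_data \<Rightarrow> ('b::complex_algebra_1 \<Rightarrow> 'a) \<Rightarrow>
    ('b \<Rightarrow> 'm::complex_vector \<Rightarrow> 'm) \<Rightarrow> ('m \<Rightarrow> 'b \<Rightarrow> 'm) \<Rightarrow> ('m \<Rightarrow> ('a, 'm) ctensor) \<Rightarrow> bool"
  where "relative_hopf_module H \<iota> la ra \<delta> \<longleftrightarrow>
    bimodule la ra \<and> finitely_generated la \<and> left_comodule H \<delta> \<and>
    (\<forall>b m. \<delta> (la b m) =
      ctensor_lift (\<lambda>a b'. ctensor_lift (\<lambda>a' m'. (a * a') \<otimes> la b' m') (\<delta> m)) (base_coaction H \<iota> b)) \<and>
    (\<forall>m b. \<exists>z. ctensor_map \<iota> id z =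
        ctensor_lift (\<lambda>a m'. ctensor_lift (\<lambda>a1 a2. (a1 * \<iota> b * antipode H a2) \<otimes> m') (comult H a)) (\<delta> m) \<and>
      ra m b = ctensor_lift la z)"

text \<open>
  The isomorphism from the conjugate bimodule to the bimodule of right module maps is given as
  \<open>h f k\<close>, standing for the value at \<open>k\<close> of the image of the conjugate of \<open>f\<close>.  The dual has
  the actions \<open>(b \<phi>) k = b \<phi>(k)\<close> and \<open>(\<phi> b) k = \<phi>(b k)\<close>.
\<close>

definition dual_module :: "('m::complex_vector \<Rightarrow> 'b::complex_algebra_1 \<Rightarrow> 'm) \<Rightarrow> ('m \<Rightarrow> 'b) set"
  where "dual_module ra = {\<phi>. (\<forall>x y. \<phi> (x + y) = \<phi> x + \<phi> y) \<and> (\<forall>x b. \<phi> (ra x b) = \<phi> x * b)}"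

definition weak_hermitian_module :: "('b::complex_star_algebra \<Rightarrow> 'm::complex_vector \<Rightarrow> 'm) \<Rightarrow>
    ('m \<Rightarrow> 'b \<Rightarrow> 'm) \<Rightarrow> ('m \<Rightarrow> 'm \<Rightarrow> 'b) \<Rightarrow> bool"
  where "weak_hermitian_module la ra h \<longleftrightarrow>
    bimodule la ra \<and> bij_betw h UNIV (dual_module ra) \<and>
    (\<forall>f f' k. h (f + f') k = h f k + h f' k) \<and>
    (\<forall>b f k. h (ra f (b\<^sup>\<star>)) k = b * h f k) \<and>
    (\<forall>b f k. h (la (b\<^sup>\<star>) f) k = h f (la b k)) \<and>
    (\<forall>f k. h f k = (h k f)\<^sup>\<star>) \<and>
    (\<forall>f. f \<noteq> 0 \<longrightarrow> h f f \<in> positive_elements)"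


section \<open>CQH-Hermitian spaces\<close>

text \<open>
  The data: the Hopf structures of \<open>A\<close> and \<open>\<pi>\<^sub>B(A)\<close>, the inclusion of \<open>B\<close> in \<open>A\<close>, the projection onto \<open>\<pi>\<^sub>B(A)\<close>, the identification of \<open>B\<close>
  with the forms of degree zero, the grading, the differential, the involution of the
  calculus, the bigrading, the two components of the differential, half the total degree,
  the Hermitian form and the coaction on forms.
\<close>

record (overloaded) ('a, 'b, 'q, 'w) cqh_data =
  hopf :: "'a::complex_vector cqga_data"
  qhopf :: "'q::complex_vector cqga_data"
  incl :: "'b \<Rightarrow> 'a"
  proj :: "'a \<Rightarrow> 'q"
  emb :: "'b \<Rightarrow> 'w"
  Forms :: "nat \<Rightarrow> 'w set"
  diff :: "'w \<Rightarrow> 'w"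
  wstar :: "'w \<Rightarrow> 'w"
  BiForms :: "nat \<times> nat \<Rightarrow> 'w set"
  del :: "'w \<Rightarrow> 'w"
  delbar :: "'w \<Rightarrow> 'w"
  halfdeg :: nat
  herm :: 'w
  coact :: "'w \<Rightarrow> ('a::complex_vector, 'w::complex_vector) ctensor"

definition form_part :: "('a::complex_vector, 'b, 'q::complex_vector, 'w::complex_vector) cqh_data \<Rightarrow> nat \<Rightarrow> 'w \<Rightarrow> 'w"
  where "form_part X k w = (THE f. decomposes UNIV (Forms X) w f) k"

definition lefschetz :: "('a::complex_vector, 'b, 'q::complex_vector, 'w::complex_algebra_1) cqh_data \<Rightarrow> 'w \<Rightarrow> 'w"
  where "lefschetz X w = herm X * w"

definition primitive :: "('a::complex_vector, 'b, 'q::complex_vector, 'w::complex_algebra_1) cqh_data \<Rightarrow> nat \<Rightarrow> 'w set"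
  where "primitive X k = (if k \<le> halfdeg X
    then {w \<in> Forms X k. (lefschetz X ^^ (halfdeg X - k + 1)) w = 0} else {0})"

definition is_hodge :: "('a::complex_vector, 'b, 'q::complex_vector, 'w::complex_algebra_1) cqh_data \<Rightarrow> ('w \<Rightarrow> 'w) \<Rightarrow> bool"
  where "is_hodge X H \<longleftrightarrow> clinear H \<and>
    (\<forall>a b j w. w \<in> primitive X (a + b) \<inter> BiForms X (a, b) \<and> j + (a + b) \<le> halfdeg X \<longrightarrow>
      H ((lefschetz X ^^ j) w) =
        ((-1) ^ ((a + b) * (a + b + 1) div 2) * \<i> powi (int a - int b)
          * fact j / fact (halfdeg X - j - (a + b)))
        *\<^sub>C (lefschetz X ^^ (halfdeg X - j - (a + b))) w)"

definition hodge :: "('a::complex_vector, 'b, 'q::complex_vector, 'w::complex_algebra_1) cqh_data \<Rightarrow> 'w \<Rightarrow> 'w"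
  where "hodge X = (THE H. is_hodge X H)"

definition metric :: "('a::complex_vector, 'b, 'q::complex_vector, 'w::complex_algebra_1) cqh_data \<Rightarrow> 'w \<Rightarrow> 'w \<Rightarrow> 'b"
  where "metric X w v = inv (emb X)
    (\<Sum>k\<le>2 * halfdeg X. hodge X (hodge X (wstar X (form_part X k w)) * form_part X k v))"

definition integral_form :: "('a::complex_star_algebra, 'b, 'q::complex_vector, 'w::complex_algebra_1) cqh_data \<Rightarrow> 'w \<Rightarrow> complex"
  where "integral_form X w = haar (hopf X) (incl X (inv (emb X) (hodge X w)))"

locale differential_calculus =
  fixes X :: "('a::complex_vector, 'b::complex_algebra_1, 'q::complex_vector, 'w::complex_algebra_1) cqh_data"
  assumes emb_algebra_map: "algebra_map (emb X)"
    and emb_inj: "inj (emb X)"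
    and forms_zero: "Forms X 0 = range (emb X)"
    and forms_direct_sum: "is_direct_sum UNIV (Forms X) UNIV"
    and forms_mult: "w \<in> Forms X k \<Longrightarrow> v \<in> Forms X l \<Longrightarrow> w * v \<in> Forms X (k + l)"
    and diff_linear: "clinear (diff X)"
    and diff_degree: "w \<in> Forms X k \<Longrightarrow> diff X w \<in> Forms X (k + 1)"
    and diff_diff: "diff X (diff X w) = 0"
    and diff_leibniz: "w \<in> Forms X k \<Longrightarrow> diff X (w * v) = diff X w * v + (-1) ^ k * (w * diff X v)"
    and forms_generated: "algebra_generated (range (emb X) \<union> range (\<lambda>b. diff X (emb X b))) = UNIV"

definition has_total_degree :: "('a::complex_vector, 'b, 'q::complex_vector, 'w::complex_vector) cqh_data \<Rightarrow> nat \<Rightarrow> bool"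
  where "has_total_degree X m \<longleftrightarrow> Forms X m \<noteq> {0} \<and> (\<forall>k>m. Forms X k = {0})"

locale star_differential_calculus = differential_calculus X
  for X :: "('a::complex_vector, 'b::complex_star_algebra, 'q::complex_vector, 'w::complex_algebra_1) cqh_data" +
  assumes wstar_emb: "wstar X (emb X b) = emb X (b\<^sup>\<star>)"
    and wstar_add: "wstar X (w + v) = wstar X w + wstar X v"
    and wstar_scaleC: "wstar X (c *\<^sub>C w) = cnj c *\<^sub>C wstar X w"
    and wstar_wstar: "wstar X (wstar X w) = w"
    and diff_wstar: "diff X (wstar X w) = wstar X (diff X w)"
    and wstar_mult: "w \<in> Forms X k \<Longrightarrow> v \<in> Forms X l \<Longrightarrow>
      wstar X (w * v) = (-1) ^ (k * l) * (wstar X v * wstar X w)"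

locale complex_structure = star_differential_calculus X
  for X :: "('a::complex_vector, 'b::complex_star_algebra, 'q::complex_vector, 'w::complex_algebra_1) cqh_data" +
  assumes biforms_direct_sum: "is_direct_sum {(a, b). a + b = k} (BiForms X) (Forms X k)"
    and biforms_mult: "w \<in> BiForms X (a, b) \<Longrightarrow> v \<in> BiForms X (a', b') \<Longrightarrow>
      w * v \<in> BiForms X (a + a', b + b')"
    and biforms_wstar: "wstar X ` BiForms X (a, b) = BiForms X (b, a)"
    and del_linear: "clinear (del X)"
    and delbar_linear: "clinear (delbar X)"
    and diff_eq: "diff X w = del X w + delbar X w"
    and del_degree: "w \<in> BiForms X (a, b) \<Longrightarrow> del X w \<in> BiForms X (a + 1, b)"
    and delbar_degree: "w \<in> BiForms X (a, b) \<Longrightarrow> delbar X w \<in> BiForms X (a, b + 1)"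

locale hermitian_structure = complex_structure X
  for X :: "('a::complex_vector, 'b::complex_star_algebra, 'q::complex_vector, 'w::complex_algebra_1) cqh_data" +
  assumes total_degree: "has_total_degree X (2 * halfdeg X)"
    and herm_degree: "herm X \<in> BiForms X (1, 1)"
    and herm_central: "herm X * w = w * herm X"
    and herm_real: "wstar X (herm X) = herm X"
    and lefschetz_iso: "k < halfdeg X \<Longrightarrow>
      bij_betw (lefschetz X ^^ (halfdeg X - k)) (Forms X k) (Forms X (2 * halfdeg X - k))"

locale positive_definite_hermitian_structure = hermitian_structure X
  for X :: "('a::complex_vector, 'b::complex_star_algebra, 'q::complex_vector, 'w::complex_algebra_1) cqh_data" +
  assumes metric_positive: "w \<noteq> 0 \<Longrightarrow> metric X w w \<in> positive_elements"

locale cqh_hermitian_space = cqga_homogeneous_space "hopf X" "qhopf X" "incl X" "proj X"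
    + positive_definite_hermitian_structure X
  for X :: "('a::complex_star_algebra, 'b::complex_star_algebra, 'q::complex_star_algebra, 'w::complex_algebra_1) cqh_data" +
  assumes forms_relative_hopf_module:
      "relative_hopf_module (hopf X) (incl X) (\<lambda>b w. emb X b * w) (\<lambda>w b. w * emb X b) (coact X)"
    and coact_emb: "coact X (emb X b) = ctensor_map id (emb X) (base_coaction (hopf X) (incl X) b)"
    and coact_diff: "coact X (diff X w) = ctensor_map id (diff X) (coact X w)"
    and coact_biforms: "w \<in> BiForms X ab \<Longrightarrow>
      coact X w \<in> cvec.span {a \<otimes> v |a v. v \<in> BiForms X ab}"
    and coact_herm: "coact X (herm X) = 1 \<otimes> herm X"
    and integral_closed: "k + 1 = 2 * halfdeg X \<Longrightarrow> w \<in> Forms X k \<Longrightarrow>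
      integral_form X (diff X w) = 0"


section \<open>Covariant Hermitian holomorphic modules\<close>

text \<open>The data: left and right action, coaction, Hermitian form, the pure tensors \<open>\<omega> \<otimes>\<^sub>B f\<close> in
  \<open>\<Omega> \<otimes>\<^sub>B F\<close> (a type \<open>'t\<close>), and the holomorphic connection.\<close>

record (overloaded) ('a, 'b, 'w, 'f, 't) module_data =
  lact :: "'b \<Rightarrow> 'f \<Rightarrow> 'f"
  ract :: "'f \<Rightarrow> 'b \<Rightarrow> 'f"
  mcoact :: "'f \<Rightarrow> ('a::complex_vector, 'f::complex_vector) ctensor"
  hform :: "'f \<Rightarrow> 'f \<Rightarrow> 'b"
  tens :: "'w \<Rightarrow> 'f \<Rightarrow> 't"
  mdelbar :: "'f \<Rightarrow> 't"

definition wedge :: "('a::complex_vector, 'b, 'w::complex_algebra_1, 'f::complex_vector, 't::complex_vector) module_data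
    \<Rightarrow> 'w \<Rightarrow> 't \<Rightarrow> 't"
  where "wedge F w = tensor_lift (tens F) (\<lambda>v f. tens F (w * v) f)"

definition tensor_ract :: "('a::complex_vector, 'b, 'w::complex_algebra_1, 'f::complex_vector, 't::complex_vector) module_data
    \<Rightarrow> 't \<Rightarrow> 'b \<Rightarrow> 't"
  where "tensor_ract F z b = tensor_lift (tens F) (\<lambda>w f. tens F w (ract F f b)) z"

definition tensor_coact :: "('a::complex_star_algebra, 'b, 'q::complex_vector, 'w::complex_algebra_1) cqh_data \<Rightarrow>
    ('a, 'b, 'w, 'f::complex_vector, 't::complex_vector) module_data \<Rightarrow> 't \<Rightarrow> ('a, 't) ctensor"
  where "tensor_coact X F = tensor_lift (tens F)
    (\<lambda>w f. ctensor_lift (\<lambda>a w'. ctensor_lift (\<lambda>c f'. (a * c) \<otimes> tens F w' f') (mcoact F f)) (coact X w))"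

definition tensor_metric :: "('a::complex_vector, 'b::complex_algebra_1, 'q::complex_vector, 'w::complex_algebra_1) cqh_data \<Rightarrow>
    ('a, 'b, 'w, 'f::complex_vector, 't::complex_vector) module_data \<Rightarrow> 't \<Rightarrow> 't \<Rightarrow> 'b"
  where "tensor_metric X F x y = tensor_lift (tens F)
    (\<lambda>w f. tensor_lift (tens F) (\<lambda>v k. hform F f (lact F (metric X w v) k)) y) x"

text \<open>The extension of the connection to \<open>\<Omega> \<otimes>\<^sub>B F\<close>; the sum implements the sign \<open>(-1)\<^bsup>|\<omega>|\<^esup>\<close>.\<close>

definition tensor_delbar :: "('a::complex_vector, 'b, 'q::complex_vector, 'w::complex_algebra_1) cqh_data \<Rightarrow>
    ('a, 'b, 'w, 'f::complex_vector, 't::complex_vector) module_data \<Rightarrow> 't \<Rightarrow> 't"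
  where "tensor_delbar X F = tensor_lift (tens F)
    (\<lambda>w f. tens F (delbar X w) f +
      wedge F (\<Sum>k\<le>2 * halfdeg X. (-1) ^ k * form_part X k w) (mdelbar F f))"

definition tensor_biforms :: "('a::complex_vector, 'b, 'q::complex_vector, 'w::complex_algebra_1) cqh_data \<Rightarrow>
    ('a, 'b, 'w, 'f::complex_vector, 't::complex_vector) module_data \<Rightarrow> nat \<times> nat \<Rightarrow> 't set"
  where "tensor_biforms X F ab = cvec.span {tens F w f |w f. w \<in> BiForms X ab}"

locale covariant_module =
  fixes X :: "('a::complex_star_algebra, 'b::complex_star_algebra, 'q::complex_star_algebra, 'w::complex_algebra_1) cqh_data"
    and F :: "('a, 'b, 'w, 'f::complex_vector, 't::complex_vector) module_data"
  assumes module_relative_hopf_module: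
      "relative_hopf_module (hopf X) (incl X) (lact F) (ract F) (mcoact F)"
    and tens_tensor_product: "is_tensor_product (\<lambda>w b. w * emb X b) (lact F) (tens F)"
    and tens_scaleC: "tens F (c *\<^sub>C w) f = c *\<^sub>C tens F w f"

text \<open>
  Covariance of the Hermitian structure: the conjugate module has the coaction that takes the
  conjugate of \<open>f\<close> to \<open>f\<^sub>(\<^sub>-\<^sub>1\<^sub>)\<^sup>\<star>\<close> tensored with the conjugate of \<open>f\<^sub>(\<^sub>0\<^sub>)\<close>, and the coaction of the
  dual module is the one for which evaluation is a comodule map.  Hence the isomorphism is a
  comodule map precisely if \<open>h(f, k)\<close> is mapped to \<open>f\<^sub>(\<^sub>-\<^sub>1\<^sub>)\<^sup>\<star> k\<^sub>(\<^sub>-\<^sub>1\<^sub>) \<otimes> h(f\<^sub>(\<^sub>0\<^sub>), k\<^sub>(\<^sub>0\<^sub>))\<close>.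
\<close>

locale covariant_hermitian_module = covariant_module X F
  for X :: "('a::complex_star_algebra, 'b::complex_star_algebra, 'q::complex_star_algebra, 'w::complex_algebra_1) cqh_data"
    and F :: "('a, 'b, 'w, 'f::complex_vector, 't::complex_vector) module_data" +
  assumes module_weak_hermitian: "weak_hermitian_module (lact F) (ract F) (hform F)"
    and tensor_weak_hermitian: "weak_hermitian_module (\<lambda>b. wedge F (emb X b)) (tensor_ract F) (tensor_metric X F)"
    and hform_covariant: "base_coaction (hopf X) (incl X) (hform F f k) =
      ctensor_lift (\<lambda>a f'. ctensor_lift (\<lambda>c k'. (a\<^sup>\<star> * c) \<otimes> hform F f' k') (mcoact F k)) (mcoact F f)"

locale covariant_holomorphic_module = covariant_module X F
  for X :: "('a::complex_star_algebra, 'b::complex_star_algebra, 'q::complex_star_algebra, 'w::complex_algebra_1) cqh_data"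
    and F :: "('a, 'b, 'w, 'f::complex_vector, 't::complex_vector) module_data" +
  assumes module_projective: "finitely_generated_projective (lact F)"
    and mdelbar_linear: "clinear (mdelbar F)"
    and mdelbar_degree: "mdelbar F f \<in> tensor_biforms X F (0, 1)"
    and mdelbar_leibniz: "mdelbar F (lact F b f) =
      tens F (delbar X (emb X b)) f + wedge F (emb X b) (mdelbar F f)"
    and tensor_delbar_square: "tensor_delbar X F (tensor_delbar X F z) = 0"
    and mdelbar_covariant: "tensor_coact X F (mdelbar F f) = ctensor_map id (mdelbar F) (mcoact F f)"

locale covariant_hermitian_holomorphic_module =
  covariant_hermitian_module X F + covariant_holomorphic_module X F
  for X :: "('a::complex_star_algebra, 'b::complex_star_algebra, 'q::complex_star_algebra, 'w::complex_algebra_1) cqh_data"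
    and F :: "('a, 'b, 'w, 'f::complex_vector, 't::complex_vector) module_data"


section \<open>Anti-holomorphic cohomology and the Dolbeault--Dirac operator\<close>

definition cocycles :: "('a::complex_vector, 'b, 'q::complex_vector, 'w::complex_algebra_1) cqh_data \<Rightarrow>
    ('a, 'b, 'w, 'f::complex_vector, 't::complex_vector) module_data \<Rightarrow> nat \<Rightarrow> 't set"
  where "cocycles X F k = {z \<in> tensor_biforms X F (0, k). tensor_delbar X F z = 0}"

definition coboundaries :: "('a::complex_vector, 'b, 'q::complex_vector, 'w::complex_algebra_1) cqh_data \<Rightarrow>
    ('a, 'b, 'w, 'f::complex_vector, 't::complex_vector) module_data \<Rightarrow> nat \<Rightarrow> 't set"
  where "coboundaries X F k = (case k of 0 \<Rightarrow> {0} | Suc l \<Rightarrow> tensor_delbar X F ` tensor_biforms X F (0, l))"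

definition euler_characteristic :: "('a::complex_vector, 'b, 'q::complex_vector, 'w::complex_algebra_1) cqh_data \<Rightarrow>
    ('a, 'b, 'w, 'f::complex_vector, 't::complex_vector) module_data \<Rightarrow> int"
  where "euler_characteristic X F =
    (\<Sum>k | quotient_dim (cocycles X F k) (coboundaries X F k) \<noteq> 0.
      (-1) ^ k * int (quotient_dim (cocycles X F k) (coboundaries X F k)))"

definition module_inner :: "('a::complex_star_algebra, 'b::complex_algebra_1, 'q::complex_vector, 'w::complex_algebra_1) cqh_data \<Rightarrow>
    ('a, 'b, 'w, 'f::complex_vector, 't::complex_vector) module_data \<Rightarrow> 't \<Rightarrow> 't \<Rightarrow> complex"
  where "module_inner X F x y = haar (hopf X) (incl X (tensor_metric X F x y))"

definition is_L2_completion :: "('a::complex_star_algebra, 'b::complex_algebra_1, 'q::complex_vector, 'w::complex_algebra_1) cqh_data \<Rightarrow>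
    ('a, 'b, 'w, 'f::complex_vector, 't::complex_vector) module_data \<Rightarrow>
    ('t \<Rightarrow> 'h::complex_hilbert_space) \<Rightarrow> bool"
  where "is_L2_completion X F J \<longleftrightarrow> clinear J \<and>
    (\<forall>x y. cinner (J x) (J y) = module_inner X F x y) \<and> closure (range J) = UNIV"

definition delbar_adjoint :: "('a::complex_star_algebra, 'b::complex_algebra_1, 'q::complex_vector, 'w::complex_algebra_1) cqh_data \<Rightarrow>
    ('a, 'b, 'w, 'f::complex_vector, 't::complex_vector) module_data \<Rightarrow> 't \<Rightarrow> 't"
  where "delbar_adjoint X F y =
    (THE z. \<forall>x. module_inner X F (tensor_delbar X F x) y = module_inner X F x z)"

text \<open>Unbounded operators are represented by their graphs.\<close>

definition dirac :: "('a::complex_star_algebra, 'b::complex_algebra_1, 'q::complex_vector, 'w::complex_algebra_1) cqh_data \<Rightarrow>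
    ('a, 'b, 'w, 'f::complex_vector, 't::complex_vector) module_data \<Rightarrow>
    ('t \<Rightarrow> 'h::complex_hilbert_space) \<Rightarrow> ('h \<times> 'h) set"
  where "dirac X F J = closure (range (\<lambda>x. (J x, J (tensor_delbar X F x + delbar_adjoint X F x))))"

definition L2_even :: "('a::complex_vector, 'b, 'q::complex_vector, 'w::complex_algebra_1) cqh_data \<Rightarrow>
    ('a, 'b, 'w, 'f::complex_vector, 't::complex_vector) module_data \<Rightarrow>
    ('t \<Rightarrow> 'h::complex_hilbert_space) \<Rightarrow> 'h set"
  where "L2_even X F J = closure (J ` cvec.span (\<Union>k\<in>{k. even k}. tensor_biforms X F (0, k)))"

definition L2_odd :: "('a::complex_vector, 'b, 'q::complex_vector, 'w::complex_algebra_1) cqh_data \<Rightarrow>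
    ('a, 'b, 'w, 'f::complex_vector, 't::complex_vector) module_data \<Rightarrow>
    ('t \<Rightarrow> 'h::complex_hilbert_space) \<Rightarrow> 'h set"
  where "L2_odd X F J = closure (J ` cvec.span (\<Union>k\<in>{k. odd k}. tensor_biforms X F (0, k)))"

definition dirac_plus :: "('a::complex_star_algebra, 'b::complex_algebra_1, 'q::complex_vector, 'w::complex_algebra_1) cqh_data \<Rightarrow>
    ('a, 'b, 'w, 'f::complex_vector, 't::complex_vector) module_data \<Rightarrow>
    ('t \<Rightarrow> 'h::complex_hilbert_space) \<Rightarrow> ('h \<times> 'h) set"
  where "dirac_plus X F J = {(u, v) \<in> dirac X F J. u \<in> L2_even X F J}"

definition op_kernel :: "('h::complex_vector \<times> 'h) set \<Rightarrow> 'h set"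
  where "op_kernel T = {u. (u, 0) \<in> T}"

definition closed_densely_defined :: "'h::complex_hilbert_space set \<Rightarrow> 'h set \<Rightarrow> ('h \<times> 'h) set \<Rightarrow> bool"
  where "closed_densely_defined H1 H2 T \<longleftrightarrow> T \<subseteq> H1 \<times> H2 \<and> single_valued T \<and>
    (0, 0) \<in> T \<and> (\<forall>u v u' v'. (u, v) \<in> T \<longrightarrow> (u', v') \<in> T \<longrightarrow> (u + u', v + v') \<in> T) \<and>
    (\<forall>c u v. (u, v) \<in> T \<longrightarrow> (c *\<^sub>C u, c *\<^sub>C v) \<in> T) \<and>
    closed T \<and> H1 \<subseteq> closure (Domain T)"

definition fredholm :: "'h::complex_hilbert_space set \<Rightarrow> 'h set \<Rightarrow> ('h \<times> 'h) set \<Rightarrow> bool"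
  where "fredholm H1 H2 T \<longleftrightarrow> closed_densely_defined H1 H2 T \<and>
    finite_dimensional (op_kernel T) \<and> finite_dimensional_quotient H2 (Range T)"

text \<open>The codomain \<open>H2\<close> enters through the cokernel \<open>H2 / Range T\<close>.\<close>

definition fredholm_index :: "'h::complex_hilbert_space set \<Rightarrow> ('h \<times> 'h) set \<Rightarrow> int"
  where "fredholm_index H2 T = int (cvec.dim (op_kernel T)) - int (quotient_dim H2 (Range T))"

end

theory Submission
  imports Defs
begin

text \<open>The index is computed by Hodge theory.  On a compact complex manifold the Hodge decomposition of
  \<open>\<Omega>\<^sup>(\<^sup>0\<^sup>,\<^sup>k\<^sup>) \<otimes> \<F>\<close> comes from elliptic analysis; here it comes from the coaction of \<open>A\<close>, which splits the
  infinite-dimensional complex into finite-dimensional pieces on which linear algebra suffices.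

  All structure maps are covariant.  For the Hodge map this holds because it is determined by the bigrading and the
  operator \<open>L\<^sub>\<sigma>\<close> (\<open>hodge_commute\<close>), for the metric because it is built from covariant maps (\<open>metricT_covariant\<close>); so
  the inner product on the forms with values in \<open>\<F>\<close> is invariant (\<open>inner_invariant\<close>), and it is definite as the Haar
  state is faithful (\<open>haar_faithful\<close>).  Applying functionals on \<open>A\<close> to the left leg of the coaction gives an algebra
  of operators, the slices of the coaction.  They commute with the Dolbeault operator, and by invariance the adjoint
  of a slice is again a slice (\<open>invariant_form_slice\<close>).

  The second ingredient is finiteness: in a finitely generated relative Hopf module, the elements whose coaction has
  left legs in a given finite-dimensional subspace of \<open>A\<close> form a finite-dimensional space
  (\<open>finite_dimensional_coefficients_in\<close>).  This is where faithful flatness is used.  Consequently every form lies in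
  a finite-dimensional space \<open>env Y\<close> that is invariant under all slices and under the Dolbeault operator.  The adjoint
  of the Dolbeault operator therefore exists on all forms, without completing, and preserves the same spaces
  (\<open>adjoint_exists\<close>).  In such a space the orthogonal complement of an image is the kernel of the adjoint, which
  gives the Hodge decomposition and represents each cohomology class by a unique harmonic form
  (\<open>hodge_decomposition\<close>, \<open>cocyc_decomposition\<close>).  The dimensions of the cohomology groups are thus those of the
  spaces of harmonic forms, and \<open>\<chi>\<close> is the difference of the dimensions of the even and of the odd harmonic forms
  (\<open>euler_ker\<close>).

  It remains to compare with the closed operator \<open>D\<^sup>+\<close>.  As the cohomology is finite-dimensional, so is the
  space of harmonic forms, and the decomposition passes to the completion (\<open>closure_decomposition\<close>), so \<open>ker D\<^sup>+\<close> consists of the even harmonic forms.  A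
  closed operator whose range has finite codimension has closed range (\<open>closed_range_if_finite_codimension\<close>), so the
  range of \<open>D\<^sup>+\<close> is the full orthogonal complement of the odd harmonic forms, and these have the dimension of the
  cokernel.\<close>

section \<open>Calculus in tensor products over the complex numbers\<close>

lemma clinear_iff:
  "clinear f \<longleftrightarrow> (\<forall>x y. f (x + y) = f x + f y) \<and> (\<forall>c x. f (c *\<^sub>C x) = c *\<^sub>C f x)"
  by (auto simp: Vector_Spaces.linear_iff cvec.vector_space_axioms)

lemma clinear_add: "clinear f \<Longrightarrow> f (x + y) = f x + f y"
  and clinear_scale: "clinear f \<Longrightarrow> f (c *\<^sub>C x) = c *\<^sub>C f x"
  by (auto simp: clinear_iff)

lemma clinearI:
  assumes "\<And>x y. f (x + y) = f x + f y" and "\<And>c x. f (c *\<^sub>C x) = c *\<^sub>C f x"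
  shows "clinear f"
  using assms by (auto simp: clinear_iff)

lemma clinear_minus: "clinear f \<Longrightarrow> f (- x) = - f x"
  using clinear_scale[of f "-1" x] by (simp add: cvec.scale_minus_left)

lemma clinear_diff: "clinear f \<Longrightarrow> f (x - y) = f x - f y"
  by (metis clinear_add clinear_minus diff_conv_add_uminus)

lemma clinear_zero: "clinear f \<Longrightarrow> f 0 = 0"
  using clinear_scale[of f 0 0] by simp

lemma clinear_sum: "clinear f \<Longrightarrow> f (\<Sum>i\<in>I. x i) = (\<Sum>i\<in>I. f (x i))"
  by (induction I rule: infinite_finite_induct) (auto simp: clinear_zero clinear_add)

lemma clinear_compose: "clinear f \<Longrightarrow> clinear g \<Longrightarrow> clinear (\<lambda>x. f (g x))"
  by (simp add: clinear_iff)

lemma cfunctional_iff: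
  "cfunctional f \<longleftrightarrow> (\<forall>x y. f (x + y) = f x + f y) \<and> (\<forall>c x. f (c *\<^sub>C x) = c * f x)"
proof -
  have "vector_space ((*) :: complex \<Rightarrow> complex \<Rightarrow> complex)"
    by unfold_locales (auto simp: algebra_simps)
  then show ?thesis
    by (auto simp: Vector_Spaces.linear_iff cvec.vector_space_axioms)
qed

lemma cfunctional_zero: "cfunctional f \<Longrightarrow> f 0 = 0"
  unfolding cfunctional_iff by (metis add_cancel_right_right)

lemma clinear_span_image:
  assumes "clinear f" and "x \<in> cvec.span S"
  shows "f x \<in> cvec.span (f ` S)"
  using assms(2)
proof (induction rule: cvec.span_induct_alt)
  case base
  show ?case using assms(1) by (simp add: clinear_zero cvec.span_zero)
next
  case (step c x y)
  then show ?case
    using assms(1) by (simp add: clinear_add clinear_scale cvec.span_add cvec.span_scale cvec.span_base)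
qed

text \<open>Recording the scalar behaviour \<open>s\<close> in the first argument treats bilinear maps and sesquilinear
  ones (products \<open>a\<^sup>\<star> c\<close>, hermitian forms) at once.\<close>

definition sesq :: "(complex \<Rightarrow> complex) \<Rightarrow>
    ('a::complex_vector \<Rightarrow> 'b::complex_vector \<Rightarrow> 'c::complex_vector) \<Rightarrow> bool"
  where "sesq s m \<longleftrightarrow> (\<forall>x x' y. m (x + x') y = m x y + m x' y) \<and>
    (\<forall>x y y'. m x (y + y') = m x y + m x y') \<and>
    (\<forall>c x y. m (c *\<^sub>C x) y = s c *\<^sub>C m x y) \<and> (\<forall>c x y. m x (c *\<^sub>C y) = c *\<^sub>C m x y)"

abbreviation bilin where "bilin \<equiv> sesq (\<lambda>c. c)"

definition slin :: "(complex \<Rightarrow> complex) \<Rightarrow> ('a::complex_vector \<Rightarrow> 'b::complex_vector) \<Rightarrow> bool"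
  where "slin s f \<longleftrightarrow> (\<forall>x y. f (x + y) = f x + f y) \<and> (\<forall>c x. f (c *\<^sub>C x) = s c *\<^sub>C f x)"

lemma clinear_slin: "clinear f \<longleftrightarrow> slin (\<lambda>c. c) f"
  by (simp add: slin_def clinear_iff)

lemma slin_star: "slin cnj (star :: 'a::complex_star_algebra \<Rightarrow> 'a)"
  by (simp add: slin_def star_add star_scaleC)

lemma slin_id: "slin (\<lambda>c. c) id"
  by (simp_all add: clinear_iff slin_def)

lemma bilin_mult: "bilin ((*) :: 'a::complex_algebra_1 \<Rightarrow> 'a \<Rightarrow> 'a)"
  by (simp add: sesq_def distrib_left distrib_right mult_scaleC_left mult_scaleC_right)

lemma sesq_star_mult: "sesq cnj (\<lambda>a c. a\<^sup>\<star> * c :: 'a::complex_star_algebra)"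
  by (simp add: sesq_def star_add star_scaleC distrib_left distrib_right mult_scaleC_left
      mult_scaleC_right)

lemma sesq_linear_right: "sesq s m \<Longrightarrow> clinear (m x)"
  by (simp add: sesq_def clinear_iff)

lemma bilin_linear_left: "bilin m \<Longrightarrow> clinear (\<lambda>x. m x y)"
  by (simp add: sesq_def clinear_iff)

lemma sesq_zero_left: "sesq s m \<Longrightarrow> m 0 y = 0"
  unfolding sesq_def by (metis add_cancel_right_right)

lemma sesq_zero_right: "sesq s m \<Longrightarrow> m x 0 = 0"
  unfolding sesq_def by (metis add_cancel_right_right)

lemma sesq_add_left: "sesq s m \<Longrightarrow> m (x + x') y = m x y + m x' y"
  and sesq_add_right: "sesq s m \<Longrightarrow> m x (y + y') = m x y + m x y'"
  and sesq_scale_left: "sesq s m \<Longrightarrow> m (c *\<^sub>C x) y = s c *\<^sub>C m x y"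
  and sesq_scale_right: "sesq s m \<Longrightarrow> m x (c *\<^sub>C y) = c *\<^sub>C m x y"
  by (auto simp: sesq_def)

lemma sesq_sum_left: "sesq s m \<Longrightarrow> m (\<Sum>i\<in>I. f i) y = (\<Sum>i\<in>I. m (f i) y)"
  by (induction I rule: infinite_finite_induct) (simp_all add: sesq_zero_left[of s] sesq_add_left[of s])

lemma sesq_sum_right: "sesq s m \<Longrightarrow> m x (\<Sum>i\<in>I. f i) = (\<Sum>i\<in>I. m x (f i))"
  by (induction I rule: infinite_finite_induct) (simp_all add: sesq_zero_right[of s] sesq_add_right[of s])

lemma ctens_add_left: "(a + a') \<otimes> b = a \<otimes> b + a' \<otimes> b"
  and ctens_add_right: "a \<otimes> (b + b') = a \<otimes> b + a \<otimes> b'"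
  and ctens_balance: "(c *\<^sub>C a) \<otimes> b = a \<otimes> (c *\<^sub>C b)"
  using is_tensor_product_ctens unfolding is_tensor_product_def balanced_def by blast+

lemma ctens_scale_left: "(c *\<^sub>C a) \<otimes> b = c *\<^sub>C (a \<otimes> b)"
  and ctens_scale_right: "a \<otimes> (c *\<^sub>C b) = c *\<^sub>C (a \<otimes> b)"
  by (simp_all add: scaleC_ctens ctens_balance)

lemma bilin_ctens: "bilin (\<otimes>)"
  by (simp add: sesq_def ctens_add_left ctens_add_right ctens_scale_left ctens_scale_right)

lemma ctensor_induct [case_names pure add]:
  assumes "\<And>a b. P (a \<otimes> b)" and "\<And>x y. P x \<Longrightarrow> P y \<Longrightarrow> P (x + y)"
  shows "P z"
proof -
  have "P (tensor_sum (\<otimes>) X)" for X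
  proof (induction X)
    case empty
    show ?case using assms(1)[of 0 0] by (simp add: sesq_zero_left[OF bilin_ctens])
  next
    case (add x X)
    then show ?case using assms by (cases x) auto
  qed
  then show ?thesis
    using is_tensor_product_ctens unfolding is_tensor_product_def by metis
qed

abbreviation bal2 :: "('a::complex_vector \<Rightarrow> 'b::complex_vector \<Rightarrow> 'p::ab_group_add) \<Rightarrow> bool"
  where "bal2 \<equiv> balanced (\<lambda>m c. c *\<^sub>C m) (*\<^sub>C)"

lemma bal2I:
  assumes "\<And>m m' n. t (m + m') n = t m n + t m' n" and "\<And>m n n'. t m (n + n') = t m n + t m n'"
    and "\<And>c m n. t (c *\<^sub>C m) n = t m (c *\<^sub>C n)"
  shows "bal2 t"
  using assms by (simp add: balanced_def)

lemma lift_ctens: "bal2 \<phi> \<Longrightarrow> ctensor_lift \<phi> (a \<otimes> b) = \<phi> a b"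
  by (rule tensor_lift_apply[OF is_tensor_product_ctens])

lemma lift_add: "bal2 \<phi> \<Longrightarrow> ctensor_lift \<phi> (x + y) = ctensor_lift \<phi> x + ctensor_lift \<phi> y"
  by (rule tensor_lift_add[OF is_tensor_product_ctens])

lemma lift_fun_add:
  assumes "bal2 \<phi>" "bal2 \<psi>"
  shows "ctensor_lift (\<lambda>a b. \<phi> a b + \<psi> a b) z = ctensor_lift \<phi> z + ctensor_lift \<psi> z"
proof -
  have "bal2 (\<lambda>a b. \<phi> a b + \<psi> a b)"
    using assms by (simp add: balanced_def algebra_simps)
  then show ?thesis
    by (induction z rule: ctensor_induct) (auto simp: lift_ctens lift_add assms algebra_simps)
qed

lemma lift_scale:
  assumes "bal2 \<phi>"
  shows "ctensor_lift \<phi> (c *\<^sub>C z) = ctensor_lift (\<lambda>a b. \<phi> (c *\<^sub>C a) b) z"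
proof -
  have "bal2 (\<lambda>a b. \<phi> (c *\<^sub>C a) b)"
    using assms by (simp add: balanced_def scaleC_add_right scaleC_scaleC mult.commute)
  then show ?thesis
    by (induction z rule: ctensor_induct)
      (auto simp: lift_ctens lift_add assms scaleC_add_right simp flip: ctens_scale_left)
qed

lemma lift_apply:
  fixes f :: "'p::ab_group_add \<Rightarrow> 'q::ab_group_add"
  assumes "bal2 \<phi>" and "\<And>x y. f (x + y) = f x + f y"
  shows "f (ctensor_lift \<phi> z) = ctensor_lift (\<lambda>a b. f (\<phi> a b)) z"
proof -
  have "bal2 (\<lambda>a b. f (\<phi> a b))"
    using assms by (simp add: balanced_def)
  then show ?thesis
    by (induction z rule: ctensor_induct) (auto simp: lift_ctens lift_add assms)
qed

lemma sesq_bal2: "bilin m \<Longrightarrow> bal2 m"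
  by (simp add: sesq_def balanced_def)

lemma bilin_lift_linear: "bilin m \<Longrightarrow> clinear (ctensor_lift m)"
proof (rule clinearI)
  assume m: "bilin m"
  show "ctensor_lift m (x + y) = ctensor_lift m x + ctensor_lift m y" for x y
    by (rule lift_add[OF sesq_bal2[OF m]])
  show "ctensor_lift m (c *\<^sub>C x) = c *\<^sub>C ctensor_lift m x" for c x
    using m by (induction x rule: ctensor_induct)
      (auto simp: scaleC_add_right lift_add lift_ctens sesq_bal2 sesq_def simp flip: ctens_scale_left)
qed

subsection \<open>Maps and products on tensors\<close>

lemma bal2_map: "slin s f \<Longrightarrow> slin s g \<Longrightarrow> bal2 (\<lambda>a b. f a \<otimes> g b)"
  by (rule bal2I)
    (auto simp: slin_def ctens_add_left ctens_add_right ctens_scale_left ctens_scale_right)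

lemma map_ctens: "slin s f \<Longrightarrow> slin s g \<Longrightarrow> ctensor_map f g (a \<otimes> b) = f a \<otimes> g b"
  by (rule lift_ctens[OF bal2_map])

lemma slin_map:
  assumes "slin s f" "slin s g"
  shows "slin s (ctensor_map f g)"
  unfolding slin_def
proof (intro conjI allI)
  show "ctensor_map f g (x + y) = ctensor_map f g x + ctensor_map f g y" for x y
    by (rule lift_add[OF bal2_map[OF assms]])
  show "ctensor_map f g (c *\<^sub>C x) = s c *\<^sub>C ctensor_map f g x" for c x
    using assms by (induction x rule: ctensor_induct)
      (auto simp: scaleC_add_right lift_add[OF bal2_map[OF assms]] map_ctens[OF assms]
        slin_def simp flip: ctens_scale_left)
qed

definition tmap where "tmap g = ctensor_map id g"

lemma tmap_ctens: "clinear g \<Longrightarrow> tmap g (a \<otimes> b) = a \<otimes> g b"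
  unfolding tmap_def clinear_slin using map_ctens[OF slin_id, of g a b] by simp

lemma tmap_linear: "clinear g \<Longrightarrow> clinear (tmap g)"
  unfolding tmap_def clinear_slin by (rule slin_map[OF slin_id])

text \<open>The extension to tensors of \<open>(a \<otimes> m, c \<otimes> n) \<mapsto> m1 a c \<otimes> m2 m n\<close>.  With \<open>m1 a c = a c\<close> it extends products and module
  actions \<open>m2\<close>, and with \<open>m1 a c = a\<^sup>\<star> c\<close> it extends sesquilinear forms \<open>m2\<close>.\<close>

definition tmul where "tmul m1 m2 z y =
  ctensor_lift (\<lambda>a m. ctensor_lift (\<lambda>c n. m1 a c \<otimes> m2 m n) y) z"

context
  fixes s and m1 :: "'a::complex_vector \<Rightarrow> 'c::complex_vector \<Rightarrow> 'p::complex_vector"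
    and m2 :: "'m::complex_vector \<Rightarrow> 'n::complex_vector \<Rightarrow> 'q::complex_vector"
  assumes m1: "sesq s m1" and m2: "sesq s m2"
begin

lemma bal2_tmul_inner: "bal2 (\<lambda>c n. m1 a c \<otimes> m2 m n)"
  using m1 m2 by (intro bal2I)
    (auto simp: sesq_def ctens_add_left ctens_add_right ctens_scale_left ctens_scale_right)

lemma bal2_tmul_outer: "bal2 (\<lambda>a m. ctensor_lift (\<lambda>c n. m1 a c \<otimes> m2 m n) y)"
proof (rule bal2I)
  show "ctensor_lift (\<lambda>c n. m1 (a + a') c \<otimes> m2 m n) y =
    ctensor_lift (\<lambda>c n. m1 a c \<otimes> m2 m n) y + ctensor_lift (\<lambda>c n. m1 a' c \<otimes> m2 m n) y" for a a' m
    unfolding sesq_add_left[OF m1] ctens_add_left by (rule lift_fun_add[OF bal2_tmul_inner bal2_tmul_inner])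
  show "ctensor_lift (\<lambda>c n. m1 a c \<otimes> m2 (m + m') n) y =
    ctensor_lift (\<lambda>c n. m1 a c \<otimes> m2 m n) y + ctensor_lift (\<lambda>c n. m1 a c \<otimes> m2 m' n) y" for a m m'
    unfolding sesq_add_left[OF m2] ctens_add_right by (rule lift_fun_add[OF bal2_tmul_inner bal2_tmul_inner])
  show "ctensor_lift (\<lambda>c n. m1 (k *\<^sub>C a) c \<otimes> m2 m n) y =
    ctensor_lift (\<lambda>c n. m1 a c \<otimes> m2 (k *\<^sub>C m) n) y" for k a m
    unfolding sesq_scale_left[OF m1] sesq_scale_left[OF m2] ctens_balance ..
qed

lemma tmul_ctens: "tmul m1 m2 (a \<otimes> m) (c \<otimes> n) = m1 a c \<otimes> m2 m n"
  unfolding tmul_def by (subst lift_ctens[OF bal2_tmul_outer], rule lift_ctens[OF bal2_tmul_inner])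

lemma sesq_tmul: "sesq s (tmul m1 m2)"
proof -
  have l: "tmul m1 m2 (x + x') y = tmul m1 m2 x y + tmul m1 m2 x' y" for x x' y
    unfolding tmul_def by (rule lift_add[OF bal2_tmul_outer])
  have r: "tmul m1 m2 x (y + y') = tmul m1 m2 x y + tmul m1 m2 x y'" for x y y'
    unfolding tmul_def lift_add[OF bal2_tmul_inner]
    by (rule lift_fun_add[OF bal2_tmul_outer bal2_tmul_outer])
  have "tmul m1 m2 (k *\<^sub>C (a \<otimes> m)) y = s k *\<^sub>C tmul m1 m2 (a \<otimes> m) y" for k a m y
    using m1 by (induction y rule: ctensor_induct)
      (auto simp: r scaleC_add_right tmul_ctens sesq_def simp flip: ctens_scale_left)
  then have ls: "tmul m1 m2 (k *\<^sub>C x) y = s k *\<^sub>C tmul m1 m2 x y" for k x y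
    by (induction x rule: ctensor_induct) (auto simp: l scaleC_add_right)
  have "tmul m1 m2 (a \<otimes> m) (k *\<^sub>C y) = k *\<^sub>C tmul m1 m2 (a \<otimes> m) y" for k a m y
    using m1 by (induction y rule: ctensor_induct)
      (auto simp: r scaleC_add_right tmul_ctens sesq_def simp flip: ctens_scale_left)
  then have rs: "tmul m1 m2 x (k *\<^sub>C y) = k *\<^sub>C tmul m1 m2 x y" for k x y
    by (induction x rule: ctensor_induct) (auto simp: l scaleC_add_right)
  show ?thesis unfolding sesq_def by (intro conjI allI l r ls rs)
qed

lemma tmul_add_left: "tmul m1 m2 (x + x') y = tmul m1 m2 x y + tmul m1 m2 x' y"
  and tmul_add_right: "tmul m1 m2 x (y + y') = tmul m1 m2 x y + tmul m1 m2 x y'"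
  by (rule sesq_add_left[OF sesq_tmul], rule sesq_add_right[OF sesq_tmul])

end

subsection \<open>Slices\<close>

text \<open>The map \<open>\<phi> \<otimes> id\<close>.  A tensor is determined by its slices along all functionals, so identities
  between tensors reduce to identities between vectors.\<close>

definition slice :: "('a::complex_vector \<Rightarrow> complex) \<Rightarrow> ('a, 'm::complex_vector) ctensor \<Rightarrow> 'm"
  where "slice \<phi> = ctensor_lift (\<lambda>a m. \<phi> a *\<^sub>C m)"

lemma bilin_slice: "cfunctional \<phi> \<Longrightarrow> bilin (\<lambda>a m. \<phi> a *\<^sub>C m)"
  by (simp add: sesq_def cfunctional_iff scaleC_add_left scaleC_add_right scaleC_scaleC mult.commute)

lemma slice_linear: "cfunctional \<phi> \<Longrightarrow> clinear (slice \<phi>)"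
  unfolding slice_def by (rule bilin_lift_linear[OF bilin_slice])

lemma slice_ctens: "cfunctional \<phi> \<Longrightarrow> slice \<phi> (a \<otimes> m) = \<phi> a *\<^sub>C m"
  unfolding slice_def by (rule lift_ctens[OF sesq_bal2[OF bilin_slice]])

lemma slice_tmap:
  assumes "cfunctional \<phi>" and "clinear g"
  shows "slice \<phi> (tmap g z) = g (slice \<phi> z)"
  by (induction z rule: ctensor_induct)
    (auto simp: assms tmap_ctens slice_ctens clinear_scale clinear_add slice_linear tmap_linear)

definition tens_in :: "'a::complex_vector set \<Rightarrow> 'm::complex_vector set \<Rightarrow> ('a, 'm) ctensor set"
  where "tens_in C V = cvec.span {a \<otimes> m |a m. a \<in> C \<and> m \<in> V}"

lemma tens_in_induct [consumes 1, case_names subspace pure add]: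
  assumes "z \<in> tens_in UNIV V" and "cvec.subspace V" and "\<And>a m. m \<in> V \<Longrightarrow> P (a \<otimes> m)"
    and "\<And>x y. P x \<Longrightarrow> P y \<Longrightarrow> P (x + y)"
  shows "P z"
  using assms(1) unfolding tens_in_def
proof (induction rule: cvec.span_induct_alt)
  case base
  have "0 \<in> V" using assms(2) by (rule cvec.subspace_0)
  then show ?case using assms(3)[of 0 0] by (simp add: sesq_zero_left[OF bilin_ctens])
next
  case (step c x y)
  then obtain a m where x: "x = a \<otimes> m" "m \<in> V" by blast
  then have "P (c *\<^sub>C x)" using assms(3)[of m "c *\<^sub>C a"] by (simp add: ctens_scale_left)
  then show ?case using step.IH assms(4) by blast
qed

lemma slice_tens_in:
  assumes "cfunctional \<phi>" "z \<in> tens_in UNIV V" "cvec.subspace V"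
  shows "slice \<phi> z \<in> V"
  using assms(2,3)
  by (induction rule: tens_in_induct)
    (use assms in \<open>auto simp: slice_ctens cvec.subspace_scale clinear_add[OF slice_linear] cvec.subspace_add\<close>)

text \<open>Writing the left legs of \<open>z\<close> in the basis \<open>E\<close>, the coefficient at \<open>e\<close> is the slice along the \<open>e\<close>-th coordinate.\<close>

lemma tensor_expansion:
  fixes z :: "('a::complex_vector, 'm::complex_vector) ctensor"
  assumes E: "cvec.independent E" "cvec.span E = UNIV"
  obtains F where "finite F" "F \<subseteq> E"
    "z = (\<Sum>e\<in>F. e \<otimes> slice (\<lambda>a. cvec.representation E a e) z)"
proof -
  let ?r = "\<lambda>e a. cvec.representation E a e"
  have r: "cfunctional (?r e)" for e
    using cvec.linear_representation[OF E] .
  \<comment> \<open>The expansion holds over all larger finite sets of basis vectors, so that those of two summands can be merged.\<close>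
  have "\<exists>F. finite F \<and> F \<subseteq> E \<and>
      (\<forall>G. finite G \<longrightarrow> F \<subseteq> G \<longrightarrow> G \<subseteq> E \<longrightarrow> z = (\<Sum>e\<in>G. e \<otimes> slice (?r e) z))"
  proof (induction z rule: ctensor_induct)
    case (pure a m)
    have fin: "finite {e. ?r e a \<noteq> 0}" by (rule cvec.finite_representation)
    have "a \<otimes> m = (\<Sum>e\<in>G. e \<otimes> slice (?r e) (a \<otimes> m))"
      if "finite G" "{e. ?r e a \<noteq> 0} \<subseteq> G" for G
    proof -
      have "a = (\<Sum>e | ?r e a \<noteq> 0. ?r e a *\<^sub>C e)"
        using cvec.sum_nonzero_representation_eq[OF E(1), of a] E(2) by simp
      also have "\<dots> = (\<Sum>e\<in>G. ?r e a *\<^sub>C e)"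
        using that by (intro sum.mono_neutral_left) auto
      finally have a: "a = (\<Sum>e\<in>G. ?r e a *\<^sub>C e)" .
      have "(\<Sum>e\<in>G. ?r e a *\<^sub>C e) \<otimes> m = (\<Sum>e\<in>G. e \<otimes> slice (?r e) (a \<otimes> m))"
        by (simp add: slice_ctens[OF r] ctens_balance sesq_sum_left[OF bilin_ctens])
      then show ?thesis
        unfolding a[symmetric] .
    qed
    moreover have "{e. ?r e a \<noteq> 0} \<subseteq> E"
      using cvec.representation_ne_zero[of E a] by blast
    ultimately show ?case using fin by blast
  next
    case (add x y)
    then obtain F G where FG: "finite F" "F \<subseteq> E" "finite G" "G \<subseteq> E"
      and F: "\<And>K. finite K \<Longrightarrow> F \<subseteq> K \<Longrightarrow> K \<subseteq> E \<Longrightarrow> x = (\<Sum>e\<in>K. e \<otimes> slice (?r e) x)"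
      and G: "\<And>K. finite K \<Longrightarrow> G \<subseteq> K \<Longrightarrow> K \<subseteq> E \<Longrightarrow> y = (\<Sum>e\<in>K. e \<otimes> slice (?r e) y)"
      by blast
    have "x + y = (\<Sum>e\<in>K. e \<otimes> slice (?r e) (x + y))" if "finite K" "F \<union> G \<subseteq> K" "K \<subseteq> E" for K
    proof -
      have "x + y = (\<Sum>e\<in>K. e \<otimes> slice (?r e) x) + (\<Sum>e\<in>K. e \<otimes> slice (?r e) y)"
        using F[of K] G[of K] that by (intro arg_cong2[where f = "(+)"]) auto
      also have "\<dots> = (\<Sum>e\<in>K. e \<otimes> slice (?r e) (x + y))"
        by (simp only: clinear_add[OF slice_linear[OF r]] ctens_add_right sum.distrib)
      finally show ?thesis .
    qed
    then show ?case using FG by (meson finite_Un Un_least)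
  qed
  then show ?thesis using that by blast
qed

text \<open>The coefficients in an expansion along a basis extending one of \<open>C\<close> are slices, and those outside
  \<open>C\<close> come from functionals vanishing on \<open>C\<close>.\<close>

lemma in_tens_in_if_slices_vanish:
  fixes z :: "('a::complex_vector, 'm::complex_vector) ctensor"
  assumes "\<And>\<phi>. cfunctional \<phi> \<Longrightarrow> (\<forall>c\<in>C. \<phi> c = 0) \<Longrightarrow> slice \<phi> z = 0"
  shows "z \<in> tens_in (cvec.span C) UNIV"
proof -
  obtain D where D: "D \<subseteq> C" "cvec.independent D" "C \<subseteq> cvec.span D"
    by (rule cvec.maximal_independent_subset)
  obtain E where E: "D \<subseteq> E" "cvec.independent E" and "UNIV \<subseteq> cvec.span E"
    by (rule cvec.maximal_independent_subset_extend[OF subset_UNIV D(2)])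
  then have E: "D \<subseteq> E" "cvec.independent E" "cvec.span E = UNIV" by auto
  let ?r = "\<lambda>e a. cvec.representation E a e"
  have r: "cfunctional (?r e)" for e
    using cvec.linear_representation[OF E(2,3)] .
  obtain F where F: "F \<subseteq> E" "z = (\<Sum>e\<in>F. e \<otimes> slice (?r e) z)"
    by (rule tensor_expansion[OF E(2,3), of z])
  have "e \<otimes> slice (?r e) z \<in> tens_in (cvec.span C) UNIV" if "e \<in> F" for e
  proof (cases "e \<in> D")
    case True
    then show ?thesis using D(1) unfolding tens_in_def
      by (intro cvec.span_base) (auto intro: cvec.span_base)
  next
    case False
    have "?r e c = 0" if "c \<in> C" for c
    proof -
      have "cvec.representation E c = cvec.representation D c"
        using E(1,2) D(3) that by (intro cvec.representation_extend) auto
      then show ?thesis using False cvec.representation_ne_zero[of D c e] by auto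
    qed
    then have "slice (?r e) z = 0" using assms r by blast
    then show ?thesis by (simp add: sesq_zero_right[OF bilin_ctens] tens_in_def cvec.span_zero)
  qed
  then have "(\<Sum>e\<in>F. e \<otimes> slice (?r e) z) \<in> tens_in (cvec.span C) UNIV"
    unfolding tens_in_def by (rule cvec.span_sum)
  then show ?thesis using F(2) by simp
qed

lemma in_tens_in_if_slices_in:
  fixes z :: "('a::complex_vector, 'm::complex_vector) ctensor"
  assumes "\<And>\<phi>. cfunctional \<phi> \<Longrightarrow> slice \<phi> z \<in> V"
  shows "z \<in> tens_in UNIV V"
proof -
  have "cvec.independent ({} :: 'a set)" by (rule cvec.independent_empty)
  then obtain E where E: "cvec.independent E" and "UNIV \<subseteq> cvec.span (E :: 'a set)"
    by (rule cvec.maximal_independent_subset_extend[OF subset_UNIV])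
  then have E: "cvec.independent E" "cvec.span E = UNIV" by auto
  obtain F where F: "z = (\<Sum>e\<in>F. e \<otimes> slice (\<lambda>a. cvec.representation E a e) z)"
    by (rule tensor_expansion[OF E, of z])
  have "(\<Sum>e\<in>F. e \<otimes> slice (\<lambda>a. cvec.representation E a e) z) \<in> tens_in UNIV V"
    unfolding tens_in_def
    by (intro cvec.span_sum cvec.span_base) (use assms[OF cvec.linear_representation[OF E]] in blast)
  then show ?thesis using F by simp
qed

lemma eq_if_slices_eq:
  assumes "\<And>\<phi>. cfunctional \<phi> \<Longrightarrow> slice \<phi> z = slice \<phi> z'"
  shows "z = z'"
proof -
  have "z - z' \<in> tens_in (cvec.span {}) UNIV"
    by (rule in_tens_in_if_slices_vanish) (simp add: assms clinear_diff[OF slice_linear])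
  moreover have "{a \<otimes> m |a m. a \<in> cvec.span {} \<and> m \<in> UNIV} \<subseteq> {0}"
    by (auto simp: sesq_zero_left[OF bilin_ctens])
  ultimately have "z - z' \<in> cvec.span {0}"
    unfolding tens_in_def using cvec.span_mono by blast
  then show ?thesis by simp
qed

lemma tmap_inj:
  assumes "clinear g" "inj g" "tmap g z = tmap g z'"
  shows "z = z'"
proof (rule eq_if_slices_eq)
  fix \<phi> :: "'c \<Rightarrow> complex" assume "cfunctional \<phi>"
  then have "g (slice \<phi> z) = g (slice \<phi> z')"
    using assms by (metis slice_tmap)
  then show "slice \<phi> z = slice \<phi> z'" using assms(2) by (simp add: inj_eq)
qed

section \<open>Comodules and invariant forms\<close>

text \<open>The expressions that may be evaluated on a threefold tensor product.  Only additivity and balancing are required, so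
  that the target may be any abelian group.\<close>

definition bal3 :: "('a::complex_vector \<Rightarrow> 'b::complex_vector \<Rightarrow> 'm::complex_vector \<Rightarrow> 'p::ab_group_add) \<Rightarrow> bool"
  where "bal3 g \<longleftrightarrow> (\<forall>a a' b m. g (a + a') b m = g a b m + g a' b m) \<and>
    (\<forall>a b b' m. g a (b + b') m = g a b m + g a b' m) \<and>
    (\<forall>a b m m'. g a b (m + m') = g a b m + g a b m') \<and>
    (\<forall>c a b m. g (c *\<^sub>C a) b m = g a (c *\<^sub>C b) m) \<and>
    (\<forall>c a b m. g a (c *\<^sub>C b) m = g a b (c *\<^sub>C m))"

context
  fixes g :: "'a::complex_vector \<Rightarrow> 'b::complex_vector \<Rightarrow> 'm::complex_vector \<Rightarrow> 'p::ab_group_add"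
  assumes g: "bal3 g"
begin

lemma bal3_12: "bal2 (\<lambda>a b. g a b m)"
  using g by (simp add: bal3_def balanced_def)

lemma bal3_23: "bal2 (g a)"
  using g by (simp add: bal3_def balanced_def)

lemma bal3_comult:
  assumes "clinear \<Delta>"
  shows "bal2 (\<lambda>a m. ctensor_lift (\<lambda>a1 a2. g a1 a2 m) (\<Delta> a))"
proof (rule bal2I)
  show "ctensor_lift (\<lambda>a1 a2. g a1 a2 m) (\<Delta> (a + a')) =
      ctensor_lift (\<lambda>a1 a2. g a1 a2 m) (\<Delta> a) + ctensor_lift (\<lambda>a1 a2. g a1 a2 m) (\<Delta> a')" for a a' m
    by (simp add: clinear_add[OF assms] lift_add[OF bal3_12])
  have "g a b (m + m') = g a b m + g a b m'" for a b m m'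
    using g by (simp add: bal3_def)
  then show "ctensor_lift (\<lambda>a1 a2. g a1 a2 (m + m')) (\<Delta> a) =
      ctensor_lift (\<lambda>a1 a2. g a1 a2 m) (\<Delta> a) + ctensor_lift (\<lambda>a1 a2. g a1 a2 m') (\<Delta> a)" for a m m'
    by (simp add: lift_fun_add[OF bal3_12 bal3_12])
  have "g (c *\<^sub>C a) b m = g a b (c *\<^sub>C m)" for a b m c
    using g by (simp add: bal3_def)
  then show "ctensor_lift (\<lambda>a1 a2. g a1 a2 m) (\<Delta> (c *\<^sub>C a)) =
      ctensor_lift (\<lambda>a1 a2. g a1 a2 (c *\<^sub>C m)) (\<Delta> a)" for c a m
    by (simp add: clinear_scale[OF assms] lift_scale[OF bal3_12])
qed

lemma bal3_lift: "bal2 (\<lambda>a y. ctensor_lift (g a) y)"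
proof (rule bal2I)
  have "g (a + a') = (\<lambda>b m. g a b m + g a' b m)" for a a'
    using g by (simp add: bal3_def fun_eq_iff)
  then show "ctensor_lift (g (a + a')) y = ctensor_lift (g a) y + ctensor_lift (g a') y" for a a' y
    by (simp add: lift_fun_add[OF bal3_23 bal3_23])
  show "ctensor_lift (g a) (y + y') = ctensor_lift (g a) y + ctensor_lift (g a) y'" for a y y'
    by (rule lift_add[OF bal3_23])
  have "g (c *\<^sub>C a) = (\<lambda>b m. g a (c *\<^sub>C b) m)" for c a
    using g by (simp add: bal3_def fun_eq_iff)
  then show "ctensor_lift (g (c *\<^sub>C a)) y = ctensor_lift (g a) (c *\<^sub>C y)" for c a y
    by (simp add: lift_scale[OF bal3_23])
qed

end

lemma bal3_ctens: "bal3 (\<lambda>a b m. a \<otimes> b \<otimes> m)"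
  by (simp add: bal3_def ctens_add_left ctens_add_right ctens_scale_left ctens_scale_right)

lemma left_comodule_linear: "left_comodule H \<delta> \<Longrightarrow> clinear \<delta>"
  and left_comodule_coassoc: "left_comodule H \<delta> \<Longrightarrow>
    ctensor_lift (\<lambda>a m. ctensor_lift (\<lambda>a1 a2. a1 \<otimes> a2 \<otimes> m) (comult H a)) (\<delta> x)
       = ctensor_lift (\<lambda>a m. a \<otimes> \<delta> m) (\<delta> x)"
  and left_comodule_counit: "left_comodule H \<delta> \<Longrightarrow> slice (counit H) (\<delta> x) = x"
  by (simp_all add: left_comodule_def slice_def)

text \<open>Sweedler calculus: an expression in \<open>x\<^sub>(\<^sub>-\<^sub>2\<^sub>)\<close>, \<open>x\<^sub>(\<^sub>-\<^sub>1\<^sub>)\<close>, \<open>x\<^sub>(\<^sub>0\<^sub>)\<close> may be evaluated by expanding either leg of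
  \<open>\<delta>(x)\<close> further, because it factors through the threefold tensor product.\<close>

lemma coassoc_apply:
  assumes \<delta>: "left_comodule H \<delta>" and \<Delta>: "clinear (comult H)" and g: "bal3 g"
  shows "ctensor_lift (\<lambda>a m. ctensor_lift (\<lambda>a1 a2. g a1 a2 m) (comult H a)) (\<delta> x) =
    ctensor_lift (\<lambda>a m. ctensor_lift (\<lambda>a2 m'. g a a2 m') (\<delta> m)) (\<delta> x)"
proof -
  let ?K = "ctensor_lift (\<lambda>a y. ctensor_lift (g a) y)"
  note K = lift_ctens[OF bal3_lift[OF g]] lift_add[OF bal3_lift[OF g]]
  have l: "?K (ctensor_lift (\<lambda>a1 a2. a1 \<otimes> a2 \<otimes> m) w) = ctensor_lift (\<lambda>a1 a2. g a1 a2 m) w" for m w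
    by (subst lift_apply[where f = ?K, OF bal3_12[OF bal3_ctens] K(2)])
      (simp add: K(1) lift_ctens[OF bal3_23[OF g]])
  have "?K (ctensor_lift (\<lambda>a m. ctensor_lift (\<lambda>a1 a2. a1 \<otimes> a2 \<otimes> m) (comult H a)) (\<delta> x)) =
      ctensor_lift (\<lambda>a m. ctensor_lift (\<lambda>a1 a2. g a1 a2 m) (comult H a)) (\<delta> x)"
    by (subst lift_apply[where f = ?K, OF bal3_comult[OF bal3_ctens \<Delta>] K(2)]) (simp only: l)
  moreover have "bal2 (\<lambda>a m. a \<otimes> \<delta> m)"
    using left_comodule_linear[OF \<delta>]
    by (intro bal2I) (simp_all add: ctens_add_left ctens_add_right ctens_balance clinear_iff)
  then have "?K (ctensor_lift (\<lambda>a m. a \<otimes> \<delta> m) (\<delta> x)) =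
      ctensor_lift (\<lambda>a m. ctensor_lift (g a) (\<delta> m)) (\<delta> x)"
    by (subst lift_apply[where f = ?K, OF _ K(2)]) (simp_all only: K(1))
  ultimately show ?thesis
    using left_comodule_coassoc[OF \<delta>] by simp
qed

definition convolution :: "'a::complex_vector cqga_data \<Rightarrow> ('a \<Rightarrow> complex) \<Rightarrow> ('a \<Rightarrow> complex) \<Rightarrow> 'a \<Rightarrow> complex"
  where "convolution H \<psi> \<phi> a = ctensor_lift (\<lambda>b c. \<psi> b * \<phi> c) (comult H a)"

lemma bal2_convolution: "cfunctional \<psi> \<Longrightarrow> cfunctional \<phi> \<Longrightarrow> bal2 (\<lambda>b c. \<psi> b * \<phi> c)"
  by (simp add: balanced_def cfunctional_iff algebra_simps)

lemma convolution_functional: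
  assumes "clinear (comult H)" "cfunctional \<psi>" "cfunctional \<phi>"
  shows "cfunctional (convolution H \<psi> \<phi>)"
  unfolding cfunctional_iff
proof (intro conjI allI)
  show "convolution H \<psi> \<phi> (x + y) = convolution H \<psi> \<phi> x + convolution H \<psi> \<phi> y" for x y
    unfolding convolution_def
    by (simp add: clinear_add[OF assms(1)] lift_add[OF bal2_convolution] assms(2,3))
  have "ctensor_lift (\<lambda>b c. \<psi> b * \<phi> c) (k *\<^sub>C z) = k * ctensor_lift (\<lambda>b c. \<psi> b * \<phi> c) z" for k z
    using assms by (subst lift_scale[OF bal2_convolution])
      (simp_all add: cfunctional_iff mult.assoc
        lift_apply[OF bal2_convolution, where f = "\<lambda>x. k * x"] distrib_left)
  then show "convolution H \<psi> \<phi> (k *\<^sub>C x) = k * convolution H \<psi> \<phi> x" for k x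
    unfolding convolution_def by (simp add: clinear_scale[OF assms(1)])
qed

text \<open>By coassociativity the operators \<open>slice \<phi> \<circ> \<delta>\<close> form an algebra, whose product is convolution in the reverse order.\<close>

lemma slice_slice:
  assumes \<delta>: "left_comodule H \<delta>" and \<Delta>: "clinear (comult H)"
    and \<psi>: "cfunctional \<psi>" and \<phi>: "cfunctional \<phi>"
  shows "slice \<phi> (\<delta> (slice \<psi> (\<delta> x))) = slice (convolution H \<psi> \<phi>) (\<delta> x)"
proof -
  let ?g = "\<lambda>a b m. (\<psi> a * \<phi> b) *\<^sub>C m"
  have g: "bal3 ?g"
    using \<psi> \<phi> by (simp add: bal3_def cfunctional_iff scaleC_add_left scaleC_add_right scaleC_scaleC
        algebra_simps)
  have "ctensor_lift (\<lambda>b c. ?g b c m) w = ctensor_lift (\<lambda>b c. \<psi> b * \<phi> c) w *\<^sub>C m" for w and m :: 'b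
    by (subst lift_apply[OF bal2_convolution[OF \<psi> \<phi>], where f = "\<lambda>x. x *\<^sub>C m"]) (simp_all add: scaleC_add_left)
  then have "slice (convolution H \<psi> \<phi>) (\<delta> x) =
      ctensor_lift (\<lambda>a m. ctensor_lift (\<lambda>b c. ?g b c m) (comult H a)) (\<delta> x)"
    unfolding slice_def convolution_def by (simp only:)
  also have "\<dots> = ctensor_lift (\<lambda>a m. ctensor_lift (\<lambda>b m'. ?g a b m') (\<delta> m)) (\<delta> x)"
    by (rule coassoc_apply[OF \<delta> \<Delta> g])
  also have "\<dots> = ctensor_lift (\<lambda>a m. \<psi> a *\<^sub>C slice \<phi> (\<delta> m)) (\<delta> x)"
  proof -
    have "ctensor_lift (\<lambda>b m'. ?g a b m') w = \<psi> a *\<^sub>C slice \<phi> w" for a and w :: "('a, 'b) ctensor"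
      unfolding slice_def
      by (subst lift_apply[OF sesq_bal2[OF bilin_slice[OF \<phi>]], where f = "\<lambda>y. \<psi> a *\<^sub>C y"])
        (simp_all add: scaleC_add_right scaleC_scaleC)
    then show ?thesis by (simp only:)
  qed
  also have "\<dots> = slice \<phi> (\<delta> (slice \<psi> (\<delta> x)))"
  proof -
    have "slice \<phi> (\<delta> (slice \<psi> z)) = ctensor_lift (\<lambda>a m. \<psi> a *\<^sub>C slice \<phi> (\<delta> m)) z" for z
      unfolding slice_def[of \<psi>]
      by (subst lift_apply[OF sesq_bal2[OF bilin_slice[OF \<psi>]], where f = "\<lambda>y. slice \<phi> (\<delta> y)"])
        (simp_all add: clinear_add[OF left_comodule_linear[OF \<delta>]] clinear_add[OF slice_linear[OF \<phi>]]
          clinear_scale[OF left_comodule_linear[OF \<delta>]] clinear_scale[OF slice_linear[OF \<phi>]])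
    then show ?thesis by simp
  qed
  finally show ?thesis by simp
qed

text \<open>For \<open>S\<close> take the right legs of an expression of \<open>\<Delta>(a)\<close>, for the finitely many left legs \<open>a\<close> of \<open>z\<close>.  Together with
  \<open>slice_slice\<close> it follows that a functional vanishing on \<open>S\<close> kills the coaction of every slice of the coaction.\<close>

lemma finite_coefficients:
  assumes \<Delta>: "clinear (comult H)"
  obtains S where "finite S" "\<And>\<psi> \<phi>. cfunctional \<psi> \<Longrightarrow> cfunctional \<phi> \<Longrightarrow> (\<forall>s\<in>S. \<phi> s = 0) \<Longrightarrow>
    slice (convolution H \<psi> \<phi>) z = 0"
proof -
  have w: "\<exists>S. finite S \<and> (\<forall>\<psi> \<phi>. cfunctional \<psi> \<longrightarrow> cfunctional \<phi> \<longrightarrow> (\<forall>s\<in>S. \<phi> s = 0) \<longrightarrow>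
      ctensor_lift (\<lambda>b c. \<psi> b * \<phi> c) w = 0)" for w :: "('a, 'a) ctensor"
  proof (induction w rule: ctensor_induct)
    case (pure a b)
    show ?case by (rule exI[of _ "{b}"]) (simp add: lift_ctens[OF bal2_convolution])
  next
    case (add x y)
    then obtain S T where "finite S" "finite T"
      "\<And>\<psi> \<phi>. cfunctional \<psi> \<Longrightarrow> cfunctional \<phi> \<Longrightarrow> (\<forall>s\<in>S. \<phi> s = 0) \<Longrightarrow> ctensor_lift (\<lambda>b c. \<psi> b * \<phi> c) x = 0"
      "\<And>\<psi> \<phi>. cfunctional \<psi> \<Longrightarrow> cfunctional \<phi> \<Longrightarrow> (\<forall>s\<in>T. \<phi> s = 0) \<Longrightarrow> ctensor_lift (\<lambda>b c. \<psi> b * \<phi> c) y = 0"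
      by blast
    then show ?case by (intro exI[of _ "S \<union> T"]) (simp add: lift_add[OF bal2_convolution])
  qed
  have "\<exists>S. finite S \<and> (\<forall>\<psi> \<phi>. cfunctional \<psi> \<longrightarrow> cfunctional \<phi> \<longrightarrow> (\<forall>s\<in>S. \<phi> s = 0) \<longrightarrow>
      slice (convolution H \<psi> \<phi>) z = 0)"
  proof (induction z rule: ctensor_induct)
    case (pure a m)
    from w[of "comult H a"] obtain S where "finite S"
      "\<And>\<psi> \<phi>. cfunctional \<psi> \<Longrightarrow> cfunctional \<phi> \<Longrightarrow> (\<forall>s\<in>S. \<phi> s = 0) \<Longrightarrow> convolution H \<psi> \<phi> a = 0"
      unfolding convolution_def by blast
    then show ?case
      by (intro exI[of _ S]) (simp add: slice_ctens convolution_functional[OF \<Delta>])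
  next
    case (add x y)
    then obtain S T where "finite S" "finite T"
      "\<And>\<psi> \<phi>. cfunctional \<psi> \<Longrightarrow> cfunctional \<phi> \<Longrightarrow> (\<forall>s\<in>S. \<phi> s = 0) \<Longrightarrow> slice (convolution H \<psi> \<phi>) x = 0"
      "\<And>\<psi> \<phi>. cfunctional \<psi> \<Longrightarrow> cfunctional \<phi> \<Longrightarrow> (\<forall>s\<in>T. \<phi> s = 0) \<Longrightarrow> slice (convolution H \<psi> \<phi>) y = 0"
      by blast
    then show ?case
      by (intro exI[of _ "S \<union> T"])
        (simp add: clinear_add[OF slice_linear] convolution_functional[OF \<Delta>])
  qed
  then show ?thesis using that by blast
qed

subsection \<open>Adjoints for invariant forms\<close>

definition cform :: "('m::complex_vector \<Rightarrow> 'm \<Rightarrow> complex) \<Rightarrow> bool"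
  where "cform s \<longleftrightarrow> (\<forall>x x' y. s (x + x') y = s x y + s x' y) \<and> (\<forall>x y y'. s x (y + y') = s x y + s x y') \<and>
    (\<forall>c x y. s (c *\<^sub>C x) y = cnj c * s x y) \<and> (\<forall>c x y. s x (c *\<^sub>C y) = c * s x y)"

text \<open>In Sweedler notation: \<open>\<langle>x\<^sub>(\<^sub>0\<^sub>), y\<^sub>(\<^sub>0\<^sub>)\<rangle> x\<^sub>(\<^sub>-\<^sub>1\<^sub>)\<^sup>\<star> y\<^sub>(\<^sub>-\<^sub>1\<^sub>) = \<langle>x, y\<rangle> 1\<close>.\<close>

definition invariant_form :: "('m::complex_vector \<Rightarrow> ('a::complex_star_algebra, 'm) ctensor) \<Rightarrow> ('m \<Rightarrow> 'm \<Rightarrow> complex) \<Rightarrow> bool"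
  where "invariant_form \<delta> s \<longleftrightarrow> cform s \<and> (\<forall>x y.
    ctensor_lift (\<lambda>a x'. ctensor_lift (\<lambda>c y'. s x' y' *\<^sub>C (a\<^sup>\<star> * c)) (\<delta> y)) (\<delta> x) = s x y *\<^sub>C 1)"

text \<open>Collapsing one factor of an invariant tensor: a functional on the second tensor factor of a product
  acts on the product of the second legs.\<close>

lemma lift_functional_tmul:
  fixes f :: "'q::complex_vector \<Rightarrow> complex"
  assumes "sesq s m1" "sesq s m2" "cfunctional f"
  shows "ctensor_lift (\<lambda>a q. f q *\<^sub>C a) (tmul m1 m2 z y) =
    ctensor_lift (\<lambda>a x'. ctensor_lift (\<lambda>c y'. f (m2 x' y') *\<^sub>C m1 a c) y) z"
proof -
  have b: "bal2 (\<lambda>a q. f q *\<^sub>C a)"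
    using assms(3) by (simp add: balanced_def cfunctional_iff scaleC_add_left scaleC_add_right
        scaleC_scaleC mult.commute)
  show ?thesis
    unfolding tmul_def
    by (subst lift_apply[OF bal2_tmul_outer[OF assms(1,2)] lift_add[OF b]],
        subst lift_apply[OF bal2_tmul_inner[OF assms(1,2)] lift_add[OF b]])
      (simp only: lift_ctens[OF b])
qed

context hopf_star_algebra
begin

lemma comult_comodule: "left_comodule H (comult H)"
  unfolding left_comodule_def using comult_linear coassociative counit_left by blast

text \<open>The antipode axiom for \<open>x\<^sup>\<star>\<close>.\<close>

lemma antipode_star_left:
  "ctensor_lift (\<lambda>a b. antipode H (a\<^sup>\<star>) * b\<^sup>\<star>) (comult H x) = cnj (counit H x) *\<^sub>C 1"
proof -
  have b: "bal2 (\<lambda>a b. antipode H a * b)"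
    using antipode_linear by (intro bal2I)
      (simp_all add: clinear_iff distrib_left distrib_right mult_scaleC_left mult_scaleC_right)
  have "ctensor_lift (\<lambda>a b. antipode H (a\<^sup>\<star>) * b\<^sup>\<star>) (comult H x) =
      ctensor_lift (\<lambda>a b. antipode H a * b) (ctensor_map star star (comult H x))"
    by (subst lift_apply[OF bal2_map[OF slin_star slin_star] lift_add[OF b]]) (simp only: lift_ctens[OF b])
  also have "\<dots> = cnj (counit H x) *\<^sub>C 1"
    unfolding comult_star[symmetric] antipode_left counit_star ..
  finally show ?thesis .
qed

text \<open>This is \<open>y\<^sub>(\<^sub>-\<^sub>1\<^sub>)\<langle>x, y\<^sub>(\<^sub>0\<^sub>)\<rangle> = S(x\<^sub>(\<^sub>-\<^sub>2\<^sub>)\<^sup>\<star>) x\<^sub>(\<^sub>-\<^sub>1\<^sub>)\<^sup>\<star> y\<^sub>(\<^sub>-\<^sub>1\<^sub>)\<langle>x\<^sub>(\<^sub>0\<^sub>), y\<^sub>(\<^sub>0\<^sub>)\<rangle> = S(x\<^sub>(\<^sub>-\<^sub>1\<^sub>)\<^sup>\<star>)\<langle>x\<^sub>(\<^sub>0\<^sub>), y\<rangle>\<close>.\<close>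

lemma invariant_form_antipode:
  assumes \<delta>: "left_comodule H \<delta>" and s: "invariant_form \<delta> s"
  shows "ctensor_lift (\<lambda>c y'. s x y' *\<^sub>C c) (\<delta> y) = ctensor_lift (\<lambda>a x'. s x' y *\<^sub>C antipode H (a\<^sup>\<star>)) (\<delta> x)"
proof -
  have cs: "cform s" using s by (simp add: invariant_form_def)
  \<comment> \<open>Here \<open>D x'\<close> is \<open>y\<^sub>(\<^sub>-\<^sub>1\<^sub>) \<langle>x', y\<^sub>(\<^sub>0\<^sub>)\<rangle>\<close>; it is conjugate-linear in \<open>x'\<close>.\<close>
  define D where "D x' = ctensor_lift (\<lambda>c y'. s x' y' *\<^sub>C c) (\<delta> y)" for x'
  have bD: "bal2 (\<lambda>c y'. s x' y' *\<^sub>C c)" for x'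
    using cs by (intro bal2I) (simp_all add: cform_def scaleC_add_left scaleC_add_right scaleC_scaleC mult.commute)
  have D_add: "D (u + v) = D u + D v" for u v
    using cs unfolding D_def lift_fun_add[OF bD bD, symmetric] by (simp add: cform_def scaleC_add_left)
  have D_scale: "D (k *\<^sub>C u) = cnj k *\<^sub>C D u" for k u
    unfolding D_def using cs
    by (subst lift_apply[OF bD, where f = "\<lambda>v. cnj k *\<^sub>C v"]) (simp_all add: scaleC_add_right cform_def scaleC_scaleC)
  have D_mult: "b * D u = ctensor_lift (\<lambda>c y'. s u y' *\<^sub>C (b * c)) (\<delta> y)" for b u
    unfolding D_def
    by (subst lift_apply[OF bD, where f = "\<lambda>v. b * v"]) (simp_all add: distrib_left mult_scaleC_right)
  let ?g = "\<lambda>a1 a2 x'. antipode H (a1\<^sup>\<star>) * (a2\<^sup>\<star> * D x')"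
  have g: "bal3 ?g"
    using antipode_linear by (simp add: bal3_def clinear_iff star_add star_scaleC D_add D_scale
        distrib_left distrib_right mult_scaleC_left mult_scaleC_right)
  have b: "bal2 (\<lambda>a b. antipode H (a\<^sup>\<star>) * b\<^sup>\<star>)"
    using antipode_linear by (intro bal2I)
      (simp_all add: clinear_iff star_add star_scaleC distrib_left distrib_right mult_scaleC_left mult_scaleC_right)
  have inner: "ctensor_lift (\<lambda>a1 a2. ?g a1 a2 x') (comult H a) = cnj (counit H a) *\<^sub>C D x'" for a x'
  proof -
    have "ctensor_lift (\<lambda>a1 a2. ?g a1 a2 x') (comult H a) =
        ctensor_lift (\<lambda>a b. antipode H (a\<^sup>\<star>) * b\<^sup>\<star>) (comult H a) * D x'"
      by (subst lift_apply[OF b, where f = "\<lambda>v. v * D x'"]) (simp_all add: distrib_right mult.assoc)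
    then show ?thesis by (simp add: antipode_star_left mult_scaleC_left)
  qed
  have "D x = D (slice (counit H) (\<delta> x))"
    by (simp add: left_comodule_counit[OF \<delta>])
  also have "\<dots> = ctensor_lift (\<lambda>a x'. cnj (counit H a) *\<^sub>C D x') (\<delta> x)"
    unfolding slice_def
    by (subst lift_apply[OF sesq_bal2[OF bilin_slice[OF counit_linear]], where f = D]) (simp_all add: D_add D_scale)
  also have "\<dots> = ctensor_lift (\<lambda>a x'. ctensor_lift (\<lambda>a1 a2. ?g a1 a2 x') (comult H a)) (\<delta> x)"
    by (simp only: inner)
  also have "\<dots> = ctensor_lift (\<lambda>a m. ctensor_lift (\<lambda>a2 m'. ?g a a2 m') (\<delta> m)) (\<delta> x)"
    by (rule coassoc_apply[OF \<delta> comult_linear g])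
  also have "\<dots> = ctensor_lift (\<lambda>a m. antipode H (a\<^sup>\<star>) * (s m y *\<^sub>C 1)) (\<delta> x)"
  proof -
    have "bal2 (\<lambda>a2 m'. a2\<^sup>\<star> * D m')"
      by (intro bal2I) (simp_all add: star_add star_scaleC D_add D_scale distrib_left distrib_right
          mult_scaleC_left mult_scaleC_right)
    then have "ctensor_lift (\<lambda>a2 m'. ?g a a2 m') (\<delta> m) =
        antipode H (a\<^sup>\<star>) * ctensor_lift (\<lambda>a2 m'. a2\<^sup>\<star> * D m') (\<delta> m)" for a m
      by (subst lift_apply[where f = "\<lambda>v. antipode H (a\<^sup>\<star>) * v"]) (simp_all add: distrib_left)
    moreover have "ctensor_lift (\<lambda>a2 m'. a2\<^sup>\<star> * D m') (\<delta> m) = s m y *\<^sub>C 1" for m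
      using s unfolding invariant_form_def D_mult by blast
    ultimately show ?thesis by simp
  qed
  finally show ?thesis by (simp add: D_def mult_scaleC_right)
qed

definition adjoint_functional :: "('a \<Rightarrow> complex) \<Rightarrow> 'a \<Rightarrow> complex"
  where "adjoint_functional \<phi> a = cnj (\<phi> (antipode H (a\<^sup>\<star>)))"

lemma adjoint_functional: "cfunctional \<phi> \<Longrightarrow> cfunctional (adjoint_functional \<phi>)"
  using antipode_linear
  by (simp add: cfunctional_iff adjoint_functional_def star_add star_scaleC clinear_iff)

text \<open>Apply \<open>\<phi>\<close> to both sides of the preceding identity: slices of the coaction have adjoints, which are slices again.\<close>

lemma invariant_form_slice:
  assumes \<delta>: "left_comodule H \<delta>" and s: "invariant_form \<delta> s" and \<phi>: "cfunctional \<phi>"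
  shows "s x (slice \<phi> (\<delta> y)) = s (slice (adjoint_functional \<phi>) (\<delta> x)) y"
proof -
  have cs: "cform s" using s by (simp add: invariant_form_def)
  have b: "bal2 (\<lambda>c y'. s x y' *\<^sub>C c)" "bal2 (\<lambda>a x'. s x' y *\<^sub>C antipode H (a\<^sup>\<star>))"
    using cs antipode_linear by (auto intro!: bal2I simp: cform_def scaleC_add_left scaleC_add_right
        scaleC_scaleC clinear_iff star_add star_scaleC mult.commute)
  have "s x (slice \<phi> (\<delta> y)) = \<phi> (ctensor_lift (\<lambda>c y'. s x y' *\<^sub>C c) (\<delta> y))"
    unfolding slice_def using cs \<phi>
    by (subst lift_apply[OF sesq_bal2[OF bilin_slice[OF \<phi>]], where f = "s x"],
        simp add: cform_def, subst lift_apply[OF b(1), where f = \<phi>])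
      (simp_all add: cfunctional_iff cform_def mult.commute)
  also have "\<dots> = \<phi> (ctensor_lift (\<lambda>a x'. s x' y *\<^sub>C antipode H (a\<^sup>\<star>)) (\<delta> x))"
    by (simp only: invariant_form_antipode[OF \<delta> s])
  also have "\<dots> = s (slice (adjoint_functional \<phi>) (\<delta> x)) y"
    unfolding slice_def using cs \<phi>
    by (subst lift_apply[OF sesq_bal2[OF bilin_slice[OF adjoint_functional[OF \<phi>]]], where f = "\<lambda>v. s v y"],
        simp add: cform_def, subst lift_apply[OF b(2), where f = \<phi>])
      (simp_all add: cfunctional_iff cform_def adjoint_functional_def mult.commute)
  finally show ?thesis .
qed

end

subsection \<open>Faithfulness of the Haar state\<close>

context cqga
begin

lemma haar_add: "haar H (x + y) = haar H x + haar H y"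
  and haar_scale: "haar H (c *\<^sub>C x) = c * haar H x"
  using haar_linear by (simp_all add: cfunctional_iff)

lemma cform_haar: "cform (\<lambda>x y. haar H (x\<^sup>\<star> * y))"
  by (simp add: cform_def star_add star_scaleC distrib_left distrib_right mult_scaleC_left mult_scaleC_right
      haar_add haar_scale)

lemma haar_expand:
  "haar H ((a + k *\<^sub>C c)\<^sup>\<star> * (a + k *\<^sub>C c)) = haar H (a\<^sup>\<star> * a) + k * haar H (a\<^sup>\<star> * c)
    + cnj k * haar H (c\<^sup>\<star> * a) + cnj k * k * haar H (c\<^sup>\<star> * c)"
  by (simp add: star_add star_scaleC distrib_left distrib_right mult_scaleC_left mult_scaleC_right
      haar_add haar_scale algebra_simps)

lemma haar_nonneg: "Im (haar H (x\<^sup>\<star> * x)) = 0" "0 \<le> Re (haar H (x\<^sup>\<star> * x))"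
  using haar_state[of x] by (auto simp: complex_nonneg_Reals_iff)

lemma haar_hermitian: "haar H (a\<^sup>\<star> * c) = cnj (haar H (c\<^sup>\<star> * a))"
proof -
  have "Im (haar H (a\<^sup>\<star> * c)) + Im (haar H (c\<^sup>\<star> * a)) = 0"
    using haar_nonneg(1)[of "a + 1 *\<^sub>C c"] haar_nonneg(1)[of a] haar_nonneg(1)[of c]
    unfolding haar_expand by simp
  moreover have "Re (haar H (a\<^sup>\<star> * c)) - Re (haar H (c\<^sup>\<star> * a)) = 0"
    using haar_nonneg(1)[of "a + \<i> *\<^sub>C c"] haar_nonneg(1)[of a] haar_nonneg(1)[of c]
    unfolding haar_expand by simp
  ultimately show ?thesis by (simp add: complex_eq_iff)
qed

text \<open>The Cauchy-Schwarz argument: if \<open>w = h(c\<^sup>\<star> a)\<close> were nonzero, moving \<open>a\<close> in the direction \<open>- w c\<close> would make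
  \<open>h(a\<^sup>\<star> a) = 0\<close> negative.\<close>

lemma haar_null:
  assumes "haar H (a\<^sup>\<star> * a) = 0"
  shows "haar H (c\<^sup>\<star> * a) = 0"
proof -
  define w where "w = haar H (c\<^sup>\<star> * a)"
  define r where "r = Re (haar H (c\<^sup>\<star> * c))"
  have r: "0 \<le> r" "haar H (c\<^sup>\<star> * c) = of_real r"
    using haar_nonneg[of c] by (auto simp: r_def complex_eq_iff)
  \<comment> \<open>With this step size the quadratic polynomial \<open>t\<^sup>2 r - 2 t\<close> is negative, also for \<open>r = 0\<close>.\<close>
  define t where "t = 1 / (r + 1)"
  have "0 \<le> Re (haar H ((a + (- of_real t * w) *\<^sub>C c)\<^sup>\<star> * (a + (- of_real t * w) *\<^sub>C c)))"
    by (rule haar_nonneg(2))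
  also have "haar H ((a + (- of_real t * w) *\<^sub>C c)\<^sup>\<star> * (a + (- of_real t * w) *\<^sub>C c)) =
      (of_real (t * t * r) - of_real (2 * t)) * (w * cnj w)"
    unfolding haar_expand haar_hermitian[of a c] w_def[symmetric] assms r(2)
    by (simp add: algebra_simps)
  also have "\<dots> = of_real ((t * t * r - 2 * t) * (cmod w)\<^sup>2)"
    by (simp only: complex_norm_square[symmetric] of_real_mult of_real_diff)
  finally have "0 \<le> (t * t * r - 2 * t) * (cmod w)\<^sup>2" by simp
  moreover have "t * t * r - 2 * t < 0"
  proof -
    have "t > 0" "t * r < 1" using r(1) by (simp_all add: t_def)
    then have "t * (t * r) < t * 1" by (intro mult_strict_left_mono) auto
    then show ?thesis using \<open>t > 0\<close> by (simp add: mult.assoc)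
  qed
  ultimately have "(cmod w)\<^sup>2 \<le> 0"
    using zero_le_mult_iff by (metis linorder_not_le zero_le_power2 order.asym order.refl)
  then show ?thesis by (simp add: w_def)
qed

text \<open>Left invariance of the Haar functional at \<open>x\<^sup>\<star> y\<close>, expanded by \<open>\<Delta>(x\<^sup>\<star> y) = \<Delta>(x)\<^sup>\<star> \<Delta>(y)\<close>.\<close>

lemma invariant_form_haar: "invariant_form (comult H) (\<lambda>x y. haar H (x\<^sup>\<star> * y))"
  unfolding invariant_form_def
proof (intro conjI allI cform_haar)
  fix x y
  have "comult H (x\<^sup>\<star> * y) = tmul (\<lambda>a c. a\<^sup>\<star> * c) (\<lambda>a c. a\<^sup>\<star> * c) (comult H x) (comult H y)"
  proof -
    have "tmul (*) (*) (ctensor_map star star z) v = tmul (\<lambda>a c. a\<^sup>\<star> * c) (\<lambda>a c. a\<^sup>\<star> * c) z v" for z v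
    proof (induction z rule: ctensor_induct)
      case (pure a b)
      show ?case
        by (induction v rule: ctensor_induct)
          (simp_all add: map_ctens[OF slin_star slin_star] tmul_ctens[OF bilin_mult bilin_mult]
            tmul_ctens[OF sesq_star_mult sesq_star_mult] tmul_add_right[OF bilin_mult bilin_mult]
            tmul_add_right[OF sesq_star_mult sesq_star_mult])
    next
      case (add z z')
      then show ?case
        by (simp add: lift_add[OF bal2_map[OF slin_star slin_star]] tmul_add_left[OF bilin_mult bilin_mult]
            tmul_add_left[OF sesq_star_mult sesq_star_mult])
    qed
    then show ?thesis
      unfolding comult_mult comult_star tmul_def[of "(*)" "(*)", symmetric] .
  qed
  then show "ctensor_lift (\<lambda>a x'. ctensor_lift (\<lambda>c y'. haar H (x'\<^sup>\<star> * y') *\<^sub>C (a\<^sup>\<star> * c)) (comult H y))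
      (comult H x) = haar H (x\<^sup>\<star> * y) *\<^sub>C 1"
    using haar_left_invariant[of "x\<^sup>\<star> * y"]
    by (simp only: lift_functional_tmul[OF sesq_star_mult sesq_star_mult haar_linear])
qed

text \<open>The null space \<open>N\<close> of the Haar form is a left ideal, and by invariance a left coideal:
  \<open>\<Delta>(N) \<subseteq> A \<otimes> N\<close>.  So \<open>\<epsilon>(a) 1 = S(a\<^sub>(\<^sub>1\<^sub>)) a\<^sub>(\<^sub>2\<^sub>) \<in> N\<close> for \<open>a \<in> N\<close>, and \<open>\<epsilon>\<close> vanishes on \<open>N\<close> as \<open>h(1) = 1\<close>;
  hence \<open>a = a\<^sub>(\<^sub>1\<^sub>) \<epsilon>(a\<^sub>(\<^sub>2\<^sub>)) = 0\<close>.\<close>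

lemma haar_faithful:
  assumes "haar H (a\<^sup>\<star> * a) = 0"
  shows "a = 0"
proof -
  define N where "N = {a. \<forall>c. haar H (c\<^sup>\<star> * a) = 0}"
  have a: "a \<in> N" using haar_null[OF assms] by (simp add: N_def)
  have N: "cvec.subspace N"
    by (auto simp: cvec.subspace_def N_def distrib_left mult_scaleC_right haar_add haar_scale
        cfunctional_zero[OF haar_linear])
  have ideal: "c * n \<in> N" if "n \<in> N" for c n
  proof -
    have "haar H (d\<^sup>\<star> * (c * n)) = haar H ((c\<^sup>\<star> * d)\<^sup>\<star> * n)" for d
      by (simp add: star_mult star_star mult.assoc)
    then show ?thesis using that by (simp add: N_def)
  qed
  have coideal: "comult H n \<in> tens_in UNIV N" if "n \<in> N" for n
  proof (rule in_tens_in_if_slices_in)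
    fix \<phi> :: "'a \<Rightarrow> complex" assume \<phi>: "cfunctional \<phi>"
    show "slice \<phi> (comult H n) \<in> N"
      using that invariant_form_slice[OF comult_comodule invariant_form_haar \<phi>, of _ n] by (simp add: N_def)
  qed
  have eps: "counit H n = 0" if n: "n \<in> N" for n
  proof -
    have b: "bal2 (\<lambda>a b. antipode H a * b)"
      using antipode_linear by (intro bal2I)
        (simp_all add: clinear_iff distrib_left distrib_right mult_scaleC_left mult_scaleC_right)
    have "ctensor_lift (\<lambda>a b. antipode H a * b) (comult H n) \<in> N"
      using coideal[OF n] by (induction rule: tens_in_induct)
        (auto simp: N ideal lift_ctens[OF b] lift_add[OF b] cvec.subspace_add)
    then have "haar H (1\<^sup>\<star> * (counit H n *\<^sub>C 1)) = 0"
      unfolding antipode_left by (simp add: N_def)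
    moreover have "(1::'a)\<^sup>\<star> = 1" by (metis mult.left_neutral mult.right_neutral star_mult star_star)
    ultimately show ?thesis by (simp add: haar_scale haar_one)
  qed
  have b: "bal2 (\<lambda>a b. counit H b *\<^sub>C a)"
    using counit_linear by (intro bal2I)
      (simp_all add: cfunctional_iff scaleC_add_left scaleC_add_right scaleC_scaleC mult.commute)
  have "ctensor_lift (\<lambda>a b. counit H b *\<^sub>C a) (comult H a) = 0"
    using coideal[OF a] by (induction rule: tens_in_induct)
      (simp_all add: N eps lift_ctens[OF b] lift_add[OF b])
  then show ?thesis by (simp add: counit_right)
qed

lemma haar_pos: "0 \<le> Re (haar H (\<Sum>x\<leftarrow>xs. x\<^sup>\<star> * x))"
  by (induction xs) (simp_all add: haar_add haar_nonneg cfunctional_zero[OF haar_linear])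

lemma haar_faithful_sum:
  assumes "Re (haar H (\<Sum>x\<leftarrow>xs. x\<^sup>\<star> * x)) = 0" and "x \<in> set xs"
  shows "x = 0"
  using assms
proof (induction xs)
  case (Cons y xs)
  have "Re (haar H (y\<^sup>\<star> * y)) + Re (haar H (\<Sum>x\<leftarrow>xs. x\<^sup>\<star> * x)) = 0"
    using Cons.prems(1) by (simp add: haar_add)
  then have *: "Re (haar H (y\<^sup>\<star> * y)) = 0" "Re (haar H (\<Sum>x\<leftarrow>xs. x\<^sup>\<star> * x)) = 0"
    using haar_nonneg(2)[of y] haar_pos[of xs] by linarith+
  then have "y = 0"
    using haar_nonneg(1)[of y] haar_faithful[of y] by (simp add: complex_eq_iff)
  then show ?case using Cons * by auto
qed simp

end

subsection \<open>The coaction on a quantum homogeneous space\<close>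

context quantum_homogeneous_space
begin

lemma incl_linear: "clinear \<iota>"
  using incl_algebra_map by (simp add: algebra_map_def)

lemma tmap_base_coaction: "tmap \<iota> (base_coaction H \<iota> b) = comult H (\<iota> b)"
proof -
  obtain z where z: "ctensor_map id \<iota> z = comult H (\<iota> b)"
    using left_coideal[of b] by (metis rangeE)
  have "ctensor_map id \<iota> (base_coaction H \<iota> b) = comult H (\<iota> b)"
    unfolding base_coaction_def
  proof (rule theI[of _ z])
    show "ctensor_map id \<iota> z' = comult H (\<iota> b) \<Longrightarrow> z' = z" for z'
      using tmap_inj[OF incl_linear incl_inj, of z' z] z by (simp only: tmap_def)
  qed (fact z)
  then show ?thesis by (simp only: tmap_def)
qed

lemma base_coaction_linear: "clinear (base_coaction H \<iota>)"
proof (rule clinearI)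
  note lin = clinear_add[OF tmap_linear[OF incl_linear]] clinear_scale[OF tmap_linear[OF incl_linear]]
    clinear_add[OF comult_linear] clinear_scale[OF comult_linear] clinear_add[OF incl_linear]
    clinear_scale[OF incl_linear]
  show "base_coaction H \<iota> (x + y) = base_coaction H \<iota> x + base_coaction H \<iota> y" for x y
    by (rule tmap_inj[OF incl_linear incl_inj]) (simp only: lin tmap_base_coaction)
  show "base_coaction H \<iota> (c *\<^sub>C x) = c *\<^sub>C base_coaction H \<iota> x" for c x
    by (rule tmap_inj[OF incl_linear incl_inj]) (simp only: lin tmap_base_coaction)
qed

text \<open>Evaluating a covariant \<open>B\<close>-valued form by the Haar functional gives an invariant form.\<close>

lemma invariant_form_of_covariant:
  assumes h: "cqga H" and g: "sesq cnj g"
    and cov: "\<And>x y. base_coaction H \<iota> (g x y) = tmul (\<lambda>a c. a\<^sup>\<star> * c) g (\<delta> x) (\<delta> y)"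
  shows "invariant_form \<delta> (\<lambda>x y. haar H (\<iota> (g x y)))"
proof -
  interpret cqga H by (fact h)
  have f: "cfunctional (\<lambda>b. haar H (\<iota> b))"
    using haar_linear incl_linear by (simp add: cfunctional_iff clinear_iff)
  have b: "bal2 (\<lambda>a b. haar H b *\<^sub>C a)"
    using haar_linear by (intro bal2I)
      (simp_all add: cfunctional_iff scaleC_add_left scaleC_add_right scaleC_scaleC mult.commute)
  have b': "bal2 (\<lambda>a b. haar H (\<iota> b) *\<^sub>C a)"
    using f by (intro bal2I)
      (simp_all add: cfunctional_iff scaleC_add_left scaleC_add_right scaleC_scaleC mult.commute)
  have "ctensor_lift (\<lambda>a b. haar H b *\<^sub>C a) (tmap \<iota> z) = ctensor_lift (\<lambda>a b. haar H (\<iota> b) *\<^sub>C a) z" for z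
    by (induction z rule: ctensor_induct) (simp_all add: tmap_ctens[OF incl_linear] lift_ctens[OF b]
        lift_ctens[OF b'] lift_add[OF b] lift_add[OF b'] clinear_add[OF tmap_linear[OF incl_linear]])
  then have "haar H (\<iota> (g x y)) *\<^sub>C 1 = ctensor_lift (\<lambda>a b. haar H (\<iota> b) *\<^sub>C a) (base_coaction H \<iota> (g x y))" for x y
    by (simp only: haar_left_invariant[symmetric] tmap_base_coaction[symmetric])
  also have "\<dots> x y = ctensor_lift (\<lambda>a x'. ctensor_lift (\<lambda>c y'. haar H (\<iota> (g x' y')) *\<^sub>C (a\<^sup>\<star> * c)) (\<delta> y)) (\<delta> x)" for x y
    unfolding cov by (rule lift_functional_tmul[OF sesq_star_mult g f])
  finally show ?thesis
    using g f unfolding invariant_form_def cform_def by (simp add: sesq_def cfunctional_iff)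
qed

end

section \<open>Finiteness of relative Hopf modules\<close>

lemma finite_dimensional_mono: "finite_dimensional W \<Longrightarrow> V \<subseteq> W \<Longrightarrow> finite_dimensional V"
  by (auto simp: finite_dimensional_def)

lemma finite_dimensional_injective:
  assumes f: "clinear f" and V: "cvec.subspace V" and W: "finite_dimensional (f ` V)"
    and inj: "\<And>x. x \<in> V \<Longrightarrow> f x = 0 \<Longrightarrow> x = 0"
  shows "finite_dimensional V"
proof -
  interpret fl: Vector_Spaces.linear scaleC scaleC f by (fact f)
  obtain D where D: "D \<subseteq> V" "cvec.independent D" "V \<subseteq> cvec.span D"
    by (rule cvec.maximal_independent_subset)
  obtain S where S: "finite S" "f ` V \<subseteq> cvec.span S"
    using W by (auto simp: finite_dimensional_def)
  have "cvec.span D \<subseteq> V" using D(1) V by (rule cvec.span_minimal)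
  then have i: "inj_on f (cvec.span D)"
    using inj fl.inj_on_iff_eq_0[OF cvec.subspace_span] by blast
  have "cvec.independent (f ` D)"
    by (rule fl.independent_injective_image[OF D(2) i])
  then have "finite (f ` D)"
    using cvec.independent_span_bound[OF S(1)] S(2) D(1) by blast
  moreover have "inj_on f D" using i by (rule inj_on_subset) (rule cvec.span_superset)
  ultimately have "finite D" using finite_imageD by blast
  then show ?thesis using D(3) by (auto simp: finite_dimensional_def)
qed

text \<open>Take a basis of the span of \<open>U\<close>, extend it by elements of \<open>G\<close>, and let \<open>q\<close> kill the former and fix the latter.\<close>

lemma projection_modulo_subspace:
  fixes U G :: "'m::complex_vector set"
  assumes "\<And>m. m \<in> cvec.span (U \<union> G)"
  obtains q where "clinear q" "range q \<subseteq> cvec.span G" "\<forall>m. m - q m \<in> cvec.span U"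
proof -
  obtain D where D: "D \<subseteq> U" "cvec.independent D" "U \<subseteq> cvec.span D"
    by (rule cvec.maximal_independent_subset)
  obtain E where E: "D \<subseteq> E" "E \<subseteq> D \<union> G" "cvec.independent E" "D \<union> G \<subseteq> cvec.span E"
    by (rule cvec.maximal_independent_subset_extend[OF Un_upper1[of D G] D(2)])
  have "cvec.span (U \<union> G) \<subseteq> cvec.span E"
  proof (rule cvec.span_minimal[OF _ cvec.subspace_span])
    have "cvec.span D \<subseteq> cvec.span E" using E(1) by (rule cvec.span_mono)
    then show "U \<union> G \<subseteq> cvec.span E" using D(3) E(4) by blast
  qed
  then have span: "m \<in> cvec.span E" for m by (rule subsetD[OF _ assms])
  have pair: "vector_space_pair (scaleC :: complex \<Rightarrow> 'm \<Rightarrow> 'm) (scaleC :: complex \<Rightarrow> 'm \<Rightarrow> 'm)"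
    by (simp add: vector_space_pair_def cvec.vector_space_axioms)
  obtain q where q: "clinear q" "\<forall>e\<in>E. q e = (if e \<in> D then 0 else e)"
    using vector_space_pair.linear_independent_extend[OF pair E(3), of "\<lambda>e. if e \<in> D then 0 else e"]
    by auto
  have "q m \<in> cvec.span G \<and> m - q m \<in> cvec.span U" for m
    using span[of m]
  proof (induction rule: cvec.span_induct_alt)
    case base
    show ?case by (simp add: clinear_zero[OF q(1)] cvec.span_zero)
  next
    case (step c e y)
    have e: "q e \<in> cvec.span G" "e - q e \<in> cvec.span U"
      using q(2) step(1) E(2) D(1) by (auto simp: cvec.span_zero intro: cvec.span_base)
    have eq: "c *\<^sub>C e + y - q (c *\<^sub>C e + y) = c *\<^sub>C (e - q e) + (y - q y)"
      by (simp add: clinear_add[OF q(1)] clinear_scale[OF q(1)] cvec.scale_right_diff_distrib)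
    have "c *\<^sub>C e + y - q (c *\<^sub>C e + y) \<in> cvec.span U"
      unfolding eq using step(2) e(2) by (intro cvec.span_add cvec.span_scale) auto
    moreover have "q (c *\<^sub>C e + y) \<in> cvec.span G"
      unfolding clinear_add[OF q(1)] clinear_scale[OF q(1)] using step(2) e(1)
      by (intro cvec.span_add cvec.span_scale) auto
    ultimately show ?case by blast
  qed
  then show ?thesis using that q(1) by blast
qed

definition lmul :: "'a::complex_algebra_1 \<Rightarrow> ('a, 'm::complex_vector) ctensor \<Rightarrow> ('a, 'm) ctensor"
  where "lmul a = ctensor_lift (\<lambda>c m. (a * c) \<otimes> m)"

lemma bal2_lmul: "bal2 (\<lambda>c m. (a * c) \<otimes> m)" for a :: "'a::complex_algebra_1"
  by (intro bal2I) (simp_all add: distrib_left ctens_add_left ctens_add_right mult_scaleC_right ctens_balance)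

lemma lmul_ctens: "lmul a (c \<otimes> m) = (a * c) \<otimes> m"
  and lmul_add: "lmul a (x + y) = lmul a x + lmul a y"
  unfolding lmul_def by (simp_all add: lift_ctens[OF bal2_lmul] lift_add[OF bal2_lmul])

lemma lmul_add_left: "lmul (a + b) x = lmul a x + lmul b x"
  by (induction x rule: ctensor_induct) (auto simp: lmul_ctens lmul_add distrib_right ctens_add_left)

lemma lmul_scale: "lmul a (c *\<^sub>C x) = lmul (c *\<^sub>C a) x" "lmul (c *\<^sub>C a) x = c *\<^sub>C lmul a x"
  by (induction x rule: ctensor_induct)
    (auto simp: lmul_ctens lmul_add scaleC_add_right mult_scaleC_left mult_scaleC_right simp flip: ctens_scale_left)

lemma lmul_linear: "clinear (lmul a)"
  by (rule clinearI) (simp_all add: lmul_add lmul_scale)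

locale hopf_module = quantum_homogeneous_space H \<iota>
  for H :: "'a::complex_star_algebra cqga_data" and \<iota> :: "'b::complex_algebra_1 \<Rightarrow> 'a" +
  fixes la :: "'b \<Rightarrow> 'm::complex_vector \<Rightarrow> 'm" and \<delta> :: "'m \<Rightarrow> ('a, 'm) ctensor"
  assumes la_bilin: "bilin la"
    and la_one: "la 1 m = m"
    and la_mult: "la (b * c) m = la b (la c m)"
    and la_fg: "finitely_generated la"
    and comodule: "left_comodule H \<delta>"
    and covariant: "\<delta> (la b m) = tmul (*) la (base_coaction H \<iota> b) (\<delta> m)"
begin

lemmas \<delta>_linear = left_comodule_linear[OF comodule]

lemma base_comodule: "left_comodule H (base_coaction H \<iota>)"
  unfolding left_comodule_def
proof (intro conjI allI)
  show "clinear (base_coaction H \<iota>)" by (rule base_coaction_linear)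
  note t = tmap_ctens[OF incl_linear] clinear_add[OF tmap_linear[OF incl_linear]]
  show "ctensor_lift (\<lambda>a m. counit H a *\<^sub>C m) (base_coaction H \<iota> x) = x" for x
  proof -
    have "\<iota> (slice (counit H) (base_coaction H \<iota> x)) = \<iota> x"
      unfolding slice_tmap[OF counit_linear incl_linear, symmetric] tmap_base_coaction
      by (rule left_comodule_counit[OF comult_comodule])
    then show ?thesis using incl_inj by (simp add: inj_eq slice_def)
  qed
  let ?T = "tmap (tmap \<iota>)"
  have lin: "clinear (tmap (\<iota>))" and lin2: "clinear ?T"
    by (intro tmap_linear incl_linear)+
  have l: "?T (ctensor_lift (\<lambda>a m. ctensor_lift (\<lambda>a1 a2. a1 \<otimes> a2 \<otimes> m) (comult H a)) z) =
      ctensor_lift (\<lambda>a m. ctensor_lift (\<lambda>a1 a2. a1 \<otimes> a2 \<otimes> m) (comult H a)) (tmap \<iota> z)" for z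
  proof -
    have h: "?T (ctensor_lift (\<lambda>a1 a2. a1 \<otimes> a2 \<otimes> m) w) = ctensor_lift (\<lambda>a1 a2. a1 \<otimes> a2 \<otimes> \<iota> m) w" for m w
      by (subst lift_apply[where f = ?T, OF bal3_12[OF bal3_ctens] clinear_add[OF lin2]])
        (simp only: tmap_ctens[OF lin] tmap_ctens[OF incl_linear])
    show ?thesis
      by (induction z rule: ctensor_induct)
        (simp_all only: h lift_ctens[OF bal3_comult[OF bal3_ctens comult_linear]] t
          lift_add[OF bal3_comult[OF bal3_ctens comult_linear]] clinear_add[OF lin2])
  qed
  have bl: "bal2 (\<lambda>a m. a \<otimes> \<Delta> m)" if "clinear \<Delta>" for \<Delta> :: "'x::complex_vector \<Rightarrow> 'y::complex_vector"
    using that by (intro bal2I) (simp_all add: ctens_add_left ctens_add_right ctens_balance clinear_iff)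
  have r: "?T (ctensor_lift (\<lambda>a m. a \<otimes> base_coaction H \<iota> m) z) = ctensor_lift (\<lambda>a m. a \<otimes> comult H m) (tmap \<iota> z)" for z
    by (induction z rule: ctensor_induct)
      (simp_all only: lift_ctens[OF bl[OF base_coaction_linear]] lift_ctens[OF bl[OF comult_linear]] t
        lift_add[OF bl[OF base_coaction_linear]] lift_add[OF bl[OF comult_linear]]
        tmap_ctens[OF lin] clinear_add[OF lin2] tmap_base_coaction)
  fix x
  show "ctensor_lift (\<lambda>a m. ctensor_lift (\<lambda>a1 a2. a1 \<otimes> a2 \<otimes> m) (comult H a)) (base_coaction H \<iota> x) =
      ctensor_lift (\<lambda>a m. a \<otimes> base_coaction H \<iota> m) (base_coaction H \<iota> x)"
  proof (rule tmap_inj[OF lin])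
    show "inj (tmap \<iota> :: ('a, 'b) ctensor \<Rightarrow> _)"
      using tmap_inj[OF incl_linear incl_inj] by (rule injI)
  qed (simp only: l r tmap_base_coaction coassociative)
qed

text \<open>The relations that cut \<open>A \<otimes>\<^sub>B M\<close> out of \<open>A \<otimes> M\<close>.\<close>

definition relations :: "('a, 'm) ctensor set"
  where "relations = cvec.span {(a * \<iota> b) \<otimes> m - a \<otimes> la b m |a b m. True}"

lemma relation: "(a * \<iota> b) \<otimes> m - a \<otimes> la b m \<in> relations"
  unfolding relations_def by (rule cvec.span_base) blast

lemma relations_subspace: "cvec.subspace relations"
  by (simp add: relations_def)

lemma lmul_relations: "z \<in> relations \<Longrightarrow> lmul c z \<in> relations"
  unfolding relations_def
proof (induction rule: cvec.span_induct_alt)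
  case base
  show ?case by (simp add: clinear_zero[OF lmul_linear] cvec.span_zero)
next
  case (step k x y)
  then obtain a b m where x: "x = (a * \<iota> b) \<otimes> m - a \<otimes> la b m" by blast
  have "lmul c x = ((c * a) * \<iota> b) \<otimes> m - (c * a) \<otimes> la b m"
    by (simp add: x clinear_diff[OF lmul_linear] lmul_ctens mult.assoc)
  then have "lmul c x \<in> cvec.span {(a * \<iota> b) \<otimes> m - a \<otimes> la b m |a b m. True}"
    using relation[of "c * a" b m] by (simp add: relations_def)
  then show ?case
    using step(2) by (simp add: lmul_add clinear_scale[OF lmul_linear] cvec.span_add cvec.span_scale)
qed

subsection \<open>The canonical map\<close>

text \<open>The map \<open>a \<otimes> m \<mapsto> a m\<^sub>(\<^sub>-\<^sub>1\<^sub>) \<otimes> m\<^sub>(\<^sub>0\<^sub>)\<close>.  It induces a map \<open>A \<otimes>\<^sub>B M \<rightarrow> A \<otimes> M/B\<^sup>+M\<close>, and the purpose of this part is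
  to show that an element \<open>1 \<otimes> x\<close> in its kernel vanishes.\<close>

definition canonical :: "('a, 'm) ctensor \<Rightarrow> ('a, 'm) ctensor"
  where "canonical = ctensor_lift (\<lambda>a m. lmul a (\<delta> m))"

definition canonical_inv :: "('a, 'm) ctensor \<Rightarrow> ('a, 'm) ctensor"
  where "canonical_inv = ctensor_lift (\<lambda>a m. ctensor_lift (\<lambda>c m'. (a * antipode H c) \<otimes> m') (\<delta> m))"

lemma canonical_bilin: "bilin (\<lambda>a m. lmul a (\<delta> m))"
  using \<delta>_linear by (simp add: sesq_def clinear_iff lmul_add lmul_add_left lmul_scale)

lemma canonical_linear: "clinear canonical"
  unfolding canonical_def by (rule bilin_lift_linear[OF canonical_bilin])

lemma canonical_ctens: "canonical (a \<otimes> m) = lmul a (\<delta> m)"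
  unfolding canonical_def by (rule lift_ctens[OF sesq_bal2[OF canonical_bilin]])

lemma bal3_antipode_left: "bal3 (\<lambda>c d m. (a * antipode H c * d) \<otimes> m)"
  and bal3_antipode_right: "bal3 (\<lambda>c d m. (a * c * antipode H d) \<otimes> m)"
  using antipode_linear
  by (simp_all add: bal3_def clinear_iff distrib_left distrib_right mult_scaleC_left mult_scaleC_right
      ctens_add_left ctens_add_right ctens_balance)

lemma bal2_antipode: "bal2 (\<lambda>c m. (a * antipode H c) \<otimes> m)"
  using antipode_linear
  by (intro bal2I) (simp_all add: clinear_iff distrib_left mult_scaleC_right ctens_add_left ctens_add_right ctens_balance)

lemma bal2_canonical_inv: "bal2 (\<lambda>a m. ctensor_lift (\<lambda>c m'. (a * antipode H c) \<otimes> m') (\<delta> m))"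
proof (rule bal2I)
  show "ctensor_lift (\<lambda>c m'. ((a + a') * antipode H c) \<otimes> m') (\<delta> m) =
      ctensor_lift (\<lambda>c m'. (a * antipode H c) \<otimes> m') (\<delta> m) +
      ctensor_lift (\<lambda>c m'. (a' * antipode H c) \<otimes> m') (\<delta> m)" for a a' m
    unfolding distrib_right ctens_add_left by (rule lift_fun_add[OF bal2_antipode bal2_antipode])
  show "ctensor_lift (\<lambda>c m'. (a * antipode H c) \<otimes> m') (\<delta> (m + n)) =
      ctensor_lift (\<lambda>c m'. (a * antipode H c) \<otimes> m') (\<delta> m) +
      ctensor_lift (\<lambda>c m'. (a * antipode H c) \<otimes> m') (\<delta> n)" for a m n
    unfolding clinear_add[OF \<delta>_linear] by (rule lift_add[OF bal2_antipode])
  show "ctensor_lift (\<lambda>c m'. ((k *\<^sub>C a) * antipode H c) \<otimes> m') (\<delta> m) =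
      ctensor_lift (\<lambda>c m'. (a * antipode H c) \<otimes> m') (\<delta> (k *\<^sub>C m))" for a m k
    unfolding clinear_scale[OF \<delta>_linear] lift_scale[OF bal2_antipode]
    using antipode_linear by (simp add: clinear_iff mult_scaleC_left mult_scaleC_right)
qed

lemma canonical_inv_ctens:
  "canonical_inv (a \<otimes> m) = ctensor_lift (\<lambda>c m'. (a * antipode H c) \<otimes> m') (\<delta> m)"
  and canonical_inv_add: "canonical_inv (x + y) = canonical_inv x + canonical_inv y"
  unfolding canonical_inv_def by (rule lift_ctens[OF bal2_canonical_inv], rule lift_add[OF bal2_canonical_inv])

lemma counit_collapse: "ctensor_lift (\<lambda>c m'. (counit H c *\<^sub>C a) \<otimes> m') (\<delta> m) = a \<otimes> m"
proof -
  have "a \<otimes> slice (counit H) z = ctensor_lift (\<lambda>c m'. (counit H c *\<^sub>C a) \<otimes> m') z" for z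
    unfolding slice_def
    by (subst lift_apply[OF sesq_bal2[OF bilin_slice[OF counit_linear]], where f = "\<lambda>y. a \<otimes> y"])
      (simp_all add: ctens_add_right flip: ctens_balance)
  then show ?thesis using left_comodule_counit[OF comodule] by metis
qed

text \<open>The composition maps \<open>a \<otimes> m\<close> to \<open>a m\<^sub>(\<^sub>-\<^sub>2\<^sub>) S(m\<^sub>(\<^sub>-\<^sub>1\<^sub>)) \<otimes> m\<^sub>(\<^sub>0\<^sub>) = a \<otimes> m\<close>.\<close>

lemma canonical_inv_canonical: "canonical_inv (canonical z) = z"
proof (induction z rule: ctensor_induct)
  case (pure a m)
  have "canonical_inv (lmul a w) = ctensor_lift (\<lambda>c m'. canonical_inv ((a * c) \<otimes> m')) w" for w
    unfolding lmul_def by (rule lift_apply[OF bal2_lmul canonical_inv_add])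
  then have "canonical_inv (canonical (a \<otimes> m)) =
      ctensor_lift (\<lambda>c m'. ctensor_lift (\<lambda>d m''. (a * c * antipode H d) \<otimes> m'') (\<delta> m')) (\<delta> m)"
    by (simp only: canonical_ctens canonical_inv_ctens)
  also have "\<dots> = ctensor_lift (\<lambda>c m'. ctensor_lift (\<lambda>c d. (a * c * antipode H d) \<otimes> m') (comult H c)) (\<delta> m)"
    by (rule coassoc_apply[OF comodule comult_linear bal3_antipode_right, symmetric])
  also have "\<dots> = ctensor_lift (\<lambda>c m'. (counit H c *\<^sub>C a) \<otimes> m') (\<delta> m)"
  proof -
    have b: "bal2 (\<lambda>c d. c * antipode H d)"
      using antipode_linear by (intro bal2I)
        (simp_all add: clinear_iff distrib_left distrib_right mult_scaleC_left mult_scaleC_right)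
    have h: "(a * ctensor_lift (\<lambda>c d. c * antipode H d) w) \<otimes> m' =
        ctensor_lift (\<lambda>c d. (a * c * antipode H d) \<otimes> m') w" for w and m' :: 'm
      by (subst lift_apply[OF b, where f = "\<lambda>v. (a * v) \<otimes> m'"]) (simp_all add: distrib_left ctens_add_left mult.assoc)
    have "ctensor_lift (\<lambda>c d. (a * c * antipode H d) \<otimes> m') (comult H c) = (counit H c *\<^sub>C a) \<otimes> m'"
      for c and m' :: 'm
      using h[of "comult H c" m'] by (simp add: antipode_right mult_scaleC_right)
    then show ?thesis by (simp only:)
  qed
  also have "\<dots> = a \<otimes> m" by (rule counit_collapse)
  finally show ?case .
next
  case (add x y)
  then show ?case by (simp add: clinear_add[OF canonical_linear] canonical_inv_add)
qed

lemma canonical_antipode: "ctensor_lift (\<lambda>c m'. lmul (a * antipode H c) (\<delta> m')) (\<delta> m) = a \<otimes> m"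
proof -
  have "ctensor_lift (\<lambda>c m'. lmul (a * antipode H c) (\<delta> m')) (\<delta> m) =
      ctensor_lift (\<lambda>c m'. ctensor_lift (\<lambda>c d. (a * antipode H c * d) \<otimes> m') (comult H c)) (\<delta> m)"
    unfolding lmul_def by (rule coassoc_apply[OF comodule comult_linear bal3_antipode_left, symmetric])
  also have "\<dots> = ctensor_lift (\<lambda>c m'. (counit H c *\<^sub>C a) \<otimes> m') (\<delta> m)"
  proof -
    have b: "bal2 (\<lambda>c d. antipode H c * d)"
      using antipode_linear by (intro bal2I)
        (simp_all add: clinear_iff distrib_left distrib_right mult_scaleC_left mult_scaleC_right)
    have h: "(a * ctensor_lift (\<lambda>c d. antipode H c * d) w) \<otimes> m' =
        ctensor_lift (\<lambda>c d. (a * antipode H c * d) \<otimes> m') w" for w and m' :: 'm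
      by (subst lift_apply[OF b, where f = "\<lambda>v. (a * v) \<otimes> m'"]) (simp_all add: distrib_left ctens_add_left mult.assoc)
    have "ctensor_lift (\<lambda>c d. (a * antipode H c * d) \<otimes> m') (comult H c) = (counit H c *\<^sub>C a) \<otimes> m'"
      for c and m' :: 'm
      using h[of "comult H c" m'] by (simp add: antipode_left mult_scaleC_right)
    then show ?thesis by (simp only:)
  qed
  also have "\<dots> = a \<otimes> m" by (rule counit_collapse)
  finally show ?thesis .
qed

end

context hopf_module
begin

text \<open>The preimage is \<open>a S(m\<^sub>(\<^sub>-\<^sub>1\<^sub>)) S(b\<^sub>(\<^sub>1\<^sub>)) \<otimes> b\<^sub>(\<^sub>2\<^sub>) m\<^sub>(\<^sub>0\<^sub>)\<close>: modulo the relations \<open>b\<^sub>(\<^sub>2\<^sub>)\<close> may be moved to the left leg,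
  which produces the factor \<open>S(b\<^sub>(\<^sub>1\<^sub>)) b\<^sub>(\<^sub>2\<^sub>) = \<epsilon>(b) = 0\<close>.\<close>

lemma augmentation_in_canonical_image:
  assumes b: "counit H (\<iota> b) = 0"
  shows "\<exists>y\<in>relations. canonical y = a \<otimes> la b m"
proof -
  \<comment> \<open>\<open>\<Theta> a' m' = a' S(b\<^sub>(\<^sub>1\<^sub>)) \<otimes> b\<^sub>(\<^sub>2\<^sub>) m'\<close> is a relation, and the canonical map sends it to \<open>a' m'\<^sub>(\<^sub>-\<^sub>1\<^sub>) \<otimes> b m'\<^sub>(\<^sub>0\<^sub>)\<close>.\<close>
  define \<Theta> where "\<Theta> a' m' = ctensor_lift (\<lambda>p q. (a' * antipode H p) \<otimes> la q m') (base_coaction H \<iota> b)" for a' m'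
  have bT: "bal2 (\<lambda>p q. (a' * antipode H p) \<otimes> la q m')" for a' m'
    using antipode_linear la_bilin
    by (intro bal2I) (simp_all add: clinear_iff sesq_def distrib_left mult_scaleC_right
        ctens_add_left ctens_add_right ctens_balance)
  have T1: "\<Theta> (a' + a'') m' = \<Theta> a' m' + \<Theta> a'' m'" for a' a'' m'
    unfolding \<Theta>_def distrib_right ctens_add_left by (rule lift_fun_add[OF bT bT])
  have T2: "\<Theta> a' (m' + m'') = \<Theta> a' m' + \<Theta> a' m''" for a' m' m''
    unfolding \<Theta>_def sesq_add_right[OF la_bilin] ctens_add_right by (rule lift_fun_add[OF bT bT])
  have T3: "\<Theta> (k *\<^sub>C a') m' = \<Theta> a' (k *\<^sub>C m')" for k a' m'
    unfolding \<Theta>_def sesq_scale_right[OF la_bilin] mult_scaleC_left ctens_balance ..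
  have bY: "bal2 (\<lambda>c m'. \<Theta> (a * antipode H c) m')"
    using antipode_linear by (intro bal2I) (simp_all add: clinear_iff distrib_left T1 T2 T3 mult_scaleC_right)
  have "\<Theta> a' m' \<in> relations" for a' m'
  proof -
    have bS: "bal2 (\<lambda>p q. antipode H p * q)"
      using antipode_linear by (intro bal2I)
        (simp_all add: clinear_iff distrib_left distrib_right mult_scaleC_left mult_scaleC_right)
    have bI: "bal2 (\<lambda>p q. antipode H p * \<iota> q)"
      using antipode_linear incl_linear by (intro bal2I)
        (simp_all add: clinear_iff distrib_left distrib_right mult_scaleC_left mult_scaleC_right)
    have "ctensor_lift (\<lambda>p q. antipode H p * q) (tmap \<iota> u) = ctensor_lift (\<lambda>p q. antipode H p * \<iota> q) u" for u
      by (induction u rule: ctensor_induct) (simp_all add: tmap_ctens[OF incl_linear] lift_ctens[OF bS]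
        lift_ctens[OF bI] lift_add[OF bS] lift_add[OF bI] clinear_add[OF tmap_linear[OF incl_linear]])
    from this[of "base_coaction H \<iota> b"]
    have z: "ctensor_lift (\<lambda>p q. antipode H p * \<iota> q) (base_coaction H \<iota> b) = 0"
      unfolding tmap_base_coaction antipode_left b by simp
    have r: "(a' * ctensor_lift (\<lambda>p q. antipode H p * \<iota> q) u) \<otimes> m' -
        ctensor_lift (\<lambda>p q. (a' * antipode H p) \<otimes> la q m') u \<in> relations" for u
    proof (induction u rule: ctensor_induct)
      case (pure p q)
      show ?case
        using relation[of "a' * antipode H p" q m'] by (simp add: lift_ctens[OF bI] lift_ctens[OF bT] mult.assoc)
    next
      case (add x y)
      from cvec.subspace_add[OF relations_subspace add.IH] show ?case
        by (simp add: lift_add[OF bI] lift_add[OF bT] distrib_left ctens_add_left algebra_simps)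
    qed
    have "- \<Theta> a' m' \<in> relations"
      using r[of "base_coaction H \<iota> b"] unfolding z \<Theta>_def[symmetric]
      by (simp add: sesq_zero_left[OF bilin_ctens])
    then show ?thesis
      using cvec.subspace_neg[OF relations_subspace, of "- \<Theta> a' m'"] by simp
  qed
  then have "ctensor_lift (\<lambda>c m'. \<Theta> (a * antipode H c) m') w \<in> relations" for w
    by (induction w rule: ctensor_induct)
      (auto simp: lift_ctens[OF bY] lift_add[OF bY] intro: cvec.subspace_add[OF relations_subspace])
  moreover have "canonical (ctensor_lift (\<lambda>c m'. \<Theta> (a * antipode H c) m') (\<delta> m)) = a \<otimes> la b m"
  proof -
    have "canonical (\<Theta> a' m') = lmul a' (tmap (la b) (\<delta> m'))" for a' m'
    proof -
      have "ctensor_lift (\<lambda>p q. lmul (a' * antipode H p) (tmul (*) la (base_coaction H \<iota> q) v)) (base_coaction H \<iota> b)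
          = lmul a' (tmap (la b) v)" for v
      proof -
        have bl: "bal2 (\<lambda>p q. lmul (a' * antipode H p) (tmul (*) la (base_coaction H \<iota> q) v))" for v
          using antipode_linear base_coaction_linear
          by (intro bal2I) (simp_all add: clinear_iff distrib_left lmul_add lmul_add_left lmul_scale
              mult_scaleC_right sesq_add_left[OF sesq_tmul[OF bilin_mult la_bilin]]
              sesq_scale_left[OF sesq_tmul[OF bilin_mult la_bilin]])
        show ?thesis
        proof (induction v rule: ctensor_induct)
          case (pure d n)
          let ?g = "\<lambda>p r s. (a' * antipode H p * r * d) \<otimes> la s n"
          have g: "bal3 ?g"
            using antipode_linear la_bilin
            by (simp add: bal3_def clinear_iff sesq_def distrib_left distrib_right mult_scaleC_left
                mult_scaleC_right ctens_add_left ctens_add_right ctens_balance)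
          have bt: "bal2 (\<lambda>r s. (r * d) \<otimes> la s n)"
            using la_bilin by (intro bal2I) (simp_all add: sesq_def distrib_right mult_scaleC_left
                ctens_add_left ctens_add_right ctens_balance)
          have t: "tmul (*) la w (d \<otimes> n) = ctensor_lift (\<lambda>r s. (r * d) \<otimes> la s n) w" for w
            by (induction w rule: ctensor_induct) (simp_all add: tmul_ctens[OF bilin_mult la_bilin]
                tmul_add_left[OF bilin_mult la_bilin] lift_ctens[OF bt] lift_add[OF bt])
          have lt: "lmul e (ctensor_lift (\<lambda>r s. (r * d) \<otimes> la s n) w) = ctensor_lift (\<lambda>r s. (e * r * d) \<otimes> la s n) w" for e w
            by (subst lift_apply[OF bt lmul_add]) (simp add: lmul_ctens mult.assoc)
          have bS: "bal2 (\<lambda>c d. antipode H c * d)"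
            using antipode_linear by (intro bal2I)
              (simp_all add: clinear_iff distrib_left distrib_right mult_scaleC_left mult_scaleC_right)
          have h: "(a' * ctensor_lift (\<lambda>c d. antipode H c * d) w * d) \<otimes> la s n = ctensor_lift (\<lambda>p r. ?g p r s) w" for w s
            by (subst lift_apply[OF bS, where f = "\<lambda>v. (a' * v * d) \<otimes> la s n"])
              (simp_all add: distrib_left distrib_right ctens_add_left mult.assoc)
          have "ctensor_lift (\<lambda>p q. lmul (a' * antipode H p) (tmul (*) la (base_coaction H \<iota> q) (d \<otimes> n))) (base_coaction H \<iota> b)
            = ctensor_lift (\<lambda>p q. ctensor_lift (\<lambda>r s. ?g p r s) (base_coaction H \<iota> q)) (base_coaction H \<iota> b)"
            by (simp only: t lt)
          also have "\<dots> = ctensor_lift (\<lambda>p q. ctensor_lift (\<lambda>p r. ?g p r q) (comult H p)) (base_coaction H \<iota> b)"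
            by (rule coassoc_apply[OF base_comodule comult_linear g, symmetric])
          also have "\<dots> = ctensor_lift (\<lambda>p q. (a' * d) \<otimes> la (counit H p *\<^sub>C q) n) (base_coaction H \<iota> b)"
            using la_bilin by (simp only: h[symmetric] antipode_left mult_scaleC_left mult_scaleC_right
                mult.right_neutral ctens_balance sesq_scale_left)
          also have "\<dots> = (a' * d) \<otimes> la (slice (counit H) (base_coaction H \<iota> b)) n"
            unfolding slice_def using la_bilin
            by (subst lift_apply[OF sesq_bal2[OF bilin_slice[OF counit_linear]], where f = "\<lambda>y. (a' * d) \<otimes> la y n"])
              (simp_all add: ctens_add_right sesq_def)
          finally show ?case
            by (simp add: left_comodule_counit[OF base_comodule] tmap_ctens[OF sesq_linear_right[OF la_bilin]] lmul_ctens)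
        next
          case (add x y)
          then show ?case
            by (simp add: tmul_add_right[OF bilin_mult la_bilin] lmul_add lift_fun_add[OF bl bl]
                clinear_add[OF tmap_linear[OF sesq_linear_right[OF la_bilin]]])
        qed
      qed
      then show ?thesis
        unfolding \<Theta>_def
        by (subst lift_apply[where f = canonical, OF bT clinear_add[OF canonical_linear]])
          (simp only: canonical_ctens covariant)
    qed
    then have "canonical (ctensor_lift (\<lambda>c m'. \<Theta> (a * antipode H c) m') (\<delta> m)) =
        ctensor_lift (\<lambda>c m'. lmul (a * antipode H c) (tmap (la b) (\<delta> m'))) (\<delta> m)"
      by (subst lift_apply[where f = canonical, OF bY clinear_add[OF canonical_linear]]) (simp only:)
    also have "\<dots> = ctensor_lift (\<lambda>c m'. tmap (la b) (lmul (a * antipode H c) (\<delta> m'))) (\<delta> m)"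
    proof -
      note l = sesq_linear_right[OF la_bilin]
      have "lmul e (tmap (la b) w) = tmap (la b) (lmul e w)" for e and w :: "('a, 'm) ctensor"
        by (induction w rule: ctensor_induct)
          (simp_all add: tmap_ctens[OF l] lmul_ctens lmul_add clinear_add[OF tmap_linear[OF l]])
      then show ?thesis by (simp only:)
    qed
    also have "\<dots> = tmap (la b) (ctensor_lift (\<lambda>c m'. lmul (a * antipode H c) (\<delta> m')) (\<delta> m))"
    proof -
      have "bal2 (\<lambda>c m'. lmul (a * antipode H c) (\<delta> m'))"
        using antipode_linear \<delta>_linear by (intro bal2I)
          (simp_all add: clinear_iff distrib_left lmul_add lmul_add_left lmul_scale mult_scaleC_right)
      from lift_apply[where f = "tmap (la b)", OF this clinear_add[OF tmap_linear[OF sesq_linear_right[OF la_bilin]]]]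
      show ?thesis by simp
    qed
    also have "\<dots> = a \<otimes> la b m"
      by (simp add: canonical_antipode tmap_ctens[OF sesq_linear_right[OF la_bilin]])
    finally show ?thesis .
  qed
  ultimately show ?thesis by blast
qed

text \<open>The subspace \<open>B\<^sup>+M\<close>.\<close>

definition augmented :: "'m set"
  where "augmented = cvec.span {la b m |b m. counit H (\<iota> b) = 0}"

text \<open>By the preceding lemma \<open>\<delta>(x)\<close> is the image of a relation under the canonical map.  But \<open>\<delta>(x)\<close> is also the image of
  \<open>1 \<otimes> x\<close>, and the canonical map is injective.\<close>

lemma one_tensor_in_relations:
  assumes "\<delta> x \<in> tens_in UNIV augmented"
  shows "1 \<otimes> x \<in> relations"
proof -
  have aug: "\<exists>y\<in>relations. canonical y = a \<otimes> m" if "m \<in> augmented" for a m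
    using that unfolding augmented_def
  proof (induction arbitrary: a rule: cvec.span_induct_alt)
    case base
    have "0 \<in> relations" by (rule cvec.subspace_0[OF relations_subspace])
    then show ?case
      by (intro bexI[of _ 0]) (simp_all add: clinear_zero[OF canonical_linear] sesq_zero_right[OF bilin_ctens])
  next
    case (step c x y)
    then obtain b m where x: "x = la b m" "counit H (\<iota> b) = 0" by blast
    obtain u where "u \<in> relations" "canonical u = (c *\<^sub>C a) \<otimes> x"
      using augmentation_in_canonical_image[OF x(2), of "c *\<^sub>C a" m] x(1) by auto
    moreover obtain v where "v \<in> relations" "canonical v = a \<otimes> y"
      using step.IH[of a] by blast
    ultimately show ?case
      by (intro bexI[of _ "u + v"])
        (simp_all add: clinear_add[OF canonical_linear] ctens_add_right ctens_balance
          cvec.subspace_add[OF relations_subspace])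
  qed
  from assms have "\<exists>y\<in>relations. canonical y = \<delta> x"
  proof (induction rule: tens_in_induct)
    case subspace
    show ?case by (simp add: augmented_def)
  next
    case (pure a m)
    then show ?case using aug by simp
  next
    case (add u v)
    then obtain y z where "y \<in> relations" "z \<in> relations" "canonical y = u" "canonical z = v" by blast
    then show ?case
      by (intro bexI[of _ "y + z"])
        (simp_all add: clinear_add[OF canonical_linear] cvec.subspace_add[OF relations_subspace])
  qed
  then obtain y where y: "y \<in> relations" "canonical y = \<delta> x" by blast
  have "lmul 1 w = w" for w :: "('a, 'm) ctensor"
    by (induction w rule: ctensor_induct) (simp_all add: lmul_ctens lmul_add)
  then have "canonical y = canonical (1 \<otimes> x)" by (simp add: y(2) canonical_ctens)
  from arg_cong[OF this, of canonical_inv] have "y = 1 \<otimes> x"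
    by (simp add: canonical_inv_canonical)
  then show ?thesis using y(1) by simp
qed

subsection \<open>Use of faithful flatness\<close>

abbreviation (input) ract_A :: "'a \<Rightarrow> 'b \<Rightarrow> 'a" where "ract_A a b \<equiv> a * \<iota> b"

lemma incl_scale_one: "\<iota> (c *\<^sub>C 1) = c *\<^sub>C 1"
  using incl_algebra_map by (simp add: algebra_map_def clinear_iff)

lemma la_scale_one: "la (c *\<^sub>C 1) m = c *\<^sub>C m"
  using la_bilin by (simp add: sesq_def la_one)

lemma tensor_eq_if_ctensor_eq:
  "ctensor_eq X Y \<Longrightarrow> tensor_eq ract_A UNIV (+) la X Y"
proof (induction rule: tensor_eq.induct)
  case (balance n m r)
  have "tensor_eq ract_A UNIV (+) la {#(m * \<iota> (r *\<^sub>C 1), n)#} {#(m, la (r *\<^sub>C 1) n)#}"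
    by (rule tensor_eq.balance) simp
  then show ?case by (simp add: incl_scale_one la_scale_one mult_scaleC_right)
qed (blast intro: tensor_eq.intros)+

lemma tensor_eq_add:
  assumes "tensor_eq ra N p l X X'" "tensor_eq ra N p l Y Y'"
  shows "tensor_eq ra N p l (X + Y) (X' + Y')"
  using tensor_eq.trans[OF tensor_eq.cong[OF assms(1), of Y]
      tensor_eq.cong[OF assms(2), of X', unfolded add.commute[of _ X']]] .

text \<open>This passes from the quotient of \<open>A \<otimes> M\<close> by the relations to the presentation of \<open>A \<otimes>\<^sub>B M\<close> by formal sums of pairs, in
  which faithful flatness is expressed.\<close>

lemma tensor_eq_if_in_relations:
  assumes "tensor_sum (\<otimes>) X \<in> relations"
  shows "tensor_eq ract_A UNIV (+) la X {#}"
proof -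
  have "\<exists>Z. tensor_sum (\<otimes>) Z = z \<and> tensor_eq ract_A UNIV (+) la Z {#}" if "z \<in> relations" for z
    using that unfolding relations_def
  proof (induction rule: cvec.span_induct_alt)
    case base
    show ?case by (rule exI[of _ "{#}"]) (simp add: tensor_eq.refl)
  next
    case (step c x y)
    then obtain a b m Z where x: "x = (a * \<iota> b) \<otimes> m - a \<otimes> la b m"
      and Z: "tensor_sum (\<otimes>) Z = y" "tensor_eq ract_A UNIV (+) la Z {#}" by blast
    let ?a = "c *\<^sub>C a"
    \<comment> \<open>The formal sum of \<open>(a b, m)\<close> and \<open>(- a, b m)\<close> represents the relation, and it is equivalent to the empty sum.\<close>
    have "tensor_eq ract_A UNIV (+) la ({#(?a * \<iota> b, m)#} + {#(- ?a, la b m)#}) ({#(?a, la b m)#} + {#(- ?a, la b m)#})"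
      by (rule tensor_eq.cong, rule tensor_eq.balance) simp
    moreover have "tensor_eq ract_A UNIV (+) la ({#(?a, la b m)#} + {#(- ?a, la b m)#}) {#(?a + - ?a, la b m)#}"
      using tensor_eq.sym[OF tensor_eq.add_left[of "la b m" UNIV ract_A "(+)" la ?a "- ?a"]]
      by (simp add: add_mset_commute)
    moreover have "tensor_eq ract_A UNIV (+) la {#(?a + - ?a, la b m)#} {#}"
      by (simp add: tensor_eq.zero)
    ultimately have "tensor_eq ract_A UNIV (+) la ({#(?a * \<iota> b, m)#} + {#(- ?a, la b m)#}) {#}"
      by (blast intro: tensor_eq.trans)
    from tensor_eq_add[OF this Z(2)]
    have "tensor_eq ract_A UNIV (+) la ({#(?a * \<iota> b, m)#} + {#(- ?a, la b m)#} + Z) {#}" by simp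
    moreover have "tensor_sum (\<otimes>) ({#(?a * \<iota> b, m)#} + {#(- ?a, la b m)#} + Z) = c *\<^sub>C x + y"
      by (simp add: Z(1) x cvec.scale_right_diff_distrib mult_scaleC_left ctens_scale_left
          clinear_minus[OF bilin_linear_left[OF bilin_ctens]])
    ultimately show ?case by blast
  qed
  from this[OF assms] obtain Z where Z: "tensor_sum (\<otimes>) Z = tensor_sum (\<otimes>) X"
    "tensor_eq ract_A UNIV (+) la Z {#}" by blast
  have "ctensor_eq X Z"
    using is_tensor_product_ctens Z(1)[symmetric] unfolding is_tensor_product_def by blast
  then show ?thesis
    by (rule tensor_eq.trans[OF tensor_eq_if_ctensor_eq Z(2)])
qed

text \<open>In \<open>A \<otimes>\<^sub>B M\<close> one has \<open>a \<otimes> b x = a b (1 \<otimes> x)\<close>.\<close>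

lemma cyclic_tensors_vanish:
  assumes x: "1 \<otimes> x \<in> relations" and Y: "set_mset Y \<subseteq> UNIV \<times> range (\<lambda>b. la b x)"
  shows "tensor_eq ract_A UNIV (+) la Y {#}"
proof (rule tensor_eq_if_in_relations)
  have "a \<otimes> la b x \<in> relations" for a b
  proof -
    have "lmul (a * \<iota> b) (1 \<otimes> x) - ((a * \<iota> b) \<otimes> x - a \<otimes> la b x) \<in> relations"
      by (rule cvec.subspace_diff[OF relations_subspace lmul_relations[OF x] relation])
    then show ?thesis by (simp add: lmul_ctens)
  qed
  then show "tensor_sum (\<otimes>) Y \<in> relations"
    using Y by (induction Y)
      (auto simp: cvec.subspace_0[OF relations_subspace] intro: cvec.subspace_add[OF relations_subspace])
qed

text \<open>If \<open>1 \<otimes> x\<close> vanishes in \<open>A \<otimes>\<^sub>B M\<close>, then so does the image of \<open>A \<otimes>\<^sub>B Bx\<close>.  Flatness gives \<open>A \<otimes>\<^sub>B Bx = 0\<close>, and then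
  faithfulness gives \<open>Bx = 0\<close>.

  The definition of faithful flatness speaks of modules whose elements are sets of sequences in \<open>B\<close>.  With a finite generating sequence, an element is encoded by the set of its coefficient sequences,
  and all operations are transported along this injection.\<close>

lemma flat_descent:
  assumes x: "1 \<otimes> x \<in> relations"
  shows "x = 0"
proof -
  obtain G where G: "finite G" "\<And>m. \<exists>c. m = (\<Sum>e\<in>G. la (c e) e)"
    using la_fg unfolding finitely_generated_def by blast
  obtain n and g :: "nat \<Rightarrow> 'm" where g: "bij_betw g {..<n} G"
    using ex_bij_betw_nat_finite[OF G(1)] by (auto simp: atLeast0LessThan)
  have gen: "\<exists>s. m = (\<Sum>i<n. la (s i) (g i))" for m
  proof -
    obtain c where "m = (\<Sum>e\<in>G. la (c e) e)" using G(2) by blast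
    also have "\<dots> = (\<Sum>i<n. la (c (g i)) (g i))"
      by (rule sum.reindex_bij_betw[OF g, symmetric])
    finally show ?thesis by (intro exI[of _ "\<lambda>i. c (g i)"])
  qed
  define enc where "enc m = {s. (\<Sum>i<n. la (s i) (g i)) = m}" for m
  have "inj enc"
  proof (rule injI)
    fix m m' assume e: "enc m = enc m'"
    obtain s where "m = (\<Sum>i<n. la (s i) (g i))" using gen by blast
    then have "s \<in> enc m" by (simp add: enc_def)
    then have "s \<in> enc m'" using e by simp
    then show "m = m'" using \<open>s \<in> enc m\<close> by (simp add: enc_def)
  qed
  define dec where "dec = inv enc"
  have dec [simp]: "dec (enc m) = m" for m
    using \<open>inj enc\<close> by (simp add: dec_def)
  define p where "p U V = enc (dec U + dec V)" for U V
  define l where "l b U = enc (la b (dec U))" for b U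
  have p_enc: "p (enc u) (enc v) = enc (u + v)" and l_enc: "l b (enc u) = enc (la b u)" for b u v
    by (simp_all add: p_def l_def)
  have module: "left_module_on (enc ` S) (enc 0) p l"
    if S: "0 \<in> S" "\<And>u v. u \<in> S \<Longrightarrow> v \<in> S \<Longrightarrow> u + v \<in> S" "\<And>b u. u \<in> S \<Longrightarrow> la b u \<in> S" for S
  proof -
    have neg: "- u \<in> S" if "u \<in> S" for u
    proof -
      have "la ((-1) *\<^sub>C 1) u = - u" by (simp only: la_scale_one) simp
      then show ?thesis using S(3)[OF that] by metis
    qed
    show ?thesis
      unfolding left_module_on_def
    proof (intro conjI)
      show "\<forall>x\<in>enc ` S. \<exists>y\<in>enc ` S. p y x = enc 0"
      proof
        fix x assume "x \<in> enc ` S"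
        then obtain u where "u \<in> S" "x = enc u" by blast
        then show "\<exists>y\<in>enc ` S. p y x = enc 0"
          using neg by (intro bexI[of _ "enc (- u)"]) (auto simp: p_def)
      qed
    qed (use S la_bilin in \<open>auto simp: p_def l_def add_ac la_mult la_one sesq_add_left sesq_add_right\<close>)
  qed
  define N0 where "N0 = enc ` {0}"
  define N1 where "N1 = enc ` range (\<lambda>b. la b x)"
  define N2 where "N2 = enc ` UNIV"
  have m0: "left_module_on N0 (enc 0) p l"
    unfolding N0_def by (rule module) (simp_all add: sesq_zero_right[OF la_bilin])
  have m1: "left_module_on N1 (enc 0) p l"
    unfolding N1_def
  proof (rule module)
    show "0 \<in> range (\<lambda>b. la b x)"
      using sesq_zero_left[OF la_bilin, of x] by (metis rangeI)
    show "u + v \<in> range (\<lambda>b. la b x)" if "u \<in> range (\<lambda>b. la b x)" "v \<in> range (\<lambda>b. la b x)" for u v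
      using that by (auto simp flip: sesq_add_left[OF la_bilin])
    show "la b u \<in> range (\<lambda>b. la b x)" if "u \<in> range (\<lambda>b. la b x)" for b u
      using that by (auto simp flip: la_mult)
  qed
  have m2: "left_module_on N2 (enc 0) p l"
    unfolding N2_def by (rule module) auto
  have N: "N0 \<subseteq> N1" "N1 \<subseteq> N2"
    using m1 by (auto simp: N0_def N1_def N2_def left_module_on_def)
  have idm: "module_map_on M p l M' p l (\<lambda>y. y)" if "M \<subseteq> M'" for M M'
    using that by (auto simp: module_map_on_def)
  have flat: "faithfully_flat ract_A" by (rule incl_faithfully_flat)
  \<comment> \<open>The sequence \<open>0 \<rightarrow> Bx \<rightarrow> M\<close> is exact, so elements of \<open>A \<otimes>\<^sub>B Bx\<close> vanishing in \<open>A \<otimes>\<^sub>B M\<close> vanish.\<close>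
  have 1: "\<forall>Y. set_mset Y \<subseteq> UNIV \<times> N1 \<longrightarrow>
      (tensor_eq ract_A N2 p l (image_mset (map_prod id (\<lambda>y. y)) Y) {#} \<longleftrightarrow>
       (\<exists>X. set_mset X \<subseteq> UNIV \<times> N0 \<and> tensor_eq ract_A N1 p l Y (image_mset (map_prod id (\<lambda>y. y)) X)))"
    using flat[unfolded faithfully_flat_def, rule_format, of N0 "enc 0" p l N1 "enc 0" p l N2 "enc 0" p l
        "\<lambda>y. y" "\<lambda>y. y"] m0 m1 m2 idm[OF N(1)] idm[OF N(2)] by (simp add: N0_def)
  \<comment> \<open>The sequence \<open>0 \<rightarrow> Bx \<rightarrow> 0\<close> is exact after tensoring.\<close>
  have zero_map: "module_map_on N1 p l N0 p l (\<lambda>_. enc 0)"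
    by (auto simp: module_map_on_def N0_def p_def l_def sesq_zero_right[OF la_bilin])
  have 2: "(\<forall>y\<in>N1. enc 0 = enc 0 \<longleftrightarrow> (\<exists>z\<in>N0. y = z)) \<longleftrightarrow> (\<forall>Y. set_mset Y \<subseteq> UNIV \<times> N1 \<longrightarrow>
      (tensor_eq ract_A N0 p l (image_mset (map_prod id (\<lambda>_. enc 0)) Y) {#} \<longleftrightarrow>
       (\<exists>X. set_mset X \<subseteq> UNIV \<times> N0 \<and> tensor_eq ract_A N1 p l Y (image_mset (map_prod id (\<lambda>y. y)) X))))"
    by (rule flat[unfolded faithfully_flat_def, rule_format, of N0 "enc 0" p l N1 "enc 0" p l N0 "enc 0" p l
        "\<lambda>y. y" "\<lambda>_. enc 0"]) (intro conjI m0 m1 idm[OF N(1)] zero_map)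
  have t0: "tensor_eq ract_A N0 p l (image_mset (map_prod id (\<lambda>_. enc 0)) Y) {#}" for Y :: "('a \<times> (nat \<Rightarrow> 'b) set) multiset"
  proof (induction Y)
    case empty
    show ?case by (simp add: tensor_eq.refl)
  next
    case (add y Y)
    obtain a u where y: "y = (a, u)" by fastforce
    have z: "enc 0 \<in> N0" by (simp add: N0_def)
    have "tensor_eq ract_A N0 p l {#(a, l 0 (enc 0))#} {#(a * \<iota> 0, enc 0)#}"
      by (rule tensor_eq.sym[OF tensor_eq.balance[OF z]])
    then have "tensor_eq ract_A N0 p l {#(a, enc 0)#} {#(0, enc 0)#}"
      by (simp add: l_def sesq_zero_right[OF la_bilin] clinear_zero[OF incl_linear])
    from tensor_eq.trans[OF this tensor_eq.zero[OF z]]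
    have "tensor_eq ract_A N0 p l {#(a, enc 0)#} {#}" .
    from tensor_eq_add[OF add.IH this] show ?case
      by (simp add: y)
  qed
  have transport: "tensor_eq ract_A N2 p l (image_mset (map_prod id enc) X) (image_mset (map_prod id enc) Y)"
    if "tensor_eq ract_A UNIV (+) la X Y" for X Y
    using that
  proof (induction rule: tensor_eq.induct)
    case (zero n)
    show ?case using tensor_eq.zero[of "enc n" N2] by (simp add: N2_def)
  next
    case (add_left n m m')
    show ?case using tensor_eq.add_left[of "enc n" N2] by (simp add: N2_def)
  next
    case (add_right n n' m)
    show ?case using tensor_eq.add_right[of "enc n" N2 "enc n'" ract_A p l m] by (simp add: N2_def p_enc)
  next
    case (balance n m r)
    show ?case using tensor_eq.balance[of "enc n" N2 ract_A p l m r] by (simp add: N2_def l_enc)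
  next
    case (trans X Y Z)
    then show ?case using tensor_eq.trans by blast
  next
    case (cong X Y Z)
    then show ?case by (simp add: tensor_eq.cong)
  qed (simp_all add: tensor_eq.refl tensor_eq.sym)
  have "\<exists>X. set_mset X \<subseteq> UNIV \<times> N0 \<and> tensor_eq ract_A N1 p l Y (image_mset (map_prod id (\<lambda>y. y)) X)"
    if Y: "set_mset Y \<subseteq> UNIV \<times> N1" for Y
  proof -
    define Y' where "Y' = image_mset (map_prod id dec) Y"
    have "image_mset (map_prod id enc) Y' = image_mset (\<lambda>y. y) Y"
      unfolding Y'_def multiset.map_comp
      by (rule image_mset_cong) (use Y in \<open>auto simp: N1_def\<close>)
    then have Y2: "image_mset (map_prod id enc) Y' = Y" by simp
    have "set_mset Y' \<subseteq> UNIV \<times> range (\<lambda>b. la b x)"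
      using Y by (fastforce simp: Y'_def N1_def)
    from transport[OF cyclic_tensors_vanish[OF x this]]
    have "tensor_eq ract_A N2 p l Y {#}"
      unfolding Y2 by (simp only: image_mset_empty)
    moreover have "image_mset (map_prod id (\<lambda>y. y)) Y = Y"
      by (simp add: map_prod_def split_def)
    ultimately have "tensor_eq ract_A N2 p l (image_mset (map_prod id (\<lambda>y. y)) Y) {#}"
      by (simp only:)
    then show ?thesis using 1 Y by blast
  qed
  then have "\<forall>y\<in>N1. \<exists>z\<in>N0. y = z" using 2 t0 by simp
  moreover have "enc x \<in> N1" unfolding N1_def using la_one[of x] by (metis imageI rangeI)
  ultimately have "enc x = enc 0" by (simp add: N0_def)
  then show ?thesis using dec by metis
qed

text \<open>Elements whose coaction has its left legs in a given finite-dimensional space.\<close>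

definition coefficients_in :: "'a set \<Rightarrow> 'm set"
  where "coefficients_in S = {x. \<forall>\<phi>. cfunctional \<phi> \<longrightarrow> (\<forall>s\<in>S. \<phi> s = 0) \<longrightarrow> slice \<phi> (\<delta> x) = 0}"

text \<open>The quotient \<open>M/B\<^sup>+M\<close> is spanned by the classes of the generators, as \<open>b e - \<epsilon>(b) e \<in> B\<^sup>+M\<close>.  The map
  \<open>x \<mapsto> x\<^sub>(\<^sub>-\<^sub>1\<^sub>) \<otimes> [x\<^sub>(\<^sub>0\<^sub>)]\<close> to \<open>A \<otimes> M/B\<^sup>+M\<close> is injective by the preceding lemmas, and it sends the space in question to
  the tensor product of the span of \<open>S\<close> with \<open>M/B\<^sup>+M\<close>.\<close>

lemma finite_dimensional_coefficients_in:
  assumes S: "finite S"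
  shows "finite_dimensional (coefficients_in S)"
proof -
  obtain G where G: "finite G" "\<And>m. \<exists>c. m = (\<Sum>e\<in>G. la (c e) e)"
    using la_fg unfolding finitely_generated_def by blast
  let ?U = "{la b m |b m. counit H (\<iota> b) = 0}"
  have span: "m \<in> cvec.span (?U \<union> G)" for m
  proof -
    from G(2)[of m] obtain c where c: "m = (\<Sum>e\<in>G. la (c e) e)" ..
    have "la b e \<in> cvec.span (?U \<union> G)" if "e \<in> G" for b e
    proof -
      let ?k = "counit H (\<iota> b)"
      have "counit H (\<iota> (b - ?k *\<^sub>C 1)) = 0"
      proof -
        have "counit H (\<iota> b + (- ?k) *\<^sub>C 1) = 0"
          using counit_linear unfolding cfunctional_iff by (simp only: counit_one) simp
        then show ?thesis by (simp add: clinear_diff[OF incl_linear] incl_scale_one)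
      qed
      then have "la (b - ?k *\<^sub>C 1) e + ?k *\<^sub>C e \<in> cvec.span (?U \<union> G)"
        using that by (intro cvec.span_add cvec.span_scale cvec.span_base) blast+
      moreover have "la (b - ?k *\<^sub>C 1) e + ?k *\<^sub>C e = la b e"
        by (simp add: clinear_diff[OF bilin_linear_left[OF la_bilin]] la_scale_one)
      ultimately show ?thesis by simp
    qed
    then show ?thesis unfolding c by (intro cvec.span_sum)
  qed
  \<comment> \<open>The range of \<open>q\<close> is a complement of \<open>B\<^sup>+M\<close> and represents the quotient \<open>M/B\<^sup>+M\<close>.\<close>
  obtain q where q: "clinear q" "range q \<subseteq> cvec.span G" "\<forall>m. m - q m \<in> cvec.span ?U"
    by (rule projection_modulo_subspace[OF span])
  show ?thesis
  proof (rule finite_dimensional_injective)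
    show "clinear (\<lambda>x. tmap q (\<delta> x))"
      by (rule clinear_compose[OF tmap_linear[OF q(1)] \<delta>_linear])
    show "cvec.subspace (coefficients_in S)"
      unfolding coefficients_in_def cvec.subspace_def
      by (simp add: clinear_zero[OF \<delta>_linear] clinear_add[OF \<delta>_linear] clinear_scale[OF \<delta>_linear]
          clinear_zero[OF slice_linear] clinear_add[OF slice_linear] clinear_scale[OF slice_linear])
    show "x = 0" if "tmap q (\<delta> x) = 0" for x
    proof -
      have "z - tmap q z \<in> tens_in UNIV augmented" for z :: "('a, 'm) ctensor"
      proof (induction z rule: ctensor_induct)
        case (pure a m)
        have "a \<otimes> (m - q m) \<in> tens_in UNIV augmented"
          unfolding tens_in_def using spec[OF q(3), of m] by (intro cvec.span_base) (auto simp: augmented_def)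
        then show ?case by (simp add: tmap_ctens[OF q(1)] clinear_diff[OF sesq_linear_right[OF bilin_ctens]])
      next
        case (add y z)
        have "y + z - tmap q (y + z) = (y - tmap q y) + (z - tmap q z)"
          by (simp add: clinear_add[OF tmap_linear[OF q(1)]])
        then show ?case using add unfolding tens_in_def by (simp only: cvec.span_add)
      qed
      from this[of "\<delta> x"] show ?thesis
        using that flat_descent[OF one_tensor_in_relations] by simp
    qed
    show "finite_dimensional ((\<lambda>x. tmap q (\<delta> x)) ` coefficients_in S)"
      unfolding finite_dimensional_def
    proof (intro exI conjI)
      let ?P = "(\<lambda>(s, e). s \<otimes> e) ` (S \<times> G)"
      show "finite ?P" using S G(1) by simp
      have base: "s \<otimes> e \<in> cvec.span ?P" if "s \<in> S" "e \<in> G" for s e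
        using that by (intro cvec.span_base) force
      have "a \<otimes> e \<in> cvec.span ?P" if "a \<in> cvec.span S" "e \<in> G" for a e
        using clinear_span_image[OF bilin_linear_left[OF bilin_ctens] that(1), of e]
          cvec.span_minimal[OF _ cvec.subspace_span, of "(\<lambda>a. a \<otimes> e) ` S" ?P] base that(2) by blast
      then have pure: "a \<otimes> m \<in> cvec.span ?P" if "a \<in> cvec.span S" "m \<in> cvec.span G" for a m
        using clinear_span_image[OF sesq_linear_right[OF bilin_ctens] that(2), of a]
          cvec.span_minimal[OF _ cvec.subspace_span, of "(\<lambda>m. a \<otimes> m) ` G" ?P] that(1) by blast
      show "(\<lambda>x. tmap q (\<delta> x)) ` coefficients_in S \<subseteq> cvec.span ?P"
      proof clarify
        fix x assume x: "x \<in> coefficients_in S"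
        have "\<delta> x \<in> tens_in (cvec.span S) UNIV"
          using x by (intro in_tens_in_if_slices_vanish) (simp add: coefficients_in_def)
        from clinear_span_image[OF tmap_linear[OF q(1)] this[unfolded tens_in_def]]
        have "tmap q (\<delta> x) \<in> cvec.span (tmap q ` {a \<otimes> m |a m. a \<in> cvec.span S \<and> m \<in> UNIV})" .
        moreover have "tmap q ` {a \<otimes> m |a m. a \<in> cvec.span S \<and> m \<in> UNIV} \<subseteq> cvec.span ?P"
          using pure subsetD[OF q(2) rangeI] by (auto simp: tmap_ctens[OF q(1)])
        ultimately show "tmap q (\<delta> x) \<in> cvec.span ?P"
          using cvec.span_minimal[OF _ cvec.subspace_span] by blast
      qed
    qed
  qed
qed

end

section \<open>Graded vector spaces\<close>

definition dproj :: "('i \<Rightarrow> 'w::complex_vector set) \<Rightarrow> 'i \<Rightarrow> 'w \<Rightarrow> 'w"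
  where "dproj V i w = (THE f. decomposes UNIV V w f) i"

lemma decomposes_add:
  assumes V: "\<And>i. cvec.subspace (V i)" and f: "decomposes UNIV V x f" and g: "decomposes UNIV V y g"
  shows "decomposes UNIV V (x + y) (\<lambda>i. f i + g i)"
proof -
  have fin: "finite {i. f i \<noteq> 0}" "finite {i. g i \<noteq> 0}"
    using f g by (auto simp: decomposes_def)
  let ?S = "{i. f i \<noteq> 0} \<union> {i. g i \<noteq> 0}"
  have "x = (\<Sum>i\<in>?S. f i)" "y = (\<Sum>i\<in>?S. g i)"
    using f g fin by (auto simp: decomposes_def intro!: sum.mono_neutral_left)
  then have "x + y = (\<Sum>i\<in>?S. f i + g i)" by (simp add: sum.distrib)
  also have "\<dots> = (\<Sum>i | f i + g i \<noteq> 0. f i + g i)"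
    using fin by (intro sum.mono_neutral_right) auto
  finally have "x + y = (\<Sum>i | f i + g i \<noteq> 0. f i + g i)" .
  moreover have "finite {i. f i + g i \<noteq> 0}"
    by (rule finite_subset[of _ ?S]) (use fin in auto)
  ultimately show ?thesis
    using f g V by (auto simp: decomposes_def intro: cvec.subspace_add)
qed

lemma decomposes_scale:
  assumes V: "\<And>i. cvec.subspace (V i)" and f: "decomposes UNIV V x f"
  shows "decomposes UNIV V (c *\<^sub>C x) (\<lambda>i. c *\<^sub>C f i)"
proof (cases "c = 0")
  case True
  then show ?thesis using V by (auto simp: decomposes_def cvec.subspace_0)
next
  case False
  then show ?thesis using f V
    by (auto simp: decomposes_def cvec.scale_sum_right[symmetric] intro: cvec.subspace_scale)
qed

lemma decomposes_single:
  assumes "\<And>i. cvec.subspace (V i)" and "x \<in> V i"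
  shows "decomposes UNIV V x (\<lambda>j. if j = i then x else 0)"
proof -
  have "{j. (if j = i then x else 0) \<noteq> 0} = (if x = 0 then {} else {i})" by auto
  then show ?thesis
    using assms by (auto simp: decomposes_def cvec.subspace_0)
qed

lemma is_direct_sumI:
  assumes V: "\<And>i. cvec.subspace (V i)" and ex: "\<And>x. \<exists>f. decomposes UNIV V x f"
    and ind: "\<And>f i. decomposes UNIV V 0 f \<Longrightarrow> f i = 0"
  shows "is_direct_sum UNIV V UNIV"
proof -
  have unique: "f = g" if f: "decomposes UNIV V x f" and g: "decomposes UNIV V x g" for x f g
  proof
    fix i
    have "decomposes UNIV V (x + (-1) *\<^sub>C x) (\<lambda>i. f i + (-1) *\<^sub>C g i)"
      by (intro decomposes_add[OF V f] decomposes_scale[OF V g])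
    then have "decomposes UNIV V 0 (\<lambda>i. f i + (-1) *\<^sub>C g i)" by simp
    from ind[OF this, of i] show "f i = g i" by simp
  qed
  show ?thesis
    unfolding is_direct_sum_def
  proof (intro conjI ballI)
    show "\<exists>!f. decomposes UNIV V x f" for x
      using ex[of x] unique[of x] by (intro ex_ex1I)
  qed (use V ex in simp_all)
qed

context
  fixes V :: "'i \<Rightarrow> 'w::complex_vector set"
  assumes V: "is_direct_sum UNIV V UNIV"
begin

lemma graded_subspace: "cvec.subspace (V i)"
  using V by (simp add: is_direct_sum_def)

lemma decomposes_dproj: "decomposes UNIV V w (\<lambda>i. dproj V i w)"
proof -
  have "\<exists>!f. decomposes UNIV V w f" using V by (simp add: is_direct_sum_def)
  from theI'[OF this] show ?thesis by (simp add: dproj_def)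
qed

lemma dproj_unique:
  assumes "decomposes UNIV V w f"
  shows "dproj V i w = f i"
proof -
  have "\<exists>!g. decomposes UNIV V w g" using V by (simp add: is_direct_sum_def)
  then obtain g where "decomposes UNIV V w g" and g: "\<forall>h. decomposes UNIV V w h \<longrightarrow> h = g"
    by (elim ex1E)
  have "(\<lambda>i. dproj V i w) = f"
    using g[rule_format, OF decomposes_dproj] g[rule_format, OF assms] by (simp only:)
  then show ?thesis by (simp add: fun_eq_iff)
qed

lemma dproj_in: "dproj V i w \<in> V i"
  and finite_dproj: "finite {i. dproj V i w \<noteq> 0}"
  and sum_dproj: "(\<Sum>i | dproj V i w \<noteq> 0. dproj V i w) = w"
  using decomposes_dproj[of w] by (auto simp: decomposes_def)

lemma dproj_linear: "clinear (dproj V i)"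
  by (rule clinearI) (auto intro!: dproj_unique decomposes_add decomposes_scale graded_subspace decomposes_dproj)

lemma dproj_homogeneous: "w \<in> V i \<Longrightarrow> dproj V j w = (if j = i then w else 0)"
  by (rule dproj_unique[OF decomposes_single[OF graded_subspace]])

lemma dproj_other: "w \<in> V i \<Longrightarrow> j \<noteq> i \<Longrightarrow> dproj V j w = 0"
  by (simp add: dproj_homogeneous)

lemma graded_induct:
  assumes "\<And>i w. w \<in> V i \<Longrightarrow> P w" and "\<And>x y. P x \<Longrightarrow> P y \<Longrightarrow> P (x + y)"
  shows "P w"
proof -
  have z: "P 0" by (rule assms(1)[of _ undefined]) (rule cvec.subspace_0[OF graded_subspace])
  have "P (\<Sum>i\<in>S. dproj V i w)" if "finite S" for S
    using that by induction (auto simp: z intro: assms(2) assms(1)[OF dproj_in])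
  from this[OF finite_dproj[of w]] show ?thesis by (simp add: sum_dproj)
qed

lemma dproj_commute:
  assumes N: "clinear N" and pres: "\<And>i w. w \<in> V i \<Longrightarrow> N w \<in> V i"
  shows "dproj V i (N w) = N (dproj V i w)"
proof (induction w rule: graded_induct)
  case (1 j w)
  show ?case
    using dproj_homogeneous[OF 1, of i] dproj_homogeneous[OF pres[OF 1], of i] by (simp add: clinear_zero[OF N])
next
  case (2 x y)
  then show ?case by (simp add: clinear_add[OF N] clinear_add[OF dproj_linear])
qed

end

section \<open>Lefschetz decomposition and the Hodge map\<close>

context complex_structure
begin

lemma form_part_dproj: "form_part X k w = dproj (Forms X) k w"
  by (simp add: form_part_def dproj_def)

lemma biform_form: "w \<in> BiForms X (a, b) \<Longrightarrow> w \<in> Forms X (a + b)"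
proof -
  assume w: "w \<in> BiForms X (a, b)"
  let ?f = "\<lambda>j. if j = (a, b) then w else 0"
  have "{j. ?f j \<noteq> 0} = (if w = 0 then {} else {(a, b)})" by auto
  then have "decomposes {(c, e). c + e = a + b} (BiForms X) w ?f"
    using w biforms_direct_sum[of "a + b"]
    by (auto simp: decomposes_def is_direct_sum_def intro: cvec.subspace_0)
  then show ?thesis using biforms_direct_sum[of "a + b"] by (auto simp: is_direct_sum_def)
qed

lemma biforms_subspace: "cvec.subspace (BiForms X ab)"
  using biforms_direct_sum[of "fst ab + snd ab"] by (cases ab) (auto simp: is_direct_sum_def)

lemma decomposes_biforms:
  assumes "w \<in> Forms X k"
  obtains f where "decomposes UNIV (BiForms X) w f" "\<And>a b. a + b \<noteq> k \<Longrightarrow> f (a, b) = 0"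
proof -
  obtain f where "decomposes {(a, b). a + b = k} (BiForms X) w f"
    using assms biforms_direct_sum[of k] by (auto simp: is_direct_sum_def)
  then have "decomposes UNIV (BiForms X) w f" "\<forall>a b. a + b \<noteq> k \<longrightarrow> f (a, b) = 0"
    using cvec.subspace_0[OF biforms_subspace] unfolding decomposes_def by auto metis
  then show ?thesis using that by blast
qed

text \<open>The grading by bidegree refines the one by degree.  In a vanishing sum of bihomogeneous forms the parts \<open>F k\<close> of
  each total degree vanish, and then the forms of the bidegrees with this total degree.\<close>

lemma biforms_graded: "is_direct_sum UNIV (BiForms X) UNIV"
proof (rule is_direct_sumI[OF biforms_subspace])
  show "\<exists>f. decomposes UNIV (BiForms X) w f" for w
  proof (induction w rule: graded_induct[OF forms_direct_sum])
    case (1 k w)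
    then show ?case using decomposes_biforms by metis
  next
    case (2 x y)
    then obtain f g where "decomposes UNIV (BiForms X) x f" "decomposes UNIV (BiForms X) y g"
      by (elim exE)
    then show ?case
      by (intro exI[of _ "\<lambda>i. f i + g i"] decomposes_add biforms_subspace)
  qed
next
  fix f and i :: "nat \<times> nat"
  assume f: "decomposes UNIV (BiForms X) 0 f"
  then have fin: "finite {i. f i \<noteq> 0}" and fi: "\<And>i. f i \<in> BiForms X i" by (auto simp: decomposes_def)
  define F where "F k = (\<Sum>i | f i \<noteq> 0 \<and> fst i + snd i = k. f i)" for k
  have F_in: "F k \<in> Forms X k" for k
    unfolding F_def using fi biform_form
    by (intro cvec.subspace_sum[OF graded_subspace[OF forms_direct_sum]]) (metis (mono_tags, lifting) mem_Collect_eq prod.collapse)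
  let ?K = "(\<lambda>i. fst i + snd i) ` {i. f i \<noteq> 0}"
  have F0: "F k = 0" if "k \<notin> ?K" for k
  proof -
    have "{i. f i \<noteq> 0 \<and> fst i + snd i = k} = {}" using that by force
    then show ?thesis by (simp only: F_def sum.empty)
  qed
  have "(\<Sum>k\<in>?K. F k) = (\<Sum>i | f i \<noteq> 0. f i)"
    unfolding F_def using sum.group[OF fin finite_imageI[OF fin] order_refl, of f "\<lambda>i. fst i + snd i"]
    by (simp add: Collect_conj_eq)
  then have "(\<Sum>k\<in>?K. F k) = 0" using f by (simp add: decomposes_def)
  moreover have "(\<Sum>k\<in>?K. F k) = (\<Sum>k | F k \<noteq> 0. F k)"
    using fin F0 by (intro sum.mono_neutral_right) auto
  moreover have "finite {k. F k \<noteq> 0}"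
    by (rule finite_subset[OF _ finite_imageI[OF fin, of "\<lambda>i. fst i + snd i"]]) (use F0 in blast)
  ultimately have "decomposes UNIV (Forms X) 0 F"
    using F_in by (simp add: decomposes_def)
  then have F: "F k = 0" for k
    using dproj_unique[OF forms_direct_sum, of 0 F k] by (simp add: clinear_zero[OF dproj_linear[OF forms_direct_sum]])
  define k where "k = fst i + snd i"
  let ?I = "{(a :: nat, b :: nat). a + b = k}"
  define g where "g j = (if j \<in> ?I then f j else 0)" for j
  have "{j. g j \<noteq> 0} = {j. f j \<noteq> 0 \<and> fst j + snd j = k}" by (auto simp: g_def)
  then have "(\<Sum>j | g j \<noteq> 0. g j) = F k" unfolding F_def by (intro sum.cong) (auto simp: g_def)
  moreover have "finite {j. g j \<noteq> 0}"
    by (rule finite_subset[OF _ fin]) (auto simp: g_def)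
  ultimately have "decomposes ?I (BiForms X) 0 g"
    using fi F by (auto simp: decomposes_def g_def)
  moreover have "decomposes ?I (BiForms X) 0 (\<lambda>_. 0)"
    using cvec.subspace_0[OF biforms_subspace] by (simp add: decomposes_def)
  moreover have "0 \<in> Forms X k" by (rule cvec.subspace_0[OF graded_subspace[OF forms_direct_sum]])
  ultimately have "g = (\<lambda>_. 0)"
    using biforms_direct_sum[of k] unfolding is_direct_sum_def by blast
  then have "g i = 0" by simp
  then show "f i = 0" by (auto simp: g_def k_def split_def split: if_splits)
qed

lemmas biforms_induct = graded_induct[OF biforms_graded]

lemma dproj_biforms_form:
  assumes "w \<in> Forms X k" "a + b \<noteq> k"
  shows "dproj (BiForms X) (a, b) w = 0"
  using decomposes_biforms[OF assms(1)] dproj_unique[OF biforms_graded] assms(2) by metis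

lemma form_induct:
  assumes w: "w \<in> Forms X k" and "\<And>a b w. a + b = k \<Longrightarrow> w \<in> BiForms X (a, b) \<Longrightarrow> P w"
    and "P 0" and "\<And>x y. P x \<Longrightarrow> P y \<Longrightarrow> P (x + y)"
  shows "P w"
proof -
  have piece: "P (dproj (BiForms X) i w)" for i
    using assms(2)[of "fst i" "snd i" "dproj (BiForms X) i w"] dproj_in[OF biforms_graded, of i w]
      dproj_biforms_form[OF w, of "fst i" "snd i"] assms(3) by (cases "fst i + snd i = k") auto
  have "P (\<Sum>i\<in>S. dproj (BiForms X) i w)" if "finite S" for S
    using that by induction (simp_all add: assms(3,4) piece)
  from this[OF finite_dproj[OF biforms_graded, of w]] show ?thesis
    by (simp add: sum_dproj[OF biforms_graded])
qed

end

context hermitian_structure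
begin

abbreviation L where "L \<equiv> lefschetz X"
abbreviation n where "n \<equiv> halfdeg X"
abbreviation bp where "bp \<equiv> dproj (BiForms X)"

lemmas forms_subspace = graded_subspace[OF forms_direct_sum]

lemma L_linear: "clinear L"
  by (rule clinearI) (simp_all add: lefschetz_def distrib_left mult_scaleC_right)

lemma Lpow_linear: "clinear (L ^^ j)"
  by (induction j) (simp_all add: clinear_iff clinear_add[OF L_linear] clinear_scale[OF L_linear])

lemma Lpow_biform: "w \<in> BiForms X (a, b) \<Longrightarrow> (L ^^ j) w \<in> BiForms X (a + j, b + j)"
proof (induction j)
  case (Suc j)
  then show ?case using biforms_mult[OF herm_degree] by (simp add: lefschetz_def)
qed simp

lemma forms_above: "k > 2 * n \<Longrightarrow> w \<in> Forms X k \<Longrightarrow> w = 0"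
  using total_degree by (auto simp: has_total_degree_def)

lemma Lpow_add: "(L ^^ i) ((L ^^ j) w) = (L ^^ (i + j)) w"
  by (simp add: funpow_add)

lemma hard_lefschetz_inj:
  assumes "k \<le> n" "w \<in> Forms X k" "(L ^^ (n - k)) w = 0"
  shows "w = 0"
proof (cases "k = n")
  case False
  then have "inj_on (L ^^ (n - k)) (Forms X k)"
    using assms(1) lefschetz_iso[of k] by (simp add: bij_betw_def)
  then show ?thesis
    using assms(2,3) cvec.subspace_0[OF forms_subspace, of k] clinear_zero[OF Lpow_linear]
    by (metis inj_onD)
qed (use assms(3) in simp)

lemma hard_lefschetz_surj:
  assumes "k \<le> n" "v \<in> Forms X (2 * n - k)"
  obtains w where "w \<in> Forms X k" "(L ^^ (n - k)) w = v"
proof (cases "k = n")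
  case False
  then have "v \<in> (L ^^ (n - k)) ` Forms X k"
    using assms lefschetz_iso[of k] by (simp add: bij_betw_def)
  then show ?thesis using that by auto
qed (use assms(2) that in auto)

lemma bp_Lpow:
  "bp (c, e) ((L ^^ j) w) = (if j \<le> c \<and> j \<le> e then (L ^^ j) (bp (c - j, e - j) w) else 0)"
proof (induction w rule: biforms_induct)
  case (1 i w)
  obtain a b where i: "i = (a, b)" by fastforce
  note h = dproj_homogeneous[OF biforms_graded 1] dproj_homogeneous[OF biforms_graded Lpow_biform[OF 1[unfolded i]]]
  show ?case unfolding h i by (auto simp: clinear_zero[OF Lpow_linear])
next
  case (2 x y)
  then show ?case
    by (simp add: clinear_add[OF Lpow_linear] clinear_add[OF dproj_linear[OF biforms_graded]])
qed

definition prim where "prim a b = primitive X (a + b) \<inter> BiForms X (a, b)"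

lemma prim_iff: "w \<in> prim a b \<longleftrightarrow> w \<in> BiForms X (a, b) \<and>
    (if a + b \<le> n then (L ^^ (n - (a + b) + 1)) w = 0 else w = 0)"
  using biform_form[of w a b] by (auto simp: prim_def primitive_def)

lemma prim_subspace: "cvec.subspace (prim a b)"
  by (rule cvec.subspaceI)
    (auto simp: prim_iff clinear_zero[OF Lpow_linear] clinear_add[OF Lpow_linear] clinear_scale[OF Lpow_linear]
      cvec.subspace_0[OF biforms_subspace] cvec.subspace_add[OF biforms_subspace]
      cvec.subspace_scale[OF biforms_subspace] simp del: funpow.simps)

lemma prim_killed:
  assumes "w \<in> prim a b" "a + b \<le> n" "j > n - (a + b)"
  shows "(L ^^ j) w = 0"
proof -
  have "(L ^^ j) w = (L ^^ (j - (n - (a + b) + 1))) ((L ^^ (n - (a + b) + 1)) w)"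
    using assms(3) by (simp only: Lpow_add) simp
  also have "(L ^^ (n - (a + b) + 1)) w = 0" using assms(1,2) unfolding prim_iff by simp
  finally show ?thesis by (simp add: clinear_zero[OF Lpow_linear])
qed

text \<open>The power \<open>L\<^sup>n\<^sup>-\<^sup>k\<close> is injective in degree \<open>k\<close>, hence so are the lower powers.\<close>

lemma prim_inj:
  assumes "w \<in> prim a b" "j + (a + b) \<le> n" "(L ^^ j) w = 0"
  shows "w = 0"
proof -
  have "(L ^^ (n - (a + b))) w = (L ^^ (n - (a + b) - j)) ((L ^^ j) w)"
    using assms(2) by (simp add: Lpow_add)
  then have z: "(L ^^ (n - (a + b))) w = 0" by (simp add: assms(3) clinear_zero[OF Lpow_linear])
  have "w \<in> BiForms X (a, b)" using assms(1) by (simp add: prim_def)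
  from hard_lefschetz_inj[OF _ biform_form[OF this] z] show ?thesis using assms(2) by simp
qed

text \<open>For \<open>w\<close> of degree \<open>k = a + b\<close> the form \<open>L\<^sup>n\<^sup>-\<^sup>k\<^sup>+\<^sup>1 w\<close> has degree \<open>2n - (k - 2)\<close>, so by the hard Lefschetz property it is
  \<open>L\<^sup>n\<^sup>-\<^sup>k\<^sup>+\<^sup>2 \<beta>\<close> for some \<open>\<beta>\<close> of degree \<open>k - 2\<close>, which may be taken bihomogeneous.  Then \<open>w - L \<beta>\<close> is primitive.\<close>

lemma lefschetz_step:
  assumes w: "w \<in> BiForms X (a, b)" and ab: "a + b \<le> n"
  obtains \<alpha> where "\<alpha> \<in> prim a b" "\<alpha> = w"
  | \<alpha> a' b' \<beta> where "\<alpha> \<in> prim a b" "a = Suc a'" "b = Suc b'" "\<beta> \<in> BiForms X (a', b')" "w = \<alpha> + L \<beta>"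
proof -
  define m where "m = n - (a + b)"
  define v where "v = (L ^^ (m + 1)) w"
  have v: "v \<in> BiForms X (a + (m + 1), b + (m + 1))" unfolding v_def by (rule Lpow_biform[OF w])
  show ?thesis
  proof (cases "v = 0")
    case True
    then have "w \<in> prim a b" using w ab by (simp add: prim_iff v_def m_def del: funpow.simps)
    then show ?thesis using that(1) by blast
  next
    case False
    then have k: "a + b \<ge> 2"
      using forms_above[OF _ biform_form[OF v]] ab by (force simp: m_def)
    have "a + (m + 1) + (b + (m + 1)) = 2 * n - (a + b - 2)" using k ab by (simp add: m_def)
    then have "v \<in> Forms X (2 * n - (a + b - 2))" using biform_form[OF v] by simp
    then obtain \<gamma> where \<gamma>: "\<gamma> \<in> Forms X (a + b - 2)" "(L ^^ (n - (a + b - 2))) \<gamma> = v"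
      using ab by (rule_tac hard_lefschetz_surj[of "a + b - 2" v]) auto
    have e: "n - (a + b - 2) = m + 2" using k ab by (simp add: m_def)
    have "v = bp (a + (m + 1), b + (m + 1)) ((L ^^ (m + 2)) \<gamma>)"
      using dproj_homogeneous[OF biforms_graded v] \<gamma>(2) by (simp add: e)
    then have *: "a \<ge> 1 \<and> b \<ge> 1 \<and> v = (L ^^ (m + 2)) (bp (a - 1, b - 1) \<gamma>)"
      using False unfolding bp_Lpow by (simp split: if_splits)
    define \<beta> where "\<beta> = bp (a - 1, b - 1) \<gamma>"
    have \<beta>: "\<beta> \<in> BiForms X (a - 1, b - 1)" unfolding \<beta>_def by (rule dproj_in[OF biforms_graded])
    have L\<beta>: "L \<beta> \<in> BiForms X (a, b)" using Lpow_biform[OF \<beta>, of 1] * by simp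
    have "(L ^^ (m + 1)) (w - L \<beta>) = v - (L ^^ (m + 1)) ((L ^^ 1) \<beta>)"
      by (simp only: clinear_diff[OF Lpow_linear] v_def) simp
    also have "\<dots> = 0" using * unfolding Lpow_add \<beta>_def by simp
    finally have "w - L \<beta> \<in> prim a b"
      using ab w L\<beta> by (simp add: prim_iff m_def cvec.subspace_diff[OF biforms_subspace] del: funpow.simps)
    moreover have "w = (w - L \<beta>) + L \<beta>" by simp
    moreover have "a = Suc (a - 1)" "b = Suc (b - 1)" using * by auto
    ultimately show ?thesis using that(2)[of "w - L \<beta>" "a - 1" "b - 1" \<beta>] \<beta> by blast
  qed
qed

text \<open>Iterating the preceding step decomposes the forms of degree at most \<open>n\<close>, and by the hard Lefschetz property those of
  higher degree are powers of \<open>L\<close> applied to them.\<close>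

lemma lefschetz_span:
  "w \<in> cvec.span {(L ^^ j) \<alpha> |j \<alpha> a b. \<alpha> \<in> prim a b \<and> j + (a + b) \<le> n}"
  (is "w \<in> cvec.span ?S")
proof -
  let ?T = "{(L ^^ j) \<alpha> |j \<alpha> a b. \<alpha> \<in> prim a b \<and> a + b \<le> n}"
  have TS: "cvec.span ?T \<subseteq> cvec.span ?S"
  proof (rule cvec.span_minimal[OF _ cvec.subspace_span], clarify)
    fix j \<alpha> a b assume \<alpha>: "\<alpha> \<in> prim a b" "a + b \<le> n"
    then show "(L ^^ j) \<alpha> \<in> cvec.span ?S"
    proof (cases "j + (a + b) \<le> n")
      case False
      then have "(L ^^ j) \<alpha> = 0" using \<alpha> by (intro prim_killed) auto
      then show ?thesis by (simp add: cvec.span_zero)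
    qed (intro cvec.span_base, blast)
  qed
  have LT: "L x \<in> cvec.span ?T" if "x \<in> cvec.span ?T" for x
  proof -
    have "L ` ?T \<subseteq> ?T"
    proof clarify
      fix j \<alpha> a b assume "\<alpha> \<in> prim a b" "a + b \<le> n"
      moreover have "L ((L ^^ j) \<alpha>) = (L ^^ Suc j) \<alpha>" by simp
      ultimately show "\<exists>j' \<alpha>' a b. L ((L ^^ j) \<alpha>) = (L ^^ j') \<alpha>' \<and> \<alpha>' \<in> prim a b \<and> a + b \<le> n" by blast
    qed
    then show ?thesis
      using clinear_span_image[OF L_linear that] cvec.span_mono by blast
  qed
  have LjT: "(L ^^ j) x \<in> cvec.span ?T" if "x \<in> cvec.span ?T" for x j
  proof (induction j)
    case 0
    show ?case unfolding funpow.simps(1) id_apply by (rule that)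
  next
    case (Suc j)
    show ?case unfolding funpow.simps(2) comp_apply by (rule LT[OF Suc.IH])
  qed
  have prim_T: "\<alpha> \<in> cvec.span ?T" if "\<alpha> \<in> prim a b" "a + b \<le> n" for \<alpha> a b
  proof (rule cvec.span_base)
    have "\<alpha> = (L ^^ 0) \<alpha>" by simp
    then show "\<alpha> \<in> ?T" using that by blast
  qed
  have low: "w \<in> cvec.span ?T" if "w \<in> BiForms X (a, b)" "a + b \<le> n" for w a b
    using that
  proof (induction a arbitrary: b w)
    case 0
    from 0 have "w \<in> prim 0 b" by (cases rule: lefschetz_step) auto
    then show ?case by (rule prim_T[OF _ 0(2)])
  next
    case (Suc a)
    from Suc.prems show ?case
    proof (cases rule: lefschetz_step)
      case (1 \<alpha>)
      from prim_T[OF 1(1) Suc.prems(2)] show ?thesis unfolding 1(2) .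
    next
      case (2 \<alpha> a' b' \<beta>)
      from 2(2-4) have \<beta>: "\<beta> \<in> BiForms X (a, b')" by simp
      have "a + b' \<le> n" using 2(2,3) Suc.prems(2) by simp
      from cvec.span_add[OF prim_T[OF 2(1) Suc.prems(2)] LT[OF Suc.IH[OF \<beta> this]]]
      show ?thesis unfolding 2(5) .
    qed
  qed
  have lowk: "w \<in> cvec.span ?T" if "w \<in> Forms X k" "k \<le> n" for w k
    using that(1)
  proof (rule form_induct)
    show "w \<in> cvec.span ?T" if "a + b = k" "w \<in> BiForms X (a, b)" for a b w
      using low[OF that(2)] that(1) \<open>k \<le> n\<close> by blast
  qed (rule cvec.span_zero, rule cvec.span_add)
  have "w \<in> cvec.span ?T"
  proof (induction w rule: graded_induct[OF forms_direct_sum])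
    case (1 k w)
    consider "k \<le> n" | "n < k" "k \<le> 2 * n" | "k > 2 * n" by linarith
    then show ?case
    proof cases
      case 2
      then have "w \<in> Forms X (2 * n - (2 * n - k))" using 1 by simp
      then obtain u where "u \<in> Forms X (2 * n - k)" "(L ^^ (n - (2 * n - k))) u = w"
        using 2 by (rule_tac hard_lefschetz_surj[of "2 * n - k" w]) auto
      moreover have "2 * n - k \<le> n" using 2 by simp
      ultimately show ?thesis using LjT lowk by blast
    next
      case 1
      from lowk[OF \<open>w \<in> Forms X k\<close> 1] show ?thesis .
    next
      case 3
      from forms_above[OF 3 \<open>w \<in> Forms X k\<close>] show ?thesis by (simp only: cvec.span_zero)
    qed
  next
    case (2 x y)
    then show ?case by (rule cvec.span_add)
  qed
  then show ?thesis using TS by blast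
qed

lemma lefschetz_induct [case_names primitive add scale]:
  assumes "\<And>j \<alpha> a b. \<alpha> \<in> prim a b \<Longrightarrow> j + (a + b) \<le> n \<Longrightarrow> P ((L ^^ j) \<alpha>)"
    and "\<And>x y. P x \<Longrightarrow> P y \<Longrightarrow> P (x + y)" and "\<And>c x. P x \<Longrightarrow> P (c *\<^sub>C x)"
  shows "P w"
  using lefschetz_span[of w]
proof (induction rule: cvec.span_induct_alt)
  case base
  have "0 \<in> prim 0 0" by (rule cvec.subspace_0[OF prim_subspace])
  from assms(1)[OF this, of 0] show ?case by simp
next
  case (step c x y)
  then show ?case using assms by blast
qed

end

lemma sign_scale: "(-1) ^ k * x = ((-1) ^ k :: complex) *\<^sub>C (x :: 'a::complex_algebra_1)"
  by (cases "even k") (simp_all add: cvec.scale_minus_left)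

context complex_structure
begin

lemma emb_linear: "clinear (emb X)"
  and emb_one: "emb X 1 = 1"
  and emb_mult: "emb X (b * c) = emb X b * emb X c"
  using emb_algebra_map by (auto simp: algebra_map_def)

lemma emb_biform: "emb X b \<in> BiForms X (0, 0)"
proof -
  have "emb X b \<in> Forms X 0" using forms_zero by blast
  then show ?thesis
    by (rule form_induct)
      (auto intro: cvec.subspace_0[OF biforms_subspace] cvec.subspace_add[OF biforms_subspace])
qed

lemma emb_form: "emb X b \<in> Forms X 0"
  using forms_zero by blast

lemma biforms_emb_right: "w \<in> BiForms X ab \<Longrightarrow> w * emb X b \<in> BiForms X ab"
  and biforms_emb_left: "w \<in> BiForms X ab \<Longrightarrow> emb X b * w \<in> BiForms X ab"
  using biforms_mult[OF _ emb_biform, of w "fst ab" "snd ab" b] biforms_mult[OF emb_biform, of w "fst ab" "snd ab" b]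
  by auto

text \<open>The component of bidegree \<open>(a, c + 1)\<close> in the Leibniz rule for \<open>d\<close>, for \<open>w\<close> of bidegree \<open>(a, c)\<close>.\<close>

lemma delbar_leibniz:
  assumes "w \<in> Forms X k"
  shows "delbar X (w * emb X b) = delbar X w * emb X b + (-1) ^ k * (w * delbar X (emb X b))"
  using assms
proof (rule form_induct)
  fix a c w assume ac: "a + c = k" and w: "w \<in> BiForms X (a, c)"
  let ?p = "dproj (BiForms X) (a, c + 1)"
  note hom = dproj_homogeneous[OF biforms_graded]
  note lin = clinear_add[OF dproj_linear[OF biforms_graded]]
  have wf: "w \<in> Forms X k" using biform_form[OF w] ac by simp
  have m: "(-1) ^ k * (w * delbar X (emb X b)) \<in> BiForms X (a, c + 1)"
    "(-1) ^ k * (w * del X (emb X b)) \<in> BiForms X (a + 1, c)"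
    unfolding sign_scale
    using biforms_mult[OF w delbar_degree[OF emb_biform]] biforms_mult[OF w del_degree[OF emb_biform]]
    by (auto intro: cvec.subspace_scale[OF biforms_subspace])
  have "del X (w * emb X b) + delbar X (w * emb X b) =
      (del X w * emb X b + (-1) ^ k * (w * del X (emb X b))) +
      (delbar X w * emb X b + (-1) ^ k * (w * delbar X (emb X b)))"
    using diff_leibniz[OF wf, of "emb X b"] unfolding diff_eq by (simp add: algebra_simps)
  from arg_cong[OF this, of ?p] show
    "delbar X (w * emb X b) = delbar X w * emb X b + (-1) ^ k * (w * delbar X (emb X b))"
    using hom[OF del_degree[OF biforms_emb_right[OF w]]] hom[OF delbar_degree[OF biforms_emb_right[OF w]]]
      hom[OF biforms_emb_right[OF del_degree[OF w]]] hom[OF biforms_emb_right[OF delbar_degree[OF w]]]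
      hom[OF m(1)] hom[OF m(2)]
    by (simp add: lin)
qed (simp_all add: clinear_zero[OF delbar_linear] clinear_add[OF delbar_linear] distrib_left distrib_right algebra_simps)

lemma wstar_form: "w \<in> Forms X k \<Longrightarrow> wstar X w \<in> Forms X k"
proof (erule form_induct)
  fix a b w assume "a + b = k" "w \<in> BiForms X (a, b)"
  then have "wstar X w \<in> BiForms X (b, a)" using biforms_wstar[of a b] by blast
  then show "wstar X w \<in> Forms X k" using biform_form \<open>a + b = k\<close> by (metis add.commute)
next
  have "wstar X 0 = 0" using wstar_scaleC[of 0 0] by simp
  then show "wstar X 0 \<in> Forms X k"
    using cvec.subspace_0[OF graded_subspace[OF forms_direct_sum]] by simp
qed (auto simp: wstar_add intro: cvec.subspace_add[OF graded_subspace[OF forms_direct_sum]])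

lemma wstar_slin: "slin cnj (wstar X)"
  by (simp add: slin_def wstar_add wstar_scaleC)

end

subsection \<open>Existence of the Hodge map\<close>

context hermitian_structure
begin

text \<open>The summands of the Lefschetz decomposition; they are set to zero for the indices where \<open>L\<^sup>j\<close> vanishes on primitive
  forms of bidegree \<open>(a, b)\<close> or there are no such forms.\<close>

definition lef :: "nat \<times> nat \<times> nat \<Rightarrow> 'w set"
  where "lef = (\<lambda>(a, b, j). if j + (a + b) \<le> n then (L ^^ j) ` prim a b else {0})"

lemma lef_iff: "x \<in> lef (a, b, j) \<longleftrightarrow> (if j + (a + b) \<le> n then \<exists>\<alpha>\<in>prim a b. x = (L ^^ j) \<alpha> else x = 0)"
  by (auto simp: lef_def)

lemma lef_subspace: "cvec.subspace (lef i)"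
proof -
  obtain a b j where i: "i = (a, b, j)" by (metis prod_cases3)
  show ?thesis
  proof (cases "j + (a + b) \<le> n")
    case True
    show ?thesis
    proof (rule cvec.subspaceI)
      show "0 \<in> lef i"
        using True cvec.subspace_0[OF prim_subspace] by (auto simp: i lef_iff clinear_zero[OF Lpow_linear] intro!: bexI[of _ 0])
      show "x + y \<in> lef i" if "x \<in> lef i" "y \<in> lef i" for x y
      proof -
        obtain \<alpha> \<beta> where "\<alpha> \<in> prim a b" "x = (L ^^ j) \<alpha>" "\<beta> \<in> prim a b" "y = (L ^^ j) \<beta>"
          using \<open>x \<in> lef i\<close> \<open>y \<in> lef i\<close> True by (auto simp: i lef_iff)
        then show ?thesis
          using True cvec.subspace_add[OF prim_subspace, of \<alpha> a b \<beta>]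
          by (auto simp: i lef_iff clinear_add[OF Lpow_linear] intro!: bexI[of _ "\<alpha> + \<beta>"])
      qed
      show "c *\<^sub>C x \<in> lef i" if "x \<in> lef i" for c x
      proof -
        obtain \<alpha> where "\<alpha> \<in> prim a b" "x = (L ^^ j) \<alpha>"
          using \<open>x \<in> lef i\<close> True by (auto simp: i lef_iff)
        then show ?thesis
          using True cvec.subspace_scale[OF prim_subspace, of \<alpha> a b c]
          by (auto simp: i lef_iff clinear_scale[OF Lpow_linear] intro!: bexI[of _ "c *\<^sub>C \<alpha>"])
      qed
    qed
  qed (simp add: i lef_def)
qed

lemma lef_biform: "x \<in> lef (a, b, j) \<Longrightarrow> x \<in> BiForms X (a + j, b + j)"
  using Lpow_biform cvec.subspace_0[OF biforms_subspace] by (auto simp: lef_iff prim_def split: if_splits)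

text \<open>Among the terms of one bidegree in a vanishing sum \<open>\<Sum> L\<^sup>j \<alpha>\<^sub>j\<close>, a suitable power of \<open>L\<close> kills all but the one
  with the largest \<open>j\<close>, and is still injective on it.\<close>

lemma lef_graded: "is_direct_sum UNIV lef UNIV"
proof (rule is_direct_sumI[OF lef_subspace])
  show "\<exists>f. decomposes UNIV lef w f" for w
  proof (induction w rule: lefschetz_induct)
    case (primitive j \<alpha> a b)
    then have "(L ^^ j) \<alpha> \<in> lef (a, b, j)" by (auto simp: lef_iff)
    then show ?case using decomposes_single[of lef, OF lef_subspace] by blast
  next
    case (add x y)
    then obtain f g where "decomposes UNIV lef x f" "decomposes UNIV lef y g" by (elim exE)
    then show ?case by (intro exI[of _ "\<lambda>i. f i + g i"] decomposes_add lef_subspace)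
  next
    case (scale c x)
    then obtain f where "decomposes UNIV lef x f" by (elim exE)
    then show ?case by (intro exI[of _ "\<lambda>i. c *\<^sub>C f i"] decomposes_scale lef_subspace)
  qed
next
  fix f and i :: "nat \<times> nat \<times> nat"
  assume f: "decomposes UNIV lef 0 f"
  then have fin: "finite {i. f i \<noteq> 0}" and fi: "\<And>i. f i \<in> lef i" and sum: "(\<Sum>i | f i \<noteq> 0. f i) = 0"
    by (auto simp: decomposes_def)
  show "f i = 0"
  proof (rule ccontr)
    assume "f i \<noteq> 0"
    then have ne: "{i. f i \<noteq> 0} \<noteq> {}" by blast
    let ?J = "(\<lambda>i. snd (snd i)) ` {i. f i \<noteq> 0}"
    have "Max ?J \<in> ?J" by (rule Max_in) (use fin ne in auto)
    then obtain i0 where i0: "f i0 \<noteq> 0" "snd (snd i0) = Max ?J" by force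
    obtain a b J where i0_eq: "i0 = (a, b, J)" by (metis prod_cases3)
    have max: "j \<le> J" if "f (a', b', j) \<noteq> 0" for a' b' j
    proof -
      have "j \<in> ?J" using that by force
      then have "j \<le> Max ?J" using fin by (intro Max_ge) auto
      then show ?thesis using i0(2) by (simp add: i0_eq)
    qed
    have J: "J + (a + b) \<le> n" using fi[of i0] i0(1) by (auto simp: i0_eq lef_iff split: if_splits)
    obtain \<alpha> where \<alpha>: "\<alpha> \<in> prim a b" "f i0 = (L ^^ J) \<alpha>" using fi[of i0] J by (auto simp: i0_eq lef_iff)
    define r where "r = n - (a + b + J)"
    let ?p = "bp (a + J, b + J)"
    have other: "(L ^^ r) (?p (f k)) = 0" if "k \<noteq> i0" for k
    proof (cases "f k = 0")
      case True
      then show ?thesis by (simp add: clinear_zero[OF dproj_linear[OF biforms_graded]] clinear_zero[OF Lpow_linear])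
    next
      case False
      obtain a' b' j where k: "k = (a', b', j)" by (metis prod_cases3)
      have fk: "f k \<in> BiForms X (a' + j, b' + j)" using lef_biform fi[of k] by (simp add: k)
      show ?thesis
      proof (cases "(a' + j, b' + j) = (a + J, b + J)")
        case True
        have "j < J" using max[of a' b' j] False that True by (cases "j = J") (auto simp: k i0_eq)
        have jn: "j + (a' + b') \<le> n" using fi[of k] False by (auto simp: k lef_iff split: if_splits)
        obtain \<beta> where \<beta>: "\<beta> \<in> prim a' b'" "f k = (L ^^ j) \<beta>" using fi[of k] jn by (auto simp: k lef_iff)
        have "(L ^^ (r + j)) \<beta> = 0"
          using True \<open>j < J\<close> J jn by (intro prim_killed[OF \<beta>(1)]) (auto simp: r_def)
        then have "(L ^^ r) (f k) = 0" by (simp only: \<beta>(2) Lpow_add)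
        moreover have "?p (f k) = f k" using dproj_homogeneous[OF biforms_graded fk] True by simp
        ultimately show ?thesis by simp
      next
        case False
        then have "?p (f k) = 0" using dproj_other[OF biforms_graded fk] by force
        then show ?thesis by (simp add: clinear_zero[OF Lpow_linear])
      qed
    qed
    have "0 = (L ^^ r) (?p (\<Sum>i | f i \<noteq> 0. f i))"
      by (simp add: sum clinear_zero[OF dproj_linear[OF biforms_graded]] clinear_zero[OF Lpow_linear])
    also have "\<dots> = (\<Sum>i | f i \<noteq> 0. (L ^^ r) (?p (f i)))"
      by (simp add: clinear_sum[OF dproj_linear[OF biforms_graded]] clinear_sum[OF Lpow_linear])
    also have "\<dots> = (L ^^ r) (?p (f i0))"
      using fin i0(1) other by (subst sum.remove[of _ i0]) (auto intro!: sum.neutral)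
    also have "?p (f i0) = f i0"
      using dproj_homogeneous[OF biforms_graded lef_biform[OF fi[of i0, unfolded i0_eq]]] by (simp add: i0_eq)
    also have "(L ^^ r) (f i0) = (L ^^ (n - (a + b))) \<alpha>"
      using J by (simp add: \<alpha>(2) Lpow_add r_def)
    finally have "\<alpha> = 0" using J by (intro prim_inj[OF \<alpha>(1), of "n - (a + b)"]) auto
    then show False using i0(1) \<alpha>(2) by (simp add: clinear_zero[OF Lpow_linear])
  qed
qed

text \<open>The factor in the definition of the Hodge map, with \<open>k = a + b\<close>.\<close>

definition hcoef :: "nat \<Rightarrow> nat \<Rightarrow> nat \<Rightarrow> complex"
  where "hcoef a b j = (-1) ^ ((a + b) * (a + b + 1) div 2) * \<i> powi (int a - int b)
          * fact j / fact (n - j - (a + b))"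

text \<open>The inverse of \<open>L\<^sup>j\<close> on a summand of the Lefschetz decomposition.\<close>

definition lroot :: "nat \<times> nat \<times> nat \<Rightarrow> 'w \<Rightarrow> 'w"
  where "lroot = (\<lambda>(a, b, j) v. THE \<alpha>. \<alpha> \<in> prim a b \<and> (L ^^ j) \<alpha> = v)"

lemma lroot: "\<alpha> \<in> prim a b \<Longrightarrow> j + (a + b) \<le> n \<Longrightarrow> lroot (a, b, j) ((L ^^ j) \<alpha>) = \<alpha>"
  unfolding lroot_def prod.case
proof (rule the_equality)
  assume a: "\<alpha> \<in> prim a b" "j + (a + b) \<le> n"
  fix \<beta> assume "\<beta> \<in> prim a b \<and> (L ^^ j) \<beta> = (L ^^ j) \<alpha>"
  then have "\<beta> - \<alpha> \<in> prim a b" "(L ^^ j) (\<beta> - \<alpha>) = 0"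
    using a by (auto simp: clinear_diff[OF Lpow_linear] intro: cvec.subspace_diff[OF prim_subspace])
  from prim_inj[OF this(1) a(2) this(2)] show "\<beta> = \<alpha>" by simp
qed simp

lemma lroot_add:
  assumes "x \<in> lef (a, b, j)" "y \<in> lef (a, b, j)" "j + (a + b) \<le> n"
  shows "lroot (a, b, j) (x + y) = lroot (a, b, j) x + lroot (a, b, j) y"
proof -
  obtain \<alpha> \<beta> where "\<alpha> \<in> prim a b" "x = (L ^^ j) \<alpha>" "\<beta> \<in> prim a b" "y = (L ^^ j) \<beta>"
    using assms by (auto simp: lef_iff)
  then show ?thesis
    using lroot[OF _ assms(3)] cvec.subspace_add[OF prim_subspace, of \<alpha> a b \<beta>]
    by (simp flip: clinear_add[OF Lpow_linear])
qed

lemma lroot_scale: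
  assumes "x \<in> lef (a, b, j)" "j + (a + b) \<le> n"
  shows "lroot (a, b, j) (c *\<^sub>C x) = c *\<^sub>C lroot (a, b, j) x"
proof -
  obtain \<alpha> where "\<alpha> \<in> prim a b" "x = (L ^^ j) \<alpha>" using assms by (auto simp: lef_iff)
  then show ?thesis
    using lroot[OF _ assms(2)] cvec.subspace_scale[OF prim_subspace, of \<alpha> a b c]
    by (simp flip: clinear_scale[OF Lpow_linear])
qed

lemma is_hodge_alt: "is_hodge X H \<longleftrightarrow> clinear H \<and>
    (\<forall>a b j \<alpha>. \<alpha> \<in> prim a b \<longrightarrow> j + (a + b) \<le> n \<longrightarrow> H ((L ^^ j) \<alpha>) = hcoef a b j *\<^sub>C (L ^^ (n - j - (a + b))) \<alpha>)"
  unfolding is_hodge_def prim_def hcoef_def by blast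

lemma hodge_exists: "\<exists>H. is_hodge X H"
proof -
  define I where "I = {(a, b, j). j + (a + b) \<le> n}"
  have "I \<subseteq> {..n} \<times> {..n} \<times> {..n}" by (auto simp: I_def)
  then have finI: "finite I" by (rule finite_subset) simp
  define c where "c i = (case i of (a, b, j) \<Rightarrow> hcoef a b j)" for i
  define e where "e i = (case i of (a, b, j) \<Rightarrow> n - j - (a + b))" for i
  define t where "t i w = c i *\<^sub>C (L ^^ e i) (lroot i (dproj lef i w))" for i w
  have t_add: "t i (x + y) = t i x + t i y" and t_scale: "t i (k *\<^sub>C x) = k *\<^sub>C t i x" if "i \<in> I" for i x y k
  proof -
    obtain a b j where i: "i = (a, b, j)" "j + (a + b) \<le> n" using \<open>i \<in> I\<close> by (auto simp: I_def)
    note d = dproj_in[OF lef_graded, of "(a, b, j)"]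
    show "t i (x + y) = t i x + t i y" "t i (k *\<^sub>C x) = k *\<^sub>C t i x"
      unfolding t_def i(1) clinear_add[OF dproj_linear[OF lef_graded]] clinear_scale[OF dproj_linear[OF lef_graded]]
        lroot_add[OF d d i(2)] lroot_scale[OF d i(2)] clinear_add[OF Lpow_linear] clinear_scale[OF Lpow_linear]
      by (simp_all add: scaleC_add_right scaleC_scaleC mult.commute)
  qed
  define H where "H w = (\<Sum>i\<in>I. t i w)" for w
  have "clinear H"
    by (rule clinearI) (simp_all add: H_def t_add t_scale sum.distrib cvec.scale_sum_right)
  moreover have "H ((L ^^ j) \<alpha>) = hcoef a b j *\<^sub>C (L ^^ (n - j - (a + b))) \<alpha>"
    if \<alpha>: "\<alpha> \<in> prim a b" and j: "j + (a + b) \<le> n" for a b j \<alpha>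
  proof -
    have mem: "(L ^^ j) \<alpha> \<in> lef (a, b, j)" using \<alpha> j by (auto simp: lef_iff)
    have "t i ((L ^^ j) \<alpha>) = 0" if "i \<in> I" "i \<noteq> (a, b, j)" for i
    proof -
      have "dproj lef i ((L ^^ j) \<alpha>) = 0" using dproj_other[OF lef_graded mem that(2)] .
      moreover obtain a' b' j' where i: "i = (a', b', j')" "j' + (a' + b') \<le> n"
        using \<open>i \<in> I\<close> by (auto simp: I_def)
      have "lroot i 0 = 0"
        using lroot[OF cvec.subspace_0[OF prim_subspace] i(2)] by (simp add: i(1) clinear_zero[OF Lpow_linear])
      ultimately show ?thesis by (simp add: t_def clinear_zero[OF Lpow_linear])
    qed
    then have "H ((L ^^ j) \<alpha>) = t (a, b, j) ((L ^^ j) \<alpha>)"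
      unfolding H_def using finI j by (subst sum.remove[of _ "(a, b, j)"]) (auto simp: I_def intro!: sum.neutral)
    also have "dproj lef (a, b, j) ((L ^^ j) \<alpha>) = (L ^^ j) \<alpha>"
      using dproj_homogeneous[OF lef_graded mem] by simp
    then have "t (a, b, j) ((L ^^ j) \<alpha>) = hcoef a b j *\<^sub>C (L ^^ (n - j - (a + b))) \<alpha>"
      by (simp add: t_def c_def e_def lroot[OF \<alpha> j])
    finally show ?thesis .
  qed
  ultimately show ?thesis unfolding is_hodge_alt by blast
qed

lemma hodge_unique:
  assumes "is_hodge X H" "is_hodge X H'"
  shows "H = H'"
proof
  fix w
  show "H w = H' w"
    using assms unfolding is_hodge_alt
    by (induction w rule: lefschetz_induct) (auto simp: clinear_add clinear_scale)
qed

lemma is_hodge_hodge: "is_hodge X (hodge X)"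
proof -
  obtain H where "is_hodge X H" using hodge_exists by (elim exE)
  then have "\<exists>!H. is_hodge X H" using hodge_unique by (intro ex1I[of _ H]) auto
  then show ?thesis unfolding hodge_def by (rule theI')
qed

lemma hodge_linear: "clinear (hodge X)"
  and hodge_Lpow: "\<alpha> \<in> prim a b \<Longrightarrow> j + (a + b) \<le> n \<Longrightarrow>
    hodge X ((L ^^ j) \<alpha>) = hcoef a b j *\<^sub>C (L ^^ (n - j - (a + b))) \<alpha>"
  using is_hodge_hodge unfolding is_hodge_alt by auto

text \<open>The Hodge map is determined by \<open>L\<close> and the bigrading.  This applies to multiplication by elements of \<open>B\<close> and to slices
  of the coaction.\<close>

lemma hodge_commute:
  assumes N: "clinear N" and NL: "\<And>w. N (L w) = L (N w)"
    and NB: "\<And>ab w. w \<in> BiForms X ab \<Longrightarrow> N w \<in> BiForms X ab"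
  shows "hodge X (N w) = N (hodge X w)"
proof (induction w rule: lefschetz_induct)
  case (primitive j \<alpha> a b)
  have NLj: "N ((L ^^ i) w) = (L ^^ i) (N w)" for i w
    by (induction i) (simp_all add: NL)
  have N\<alpha>: "N \<alpha> \<in> prim a b"
    using primitive(1) NB NLj[of "n - (a + b) + 1" \<alpha>] clinear_zero[OF N]
    by (auto simp: prim_iff simp del: funpow.simps split: if_splits)
  show ?case
    by (simp only: NLj hodge_Lpow[OF N\<alpha> primitive(2)] hodge_Lpow[OF primitive] clinear_scale[OF N])
next
  case (add x y)
  then show ?case by (simp add: clinear_add[OF N] clinear_add[OF hodge_linear])
next
  case (scale c x)
  then show ?case by (simp add: clinear_scale[OF N] clinear_scale[OF hodge_linear])
qed

text \<open>A form \<open>L\<^sup>j \<alpha>\<close> with \<open>\<alpha>\<close> primitive of bidegree \<open>(a, b)\<close> has bidegree \<open>(a + j, b + j)\<close>, where \<open>j + a + b \<le> n\<close>.\<close>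

lemma biforms_bounded:
  assumes "p > n \<or> q > n" "w \<in> BiForms X (p, q)"
  shows "w = 0"
proof -
  have "bp (p, q) x = 0" for x
  proof (induction x rule: lefschetz_induct)
    case (primitive j \<alpha> a b)
    then have "(L ^^ j) \<alpha> \<in> BiForms X (a + j, b + j)" by (intro Lpow_biform) (simp add: prim_def)
    from dproj_other[OF biforms_graded this] show ?case using primitive(2) assms(1) by force
  qed (simp_all add: clinear_add[OF dproj_linear[OF biforms_graded]] clinear_scale[OF dproj_linear[OF biforms_graded]])
  then show ?thesis using dproj_homogeneous[OF biforms_graded assms(2), of "(p, q)"] by simp
qed

text \<open>For \<open>\<alpha>\<close> primitive of bidegree \<open>(a, b)\<close> the form \<open>L\<^sup>j \<alpha>\<close> of bidegree \<open>(a + j, b + j)\<close> is sent to a multiple of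
  \<open>L\<^sup>n\<^sup>-\<^sup>j\<^sup>-\<^sup>a\<^sup>-\<^sup>b \<alpha>\<close>, of bidegree \<open>(n - j - b, n - j - a)\<close>.\<close>

lemma hodge_biform:
  assumes w: "w \<in> BiForms X (p, q)"
  shows "hodge X w \<in> BiForms X (n - q, n - p)"
proof (cases "p > n \<or> q > n")
  case True
  then show ?thesis
    using biforms_bounded[OF True w] cvec.subspace_0[OF biforms_subspace] by (simp add: clinear_zero[OF hodge_linear])
next
  case False
  have "hodge X (bp (p, q) x) \<in> BiForms X (n - q, n - p)" for x
  proof (induction x rule: lefschetz_induct)
    case (primitive j \<alpha> a b)
    have \<alpha>: "\<alpha> \<in> BiForms X (a, b)" using primitive by (simp add: prim_def)
    note h = dproj_homogeneous[OF biforms_graded Lpow_biform[OF \<alpha>, of j], of "(p, q)"]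
    show ?case
    proof (cases "(p, q) = (a + j, b + j)")
      case True
      have "(L ^^ (n - j - (a + b))) \<alpha> \<in> BiForms X (a + (n - j - (a + b)), b + (n - j - (a + b)))"
        by (rule Lpow_biform[OF \<alpha>])
      also have "(a + (n - j - (a + b)), b + (n - j - (a + b))) = (n - q, n - p)"
        using True primitive(2) by auto
      finally show ?thesis
        using h True primitive by (simp add: hodge_Lpow cvec.subspace_scale[OF biforms_subspace])
    next
      case False
      then have "bp (p, q) ((L ^^ j) \<alpha>) = 0" using h by auto
      then show ?thesis using cvec.subspace_0[OF biforms_subspace] by (simp add: clinear_zero[OF hodge_linear])
    qed
  qed (simp_all add: clinear_add[OF dproj_linear[OF biforms_graded]] clinear_scale[OF dproj_linear[OF biforms_graded]]
      clinear_add[OF hodge_linear] clinear_scale[OF hodge_linear] cvec.subspace_add[OF biforms_subspace]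
      cvec.subspace_scale[OF biforms_subspace])
  from this[of w] show ?thesis using dproj_homogeneous[OF biforms_graded w, of "(p, q)"] by simp
qed

lemma hodge_form: "w \<in> Forms X k \<Longrightarrow> hodge X w \<in> Forms X (2 * n - k)"
proof (erule form_induct)
  fix a b w assume ab: "a + b = k" and w: "w \<in> BiForms X (a, b)"
  show "hodge X w \<in> Forms X (2 * n - k)"
  proof (cases "a > n \<or> b > n")
    case True
    from biforms_bounded[OF True w] show ?thesis
      by (simp add: clinear_zero[OF hodge_linear] cvec.subspace_0[OF forms_subspace])
  next
    case False
    have "n - b + (n - a) = 2 * n - k" using False ab by simp
    then show ?thesis using biform_form[OF hodge_biform[OF w]] by simp
  qed
qed (simp_all add: clinear_zero[OF hodge_linear] clinear_add[OF hodge_linear] cvec.subspace_0[OF forms_subspace]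
    cvec.subspace_add[OF forms_subspace])

subsection \<open>The metric\<close>

abbreviation fp where "fp \<equiv> dproj (Forms X)"

text \<open>The image of the metric in \<open>\<Omega>\<^sup>0\<close>, where it can be computed with.\<close>

definition metric_form :: "'w \<Rightarrow> 'w \<Rightarrow> 'w"
  where "metric_form w v = (\<Sum>k\<le>2 * n. hodge X (hodge X (wstar X (fp k w)) * fp k v))"

lemma emb_metric: "emb X (metric X w v) = metric_form w v"
proof -
  have "hodge X (hodge X (wstar X (fp k w)) * fp k v) \<in> Forms X 0" if "k \<le> 2 * n" for k
  proof -
    have "hodge X (wstar X (fp k w)) * fp k v \<in> Forms X (2 * n - k + k)"
      by (intro forms_mult hodge_form wstar_form dproj_in[OF forms_direct_sum])
    from hodge_form[OF this] show ?thesis using that by simp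
  qed
  then have "metric_form w v \<in> range (emb X)"
    unfolding metric_form_def forms_zero[symmetric] by (intro cvec.subspace_sum[OF forms_subspace]) simp
  then show ?thesis
    by (simp add: metric_def form_part_dproj metric_form_def f_inv_into_f)
qed

lemma metric_eqI: "metric_form w v = emb X b \<Longrightarrow> metric X w v = b"
  using emb_metric[of w v] emb_inj by (simp add: inj_eq)

lemma sesq_metric_form: "sesq cnj metric_form"
  unfolding sesq_def metric_form_def
  by (simp add: clinear_add[OF dproj_linear[OF forms_direct_sum]] clinear_scale[OF dproj_linear[OF forms_direct_sum]]
      clinear_add[OF hodge_linear] clinear_scale[OF hodge_linear] wstar_add wstar_scaleC distrib_left distrib_right
      mult_scaleC_left mult_scaleC_right sum.distrib cvec.scale_sum_right)

lemma sesq_metric: "sesq cnj (metric X)"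
proof -
  have "inj (emb X)" by (rule emb_inj)
  then have *: "x = y" if "emb X x = emb X y" for x y using that by (rule injD)
  show ?thesis
    unfolding sesq_def
    by (intro conjI allI; rule *) (simp_all add: emb_metric clinear_add[OF emb_linear] clinear_scale[OF emb_linear]
        sesq_add_left[OF sesq_metric_form] sesq_add_right[OF sesq_metric_form]
        sesq_scale_left[OF sesq_metric_form] sesq_scale_right[OF sesq_metric_form])
qed

lemma hodge_emb_right: "hodge X (w * emb X b) = hodge X w * emb X b"
  by (rule hodge_commute[of "\<lambda>w. w * emb X b"])
    (auto simp: clinear_iff distrib_right mult_scaleC_left lefschetz_def mult.assoc biforms_emb_right)

lemma hodge_emb_left: "hodge X (emb X b * w) = emb X b * hodge X w"
proof (rule hodge_commute[of "\<lambda>w. emb X b * w"])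
  show "emb X b * L w = L (emb X b * w)" for w
    unfolding lefschetz_def mult.assoc[symmetric] herm_central[of "emb X b"] ..
qed (simp_all add: clinear_iff distrib_left mult_scaleC_right biforms_emb_left)

lemma fp_emb_right: "fp k (w * emb X b) = fp k w * emb X b"
  by (rule dproj_commute[OF forms_direct_sum, of "\<lambda>w. w * emb X b"])
    (use forms_mult[OF _ emb_form] in \<open>auto simp: clinear_iff distrib_right mult_scaleC_left\<close>)

lemma metric_right: "metric X w (v * emb X b) = metric X w v * b"
  by (rule metric_eqI)
    (simp add: emb_mult emb_metric metric_form_def fp_emb_right hodge_emb_right sum_distrib_right flip: mult.assoc)

lemma metric_left: "metric X (w * emb X b) v = b\<^sup>\<star> * metric X w v"
proof (rule metric_eqI)
  have "wstar X (fp k w * emb X b) = emb X (b\<^sup>\<star>) * wstar X (fp k w)" for k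
    using wstar_mult[OF dproj_in[OF forms_direct_sum] emb_form, of k w b] by (simp add: wstar_emb)
  then show "metric_form (w * emb X b) v = emb X (b\<^sup>\<star> * metric X w v)"
    by (simp add: emb_mult emb_metric metric_form_def fp_emb_right hodge_emb_left sum_distrib_left mult.assoc)
qed

text \<open>In equal total degree \<open>\<ast>(w\<^sup>\<star>) \<and> v\<close> has bidegree \<open>(n - a + a', n - b + b')\<close>, and one of the two exceeds \<open>n\<close>.\<close>

lemma metric_orthogonal:
  assumes w: "w \<in> BiForms X (a, b)" and v: "v \<in> BiForms X (a', b')" and ne: "(a, b) \<noteq> (a', b')"
  shows "metric X w v = 0"
proof (rule metric_eqI)
  have wz: "wstar X 0 = 0" using wstar_scaleC[of 0 0] by simp
  note fw = dproj_homogeneous[OF forms_direct_sum biform_form[OF w]]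
    and fv = dproj_homogeneous[OF forms_direct_sum biform_form[OF v]]
  have "hodge X (hodge X (wstar X (fp k w)) * fp k v) = 0" for k
  proof (cases "k = a + b \<and> k = a' + b'")
    case True
    have ws: "wstar X w \<in> BiForms X (b, a)" using w biforms_wstar[of a b] by blast
    have "hodge X (wstar X w) * v = 0"
    proof (cases "a > n \<or> b > n")
      case True
      then show ?thesis using biforms_bounded[OF True w] by (simp add: wz clinear_zero[OF hodge_linear])
    next
      case False
      have "hodge X (wstar X w) * v \<in> BiForms X (n - a + a', n - b + b')"
        by (rule biforms_mult[OF hodge_biform[OF ws] v])
      moreover have "n - a + a' > n \<or> n - b + b' > n" using \<open>k = a + b \<and> k = a' + b'\<close> ne False by auto
      ultimately show ?thesis by (intro biforms_bounded)
    qed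
    then show ?thesis using fw[of k] fv[of k] True by (simp add: clinear_zero[OF hodge_linear])
  next
    case False
    then show ?thesis using fw[of k] fv[of k] by (auto simp: wz clinear_zero[OF hodge_linear])
  qed
  then show "metric_form w v = emb X 0" by (simp add: metric_form_def clinear_zero[OF emb_linear])
qed

end

section \<open>Covariance of the calculus\<close>

lemma tmul_assoc:
  assumes m: "bilin m1" "bilin m2" "bilin m3" "bilin m4" and "\<And>a b c. m1 (m2 a b) c = m3 a (m4 b c)"
  shows "tmul (*) m1 (tmul (*) m2 x y) z = tmul (*) m3 x (tmul (*) m4 y z :: ('a::complex_algebra_1, _) ctensor)"
proof (induction x rule: ctensor_induct)
  case (pure a u)
  show ?case
  proof (induction y rule: ctensor_induct)
    case (pure b v)
    show ?case
      by (induction z rule: ctensor_induct)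
        (simp_all add: tmul_ctens[OF bilin_mult] m assms(5) mult.assoc tmul_add_right[OF bilin_mult])
  qed (simp add: tmul_add_right[OF bilin_mult] tmul_add_left[OF bilin_mult] m)
qed (simp add: tmul_add_left[OF bilin_mult] m)

lemma tmul_tmap_left:
  assumes "sesq s (m1 :: 'a::complex_vector \<Rightarrow> _)" "sesq s m2" "sesq s m3" "clinear e" "\<And>u v. m3 u v = m2 (e u) v"
  shows "tmul m1 m2 (tmap e x) y = tmul m1 m3 x y"
proof (induction x rule: ctensor_induct)
  case (pure a u)
  show ?case
    by (induction y rule: ctensor_induct)
      (simp_all add: tmap_ctens assms(4) assms(5)[symmetric] tmul_ctens[OF assms(1,2)] tmul_ctens[OF assms(1,3)]
        tmul_add_right[OF assms(1,2)] tmul_add_right[OF assms(1,3)])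
qed (simp add: clinear_add[OF tmap_linear[OF assms(4)]] tmul_add_left[OF assms(1,2)] tmul_add_left[OF assms(1,3)])

lemma tmap_tmul:
  assumes "sesq s (m1 :: 'a::complex_vector \<Rightarrow> _)" "sesq s m2" "sesq s m3" "clinear e" "\<And>u v. e (m2 u v) = m3 u v"
  shows "tmap e (tmul m1 m2 x y) = tmul m1 m3 x y"
proof (induction x rule: ctensor_induct)
  case (pure a u)
  show ?case
    by (induction y rule: ctensor_induct)
      (simp_all add: tmap_ctens assms(4,5) tmul_ctens[OF assms(1,2)] tmul_ctens[OF assms(1,3)]
        tmul_add_right[OF assms(1,2)] tmul_add_right[OF assms(1,3)] clinear_add[OF tmap_linear[OF assms(4)]])
qed (simp add: clinear_add[OF tmap_linear[OF assms(4)]] tmul_add_left[OF assms(1,2)] tmul_add_left[OF assms(1,3)])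

context cqh_hermitian_space
begin

abbreviation \<beta> where "\<beta> \<equiv> base_coaction (hopf X) (incl X)"

lemma coact_comodule: "left_comodule (hopf X) (coact X)"
  and coact_emb_mult: "coact X (emb X b * w) = tmul (*) (\<lambda>b w. emb X b * w) (\<beta> b) (coact X w)"
  and forms_fg: "finitely_generated (\<lambda>b w. emb X b * w)"
  using forms_relative_hopf_module by (simp_all add: relative_hopf_module_def tmul_def)

lemmas coact_linear = left_comodule_linear[OF coact_comodule]
lemmas coact_emb' = coact_emb[folded tmap_def]
lemmas coact_diff' = coact_diff[folded tmap_def]

lemma bilin_emb_mult: "bilin (\<lambda>b w. emb X b * w)"
  by (simp add: sesq_def clinear_add[OF emb_linear] clinear_scale[OF emb_linear] distrib_left distrib_right
      mult_scaleC_left mult_scaleC_right)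

lemma coact_emb_mult': "coact X (emb X b * w) = tmul (*) (*) (coact X (emb X b)) (coact X w)"
  unfolding coact_emb_mult coact_emb'
  by (rule tmul_tmap_left[OF bilin_mult bilin_mult bilin_emb_mult emb_linear HOL.refl, symmetric])

text \<open>The set of forms \<open>w\<close> with \<open>\<delta>(w v) = \<delta>(w) \<delta>(v)\<close> for all \<open>v\<close> is an algebra containing \<open>B\<close>; as \<open>\<delta>\<close> commutes
  with \<open>d\<close>, applying this to \<open>d(b v) = (d b) v + b d v\<close> shows that it contains \<open>d b\<close>.\<close>

lemma coact_mult: "coact X (w * v) = tmul (*) (*) (coact X w) (coact X v)"
proof -
  note lin = clinear_add[OF coact_linear] clinear_scale[OF coact_linear]
  note tl = sesq_add_left[OF sesq_tmul[OF bilin_mult bilin_mult]] sesq_scale_left[OF sesq_tmul[OF bilin_mult bilin_mult]]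
  have leib: "tmap (diff X) (tmul (*) (*) (tmap (emb X) z) y) =
      tmul (*) (*) (tmap (diff X) (tmap (emb X) z)) y + tmul (*) (*) (tmap (emb X) z) (tmap (diff X) y)"
    for z :: "('a, 'b) ctensor" and y
  proof (induction z rule: ctensor_induct)
    case (pure a b)
    show ?case
    proof (induction y rule: ctensor_induct)
      case (pure c v)
      show ?case
        using diff_leibniz[OF emb_form, of b v]
        by (simp add: tmap_ctens emb_linear diff_linear tmul_ctens[OF bilin_mult bilin_mult] ctens_add_right)
    next
      case (add y y')
      then show ?case
        by (simp add: tmul_add_right[OF bilin_mult bilin_mult] clinear_add[OF tmap_linear[OF diff_linear]])
    qed
  next
    case (add z z')
    then show ?case
      by (simp add: tmul_add_left[OF bilin_mult bilin_mult] clinear_add[OF tmap_linear[OF diff_linear]]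
          clinear_add[OF tmap_linear[OF emb_linear]])
  qed
  have "w \<in> algebra_generated (range (emb X) \<union> range (\<lambda>b. diff X (emb X b)))"
    using forms_generated by simp
  then have "\<forall>v. coact X (w * v) = tmul (*) (*) (coact X w) (coact X v)"
  proof (induction rule: algebra_generated.induct)
    case (gen x)
    then consider b where "x = emb X b" | b where "x = diff X (emb X b)" by blast
    then show ?case
    proof cases
      case 1
      then show ?thesis by (simp add: coact_emb_mult')
    next
      case 2
      show ?thesis
      proof
        fix v
        have "coact X (x * v) = coact X (diff X (emb X b * v)) - coact X (emb X b * diff X v)"
          using diff_leibniz[OF emb_form, of b v] by (simp add: 2 flip: clinear_diff[OF coact_linear])
        also have "\<dots> = tmap (diff X) (tmul (*) (*) (coact X (emb X b)) (coact X v))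
            - tmul (*) (*) (coact X (emb X b)) (tmap (diff X) (coact X v))"
          by (simp only: coact_diff' coact_emb_mult')
        also have "\<dots> = tmul (*) (*) (coact X x) (coact X v)"
          unfolding 2 coact_diff' coact_emb' leib by simp
        finally show "coact X (x * v) = tmul (*) (*) (coact X x) (coact X v)" .
      qed
    qed
  next
    case one
    show ?case using coact_emb_mult'[of 1] by (simp add: emb_one)
  next
    case (mult x y)
    then show ?case
      using tmul_assoc[OF bilin_mult bilin_mult bilin_mult bilin_mult mult.assoc, of "coact X x" "coact X y"]
      by (simp add: mult.assoc)
  qed (simp_all add: lin tl distrib_right mult_scaleC_left)
  then show ?thesis by blast
qed

text \<open>The dual action on forms.  Proving that an operator is covariant amounts to proving that it commutes with all these
  operators, for which it may be characterized by properties that they preserve.\<close>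

definition act where "act \<phi> w = slice \<phi> (coact X w)"

lemma act_linear: "cfunctional \<phi> \<Longrightarrow> clinear (act \<phi>)"
  unfolding act_def by (rule clinear_compose[OF slice_linear coact_linear])

lemma coact_biforms': "w \<in> BiForms X ab \<Longrightarrow> coact X w \<in> tens_in UNIV (BiForms X ab)"
  using coact_biforms unfolding tens_in_def by simp

lemma coact_forms: "w \<in> Forms X k \<Longrightarrow> coact X w \<in> tens_in UNIV (Forms X k)"
proof (erule form_induct)
  fix a b w assume "a + b = k" "w \<in> BiForms X (a, b)"
  then have "coact X w \<in> tens_in UNIV (BiForms X (a, b))" by (intro coact_biforms')
  moreover have "{a' \<otimes> m |a' m. a' \<in> UNIV \<and> m \<in> BiForms X (a, b)} \<subseteq> {a' \<otimes> m |a' m. a' \<in> UNIV \<and> m \<in> Forms X k}"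
    using biform_form \<open>a + b = k\<close> by blast
  ultimately show "coact X w \<in> tens_in UNIV (Forms X k)"
    unfolding tens_in_def using cvec.span_mono by blast
qed (simp_all add: tens_in_def clinear_zero[OF coact_linear] clinear_add[OF coact_linear] cvec.span_zero cvec.span_add)

lemma act_biforms: "cfunctional \<phi> \<Longrightarrow> w \<in> BiForms X ab \<Longrightarrow> act \<phi> w \<in> BiForms X ab"
  unfolding act_def by (rule slice_tens_in[OF _ coact_biforms' biforms_subspace])

lemma act_forms: "cfunctional \<phi> \<Longrightarrow> w \<in> Forms X k \<Longrightarrow> act \<phi> w \<in> Forms X k"
  unfolding act_def by (rule slice_tens_in[OF _ coact_forms forms_subspace])

lemma coact_if_act_commutes:
  assumes "clinear N" "\<And>\<phi> w. cfunctional \<phi> \<Longrightarrow> act \<phi> (N w) = N (act \<phi> w)"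
  shows "coact X (N w) = tmap N (coact X w)"
  by (rule eq_if_slices_eq) (use assms in \<open>simp add: act_def slice_tmap\<close>)

lemma coact_fp: "coact X (fp k w) = tmap (fp k) (coact X w)"
  by (rule coact_if_act_commutes[OF dproj_linear[OF forms_direct_sum]])
    (rule dproj_commute[OF forms_direct_sum act_linear act_forms, symmetric])

text \<open>As \<open>\<sigma>\<close> is coinvariant and the coaction is multiplicative, slices of the coaction commute with \<open>L\<close>.\<close>

lemma coact_hodge: "coact X (hodge X w) = tmap (hodge X) (coact X w)"
proof (rule coact_if_act_commutes[OF hodge_linear])
  fix \<phi> :: "'a \<Rightarrow> complex" and w assume \<phi>: "cfunctional \<phi>"
  show "act \<phi> (hodge X w) = hodge X (act \<phi> w)"
  proof (rule hodge_commute[OF act_linear[OF \<phi>] _ act_biforms[OF \<phi>], symmetric])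
    fix w
    have "tmul (*) (*) (1 \<otimes> herm X) y = tmap (lefschetz X) y" for y :: "('a, 'w) ctensor"
      by (induction y rule: ctensor_induct) (simp_all add: tmul_ctens[OF bilin_mult bilin_mult]
        tmap_ctens[OF L_linear] lefschetz_def[symmetric] tmul_add_right[OF bilin_mult bilin_mult]
        clinear_add[OF tmap_linear[OF L_linear]])
    then have "coact X (lefschetz X w) = tmap (lefschetz X) (coact X w)"
      unfolding lefschetz_def coact_mult coact_herm by (simp only: lefschetz_def)
    then show "act \<phi> (lefschetz X w) = lefschetz X (act \<phi> w)"
      by (simp add: act_def slice_tmap[OF \<phi> L_linear])
  qed
qed

text \<open>Slices preserve bidegrees and commute with \<open>d\<close>, hence with its component \<open>delbar\<close>.\<close>

lemma coact_delbar: "coact X (delbar X w) = tmap (delbar X) (coact X w)"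
proof (rule coact_if_act_commutes[OF delbar_linear])
  fix \<phi> :: "'a \<Rightarrow> complex" and w assume \<phi>: "cfunctional \<phi>"
  note al = act_linear[OF \<phi>]
  show "act \<phi> (delbar X w) = delbar X (act \<phi> w)"
  proof (induction w rule: biforms_induct)
    case (1 i w)
    obtain a b where i: "i = (a, b)" by fastforce
    have w: "w \<in> BiForms X (a, b)" using 1 by (simp add: i)
    let ?p = "dproj (BiForms X) (a, b + 1)"
    note hom = dproj_homogeneous[OF biforms_graded]
    have "act \<phi> (diff X w) = diff X (act \<phi> w)"
      by (simp add: act_def coact_diff' slice_tmap[OF \<phi> diff_linear])
    then have "act \<phi> (del X w) + act \<phi> (delbar X w) = del X (act \<phi> w) + delbar X (act \<phi> w)"
      by (simp add: diff_eq clinear_add[OF al])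
    from arg_cong[OF this, of ?p] show ?case
      using hom[OF act_biforms[OF \<phi> del_degree[OF w]]] hom[OF act_biforms[OF \<phi> delbar_degree[OF w]]]
        hom[OF del_degree[OF act_biforms[OF \<phi> w]]] hom[OF delbar_degree[OF act_biforms[OF \<phi> w]]]
      by (simp add: clinear_add[OF dproj_linear[OF biforms_graded]])
  next
    case (2 x y)
    then show ?case by (simp add: clinear_add[OF al] clinear_add[OF delbar_linear])
  qed
qed

abbreviation smap where "smap \<equiv> ctensor_map star (wstar X)"

lemmas smap_ctens = map_ctens[OF slin_star wstar_slin]
lemmas smap_add = lift_add[OF bal2_map[OF slin_star wstar_slin]]

lemma base_coaction_star: "\<beta> (b\<^sup>\<star>) = ctensor_map star star (\<beta> b)"
proof (rule tmap_inj[OF incl_linear incl_inj])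
  have "tmap (incl X) (ctensor_map star star z) = ctensor_map star star (tmap (incl X) z)"
    for z :: "('a, 'b) ctensor"
    by (induction z rule: ctensor_induct)
      (simp_all add: map_ctens[OF slin_star slin_star] tmap_ctens[OF incl_linear] incl_star
        lift_add[OF bal2_map[OF slin_star slin_star]] clinear_add[OF tmap_linear[OF incl_linear]])
  then show "tmap (incl X) (\<beta> (b\<^sup>\<star>)) = tmap (incl X) (ctensor_map star star (\<beta> b))"
    by (simp only: tmap_base_coaction incl_star comult_star)
qed

text \<open>The involution reverses products of homogeneous forms only up to sign, so the induction over the generators
  is carried out on homogeneous components.\<close>

lemma coact_wstar: "coact X (wstar X w) = smap (coact X w)"
proof -
  define P where "P w \<longleftrightarrow> coact X (wstar X w) = smap (coact X w)" for w
  have wz: "wstar X 0 = 0" using wstar_scaleC[of 0 0] by simp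
  have P_add: "P (x + y)" if "P x" "P y" for x y
    using that by (simp add: P_def wstar_add clinear_add[OF coact_linear] smap_add)
  have P0: "P 0"
    using smap_add[of 0 0] by (simp add: P_def wz clinear_zero[OF coact_linear])
  have P_scale: "P (c *\<^sub>C x)" if "P x" for c x
  proof -
    have "smap (c *\<^sub>C z) = cnj c *\<^sub>C smap z" for z :: "('a, 'w) ctensor"
      using slin_map[OF slin_star wstar_slin] unfolding slin_def by blast
    then show ?thesis using that by (simp add: P_def wstar_scaleC clinear_scale[OF coact_linear])
  qed
  have P_sum: "P (\<Sum>i\<in>S. f i)" if "\<And>i. P (f i)" for f and S :: "nat set"
    by (induction S rule: infinite_finite_induct) (auto simp: P0 P_add that)
  have P_emb: "P (emb X b)" for b
  proof -
    have "tmap (emb X) (ctensor_map star star z) = smap (tmap (emb X) z)" for z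
      by (induction z rule: ctensor_induct)
        (simp_all add: map_ctens[OF slin_star slin_star] tmap_ctens[OF emb_linear] wstar_emb smap_ctens smap_add
          lift_add[OF bal2_map[OF slin_star slin_star]] clinear_add[OF tmap_linear[OF emb_linear]])
    then show ?thesis by (simp only: P_def wstar_emb coact_emb' base_coaction_star)
  qed
  have P_diff: "P (diff X w)" if "P w" for w
  proof -
    have "tmap (diff X) (smap z) = smap (tmap (diff X) z)" for z
      by (induction z rule: ctensor_induct)
        (simp_all add: tmap_ctens[OF diff_linear] diff_wstar smap_ctens smap_add clinear_add[OF tmap_linear[OF diff_linear]])
    then show ?thesis using that by (simp only: P_def diff_wstar[symmetric] coact_diff')
  qed
  have P_mult: "P (w * v)" if w: "w \<in> Forms X k" "P w" and v: "v \<in> Forms X l" "P v" for w v k l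
  proof -
    have "smap (tmul (*) (*) z y) = ((-1) ^ (k * l) :: complex) *\<^sub>C tmul (*) (*) (smap y) (smap z)"
      if "z \<in> tens_in UNIV (Forms X k)" "y \<in> tens_in UNIV (Forms X l)" for z y :: "('a, 'w) ctensor"
      using that(1)
    proof (induction rule: tens_in_induct)
      case (pure a w)
      show ?case using that(2)
      proof (induction rule: tens_in_induct)
        case (pure c v)
        then show ?case
          using wstar_mult[OF \<open>w \<in> Forms X k\<close> pure]
          by (simp add: tmul_ctens[OF bilin_mult bilin_mult] smap_ctens star_mult sign_scale ctens_scale_right)
      qed (simp_all add: forms_subspace tmul_add_left[OF bilin_mult bilin_mult]
          tmul_add_right[OF bilin_mult bilin_mult] smap_add scaleC_add_right)
    qed (simp_all add: forms_subspace tmul_add_left[OF bilin_mult bilin_mult]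
        tmul_add_right[OF bilin_mult bilin_mult] smap_add scaleC_add_right)
    from this[OF coact_forms[OF w(1)] coact_forms[OF v(1)]] show ?thesis
      using w(2) v(2) by (simp add: P_def wstar_mult[OF w(1) v(1)] sign_scale clinear_scale[OF coact_linear] coact_mult)
  qed
  have "w \<in> algebra_generated (range (emb X) \<union> range (\<lambda>b. diff X (emb X b)))"
    using forms_generated by simp
  then have "\<forall>k. P (fp k w)"
  proof (induction rule: algebra_generated.induct)
    case (gen x)
    have hom: "\<forall>k. P (fp k y)" if "y \<in> Forms X l" "P y" for y l
      using dproj_homogeneous[OF forms_direct_sum that(1)] that(2) P0 by simp
    from gen show ?case
      using hom[OF emb_form P_emb] hom[OF diff_degree[OF emb_form] P_diff[OF P_emb]] by blast
  next
    case one
    show ?case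
      using dproj_homogeneous[OF forms_direct_sum emb_form, of _ 1] P_emb[of 1] P0 by (simp add: emb_one)
  next
    case (mult x y)
    show ?case
    proof
      fix k
      let ?S = "\<lambda>x. {i. fp i x \<noteq> 0}"
      have "x * y = (\<Sum>i\<in>?S x. fp i x) * (\<Sum>j\<in>?S y. fp j y)"
        by (simp only: sum_dproj[OF forms_direct_sum])
      also have "fp k \<dots> = (\<Sum>i\<in>?S x. \<Sum>j\<in>?S y. fp k (fp i x * fp j y))"
        by (simp only: sum_product clinear_sum[OF dproj_linear[OF forms_direct_sum]])
      finally have eq: "fp k (x * y) = (\<Sum>i\<in>?S x. \<Sum>j\<in>?S y. fp k (fp i x * fp j y))" .
      have "P (fp k (fp i x * fp j y))" for i j
      proof -
        note d = dproj_in[OF forms_direct_sum]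
        have "P (fp i x * fp j y)" using mult.IH by (intro P_mult[OF d _ d]) auto
        then show ?thesis
          using dproj_homogeneous[OF forms_direct_sum forms_mult[OF d d], of k i x j y] P0 by simp
      qed
      then show "P (fp k (x * y))" unfolding eq by (intro P_sum)
    qed
  qed (simp_all add: clinear_add[OF dproj_linear[OF forms_direct_sum]] clinear_scale[OF dproj_linear[OF forms_direct_sum]]
      P_add P_scale)
  then have "P (\<Sum>k\<in>{k. fp k w \<noteq> 0}. fp k w)" by (intro P_sum) simp
  then show ?thesis by (simp add: P_def sum_dproj[OF forms_direct_sum])
qed

text \<open>The metric is composed of maps that are compatible with the coaction; the composition \<open>?t\<close> of their extensions to
  tensors is computed on pure tensors.\<close>

lemma metric_covariant: "\<beta> (metric X w v) = tmul (\<lambda>a c. a\<^sup>\<star> * c) (metric X) (coact X w) (coact X v)"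
proof (rule tmap_inj[OF emb_linear emb_inj])
  let ?t = "\<lambda>k z y. tmap (hodge X) (tmul (*) (*) (tmap (hodge X) (smap (tmap (fp k) z))) (tmap (fp k) y))"
  note lin = dproj_linear[OF forms_direct_sum]
  note adds = clinear_add[OF tmap_linear[OF lin]] clinear_add[OF tmap_linear[OF hodge_linear]] smap_add
    tmul_add_left[OF bilin_mult bilin_mult] tmul_add_right[OF bilin_mult bilin_mult]
    tmul_add_left[OF sesq_star_mult sesq_metric_form] tmul_add_right[OF sesq_star_mult sesq_metric_form]
  have "(\<Sum>k\<le>2 * halfdeg X. ?t k z y) = tmul (\<lambda>a c. a\<^sup>\<star> * c) metric_form z y" for z y :: "('a, 'w) ctensor"
  proof (induction z rule: ctensor_induct)
    case (pure a w)
    show ?case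
    proof (induction y rule: ctensor_induct)
      case (pure c v)
      show ?case
        by (simp add: tmap_ctens lin hodge_linear smap_ctens tmul_ctens[OF bilin_mult bilin_mult]
            tmul_ctens[OF sesq_star_mult sesq_metric_form] metric_form_def[of w v] sesq_sum_right[OF bilin_ctens])
    next
      case (add y y')
      then show ?case by (simp only: adds sum.distrib)
    qed
  next
    case (add z z')
    then show ?case by (simp only: adds sum.distrib)
  qed
  then have "coact X (metric_form w v) = tmul (\<lambda>a c. a\<^sup>\<star> * c) metric_form (coact X w) (coact X v)"
    unfolding metric_form_def
    by (simp only: clinear_sum[OF coact_linear] coact_hodge coact_mult coact_wstar coact_fp metric_form_def)
  then show "tmap (emb X) (\<beta> (metric X w v)) =
      tmap (emb X) (tmul (\<lambda>a c. a\<^sup>\<star> * c) (metric X) (coact X w) (coact X v))"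
    by (simp only: coact_emb'[symmetric] emb_metric tmap_tmul[OF sesq_star_mult sesq_metric sesq_metric_form emb_linear emb_metric])
qed

end

section \<open>Forms with values in a covariant module\<close>

text \<open>\<open>\<Delta> \<otimes> id\<close>, one side of the coassociativity of a coaction.\<close>

definition cassoc :: "'a::complex_vector cqga_data \<Rightarrow> ('a, 'm::complex_vector) ctensor \<Rightarrow> ('a, ('a, 'm) ctensor) ctensor"
  where "cassoc H = ctensor_lift (\<lambda>a m. ctensor_lift (\<lambda>a1 a2. a1 \<otimes> a2 \<otimes> m) (comult H a))"

lemma cassoc_ctens: "clinear (comult H) \<Longrightarrow>
    cassoc H (a \<otimes> m) = ctensor_lift (\<lambda>a1 a2. a1 \<otimes> a2 \<otimes> m) (comult H a)"
  and cassoc_add: "clinear (comult H) \<Longrightarrow> cassoc H (x + y) = cassoc H x + cassoc H y"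
  unfolding cassoc_def
  by (rule lift_ctens[OF bal3_comult[OF bal3_ctens]], assumption, rule lift_add[OF bal3_comult[OF bal3_ctens]], assumption)

lemma cassoc_comodule: "left_comodule H \<delta> \<Longrightarrow> cassoc H (\<delta> x) = tmap \<delta> (\<delta> x)"
  using left_comodule_coassoc[of H \<delta> x] by (simp add: cassoc_def tmap_def)

lemma weak_hermitian_form:
  fixes h :: "'m::complex_vector \<Rightarrow> 'm \<Rightarrow> 'b::complex_star_algebra"
  assumes "weak_hermitian_module la ra h"
  shows "sesq cnj h" and "h f (la b k) = h (la (b\<^sup>\<star>) f) k" and "h f k = (h k f)\<^sup>\<star>"
    and "f \<noteq> 0 \<Longrightarrow> h f f \<in> positive_elements"
proof -
  note conj = assms[unfolded weak_hermitian_module_def]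
  note bi = conj[THEN conjunct1] and bij = conj[THEN conjunct2, THEN conjunct1]
    and add = conj[THEN conjunct2, THEN conjunct2, THEN conjunct1]
  note rest = conj[THEN conjunct2, THEN conjunct2, THEN conjunct2, THEN conjunct2]
  note bal = rest[THEN conjunct1] and herm = rest[THEN conjunct2, THEN conjunct1]
    and pos = rest[THEN conjunct2, THEN conjunct2]
  have dual: "h f \<in> dual_module ra" for f
    using bij by (auto simp: bij_betw_def)
  have add2: "h f (x + y) = h f x + h f y" and r: "h f (ra x b) = h f x * b" for f x y b
    using dual[of f] by (simp_all add: dual_module_def)
  have ras: "ra x (c *\<^sub>C 1) = c *\<^sub>C x" for x c
  proof -
    have "clinear (ra x)" "ra x 1 = x" using bi by (simp_all add: bimodule_def)
    then show ?thesis by (simp add: clinear_iff)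
  qed
  have s2: "h f (c *\<^sub>C x) = c *\<^sub>C h f x" for f c x
    using r[of f x "c *\<^sub>C 1"] by (simp add: ras mult_scaleC_right)
  have s1: "h (c *\<^sub>C f) x = cnj c *\<^sub>C h f x" for f c x
    unfolding spec[OF spec[OF herm], of "c *\<^sub>C f" x] spec[OF spec[OF herm], of f x] by (simp only: s2 star_scaleC)
  show "sesq cnj h" using add by (simp add: sesq_def add2 s1 s2)
  show "h f (la b k) = h (la (b\<^sup>\<star>) f) k" using bal by simp
  show "h f k = (h k f)\<^sup>\<star>" by (rule spec[OF spec[OF herm]])
  show "f \<noteq> 0 \<Longrightarrow> h f f \<in> positive_elements" using pos by blast
qed

locale cqh_module = cqh_hermitian_space X + covariant_hermitian_holomorphic_module X F
  for X :: "('a::complex_star_algebra, 'b::complex_star_algebra, 'q::complex_star_algebra, 'w::complex_algebra_1) cqh_data"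
    and F :: "('a, 'b, 'w, 'f::complex_vector, 't::complex_vector) module_data"
begin

abbreviation tn where "tn \<equiv> tens F"
abbreviation wd where "wd \<equiv> wedge F"
abbreviation \<delta>T where "\<delta>T \<equiv> tensor_coact X F"
abbreviation gT where "gT \<equiv> tensor_metric X F"
abbreviation dT where "dT \<equiv> tensor_delbar X F"

lemma module_bimodule: "bimodule (lact F) (ract F)"
  and module_fg: "finitely_generated (lact F)"
  and mcoact_comodule: "left_comodule (hopf X) (mcoact F)"
  and mcoact_lact: "mcoact F (lact F b f) = tmul (*) (lact F) (\<beta> b) (mcoact F f)"
  using module_relative_hopf_module by (simp_all add: relative_hopf_module_def tmul_def)

lemmas mcoact_linear = left_comodule_linear[OF mcoact_comodule]

lemma bilin_lact: "bilin (lact F)"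
  and lact_one: "lact F 1 f = f"
  and lact_mult: "lact F (b * c) f = lact F b (lact F c f)"
  using module_bimodule by (simp_all add: bimodule_def sesq_def clinear_iff)

lemma lact_scale_one: "lact F (c *\<^sub>C 1) f = c *\<^sub>C f"
  by (simp add: sesq_scale_left[OF bilin_lact] lact_one)

abbreviation balT where "balT \<equiv> balanced (\<lambda>w b. w * emb X b) (lact F)"

lemma balanced_tens: "balT tn"
  using tens_tensor_product by (simp add: is_tensor_product_def)

lemma tens_balance: "tn (w * emb X b) f = tn w (lact F b f)"
  using balanced_tens by (simp add: balanced_def)

lemma bilin_tens: "bilin tn"
proof -
  have "tn w (c *\<^sub>C f) = tn (w * emb X (c *\<^sub>C 1)) f" for w c f
    by (simp add: tens_balance lact_scale_one)
  then show ?thesis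
    using balanced_tens tens_scaleC
    by (simp add: sesq_def balanced_def clinear_scale[OF emb_linear] emb_one mult_scaleC_right)
qed

lemma tens_induct [case_names pure add]:
  assumes "\<And>w f. P (tn w f)" and "\<And>x y. P x \<Longrightarrow> P y \<Longrightarrow> P (x + y)"
  shows "P z"
proof -
  have "P (tensor_sum tn Y)" for Y
  proof (induction Y)
    case empty
    show ?case using assms(1)[of 0 0] by (simp add: sesq_zero_left[OF bilin_tens])
  next
    case (add x Y)
    then show ?case using assms by (cases x) auto
  qed
  then show ?thesis
    using tens_tensor_product unfolding is_tensor_product_def by metis
qed

abbreviation tlift where "tlift \<equiv> tensor_lift tn"

lemma tlift_tens: "balT \<phi> \<Longrightarrow> tlift \<phi> (tn w f) = \<phi> w f"
  by (rule tensor_lift_apply[OF tens_tensor_product])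

lemma tlift_add: "balT \<phi> \<Longrightarrow> tlift \<phi> (x + y) = tlift \<phi> x + tlift \<phi> y"
  by (rule tensor_lift_add[OF tens_tensor_product])

lemma balT_I:
  assumes "\<And>m m' n. t (m + m') n = t m n + t m' n" and "\<And>m n n'. t m (n + n') = t m n + t m n'"
    and "\<And>m b n. t (m * emb X b) n = t m (lact F b n)"
  shows "balT t"
  using assms by (simp add: balanced_def)

lemma balanced_wedge: "balT (\<lambda>v f. tn (w * v) f)"
  by (rule balT_I) (simp_all add: distrib_left sesq_add_left[OF bilin_tens] sesq_add_right[OF bilin_tens]
      tens_balance flip: mult.assoc)

lemma wedge_tens: "wd w (tn v f) = tn (w * v) f"
  and wedge_add: "wd w (x + y) = wd w x + wd w y"
  unfolding wedge_def by (rule tlift_tens[OF balanced_wedge], rule tlift_add[OF balanced_wedge])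

lemma bilin_wedge: "bilin wd"
proof -
  have "wd (w + w') x = wd w x + wd w' x" for w w' x
    by (induction x rule: tens_induct)
      (simp_all add: wedge_tens wedge_add distrib_right sesq_add_left[OF bilin_tens])
  moreover have "wd (c *\<^sub>C w) x = c *\<^sub>C wd w x" for c w x
    by (induction x rule: tens_induct)
      (simp_all add: wedge_tens wedge_add mult_scaleC_left sesq_scale_left[OF bilin_tens] scaleC_add_right)
  moreover have "wd w (c *\<^sub>C x) = c *\<^sub>C wd w x" for c w x
  proof (induction x rule: tens_induct)
    case (pure v f)
    have "wd w (c *\<^sub>C tn v f) = tn (w * (c *\<^sub>C v)) f"
      by (simp only: sesq_scale_left[OF bilin_tens, symmetric] wedge_tens)
    then show ?case by (simp only: wedge_tens mult_scaleC_right sesq_scale_left[OF bilin_tens])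
  qed (simp add: wedge_add scaleC_add_right)
  ultimately show ?thesis by (simp add: sesq_def wedge_add)
qed

lemma wedge_mult: "wd (w * v) x = wd w (wd v x)"
  by (induction x rule: tens_induct) (simp_all add: wedge_tens wedge_add mult.assoc)

lemma wedge_one: "wd 1 x = x"
  by (induction x rule: tens_induct) (simp_all add: wedge_tens wedge_add)

subsection \<open>The coaction\<close>

lemma balanced_coact: "balT (\<lambda>w f. tmul (*) tn (coact X w) (mcoact F f))"
proof (rule balT_I)
  note tm = sesq_tmul[OF bilin_mult bilin_tens]
  fix w b f
  have "tmul (*) (*) (coact X w) (coact X (emb X b)) = tmul (*) (\<lambda>w b. w * emb X b) (coact X w) (\<beta> b)"
  proof -
    have bs: "bilin (\<lambda>w b. w * emb X b)"
      by (simp add: sesq_def clinear_add[OF emb_linear] clinear_scale[OF emb_linear] distrib_left distrib_right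
          mult_scaleC_left mult_scaleC_right)
    have "tmul (*) (*) z (tmap (emb X) y) = tmul (*) (\<lambda>w b. w * emb X b) z y" for z :: "('a, 'w) ctensor" and y
    proof (induction z rule: ctensor_induct)
      case (pure a w)
      show ?case
        by (induction y rule: ctensor_induct)
          (simp_all add: tmap_ctens emb_linear tmul_ctens[OF bilin_mult bilin_mult] tmul_ctens[OF bilin_mult bs]
            tmul_add_right[OF bilin_mult bilin_mult] tmul_add_right[OF bilin_mult bs] clinear_add[OF tmap_linear[OF emb_linear]])
    qed (simp add: tmul_add_left[OF bilin_mult bilin_mult] tmul_add_left[OF bilin_mult bs])
    then show ?thesis by (simp only: coact_emb')
  qed
  moreover have "tmul (*) tn (tmul (*) (\<lambda>w b. w * emb X b) x y) z = tmul (*) tn x (tmul (*) (lact F) y z)"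
    for x y and z :: "('a, 'f) ctensor"
    by (rule tmul_assoc[OF bilin_tens _ bilin_tens bilin_lact tens_balance])
      (simp add: sesq_def clinear_add[OF emb_linear] clinear_scale[OF emb_linear] distrib_left distrib_right
          mult_scaleC_left mult_scaleC_right)
  ultimately show "tmul (*) tn (coact X (w * emb X b)) (mcoact F f) = tmul (*) tn (coact X w) (mcoact F (lact F b f))"
    by (simp only: coact_mult mcoact_lact)
qed (simp_all add: clinear_add[OF coact_linear] clinear_add[OF mcoact_linear] tmul_add_left[OF bilin_mult bilin_tens]
    tmul_add_right[OF bilin_mult bilin_tens])

lemma tensor_coact_alt: "\<delta>T = tlift (\<lambda>w f. tmul (*) tn (coact X w) (mcoact F f))"
  by (rule ext) (simp add: tensor_coact_def tmul_def)

lemma coactT_tens: "\<delta>T (tn w f) = tmul (*) tn (coact X w) (mcoact F f)"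
  and coactT_add: "\<delta>T (x + y) = \<delta>T x + \<delta>T y"
  unfolding tensor_coact_alt by (rule tlift_tens[OF balanced_coact], rule tlift_add[OF balanced_coact])

lemma coactT_linear: "clinear \<delta>T"
proof (rule clinearI[OF coactT_add])
  fix c x
  show "\<delta>T (c *\<^sub>C x) = c *\<^sub>C \<delta>T x"
  proof (induction x rule: tens_induct)
    case (pure w f)
    have "\<delta>T (c *\<^sub>C tn w f) = \<delta>T (tn (c *\<^sub>C w) f)" by (simp add: sesq_scale_left[OF bilin_tens])
    then show ?case
      by (simp add: coactT_tens clinear_scale[OF coact_linear] sesq_scale_left[OF sesq_tmul[OF bilin_mult bilin_tens]])
  qed (simp add: coactT_add scaleC_add_right)
qed

lemma coactT_wedge: "\<delta>T (wd w x) = tmul (*) wd (coact X w) (\<delta>T x)"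
proof (induction x rule: tens_induct)
  case (pure v f)
  show ?case
    by (simp only: wedge_tens coactT_tens coact_mult
        tmul_assoc[OF bilin_tens bilin_mult bilin_wedge bilin_tens wedge_tens[symmetric]])
qed (simp add: wedge_add coactT_add tmul_add_right[OF bilin_mult bilin_wedge])

lemma coactT_comodule: "left_comodule (hopf X) \<delta>T"
  unfolding left_comodule_def
proof (intro conjI allI)
  show "clinear \<delta>T" by (rule coactT_linear)
  note tadd = tmul_add_left[OF bilin_mult bilin_tens] tmul_add_right[OF bilin_mult bilin_tens]
  have eps: "slice (counit (hopf X)) (tmul (*) tn z y) = tn (slice (counit (hopf X)) z) (slice (counit (hopf X)) y)"
    for z :: "('a, 'w) ctensor" and y :: "('a, 'f) ctensor"
  proof (induction z rule: ctensor_induct)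
    case (pure a w)
    show ?case
      by (induction y rule: ctensor_induct)
        (simp_all add: tmul_ctens[OF bilin_mult bilin_tens] slice_ctens[OF counit_linear] counit_mult scaleC_scaleC mult.commute
          sesq_scale_left[OF bilin_tens] sesq_scale_right[OF bilin_tens] sesq_add_right[OF bilin_tens]
          tadd clinear_add[OF slice_linear[OF counit_linear]] scaleC_add_right)
  qed (simp add: tadd clinear_add[OF slice_linear[OF counit_linear]] sesq_add_left[OF bilin_tens])
  have "slice (counit (hopf X)) (\<delta>T x) = x" for x
    by (induction x rule: tens_induct)
      (simp_all add: coactT_tens eps left_comodule_counit[OF coact_comodule] left_comodule_counit[OF mcoact_comodule]
        coactT_add clinear_add[OF slice_linear[OF counit_linear]])
  then show "ctensor_lift (\<lambda>a m. counit (hopf X) a *\<^sub>C m) (\<delta>T x) = x" for x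
    by (simp only: slice_def)
  note \<Delta> = comult_linear
  have pure3: "ctensor_lift (\<lambda>a1 a2. a1 \<otimes> a2 \<otimes> tn w f) (tmul (*) (*) u v) =
      tmul (*) (tmul (*) tn) (ctensor_lift (\<lambda>a1 a2. a1 \<otimes> a2 \<otimes> w) u) (ctensor_lift (\<lambda>a1 a2. a1 \<otimes> a2 \<otimes> f) v)"
    for w f and u v :: "('a, 'a) ctensor"
  proof (induction u rule: ctensor_induct)
    case (pure a b)
    show ?case
      by (induction v rule: ctensor_induct)
        (simp_all only: tmul_ctens[OF bilin_mult bilin_mult] lift_ctens[OF bal3_12[OF bal3_ctens]]
          tmul_ctens[OF bilin_mult bilin_tens] tmul_ctens[OF bilin_mult sesq_tmul[OF bilin_mult bilin_tens]]
          tmul_add_right[OF bilin_mult bilin_mult] lift_add[OF bal3_12[OF bal3_ctens]]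
          tmul_add_right[OF bilin_mult sesq_tmul[OF bilin_mult bilin_tens]])
  qed (simp only: tmul_add_left[OF bilin_mult bilin_mult] lift_add[OF bal3_12[OF bal3_ctens]]
      tmul_add_left[OF bilin_mult sesq_tmul[OF bilin_mult bilin_tens]])
  have left: "cassoc (hopf X) (tmul (*) tn z y) = tmul (*) (tmul (*) tn) (cassoc (hopf X) z) (cassoc (hopf X) y)"
    for z :: "('a, 'w) ctensor" and y :: "('a, 'f) ctensor"
  proof (induction z rule: ctensor_induct)
    case (pure a w)
    show ?case
      by (induction y rule: ctensor_induct)
        (simp_all only: tmul_ctens[OF bilin_mult bilin_tens] cassoc_ctens[OF \<Delta>] cassoc_add[OF \<Delta>] tadd
          comult_mult tmul_def[of "(*)" "(*)", symmetric] pure3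
          tmul_add_right[OF bilin_mult sesq_tmul[OF bilin_mult bilin_tens]])
  qed (simp only: tadd cassoc_add[OF \<Delta>] tmul_add_left[OF bilin_mult sesq_tmul[OF bilin_mult bilin_tens]])
  have right: "tmap \<delta>T (tmul (*) tn z y) = tmul (*) (tmul (*) tn) (tmap (coact X) z) (tmap (mcoact F) y)"
    for z :: "('a, 'w) ctensor" and y :: "('a, 'f) ctensor"
  proof (induction z rule: ctensor_induct)
    case (pure a w)
    show ?case
      by (induction y rule: ctensor_induct)
        (simp_all only: tmul_ctens[OF bilin_mult bilin_tens] tmap_ctens[OF coactT_linear] tmap_ctens[OF coact_linear]
          tmap_ctens[OF mcoact_linear] coactT_tens tmul_ctens[OF bilin_mult sesq_tmul[OF bilin_mult bilin_tens]] tadd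
          clinear_add[OF tmap_linear[OF coactT_linear]] clinear_add[OF tmap_linear[OF mcoact_linear]]
          tmul_add_right[OF bilin_mult sesq_tmul[OF bilin_mult bilin_tens]])
  qed (simp only: tadd clinear_add[OF tmap_linear[OF coactT_linear]] clinear_add[OF tmap_linear[OF coact_linear]]
      tmul_add_left[OF bilin_mult sesq_tmul[OF bilin_mult bilin_tens]])
  have "cassoc (hopf X) (\<delta>T x) = tmap \<delta>T (\<delta>T x)" for x
    by (induction x rule: tens_induct)
      (simp_all only: coactT_tens left right cassoc_comodule[OF coact_comodule] cassoc_comodule[OF mcoact_comodule]
        coactT_add cassoc_add[OF \<Delta>] clinear_add[OF tmap_linear[OF coactT_linear]])
  then show "ctensor_lift (\<lambda>a m. ctensor_lift (\<lambda>a1 a2. a1 \<otimes> a2 \<otimes> m) (comult (hopf X) a)) (\<delta>T x) =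
      ctensor_lift (\<lambda>a m. a \<otimes> \<delta>T m) (\<delta>T x)" for x
    by (simp add: cassoc_def tmap_def)
qed

text \<open>Products of generators generate: \<open>w \<otimes> b e = w b \<otimes> e\<close>, and \<open>w b\<close> is a left combination of the generators of the forms.\<close>

lemma tensor_finitely_generated: "finitely_generated (\<lambda>b. wd (emb X b))"
proof -
  obtain G1 where G1: "finite G1" "\<forall>w. \<exists>c. w = (\<Sum>e\<in>G1. emb X (c e) * e)"
    using forms_fg unfolding finitely_generated_def by (elim exE conjE)
  obtain G2 where G2: "finite G2" "\<forall>f. \<exists>c. f = (\<Sum>e\<in>G2. lact F (c e) e)"
    using module_fg unfolding finitely_generated_def by (elim exE conjE)
  define G where "G = (\<lambda>(w, f). tn w f) ` (G1 \<times> G2)"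
  have G: "finite G" using G1(1) G2(1) by (simp add: G_def)
  define R where "R = {m. \<exists>c. m = (\<Sum>e\<in>G. wd (emb X (c e)) e)}"
  have R_add: "x + y \<in> R" if xy: "x \<in> R" "y \<in> R" for x y
  proof -
    obtain c d where "x = (\<Sum>e\<in>G. wd (emb X (c e)) e)" "y = (\<Sum>e\<in>G. wd (emb X (d e)) e)"
      using xy unfolding R_def by (elim CollectE exE)
    then have "x + y = (\<Sum>e\<in>G. wd (emb X (c e + d e)) e)"
      by (simp add: clinear_add[OF emb_linear] sesq_add_left[OF bilin_wedge] sum.distrib)
    then show ?thesis unfolding R_def by (intro CollectI exI[of _ "\<lambda>e. c e + d e"])
  qed
  have R0: "0 \<in> R"
    unfolding R_def
    by (intro CollectI exI[of _ "\<lambda>_. 0"])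
      (simp add: clinear_zero[OF emb_linear] sesq_zero_left[OF bilin_wedge])
  have R_sum: "(\<Sum>i\<in>S. g i) \<in> R" if "\<And>i. i \<in> S \<Longrightarrow> g i \<in> R" for S :: "'i set" and g
    using that by (induction S rule: infinite_finite_induct) (auto simp: R0 R_add)
  have R_gen: "wd (emb X b) e \<in> R" if "e \<in> G" for b e
  proof -
    have "wd (emb X b) e = (\<Sum>e'\<in>G. wd (emb X (if e' = e then b else 0)) e')"
      using G that by (subst sum.remove[of _ e])
        (auto simp: clinear_zero[OF emb_linear] sesq_zero_left[OF bilin_wedge] intro!: sum.neutral)
    then show ?thesis unfolding R_def by (intro CollectI exI[of _ "\<lambda>e'. if e' = e then b else 0"])
  qed
  have "x \<in> R" for x
  proof (induction x rule: tens_induct)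
    case (pure w f)
    from spec[OF G2(2), of f] obtain c where c: "f = (\<Sum>e\<in>G2. lact F (c e) e)" ..
    have "tn w (lact F b e) \<in> R" if "e \<in> G2" for b e
    proof -
      from spec[OF G1(2), of "w * emb X b"] obtain d where d: "w * emb X b = (\<Sum>v\<in>G1. emb X (d v) * v)" ..
      have "tn w (lact F b e) = (\<Sum>v\<in>G1. wd (emb X (d v)) (tn v e))"
        by (simp add: tens_balance[symmetric] d sesq_sum_left[OF bilin_tens] wedge_tens)
      then show ?thesis
        using R_gen that by (auto simp: G_def intro!: R_sum)
    qed
    then show ?case unfolding c sesq_sum_right[OF bilin_tens] by (intro R_sum)
  qed (rule R_add)
  then show ?thesis
    using G unfolding finitely_generated_def R_def by (intro exI[of _ G]) simp
qed

lemma bilin_emb_wedge: "bilin (\<lambda>b. wd (emb X b))"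
  using bilin_wedge by (simp add: sesq_def clinear_add[OF emb_linear] clinear_scale[OF emb_linear])

lemma tensor_hopf_module: "hopf_module (hopf X) (incl X) (\<lambda>b. wd (emb X b)) \<delta>T"
proof unfold_locales
  show "bilin (\<lambda>b. wd (emb X b))" by (rule bilin_emb_wedge)
  show "wd (emb X 1) m = m" for m by (simp add: emb_one wedge_one)
  show "wd (emb X (b * c)) m = wd (emb X b) (wd (emb X c) m)" for b c m by (simp add: emb_mult wedge_mult)
  show "finitely_generated (\<lambda>b. wd (emb X b))" by (rule tensor_finitely_generated)
  show "left_comodule (hopf X) \<delta>T" by (rule coactT_comodule)
  show "\<delta>T (wd (emb X b) m) = tmul (*) (\<lambda>b. wd (emb X b)) (\<beta> b) (\<delta>T m)" for b m
    unfolding coactT_wedge coact_emb'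
    by (rule tmul_tmap_left[OF bilin_mult bilin_wedge bilin_emb_wedge emb_linear HOL.refl])
qed

subsection \<open>The metric\<close>

lemmas sesq_hform = weak_hermitian_form(1)[OF module_weak_hermitian]
lemmas sesq_gT = weak_hermitian_form(1)[OF tensor_weak_hermitian]

lemma balanced_metric_inner: "balT (\<lambda>v k. hform F f (lact F (metric X w v) k))"
  by (rule balT_I) (simp_all add: sesq_add_right[OF sesq_metric] sesq_add_left[OF bilin_lact]
      sesq_add_right[OF bilin_lact] sesq_add_right[OF sesq_hform] metric_right lact_mult)

lemma balanced_metric_outer: "balT (\<lambda>w f. tlift (\<lambda>v k. hform F f (lact F (metric X w v) k)) y)"
proof -
  define m where "m w f v k = hform F f (lact F (metric X w v) k)" for w f v k
  have m: "balT (m w f)" for w f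
    unfolding m_def by (rule balanced_metric_inner)
  note i = tlift_tens[OF m] tlift_add[OF m]
  have "balT (\<lambda>w f. tlift (m w f) y)"
  proof (rule balT_I)
    have "m (w + w') f v k = m w f v k + m w' f v k" for w w' f v k
      by (simp add: m_def sesq_add_left[OF sesq_metric] sesq_add_left[OF bilin_lact] sesq_add_right[OF sesq_hform])
    then show "tlift (m (w + w') f) y = tlift (m w f) y + tlift (m w' f) y" for w w' f
      by (induction y rule: tens_induct) (simp_all add: i)
    have "m w (f + f') v k = m w f v k + m w f' v k" for w f f' v k
      by (simp add: m_def sesq_add_left[OF sesq_hform])
    then show "tlift (m w (f + f')) y = tlift (m w f) y + tlift (m w f') y" for w f f'
      by (induction y rule: tens_induct) (simp_all add: i)
    have "m (w * emb X b) f v k = m w (lact F b f) v k" for w b f v k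
      by (simp add: m_def metric_left lact_mult star_star
          weak_hermitian_form(2)[OF module_weak_hermitian, of _ "b\<^sup>\<star>"])
    then show "tlift (m (w * emb X b) f) y = tlift (m w (lact F b f)) y" for w b f
      by (induction y rule: tens_induct) (simp_all add: i)
  qed
  then show ?thesis unfolding m_def .
qed

lemma metricT_tens: "gT (tn w f) (tn v k) = hform F f (lact F (metric X w v) k)"
  unfolding tensor_metric_def
  by (subst tlift_tens[OF balanced_metric_outer], rule tlift_tens[OF balanced_metric_inner])

lemma metricT_covariant: "\<beta> (gT x y) = tmul (\<lambda>a c. a\<^sup>\<star> * c) gT (\<delta>T x) (\<delta>T y)"
proof -
  note s1 = sesq_star_mult and gs = sesq_tmul[OF sesq_star_mult sesq_metric]
  have hcov: "\<beta> (hform F f k) = tmul (\<lambda>a c. a\<^sup>\<star> * c) (hform F) (mcoact F f) (mcoact F k)" for f k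
    unfolding hform_covariant tmul_def ..
  note adds = tmul_add_left[OF s1 sesq_hform] tmul_add_right[OF s1 sesq_hform]
    tmul_add_left[OF bilin_mult bilin_lact] tmul_add_right[OF bilin_mult bilin_lact]
    tmul_add_left[OF s1 sesq_metric] tmul_add_right[OF s1 sesq_metric]
    tmul_add_left[OF bilin_mult bilin_tens] tmul_add_right[OF bilin_mult bilin_tens]
    tmul_add_left[OF s1 sesq_gT] tmul_add_right[OF s1 sesq_gT]
  \<comment> \<open>With arbitrary tensors in place of the four coactions the identity can be checked on pure tensors.\<close>
  have core: "tmul (\<lambda>a c. a\<^sup>\<star> * c) (hform F) zf (tmul (*) (lact F) (tmul (\<lambda>a c. a\<^sup>\<star> * c) (metric X) zw zv) zk) =
      tmul (\<lambda>a c. a\<^sup>\<star> * c) gT (tmul (*) tn zw zf) (tmul (*) tn zv zk)"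
    for zf zk :: "('a, 'f) ctensor" and zw zv :: "('a, 'w) ctensor"
  proof (induction zf rule: ctensor_induct)
    case (pure a1 f)
    show ?case
    proof (induction zw rule: ctensor_induct)
      case (pure a2 w)
      show ?case
      proof (induction zv rule: ctensor_induct)
        case (pure a3 v)
        show ?case
          by (induction zk rule: ctensor_induct)
            (simp_all only: tmul_ctens[OF s1 sesq_hform] tmul_ctens[OF bilin_mult bilin_lact]
              tmul_ctens[OF s1 sesq_metric] tmul_ctens[OF bilin_mult bilin_tens] tmul_ctens[OF s1 sesq_gT]
              metricT_tens star_mult mult.assoc adds)
      qed (simp only: adds)
    qed (simp only: adds)
  qed (simp only: adds)
  have "\<beta> (gT (tn w f) y) = tmul (\<lambda>a c. a\<^sup>\<star> * c) gT (\<delta>T (tn w f)) (\<delta>T y)" for w f y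
    by (induction y rule: tens_induct)
      (simp_all only: metricT_tens hcov mcoact_lact metric_covariant core coactT_tens coactT_add
        sesq_add_right[OF sesq_gT] clinear_add[OF base_coaction_linear] adds)
  then show ?thesis
    by (induction x rule: tens_induct)
      (simp_all only: coactT_add sesq_add_left[OF sesq_gT] clinear_add[OF base_coaction_linear] adds)
qed

text \<open>The inner product of the module is invariant, so slices of the coaction have adjoints.\<close>

lemma inner_invariant: "invariant_form \<delta>T (module_inner X F)"
  unfolding module_inner_def
  by (rule invariant_form_of_covariant[OF cqga_axioms sesq_gT metricT_covariant])

subsection \<open>The Dolbeault operator\<close>

text \<open>The grading operator \<open>w \<mapsto> (-1)\<^sup>|\<^sup>w\<^sup>| w\<close>, in terms of which the Leibniz rule also holds for inhomogeneous forms.\<close>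

definition sg :: "'w \<Rightarrow> 'w" where "sg w = (\<Sum>k\<le>2 * halfdeg X. (-1) ^ k * fp k w)"

lemma sg_linear: "clinear sg"
  unfolding sg_def sign_scale
  by (rule clinearI) (simp_all add: clinear_add[OF dproj_linear[OF forms_direct_sum]]
      clinear_scale[OF dproj_linear[OF forms_direct_sum]] scaleC_add_right sum.distrib cvec.scale_sum_right
      scaleC_scaleC mult.commute)

lemma sg_form: "w \<in> Forms X k \<Longrightarrow> sg w = (-1) ^ k * w"
proof -
  assume w: "w \<in> Forms X k"
  note h = dproj_homogeneous[OF forms_direct_sum w]
  show ?thesis
  proof (cases "k \<le> 2 * halfdeg X")
    case True
    then have "sg w = (-1) ^ k * fp k w"
      unfolding sg_def by (subst sum.remove[of _ k]) (auto simp: h intro!: sum.neutral)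
    then show ?thesis by (simp add: h)
  next
    case False
    then have "w = 0" using forms_above[OF _ w] by simp
    then show ?thesis by (simp add: clinear_zero[OF sg_linear])
  qed
qed

lemma sg_emb_right: "sg (w * emb X b) = sg w * emb X b"
  by (simp add: sg_def fp_emb_right sum_distrib_right mult.assoc)

lemma coact_sg: "coact X (sg w) = tmap sg (coact X w)"
proof (rule coact_if_act_commutes[OF sg_linear])
  fix \<phi> :: "'a \<Rightarrow> complex" and w assume \<phi>: "cfunctional \<phi>"
  have "act \<phi> (fp k w) = fp k (act \<phi> w)" for k
    by (rule dproj_commute[OF forms_direct_sum act_linear[OF \<phi>] act_forms[OF \<phi>], symmetric])
  then show "act \<phi> (sg w) = sg (act \<phi> w)"
    unfolding sg_def sign_scale by (simp add: clinear_sum[OF act_linear[OF \<phi>]] clinear_scale[OF act_linear[OF \<phi>]])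
qed

lemma delbar_emb: "delbar X (w * emb X b) = delbar X w * emb X b + sg w * delbar X (emb X b)"
proof (induction w rule: graded_induct[OF forms_direct_sum])
  case (1 k w)
  then show ?case using delbar_leibniz[OF 1] sg_form[OF 1] by (simp add: mult.assoc)
next
  case (2 x y)
  then show ?case
    by (simp add: distrib_right clinear_add[OF delbar_linear] clinear_add[OF sg_linear] algebra_simps)
qed

lemma delbarT_alt: "dT = tlift (\<lambda>w f. tn (delbar X w) f + wd (sg w) (mdelbar F f))"
  by (rule ext) (simp add: tensor_delbar_def sg_def form_part_dproj)

lemma balanced_delbar: "balT (\<lambda>w f. tn (delbar X w) f + wd (sg w) (mdelbar F f))"
proof (rule balT_I)
  show "tn (delbar X (w * emb X b)) f + wd (sg (w * emb X b)) (mdelbar F f) =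
      tn (delbar X w) (lact F b f) + wd (sg w) (mdelbar F (lact F b f))" for w b f
    by (simp add: delbar_emb sg_emb_right mdelbar_leibniz wedge_add wedge_tens wedge_mult tens_balance
        sesq_add_left[OF bilin_tens] add_ac)
qed (simp_all add: clinear_add[OF delbar_linear] clinear_add[OF sg_linear] clinear_add[OF mdelbar_linear]
    sesq_add_left[OF bilin_tens] sesq_add_right[OF bilin_tens] sesq_add_left[OF bilin_wedge] wedge_add)

lemma delbarT_tens: "dT (tn w f) = tn (delbar X w) f + wd (sg w) (mdelbar F f)"
  and delbarT_add: "dT (x + y) = dT x + dT y"
  unfolding delbarT_alt by (rule tlift_tens[OF balanced_delbar], rule tlift_add[OF balanced_delbar])

lemma delbarT_linear: "clinear dT"
proof (rule clinearI[OF delbarT_add])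
  fix c x
  show "dT (c *\<^sub>C x) = c *\<^sub>C dT x"
  proof (induction x rule: tens_induct)
    case (pure w f)
    have "dT (c *\<^sub>C tn w f) = tn (delbar X (c *\<^sub>C w)) f + wd (sg (c *\<^sub>C w)) (mdelbar F f)"
      by (simp only: sesq_scale_left[OF bilin_tens, symmetric] delbarT_tens)
    then show ?case
      by (simp only: delbarT_tens clinear_scale[OF delbar_linear] clinear_scale[OF sg_linear]
          sesq_scale_left[OF bilin_tens] sesq_scale_left[OF bilin_wedge] scaleC_add_right)
  qed (simp add: delbarT_add scaleC_add_right)
qed

text \<open>Both summands of \<open>delbar w \<otimes> f + (-1)\<^sup>|\<^sup>w\<^sup>| w \<and> delbar f\<close> are composed of covariant maps.\<close>

lemma coactT_delbar: "\<delta>T (dT x) = tmap dT (\<delta>T x)"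
proof -
  note lT = tmap_linear[OF delbarT_linear]
  \<comment> \<open>With arbitrary tensors in place of the two coactions the identity can be checked on pure tensors.\<close>
  have core: "tmul (*) tn (tmap (delbar X) z) y + tmul (*) wd (tmap sg z) (tmap (mdelbar F) y) = tmap dT (tmul (*) tn z y)"
    for z :: "('a, 'w) ctensor" and y
  proof (induction z rule: ctensor_induct)
    case (pure a w)
    show ?case
    proof (induction y rule: ctensor_induct)
      case (pure c f)
      show ?case
        by (simp only: tmap_ctens delbar_linear sg_linear mdelbar_linear delbarT_linear tmul_ctens[OF bilin_mult bilin_tens]
            tmul_ctens[OF bilin_mult bilin_wedge] delbarT_tens ctens_add_right)
    next
      case (add y y')
      then show ?case
        by (simp add: tmul_add_right[OF bilin_mult bilin_tens] tmul_add_right[OF bilin_mult bilin_wedge]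
            clinear_add[OF tmap_linear[OF mdelbar_linear]] clinear_add[OF lT] add_ac flip: add.IH)
    qed
  next
    case (add z z')
    then show ?case
      by (simp add: tmul_add_left[OF bilin_mult bilin_tens] tmul_add_left[OF bilin_mult bilin_wedge]
          clinear_add[OF tmap_linear[OF delbar_linear]] clinear_add[OF tmap_linear[OF sg_linear]]
          clinear_add[OF lT] add_ac flip: add.IH)
  qed
  have m: "\<delta>T (mdelbar F f) = tmap (mdelbar F) (mcoact F f)" for f
    unfolding mdelbar_covariant tmap_def ..
  show ?thesis
  proof (induction x rule: tens_induct)
    case (pure w f)
    show ?case by (simp only: delbarT_tens coactT_add coactT_tens coactT_wedge coact_delbar coact_sg m core)
  qed (simp add: delbarT_add coactT_add clinear_add[OF lT])
qed

subsection \<open>The grading\<close>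

abbreviation TB where "TB \<equiv> tensor_biforms X F"

lemma TB_subspace: "cvec.subspace (TB ab)"
  by (simp add: tensor_biforms_def)

lemma tens_in_TB: "w \<in> BiForms X ab \<Longrightarrow> tn w f \<in> TB ab"
  unfolding tensor_biforms_def by (rule cvec.span_base) blast

lemma TB_induct [consumes 1, case_names zero step]:
  assumes "x \<in> TB ab" and "P 0" and "\<And>c w f y. w \<in> BiForms X ab \<Longrightarrow> P y \<Longrightarrow> P (c *\<^sub>C tn w f + y)"
  shows "P x"
  using assms(1) unfolding tensor_biforms_def
proof (induction rule: cvec.span_induct_alt)
  case base
  show ?case by (rule assms(2))
next
  case (step c x y)
  then obtain w f where "x = tn w f" "w \<in> BiForms X ab" by blast
  then show ?case using assms(3) step.IH by simp
qed

lemma TB_total: "x \<in> cvec.span (\<Union>ab. TB ab)"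
proof (induction x rule: tens_induct)
  case (pure w f)
  show ?case
  proof (induction w rule: biforms_induct)
    case (1 i w)
    show ?case by (rule cvec.span_base) (use tens_in_TB[OF 1] in blast)
  next
    case (2 x y)
    then show ?case by (simp only: sesq_add_left[OF bilin_tens] cvec.span_add)
  qed
qed (rule cvec.span_add)

lemma wedge_TB:
  assumes "w \<in> BiForms X (a, b)" "x \<in> TB (c, d)"
  shows "wd w x \<in> TB (a + c, b + d)"
  using assms(2)
proof (induction rule: TB_induct)
  case zero
  show ?case by (simp add: sesq_zero_right[OF bilin_wedge] cvec.subspace_0[OF TB_subspace])
next
  case (step k v f y)
  then show ?case
    by (simp add: sesq_add_right[OF bilin_wedge] sesq_scale_right[OF bilin_wedge] wedge_tens
        cvec.subspace_add[OF TB_subspace] cvec.subspace_scale[OF TB_subspace] tens_in_TB[OF biforms_mult[OF assms(1)]])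
qed

lemma delbarT_TB:
  assumes "x \<in> TB (a, b)"
  shows "dT x \<in> TB (a, b + 1)"
  using assms
proof (induction rule: TB_induct)
  case zero
  show ?case by (simp add: clinear_zero[OF delbarT_linear] cvec.subspace_0[OF TB_subspace])
next
  case (step k w f y)
  have "sg w \<in> BiForms X (a, b)"
    unfolding sg_form[OF biform_form[OF step(1)]] sign_scale by (rule cvec.subspace_scale[OF biforms_subspace step(1)])
  from wedge_TB[OF this mdelbar_degree[of f]] have "wd (sg w) (mdelbar F f) \<in> TB (a, b + 1)" by simp
  moreover have "tn (delbar X w) f \<in> TB (a, b + 1)" by (rule tens_in_TB[OF delbar_degree[OF step(1)]])
  ultimately show ?case
    using step(2) by (simp add: delbarT_add clinear_scale[OF delbarT_linear] delbarT_tens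
        cvec.subspace_add[OF TB_subspace] cvec.subspace_scale[OF TB_subspace])
qed

lemma metricT_orthogonal:
  assumes "x \<in> TB (a, b)" "y \<in> TB (c, d)" "(a, b) \<noteq> (c, d)"
  shows "gT x y = 0"
  using assms(1)
proof (induction rule: TB_induct)
  case (step k w f x)
  have "gT (tn w f) y = 0"
    using assms(2)
  proof (induction rule: TB_induct)
    case (step l v g y)
    then show ?case
      using metric_orthogonal[OF \<open>w \<in> BiForms X (a, b)\<close> step(1) assms(3)]
      by (simp add: sesq_add_right[OF sesq_gT] sesq_scale_right[OF sesq_gT] metricT_tens
          sesq_zero_left[OF bilin_lact] sesq_zero_right[OF sesq_hform])
  qed (rule sesq_zero_right[OF sesq_gT])
  then show ?case using step(2) by (simp add: sesq_add_left[OF sesq_gT] sesq_scale_left[OF sesq_gT])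
qed (rule sesq_zero_left[OF sesq_gT])

lemma TB_above:
  assumes b: "b > 2 * halfdeg X" and x: "x \<in> TB (0, b)"
  shows "x = 0"
  using x
proof (induction rule: TB_induct)
  case (step k w f y)
  then have "w = 0" using forms_above[OF _ biform_form[OF step(1)]] b by simp
  then show ?case using step(2) by (simp add: sesq_zero_left[OF bilin_tens])
qed simp

end

section \<open>Finite-dimensional subspaces and quotients\<close>

lemma finite_dimensional_basis:
  assumes "cvec.subspace E" "finite_dimensional E"
  obtains B where "finite B" "cvec.independent B" "cvec.span B = E" "card B = cvec.dim E"
proof -
  obtain B where B: "B \<subseteq> E" "cvec.independent B" "E \<subseteq> cvec.span B" "card B = cvec.dim E"
    using cvec.basis_exists[of E] by metis
  obtain S where "finite S" "E \<subseteq> cvec.span S" using assms(2) by (auto simp: finite_dimensional_def)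
  then have "finite B" using B(1,2) cvec.independent_span_bound[of S B] by auto
  moreover have "cvec.span B = E"
    using B(1,3) cvec.span_minimal[OF B(1) assms(1)] by auto
  ultimately show ?thesis using that B by blast
qed

text \<open>For a quotient basis \<open>S\<close> of \<open>V = K \<oplus> W\<close> modulo \<open>W\<close>, the projection to \<open>K\<close> maps \<open>S\<close> bijectively to a basis
  of \<open>K\<close>.\<close>

lemma quotient_basis_card:
  assumes K: "cvec.subspace K" and W: "cvec.subspace W" and V: "V = {k + w |k w. k \<in> K \<and> w \<in> W}"
    and KW: "K \<inter> W \<subseteq> {0}" and S: "quotient_basis S V W"
  obtains B where "cvec.independent B" "cvec.span B = K" "card B = card S" "finite S \<longleftrightarrow> finite B"
proof -
  have rep: "\<exists>!c. (\<forall>s. s \<notin> S \<longrightarrow> c s = 0) \<and> finite {s. c s \<noteq> 0} \<and>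
       v - (\<Sum>s | c s \<noteq> 0. c s *\<^sub>C s) \<in> W" if "v \<in> V" for v
    using S that by (simp add: quotient_basis_def)
  have "\<forall>s\<in>S. \<exists>k. k \<in> K \<and> s - k \<in> W"
    using S V by (force simp: quotient_basis_def)
  then obtain \<pi> where \<pi>: "\<And>s. s \<in> S \<Longrightarrow> \<pi> s \<in> K \<and> s - \<pi> s \<in> W" by metis
  have "0 \<in> V" unfolding V using cvec.subspace_0[OF K] cvec.subspace_0[OF W] by force
  have zero: "c s = 0" if F: "finite F" "F \<subseteq> S" and c: "(\<Sum>s\<in>F. c s *\<^sub>C \<pi> s) = 0" and s: "s \<in> F" for F c s
  proof -
    define c' where "c' s = (if s \<in> F then c s else 0)" for s
    have "(\<Sum>s | c' s \<noteq> 0. c' s *\<^sub>C s) = (\<Sum>s\<in>F. c s *\<^sub>C s)"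
      using F(1) by (intro sum.mono_neutral_cong_left) (auto simp: c'_def)
    also have "\<dots> = (\<Sum>s\<in>F. c s *\<^sub>C (s - \<pi> s))"
      using c by (simp add: cvec.scale_right_diff_distrib sum_subtractf)
    also have "\<dots> \<in> W"
      using F(2) \<pi> by (intro cvec.subspace_sum[OF W] cvec.subspace_scale[OF W]) auto
    finally have "0 - (\<Sum>s | c' s \<noteq> 0. c' s *\<^sub>C s) \<in> W"
      by (simp add: cvec.subspace_neg[OF W])
    moreover have "finite {s. c' s \<noteq> 0}" by (rule finite_subset[OF _ F(1)]) (auto simp: c'_def)
    moreover have "\<forall>s. s \<notin> S \<longrightarrow> c' s = 0" using F(2) by (auto simp: c'_def)
    ultimately have c': "(\<forall>s. s \<notin> S \<longrightarrow> c' s = 0) \<and> finite {s. c' s \<noteq> 0} \<and>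
        0 - (\<Sum>s | c' s \<noteq> 0. c' s *\<^sub>C s) \<in> W" by blast
    obtain g where g: "\<forall>h. (\<forall>s. s \<notin> S \<longrightarrow> h s = 0) \<and> finite {s. h s \<noteq> 0} \<and>
        0 - (\<Sum>s | h s \<noteq> 0. h s *\<^sub>C s) \<in> W \<longrightarrow> h = g"
      using rep[OF \<open>0 \<in> V\<close>] by (elim ex1E)
    have "c' = g" by (rule mp[OF spec[OF g] c'])
    moreover have "(\<lambda>_. 0) = g"
      by (rule mp[OF spec[OF g]]) (simp add: cvec.subspace_0[OF W])
    ultimately have "c' s = 0" by (metis (full_types))
    then show ?thesis using s by (simp add: c'_def)
  qed
  have inj: "inj_on \<pi> S"
  proof (rule inj_onI, rule ccontr)
    fix s t assume st: "s \<in> S" "t \<in> S" "\<pi> s = \<pi> t" "s \<noteq> t"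
    then have "(\<Sum>r\<in>{s, t}. (if r = s then 1 else - 1) *\<^sub>C \<pi> r) = 0" by simp
    from zero[OF _ _ this, of s] show False using st by simp
  qed
  have indep: "cvec.independent (\<pi> ` S)"
    unfolding cvec.independent_explicit_finite_subsets
  proof (intro allI impI ballI)
    fix A u v assume A: "A \<subseteq> \<pi> ` S" "finite A" "(\<Sum>v\<in>A. u v *\<^sub>C v) = 0" and v: "v \<in> A"
    define F where "F = {s \<in> S. \<pi> s \<in> A}"
    have im: "\<pi> ` F = A" using A(1) by (auto simp: F_def)
    have injF: "inj_on \<pi> F" by (rule inj_on_subset[OF inj]) (auto simp: F_def)
    have "finite F" using finite_imageD[OF _ injF] im A(2) by simp
    moreover have "(\<Sum>s\<in>F. u (\<pi> s) *\<^sub>C \<pi> s) = 0"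
      using A(3) sum.reindex[OF injF, of "\<lambda>v. u v *\<^sub>C v"] by (simp add: im)
    moreover obtain s where "s \<in> F" "v = \<pi> s" using v im by blast
    ultimately show "u v = 0" using zero[of F "\<lambda>s. u (\<pi> s)" s] by (auto simp: F_def)
  qed
  have span: "cvec.span (\<pi> ` S) = K"
  proof
    show "cvec.span (\<pi> ` S) \<subseteq> K" using \<pi> by (intro cvec.span_minimal[OF _ K]) auto
    show "K \<subseteq> cvec.span (\<pi> ` S)"
    proof
      fix k assume k: "k \<in> K"
      then have "k \<in> V" unfolding V using cvec.subspace_0[OF W] by force
      from ex1_implies_ex[OF rep[OF this]] obtain c where c: "\<forall>s. s \<notin> S \<longrightarrow> c s = 0" "finite {s. c s \<noteq> 0}"
        "k - (\<Sum>s | c s \<noteq> 0. c s *\<^sub>C s) \<in> W" by (elim exE conjE)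
      have cS: "s \<in> S" if "c s \<noteq> 0" for s using c(1) that by blast
      let ?p = "\<Sum>s | c s \<noteq> 0. c s *\<^sub>C \<pi> s"
      have "(\<Sum>s | c s \<noteq> 0. c s *\<^sub>C (s - \<pi> s)) \<in> W"
        using cS \<pi> by (intro cvec.subspace_sum[OF W] cvec.subspace_scale[OF W]) auto
      from cvec.subspace_add[OF W c(3) this] have "k - ?p \<in> W"
        by (simp add: cvec.scale_right_diff_distrib sum_subtractf)
      moreover have "?p \<in> K"
        using cS \<pi> by (intro cvec.subspace_sum[OF K] cvec.subspace_scale[OF K]) auto
      then have "k - ?p \<in> K" by (rule cvec.subspace_diff[OF K k])
      ultimately have "k - ?p = 0" using KW by blast
      then have "k = ?p" by simp
      also have "?p \<in> cvec.span (\<pi> ` S)"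
        using cS by (intro cvec.span_sum cvec.span_scale cvec.span_base) auto
      finally show "k \<in> cvec.span (\<pi> ` S)" .
    qed
  qed
  show ?thesis
    by (rule that[OF indep span card_image[OF inj]]) (use finite_imageD[OF _ inj] in blast)
qed

lemma quotient_dim_complement:
  assumes K: "cvec.subspace K" and W: "cvec.subspace W" and V: "V = {k + w |k w. k \<in> K \<and> w \<in> W}"
    and KW: "K \<inter> W \<subseteq> {0}" and fin: "finite_dimensional_quotient V W"
  shows "finite_dimensional K" "quotient_dim V W = cvec.dim K"
proof -
  obtain S where S: "finite S" "quotient_basis S V W"
    using fin by (auto simp: finite_dimensional_quotient_def)
  obtain B where B: "cvec.independent B" "cvec.span B = K" "card B = card S" "finite S \<longleftrightarrow> finite B"
    by (rule quotient_basis_card[OF K W V KW S(2)])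
  then show fK: "finite_dimensional K" using S(1) by (auto simp: finite_dimensional_def)
  define S' where "S' = (SOME S. quotient_basis S V W)"
  have "quotient_basis S' V W" unfolding S'_def using S(2) by (rule someI)
  then obtain B' where "cvec.independent B'" "cvec.span B' = K" "card B' = card S'"
    by (rule quotient_basis_card[OF K W V KW])
  then have "card S' = cvec.dim K" using cvec.dim_span_eq_card_independent by metis
  then show "quotient_dim V W = cvec.dim K" using fin by (simp add: quotient_dim_def S'_def)
qed

lemma dim_zero: "cvec.dim ({0} :: 'a::complex_vector set) = 0"
  using cvec.dim_span_eq_card_independent[OF cvec.independent_empty] by simp

lemma dim_direct_sum:
  assumes U: "cvec.subspace U" "finite_dimensional U" and W: "cvec.subspace W" "finite_dimensional W"
    and UW: "U \<inter> W \<subseteq> {0}"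
  shows "cvec.dim {u + w |u w. u \<in> U \<and> w \<in> W} = cvec.dim U + cvec.dim W"
proof -
  obtain A where A: "finite A" "cvec.independent A" "cvec.span A = U" "card A = cvec.dim U"
    by (rule finite_dimensional_basis[OF U])
  obtain B where B: "finite B" "cvec.independent B" "cvec.span B = W" "card B = cvec.dim W"
    by (rule finite_dimensional_basis[OF W])
  have "cvec.independent (A \<union> B') \<and> A \<inter> B' = {}" if "B' \<subseteq> B" for B'
    using finite_subset[OF that B(1)] that
  proof (induction B' rule: finite_induct)
    case empty
    then show ?case using A(2) by simp
  next
    case (insert b B')
    have "b \<notin> cvec.span (A \<union> B')"
    proof
      assume "b \<in> cvec.span (A \<union> B')"
      then obtain u w where uw: "b = u + w" "u \<in> cvec.span A" "w \<in> cvec.span B'"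
        unfolding cvec.span_Un by auto
      have B'W: "cvec.span B' \<subseteq> W" using insert.prems B(3) cvec.span_mono[of B' B] by auto
      have "b \<in> W" using insert.prems B(3) cvec.span_base by auto
      then have "b - w \<in> W" using uw(3) B'W by (intro cvec.subspace_diff[OF W(1)]) auto
      then have "u \<in> W" using uw(1) by simp
      then have "u = 0" using uw(2) UW A(3) by auto
      then have "b \<in> cvec.span B'" using uw by simp
      moreover have "cvec.independent (insert b B')"
        by (rule cvec.independent_mono[OF B(2) insert.prems])
      ultimately show False using insert.hyps(2) cvec.independent_insert[of b B'] by simp
    qed
    moreover from this have "b \<notin> A" using cvec.span_base[of b "A \<union> B'"] by blast
    ultimately show ?case
      using insert cvec.independent_insertI[of b "A \<union> B'"] by simp
  qed
  then have AB: "cvec.independent (A \<union> B)" "A \<inter> B = {}" by auto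
  have "{u + w |u w. u \<in> U \<and> w \<in> W} = cvec.span (A \<union> B)"
    unfolding cvec.span_Un A(3) B(3) by auto
  then show ?thesis
    using cvec.dim_span_eq_card_independent[OF AB(1)] card_Un_disjoint[OF A(1) B(1) AB(2)] A(4) B(4) by simp
qed

section \<open>Positive definite forms\<close>

locale definite_form =
  fixes s :: "'t::complex_vector \<Rightarrow> 't \<Rightarrow> complex"
  assumes s_form: "cform s"
    and s_herm: "s x y = cnj (s y x)"
    and s_definite: "s x x = 0 \<Longrightarrow> x = 0"
begin

lemma s_add_left: "s (x + x') y = s x y + s x' y"
  and s_add_right: "s x (y + y') = s x y + s x y'"
  and s_scale_left: "s (c *\<^sub>C x) y = cnj c * s x y"
  and s_scale_right: "s x (c *\<^sub>C y) = c * s x y"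
  using s_form by (simp_all add: cform_def)

lemma s_zero: "s x 0 = 0" "s 0 x = 0"
  using s_scale_right[of x 0 0] s_scale_left[of 0 0 x] by simp_all

lemma s_diff: "s x (y - z) = s x y - s x z"
  using s_add_right[of x "y - z" z] by simp

lemma s_sym_zero: "s x y = 0 \<Longrightarrow> s y x = 0"
  using s_herm[of y x] by simp

lemma riesz_finite:
  assumes "finite S" and "\<And>x y. f (x + y) = f x + f y" and "\<And>c x. f (c *\<^sub>C x) = cnj c * f x"
  shows "\<exists>z\<in>cvec.span S. \<forall>x\<in>cvec.span S. f x = s x z"
  using assms
proof (induction S arbitrary: f rule: finite_induct)
  case empty
  have "f 0 = 0" using empty(2)[of 0 0] by simp
  then show ?case by (simp add: s_zero)
next
  case (insert e S)
  obtain p where p: "p \<in> cvec.span S" "\<forall>x\<in>cvec.span S. s x e = s x p"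
    using insert.IH[of "\<lambda>x. s x e"] s_add_left s_scale_left by blast
  obtain z where z: "z \<in> cvec.span S" "\<forall>x\<in>cvec.span S. f x = s x z"
    using insert.IH[of f] insert.prems by blast
  \<comment> \<open>The part of \<open>e\<close> orthogonal to the span of \<open>S\<close>; it vanishes if \<open>e\<close> lies in this span.\<close>
  define q where "q = e - p"
  have q: "s x q = 0" if "x \<in> cvec.span S" for x
    using p(2) that by (simp add: q_def s_diff)
  have mono: "cvec.span S \<subseteq> cvec.span (insert e S)" by (rule cvec.span_mono) blast
  have q_in: "q \<in> cvec.span (insert e S)"
    unfolding q_def by (rule cvec.span_diff[OF cvec.span_base subsetD[OF mono p(1)]]) simp
  have dec: "\<exists>y c. y \<in> cvec.span S \<and> x = y + c *\<^sub>C q" if x: "x \<in> cvec.span (insert e S)" for x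
  proof -
    obtain k where k: "x - k *\<^sub>C e \<in> cvec.span S" using x unfolding cvec.span_breakdown_eq by blast
    have "(x - k *\<^sub>C e) + k *\<^sub>C p \<in> cvec.span S" using k p(1) by (intro cvec.span_add cvec.span_scale)
    moreover have "x = ((x - k *\<^sub>C e) + k *\<^sub>C p) + k *\<^sub>C q"
      by (simp add: q_def cvec.scale_right_diff_distrib)
    ultimately show ?thesis by blast
  qed
  define c where "c = (if q = 0 then 0 else f q / s q q)"
  have fq: "f q = c * s q q"
    using s_definite[of q] insert.prems(1)[of 0 0] by (auto simp: c_def)
  show ?case
  proof (intro bexI ballI)
    show "z + c *\<^sub>C q \<in> cvec.span (insert e S)"
      using z(1) mono q_in by (intro cvec.span_add cvec.span_scale) auto
    fix x assume "x \<in> cvec.span (insert e S)"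
    then obtain y k where y: "y \<in> cvec.span S" "x = y + k *\<^sub>C q" using dec by blast
    show "f x = s x (z + c *\<^sub>C q)"
      using z(2) y(1) q[OF y(1)] s_sym_zero[OF q[OF z(1)]]
      by (simp add: y(2) insert.prems fq s_add_left s_add_right s_scale_left s_scale_right)
  qed
qed

lemma riesz:
  assumes "cvec.subspace E" "finite_dimensional E"
    and "\<And>x y. f (x + y) = f x + f y" "\<And>c x. f (c *\<^sub>C x) = cnj c * f x"
  obtains z where "z \<in> E" "\<And>x. x \<in> E \<Longrightarrow> f x = s x z"
proof -
  obtain B where "finite B" "cvec.span B = E" using finite_dimensional_basis[OF assms(1,2)] by metis
  then show ?thesis using riesz_finite[of B f] assms(3,4) that by blast
qed

lemma projection:
  assumes "cvec.subspace E" "finite_dimensional E"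
  obtains p where "p \<in> E" "\<And>x. x \<in> E \<Longrightarrow> s x (v - p) = 0"
proof -
  obtain p where "p \<in> E" "\<And>x. x \<in> E \<Longrightarrow> s x v = s x p"
    by (rule riesz[OF assms, of "\<lambda>x. s x v"]) (simp_all add: s_add_left s_scale_left)
  then show ?thesis using that by (simp add: s_diff)
qed

end

subsection \<open>Adjoints for operators commuting with a large *-algebra\<close>

text \<open>For \<open>\<Phi>\<close> think of the slices of a coaction.  The space in the last assumption consists of the elements killed by all
  operators in \<open>\<Phi>\<close> that kill the \<open>\<Phi>\<close>-submodule generated by \<open>Y\<close>.  This submodule itself need not be preserved by \<open>d\<close>, but
  the larger space is, as \<open>p x = 0\<close> implies \<open>p (d x) = 0\<close>.\<close>

locale commuting_operator = definite_form s
  for s :: "'t::complex_vector \<Rightarrow> 't \<Rightarrow> complex" +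
  fixes \<Phi> :: "('t \<Rightarrow> 't) set" and d :: "'t \<Rightarrow> 't"
  assumes d_linear: "clinear d"
    and id_in: "(\<lambda>x. x) \<in> \<Phi>"
    and comp_in: "p \<in> \<Phi> \<Longrightarrow> r \<in> \<Phi> \<Longrightarrow> (\<lambda>x. p (r x)) \<in> \<Phi>"
    and op_linear: "p \<in> \<Phi> \<Longrightarrow> clinear p"
    and op_adjoint: "p \<in> \<Phi> \<Longrightarrow> \<exists>p'\<in>\<Phi>. \<forall>x y. s x (p y) = s (p' x) y"
    and op_commute: "p \<in> \<Phi> \<Longrightarrow> d (p x) = p (d x)"
    and env_finite: "finite Y \<Longrightarrow>
      finite_dimensional {y. \<forall>p\<in>\<Phi>. (\<forall>r\<in>\<Phi>. \<forall>x\<in>Y. p (r x) = 0) \<longrightarrow> p y = 0}"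
begin

definition env :: "'t set \<Rightarrow> 't set"
  where "env Y = {y. \<forall>p\<in>\<Phi>. (\<forall>r\<in>\<Phi>. \<forall>x\<in>Y. p (r x) = 0) \<longrightarrow> p y = 0}"

lemma env_D: "y \<in> env Y \<Longrightarrow> p \<in> \<Phi> \<Longrightarrow> (\<And>r x. r \<in> \<Phi> \<Longrightarrow> x \<in> Y \<Longrightarrow> p (r x) = 0) \<Longrightarrow> p y = 0"
  and env_I: "(\<And>p. p \<in> \<Phi> \<Longrightarrow> (\<And>r x. r \<in> \<Phi> \<Longrightarrow> x \<in> Y \<Longrightarrow> p (r x) = 0) \<Longrightarrow> p y = 0) \<Longrightarrow> y \<in> env Y"
  unfolding env_def by blast+

lemma env_subspace: "cvec.subspace (env Y)"
proof (rule cvec.subspaceI)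
  show "0 \<in> env Y" by (rule env_I) (simp add: clinear_zero[OF op_linear])
  show "x + y \<in> env Y" if x: "x \<in> env Y" and y: "y \<in> env Y" for x y
  proof (rule env_I)
    fix p assume p: "p \<in> \<Phi>" and ann: "\<And>r x. r \<in> \<Phi> \<Longrightarrow> x \<in> Y \<Longrightarrow> p (r x) = 0"
    have "p x = 0" by (rule env_D[OF x p]) (rule ann)
    moreover have "p y = 0" by (rule env_D[OF y p]) (rule ann)
    ultimately show "p (x + y) = 0" by (simp add: clinear_add[OF op_linear[OF p]])
  qed
  show "c *\<^sub>C x \<in> env Y" if x: "x \<in> env Y" for c x
  proof (rule env_I)
    fix p assume p: "p \<in> \<Phi>" and ann: "\<And>r x. r \<in> \<Phi> \<Longrightarrow> x \<in> Y \<Longrightarrow> p (r x) = 0"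
    have "p x = 0" by (rule env_D[OF x p]) (rule ann)
    then show "p (c *\<^sub>C x) = 0" by (simp add: clinear_scale[OF op_linear[OF p]])
  qed
qed

lemma env_fd: "finite Y \<Longrightarrow> finite_dimensional (env Y)"
  unfolding env_def by (rule env_finite)

lemma env_base: "x \<in> Y \<Longrightarrow> x \<in> env Y"
  by (rule env_I) (use id_in in force)

lemma env_mono: "Y \<subseteq> Y' \<Longrightarrow> env Y \<subseteq> env Y'"
  unfolding env_def by blast

lemma env_op:
  assumes "r \<in> \<Phi>" "y \<in> env Y"
  shows "r y \<in> env Y"
proof (rule env_I)
  fix p assume p: "p \<in> \<Phi>" and ann: "\<And>r x. r \<in> \<Phi> \<Longrightarrow> x \<in> Y \<Longrightarrow> p (r x) = 0"
  show "p (r y) = 0"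
    by (rule env_D[OF assms(2) comp_in[OF p assms(1)]]) (rule ann[OF comp_in[OF assms(1)]])
qed

lemma env_d: "y \<in> env Y \<Longrightarrow> d y \<in> env Y"
proof (rule env_I)
  fix p assume y: "y \<in> env Y" and p: "p \<in> \<Phi>" and ann: "\<And>r x. r \<in> \<Phi> \<Longrightarrow> x \<in> Y \<Longrightarrow> p (r x) = 0"
  have "p y = 0" by (rule env_D[OF y p]) (rule ann)
  then show "p (d y) = 0" using op_commute[OF p, of y] clinear_zero[OF d_linear] by simp
qed

text \<open>The adjoint within a finite-dimensional \<open>env Y'\<close> commutes with the *-algebra as well, so it preserves the smaller
  \<open>env Y\<close>, where it is determined by \<open>d\<close>; hence it does not depend on \<open>Y'\<close>.\<close>

lemma adjoint_exists:
  assumes Y: "finite Y" and y: "y \<in> env Y"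
  shows "\<exists>z\<in>env Y. \<forall>x. s (d x) y = s x z"
proof -
  have ex: "\<exists>z\<in>env Y. \<forall>x\<in>env Y'. s (d x) y = s x z" if Y': "finite Y'" "Y \<subseteq> Y'" for Y'
  proof -
    obtain z where z: "z \<in> env Y'" "\<And>x. x \<in> env Y' \<Longrightarrow> s (d x) y = s x z"
      by (rule riesz[OF env_subspace env_fd[OF Y'(1)], of "\<lambda>x. s (d x) y"])
        (auto simp: clinear_add[OF d_linear] clinear_scale[OF d_linear] s_add_left s_scale_left)
    have "z \<in> env Y"
    proof (rule env_I)
      fix p assume p: "p \<in> \<Phi>" and ann: "\<And>r x. r \<in> \<Phi> \<Longrightarrow> x \<in> Y \<Longrightarrow> p (r x) = 0"
      have py: "p y = 0" by (rule env_D[OF y p]) (rule ann)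
      obtain p' where p': "p' \<in> \<Phi>" "\<forall>x y. s x (p y) = s (p' x) y" using op_adjoint[OF p] by blast
      have pz: "p z \<in> env Y'" by (rule env_op[OF p z(1)])
      have "s (p z) (p z) = s (d (p' (p z))) y"
        using p'(2) z(2)[OF env_op[OF p'(1) pz]] by simp
      also have "\<dots> = s (d (p z)) (p y)" using p'(2) op_commute[OF p'(1)] by simp
      finally show "p z = 0" using s_definite by (simp add: py s_zero)
    qed
    then show ?thesis using z(2) by blast
  qed
  obtain z where z: "z \<in> env Y" "\<forall>x\<in>env Y. s (d x) y = s x z" using ex[OF Y] by blast
  have "s (d x) y = s x z" for x
  proof -
    obtain z' where z': "z' \<in> env Y" "\<forall>x\<in>env (insert x Y). s (d x) y = s x z'"
      using ex[of "insert x Y"] Y by blast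
    have "s (z - z') (z - z') = 0"
    proof -
      have m: "z - z' \<in> env Y" by (rule cvec.subspace_diff[OF env_subspace z(1) z'(1)])
      then have m': "z - z' \<in> env (insert x Y)" using env_mono[of Y "insert x Y"] by blast
      have "s (z - z') z = s (z - z') z'" using bspec[OF z(2) m] bspec[OF z'(2) m'] by simp
      then show ?thesis by (simp add: s_diff)
    qed
    then have "z = z'" using s_definite[of "z - z'"] by simp
    then show ?thesis using z'(2) env_base[of x "insert x Y"] by blast
  qed
  then show ?thesis using z(1) by blast
qed

definition adj :: "'t \<Rightarrow> 't" where "adj y = (THE z. \<forall>x. s (d x) y = s x z)"

lemma adj_unique: "\<forall>x. s (d x) y = s x z \<Longrightarrow> adj y = z"
  unfolding adj_def
proof (rule the_equality)
  fix z' assume "\<forall>x. s (d x) y = s x z" "\<forall>x. s (d x) y = s x z'"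
  then have "s (z' - z) (z' - z) = 0" by (simp add: s_diff)
  then show "z' = z" using s_definite[of "z' - z"] by simp
qed

lemma adj_env: "finite Y \<Longrightarrow> y \<in> env Y \<Longrightarrow> adj y \<in> env Y"
  using adjoint_exists[of Y y] adj_unique[of y] by blast

lemma adj: "s (d x) y = s x (adj y)"
  using adjoint_exists[of "{y}" y] env_base[of y "{y}"] adj_unique[of y] by blast

end

section \<open>Hodge decomposition of a graded complex\<close>

text \<open>The Dolbeault complex with its inner product; the last assumption takes the place of ellipticity.\<close>

locale graded_complex = definite_form s
  for s :: "'t::complex_vector \<Rightarrow> 't \<Rightarrow> complex" +
  fixes d dadj :: "'t \<Rightarrow> 't" and V :: "nat \<Rightarrow> 't set" and N :: nat
  assumes d_linear: "clinear d"
    and d_adj: "s (d x) y = s x (dadj y)"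
    and d_d: "d (d x) = 0"
    and V_subspace: "cvec.subspace (V k)"
    and V_d: "x \<in> V k \<Longrightarrow> d x \<in> V (Suc k)"
    and V_dadj: "x \<in> V (Suc k) \<Longrightarrow> dadj x \<in> V k"
    and V_dadj_0: "x \<in> V 0 \<Longrightarrow> dadj x = 0"
    and V_orthogonal: "x \<in> V j \<Longrightarrow> y \<in> V k \<Longrightarrow> j \<noteq> k \<Longrightarrow> s x y = 0"
    and V_above: "k > N \<Longrightarrow> x \<in> V k \<Longrightarrow> x = 0"
    and invariant_subspace: "\<exists>E. cvec.subspace E \<and> finite_dimensional E \<and> x \<in> E \<and> (\<forall>y\<in>E. d y \<in> E \<and> dadj y \<in> E)"
begin

lemma s_eqI:
  assumes "\<And>x. s x y = s x z"
  shows "y = z"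
proof -
  have "s (y - z) (y - z) = 0" by (simp only: s_diff assms diff_self)
  then show ?thesis using s_definite[of "y - z"] by simp
qed

lemma dadj_linear: "clinear dadj"
  by (rule clinearI; rule s_eqI) (simp_all add: d_adj[symmetric] s_add_right s_scale_right)

definition D where "D x = d x + dadj x"

lemma D_linear: "clinear D"
  unfolding D_def by (rule clinearI)
    (simp_all add: clinear_add[OF d_linear] clinear_add[OF dadj_linear] clinear_scale[OF d_linear]
      clinear_scale[OF dadj_linear] scaleC_add_right add_ac)

lemma D_symmetric: "s (D x) y = s x (D y)"
proof -
  have "s (dadj x) y = cnj (s (d y) x)" unfolding d_adj by (rule s_herm)
  also have "\<dots> = s x (d y)" by (rule s_herm[symmetric])
  finally show ?thesis by (simp add: D_def s_add_left s_add_right d_adj add.commute)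
qed

text \<open>The ranges of \<open>d\<close> and of its adjoint are orthogonal, because \<open>d\<close> squares to zero.\<close>

lemma D_zero:
  assumes "D x = 0"
  shows "d x = 0" "dadj x = 0"
proof -
  have e: "d x = (-1) *\<^sub>C dadj x" using assms by (simp add: D_def eq_neg_iff_add_eq_0)
  have "s (d x) (dadj x) = 0" unfolding d_adj[symmetric] d_d by (rule s_zero)
  then have "s (d x) (d x) = 0" by (subst (2) e) (simp add: s_scale_right del: cvec.scale_minus_left)
  then show "d x = 0" by (rule s_definite)
  then show "dadj x = 0" using assms by (simp add: D_def)
qed

text \<open>The part of the complex in the degrees satisfying \<open>P\<close>; with \<open>P\<close> one of \<open>even\<close> and \<open>odd\<close>, and \<open>Q\<close> the other, both
  parities are treated at once.\<close>

definition G where "G P = cvec.span (\<Union>k\<in>{k. P k}. V k)"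

lemma G_base: "P k \<Longrightarrow> x \<in> V k \<Longrightarrow> x \<in> G P"
  unfolding G_def by (rule cvec.span_base) blast

lemma G_subspace: "cvec.subspace (G P)"
  by (simp add: G_def)

lemma G_components:
  assumes "x \<in> G P"
  obtains f where "\<And>k. f k \<in> V k" "\<And>k. \<not> P k \<Longrightarrow> f k = 0" "x = (\<Sum>k\<le>N. f k)"
proof -
  have "\<exists>f. (\<forall>k. f k \<in> V k) \<and> (\<forall>k. \<not> P k \<longrightarrow> f k = 0) \<and> x = (\<Sum>k\<le>N. f k)"
    using assms unfolding G_def
  proof (induction rule: cvec.span_induct_alt)
    case base
    show ?case by (rule exI[of _ "\<lambda>_. 0"]) (simp add: cvec.subspace_0[OF V_subspace])
  next
    case (step c x y)
    then obtain j f where j: "P j" "x \<in> V j"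
      and f: "\<forall>k. f k \<in> V k" "\<forall>k. \<not> P k \<longrightarrow> f k = 0" "y = (\<Sum>k\<le>N. f k)" by blast
    define g where "g k = (if k = j then c *\<^sub>C x else 0) + f k" for k
    have "c *\<^sub>C x = (\<Sum>k\<le>N. if k = j then c *\<^sub>C x else 0)"
      using V_above[of j x] j(2) by (cases "j \<le> N") auto
    then have "c *\<^sub>C x + y = (\<Sum>k\<le>N. g k)" by (simp add: g_def sum.distrib f(3))
    moreover have "g k \<in> V k" for k
      using f(1) j(2) by (auto simp: g_def intro: cvec.subspace_add[OF V_subspace] cvec.subspace_scale[OF V_subspace])
    moreover have "g k = 0" if "\<not> P k" for k using that f(2) j(1) by (auto simp: g_def)
    ultimately show ?case by blast
  qed
  then show ?thesis using that by blast
qed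

lemma D_G:
  assumes PQ: "\<And>k. P k \<Longrightarrow> Q (Suc k)" "\<And>k. P (Suc k) \<Longrightarrow> Q k" and x: "x \<in> G P"
  shows "D x \<in> G Q"
  using x unfolding G_def[of P]
proof (induction rule: cvec.span_induct_alt)
  case base
  show ?case by (simp add: clinear_zero[OF D_linear] cvec.subspace_0[OF G_subspace])
next
  case (step c x y)
  then obtain k where k: "P k" "x \<in> V k" by blast
  have "d x \<in> G Q" by (rule G_base[where P = Q, OF PQ(1)[OF k(1)] V_d[OF k(2)]])
  moreover have "dadj x \<in> G Q"
  proof (cases k)
    case 0
    then show ?thesis using V_dadj_0 k(2) cvec.subspace_0[OF G_subspace] by simp
  next
    case (Suc j)
    then show ?thesis using G_base[where P = Q, OF PQ(2)[of j] V_dadj[of x j]] k by simp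
  qed
  ultimately have "D x \<in> G Q" unfolding D_def by (rule cvec.subspace_add[OF G_subspace])
  then show ?case
    using step(2) by (simp add: clinear_add[OF D_linear] clinear_scale[OF D_linear]
        cvec.subspace_add[OF G_subspace] cvec.subspace_scale[OF G_subspace])
qed

lemma finite_dimensional_image:
  assumes "clinear f" "finite_dimensional E"
  shows "finite_dimensional (f ` E)"
proof -
  obtain S where "finite S" "E \<subseteq> cvec.span S" using assms(2) by (auto simp: finite_dimensional_def)
  then have "finite (f ` S)" "f ` E \<subseteq> cvec.span (f ` S)"
    using clinear_span_image[OF assms(1)] by auto
  then show ?thesis unfolding finite_dimensional_def by blast
qed

lemma subspace_image:
  assumes f: "clinear f" and E: "cvec.subspace E"
  shows "cvec.subspace (f ` E)"
proof (rule cvec.subspaceI)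
  show "0 \<in> f ` E" using cvec.subspace_0[OF E] clinear_zero[OF f] by (metis imageI)
  show "x + y \<in> f ` E" if xy: "x \<in> f ` E" "y \<in> f ` E" for x y
  proof -
    obtain u v where "u \<in> E" "v \<in> E" "x = f u" "y = f v" using xy by blast
    then show ?thesis using cvec.subspace_add[OF E] clinear_add[OF f] by (metis imageI)
  qed
  show "c *\<^sub>C x \<in> f ` E" if x: "x \<in> f ` E" for c x
  proof -
    obtain u where "u \<in> E" "x = f u" using x by blast
    then show ?thesis using cvec.subspace_scale[OF E] clinear_scale[OF f] by (metis imageI)
  qed
qed

definition ker where "ker P = {x \<in> G P. D x = 0}"

lemma ker_subspace: "cvec.subspace (ker P)"
  unfolding ker_def
  by (rule cvec.subspaceI)
    (simp_all add: clinear_zero[OF D_linear] clinear_add[OF D_linear] clinear_scale[OF D_linear]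
      cvec.subspace_0[OF G_subspace] cvec.subspace_add[OF G_subspace] cvec.subspace_scale[OF G_subspace])

text \<open>In a finite-dimensional invariant subspace orthogonal projections exist, and as \<open>D\<close> is symmetric the orthogonal
  complement of its image is its kernel.\<close>

lemma hodge_decomposition:
  assumes PQ: "\<And>k. P k \<Longrightarrow> Q (Suc k)" "\<And>k. P (Suc k) \<Longrightarrow> Q k"
    and QP: "\<And>k. Q k \<Longrightarrow> P (Suc k)" "\<And>k. Q (Suc k) \<Longrightarrow> P k" and x: "x \<in> G P"
  obtains r y where "r \<in> ker P" "y \<in> G Q" "x = r + D y"
proof -
  obtain E where E: "cvec.subspace E" "finite_dimensional E" "x \<in> E" "\<forall>y\<in>E. d y \<in> E \<and> dadj y \<in> E"
    using invariant_subspace by blast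
  have DE: "D y \<in> E" if "y \<in> E" for y
    unfolding D_def using E(4) that by (intro cvec.subspace_add[OF E(1)]) auto
  define E' where "E' = D ` (E \<inter> G Q)"
  have E': "cvec.subspace E'" "finite_dimensional E'"
    unfolding E'_def
    by (rule subspace_image[OF D_linear cvec.subspace_inter[OF E(1) G_subspace]],
        rule finite_dimensional_image[OF D_linear finite_dimensional_mono[OF E(2)]]) blast
  obtain p where p: "p \<in> E'" "\<And>e. e \<in> E' \<Longrightarrow> s e (x - p) = 0" by (rule projection[OF E']) blast
  then obtain y where y: "y \<in> E" "y \<in> G Q" "p = D y" by (auto simp: E'_def)
  define r where "r = x - p"
  have pG: "p \<in> G P" unfolding y(3) by (rule D_G[where P = Q and Q = P, OF QP y(2)])
  have r: "r \<in> E" "r \<in> G P"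
    unfolding r_def using E(3) DE[OF y(1)] x pG
    by (auto simp: y(3) intro: cvec.subspace_diff[OF E(1)] cvec.subspace_diff[OF G_subspace])
  have "D r \<in> G Q" by (rule D_G[where P = P and Q = Q, OF PQ r(2)])
  then have "D (D r) \<in> E'" using DE[OF r(1)] by (auto simp: E'_def)
  from p(2)[OF this] have "s (D r) (D r) = 0" unfolding r_def[symmetric] D_symmetric[symmetric] .
  then have "D r = 0" by (rule s_definite)
  then have "r \<in> ker P" using r(2) by (simp add: ker_def)
  moreover have "x = r + D y" by (simp add: r_def y(3))
  ultimately show ?thesis using that y(2) by blast
qed

subsection \<open>Harmonic representatives of cohomology classes\<close>

definition harm where "harm k = {x \<in> V k. d x = 0 \<and> dadj x = 0}"
definition cocyc where "cocyc k = {x \<in> V k. d x = 0}"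
definition cob where "cob k = (case k of 0 \<Rightarrow> {0} | Suc l \<Rightarrow> d ` V l)"

lemma harm_subspace: "cvec.subspace (harm k)"
  unfolding harm_def
  by (rule cvec.subspaceI)
    (simp_all add: clinear_zero[OF d_linear] clinear_add[OF d_linear] clinear_scale[OF d_linear]
      clinear_zero[OF dadj_linear] clinear_add[OF dadj_linear] clinear_scale[OF dadj_linear]
      cvec.subspace_0[OF V_subspace] cvec.subspace_add[OF V_subspace] cvec.subspace_scale[OF V_subspace])

lemma cob_subspace: "cvec.subspace (cob k)"
  by (cases k) (simp_all add: cob_def subspace_image[OF d_linear V_subspace])

lemma harm_cob: "harm k \<inter> cob k \<subseteq> {0}"
proof
  fix x assume x: "x \<in> harm k \<inter> cob k"
  show "x \<in> {0}"
  proof (cases k)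
    case (Suc l)
    then obtain u where "x = d u" using x by (auto simp: cob_def)
    then have "s x x = 0" using x d_adj[of u x] by (simp add: harm_def s_zero)
    then show ?thesis using s_definite by simp
  qed (use x in \<open>simp add: cob_def\<close>)
qed

text \<open>The same argument for \<open>d\<close>: in a finite-dimensional invariant subspace the orthogonal complement of the image of \<open>d\<close> is
  the kernel of the adjoint.\<close>

lemma cocyc_decomposition: "cocyc k = {r + w |r w. r \<in> harm k \<and> w \<in> cob k}"
proof
  show "{r + w |r w. r \<in> harm k \<and> w \<in> cob k} \<subseteq> cocyc k"
  proof clarify
    fix r w assume r: "r \<in> harm k" and w: "w \<in> cob k"
    have "w \<in> V k \<and> d w = 0"
      using w cvec.subspace_0[OF V_subspace] V_d clinear_zero[OF d_linear] by (cases k) (auto simp: cob_def d_d)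
    then show "r + w \<in> cocyc k"
      using r by (simp add: harm_def cocyc_def clinear_add[OF d_linear] cvec.subspace_add[OF V_subspace])
  qed
  show "cocyc k \<subseteq> {r + w |r w. r \<in> harm k \<and> w \<in> cob k}"
  proof
    fix x assume x: "x \<in> cocyc k"
    have "\<exists>r w. x = r + w \<and> r \<in> harm k \<and> w \<in> cob k"
    proof (cases k)
      case 0
      then show ?thesis
        using x V_dadj_0 by (intro exI[of _ x] exI[of _ 0]) (simp add: cocyc_def harm_def cob_def)
    next
      case (Suc l)
      have x': "x \<in> V (Suc l)" "d x = 0" using x Suc by (auto simp: cocyc_def)
      obtain E where E: "cvec.subspace E" "finite_dimensional E" "x \<in> E" "\<forall>y\<in>E. d y \<in> E \<and> dadj y \<in> E"
        using invariant_subspace by blast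
      define E' where "E' = d ` (E \<inter> V l)"
      have E': "cvec.subspace E'" "finite_dimensional E'"
        unfolding E'_def
        by (rule subspace_image[OF d_linear cvec.subspace_inter[OF E(1) V_subspace]],
            rule finite_dimensional_image[OF d_linear finite_dimensional_mono[OF E(2)]]) blast
      obtain p where p: "p \<in> E'" "\<And>e. e \<in> E' \<Longrightarrow> s e (x - p) = 0" by (rule projection[OF E']) blast
      then obtain y where y: "y \<in> E" "y \<in> V l" "p = d y" by (auto simp: E'_def)
      define r where "r = x - p"
      have r: "r \<in> E" "r \<in> V (Suc l)" "d r = 0"
        unfolding r_def using E(3,4) y x' V_d[OF y(2)]
        by (auto simp: y(3) clinear_diff[OF d_linear] d_d intro: cvec.subspace_diff[OF E(1)] cvec.subspace_diff[OF V_subspace])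
      have "d (dadj r) \<in> E'" using E(4) r(1) V_dadj[OF r(2)] by (auto simp: E'_def)
      from p(2)[OF this] have "s (dadj r) (dadj r) = 0" unfolding r_def[symmetric] d_adj .
      then have "dadj r = 0" by (rule s_definite)
      then have "r \<in> harm k" using r Suc by (simp add: harm_def)
      moreover have "p \<in> cob k" using y Suc by (auto simp: cob_def)
      moreover have "x = r + p" by (simp add: r_def)
      ultimately show ?thesis by blast
    qed
    then show "x \<in> {r + w |r w. r \<in> harm k \<and> w \<in> cob k}" by blast
  qed
qed

lemma harm_above: "k > N \<Longrightarrow> harm k = {0}"
  using V_above[of k] cvec.subspace_0[OF harm_subspace, of k] by (auto simp: harm_def)

context
  assumes fd: "\<And>k. finite_dimensional_quotient (cocyc k) (cob k)"
begin

lemma harm_finite_dimensional: "finite_dimensional (harm k)"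
  and quotient_dim_harm: "quotient_dim (cocyc k) (cob k) = cvec.dim (harm k)"
  using quotient_dim_complement[OF harm_subspace cob_subspace cocyc_decomposition harm_cob fd, of k] by auto

lemma harm_span:
  assumes "finite I"
  shows "finite_dimensional (cvec.span (\<Union>k\<in>I. harm k)) \<and>
    cvec.dim (cvec.span (\<Union>k\<in>I. harm k)) = (\<Sum>k\<in>I. cvec.dim (harm k))"
  using assms
proof induction
  case empty
  have "finite_dimensional ({0} :: 't set)" unfolding finite_dimensional_def by (intro exI[of _ "{}"]) simp
  then show ?case by (simp add: dim_zero)
next
  case (insert k I)
  let ?W = "cvec.span (\<Union>k\<in>I. harm k)"
  have "cvec.span (\<Union>k\<in>insert k I. harm k) = cvec.span (harm k \<union> (\<Union>k\<in>I. harm k))" by simp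
  also have "\<dots> = {u + w |u w. u \<in> harm k \<and> w \<in> ?W}"
    unfolding cvec.span_Un cvec.span_eq_iff[THEN iffD2, OF harm_subspace] by auto
  finally have eq: "cvec.span (\<Union>k\<in>insert k I. harm k) = {u + w |u w. u \<in> harm k \<and> w \<in> ?W}" .
  have orth: "s x w = 0" if "x \<in> V k" "w \<in> ?W" for x w
    using that(2)
  proof (induction rule: cvec.span_induct_alt)
    case (step c u y)
    then obtain j where "j \<in> I" "u \<in> V j" by (auto simp: harm_def)
    then have "s x u = 0" using V_orthogonal[OF that(1)] insert.hyps(2) by metis
    then show ?case using step(2) by (simp add: s_add_right s_scale_right)
  qed (rule s_zero)
  have int: "harm k \<inter> ?W \<subseteq> {0}"
  proof
    fix x assume "x \<in> harm k \<inter> ?W"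
    then have "s x x = 0" using orth[of x x] by (auto simp: harm_def)
    then show "x \<in> {0}" using s_definite by simp
  qed
  have "finite_dimensional {u + w |u w. u \<in> harm k \<and> w \<in> ?W}"
  proof -
    obtain A B where "finite A" "harm k \<subseteq> cvec.span A" "finite B" "?W \<subseteq> cvec.span B"
      using harm_finite_dimensional[of k] insert.IH unfolding finite_dimensional_def by blast
    then have "finite (A \<union> B)" "{u + w |u w. u \<in> harm k \<and> w \<in> ?W} \<subseteq> cvec.span (A \<union> B)"
      unfolding cvec.span_Un by auto
    then show ?thesis unfolding finite_dimensional_def by blast
  qed
  moreover have "cvec.dim {u + w |u w. u \<in> harm k \<and> w \<in> ?W} = cvec.dim (harm k) + cvec.dim ?W"
    using insert.IH by (intro dim_direct_sum harm_subspace harm_finite_dimensional cvec.subspace_span int) simp_all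
  ultimately show ?case unfolding eq using insert by simp
qed

text \<open>The components of \<open>d x\<close>, and those of the adjoint at \<open>x\<close>, lie in different degrees, so they vanish separately.\<close>

lemma ker_harm: "ker P = cvec.span (\<Union>k\<in>{k. P k \<and> k \<le> N}. harm k)"
proof
  show "cvec.span (\<Union>k\<in>{k. P k \<and> k \<le> N}. harm k) \<subseteq> ker P"
  proof (rule cvec.span_minimal[OF _ ker_subspace])
    show "(\<Union>k\<in>{k. P k \<and> k \<le> N}. harm k) \<subseteq> ker P"
      using G_base[of P] by (auto simp: ker_def harm_def D_def)
  qed
  show "ker P \<subseteq> cvec.span (\<Union>k\<in>{k. P k \<and> k \<le> N}. harm k)"
  proof
    fix x assume x: "x \<in> ker P"
    then obtain f where f: "\<And>k. f k \<in> V k" "\<And>k. \<not> P k \<Longrightarrow> f k = 0" "x = (\<Sum>k\<le>N. f k)"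
      by (auto simp: ker_def elim: G_components)
    have z: "d x = 0" "dadj x = 0" using D_zero[of x] x by (auto simp: ker_def)
    \<comment> \<open>Terms of a vanishing sum of pairwise orthogonal elements vanish.\<close>
    have orth_sum: "s (g k) (g k) = 0"
      if "\<And>j. j \<noteq> k \<Longrightarrow> s (g k) (g j) = 0" "(\<Sum>k\<le>N. g k) = 0" "k \<le> N" for g k
    proof -
      have "s (g k) (\<Sum>j\<in>S. g j) = (\<Sum>j\<in>S. s (g k) (g j))" for S
        by (induction S rule: infinite_finite_induct) (simp_all add: s_zero s_add_right)
      then have "0 = (\<Sum>j\<le>N. s (g k) (g j))" using that(2) by (metis s_zero(1))
      also have "\<dots> = s (g k) (g k)"
        using that(1,3) by (subst sum.remove[of _ k]) auto
      finally show ?thesis by simp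
    qed
    have harm: "f k \<in> harm k" if "k \<le> N" for k
    proof -
      have "s (d (f k)) (d (f k)) = 0"
        using V_orthogonal[OF V_d[OF f(1)] V_d[OF f(1)], of k] z(1) that
        by (intro orth_sum[of k "\<lambda>k. d (f k)"]) (simp_all add: f(3) clinear_sum[OF d_linear])
      moreover have "s (dadj (f k)) (dadj (f k)) = 0"
      proof (rule orth_sum[of k "\<lambda>k. dadj (f k)"])
        show "s (dadj (f k)) (dadj (f j)) = 0" if "j \<noteq> k" for j
          using that V_dadj_0[of "f 0"] f(1)[of 0] V_dadj[of "f k" "k - 1"] V_dadj[of "f j" "j - 1"] f(1)[of j] f(1)[of k]
            V_orthogonal[of "dadj (f k)" "k - 1" "dadj (f j)" "j - 1"]
          by (cases "k = 0"; cases "j = 0") (auto simp: s_zero)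
        show "(\<Sum>k\<le>N. dadj (f k)) = 0" using z(2) by (simp add: f(3) clinear_sum[OF dadj_linear])
      qed (rule that)
      ultimately show ?thesis using f(1) s_definite by (simp add: harm_def)
    qed
    have "f k \<in> cvec.span (\<Union>k\<in>{k. P k \<and> k \<le> N}. harm k)" if "k \<le> N" for k
    proof (cases "P k")
      case True
      then show ?thesis using harm[OF that] that by (intro cvec.span_base) auto
    qed (simp add: f(2) cvec.span_zero)
    then show "x \<in> cvec.span (\<Union>k\<in>{k. P k \<and> k \<le> N}. harm k)"
      unfolding f(3) by (intro cvec.span_sum) simp
  qed
qed

lemma ker_finite_dimensional: "finite_dimensional (ker P)"
  and dim_ker: "cvec.dim (ker P) = (\<Sum>k | P k \<and> k \<le> N. cvec.dim (harm k))"
  using harm_span[of "{k. P k \<and> k \<le> N}"] by (simp_all add: ker_harm)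

lemma euler_ker:
  "(\<Sum>k | quotient_dim (cocyc k) (cob k) \<noteq> 0. (-1) ^ k * int (quotient_dim (cocyc k) (cob k)))
    = int (cvec.dim (ker even)) - int (cvec.dim (ker odd))"
proof -
  have "cvec.dim (harm k) = 0" if "k > N" for k using harm_above[OF that] by (simp add: dim_zero)
  then have "{k. cvec.dim (harm k) \<noteq> 0} \<subseteq> {..N}" by (force simp: not_less)
  then have "(\<Sum>k | cvec.dim (harm k) \<noteq> 0. (-1) ^ k * int (cvec.dim (harm k))) =
      (\<Sum>k\<le>N. (-1) ^ k * int (cvec.dim (harm k)))"
    by (intro sum.mono_neutral_left) auto
  also have "{..N} = {k. even k \<and> k \<le> N} \<union> {k. odd k \<and> k \<le> N}" by auto
  also have "(\<Sum>k\<in>\<dots>. (-1) ^ k * int (cvec.dim (harm k))) =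
      (\<Sum>k | even k \<and> k \<le> N. (-1) ^ k * int (cvec.dim (harm k))) +
      (\<Sum>k | odd k \<and> k \<le> N. (-1) ^ k * int (cvec.dim (harm k)))"
    by (rule sum.union_disjoint) auto
  also have "(\<Sum>k | even k \<and> k \<le> N. (-1) ^ k * int (cvec.dim (harm k))) = int (cvec.dim (ker even))"
    by (simp add: dim_ker)
  also have "(\<Sum>k | odd k \<and> k \<le> N. (-1) ^ k * int (cvec.dim (harm k))) = - int (cvec.dim (ker odd))"
    by (simp add: dim_ker sum_negf)
  finally show ?thesis by (simp add: quotient_dim_harm)
qed

end

end

section \<open>Closed operators on Hilbert spaces\<close>

lemma cinner_add_left: "cinner (x + y) (z :: 'h::complex_hilbert_space) = cinner x z + cinner y z"
  unfolding cinner_commute[of _ z] cinner_add_right by simp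

lemma cinner_scaleC_left: "cinner (c *\<^sub>C x) (z :: 'h::complex_hilbert_space) = cnj c * cinner x z"
  unfolding cinner_commute[of _ z] cinner_scaleC_right by simp

lemma cinner_self: "cinner x (x :: 'h::complex_hilbert_space) = of_real ((norm x)\<^sup>2)"
proof -
  have "cinner x x = cnj (cinner x x)" by (rule cinner_commute)
  then have "Im (cinner x x) = 0" by (simp add: complex_eq_iff)
  moreover have "0 \<le> Re (cinner x x)"
    using norm_ge_zero[of x] unfolding norm_eq_sqrt_cinner by simp
  then have "(norm x)\<^sup>2 = Re (cinner x x)" unfolding norm_eq_sqrt_cinner by simp
  ultimately show ?thesis by (simp add: complex_eq_iff)
qed

lemma cform_cinner: "cform (cinner :: 'h::complex_hilbert_space \<Rightarrow> 'h \<Rightarrow> complex)"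
  by (simp add: cform_def cinner_add_left cinner_add_right cinner_scaleC_left cinner_scaleC_right)

interpretation hilbert: definite_form "cinner :: 'h::complex_hilbert_space \<Rightarrow> 'h \<Rightarrow> complex"
  by unfold_locales (rule cform_cinner, rule cinner_commute, simp add: cinner_self)

lemma norm_scaleC: "norm (c *\<^sub>C x :: 'h::complex_hilbert_space) = cmod c * norm x"
proof -
  have "complex_of_real ((norm (c *\<^sub>C x))\<^sup>2) = (cnj c * c) * cinner x x"
    unfolding cinner_self[symmetric] by (simp add: cinner_scaleC_left cinner_scaleC_right)
  also have "\<dots> = of_real ((cmod c * norm x)\<^sup>2)"
    unfolding cinner_self
    by (simp add: power_mult_distrib complex_norm_square[unfolded of_real_power] mult.commute)
  finally have "(norm (c *\<^sub>C x))\<^sup>2 = (cmod c * norm x)\<^sup>2" by (simp only: of_real_eq_iff)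
  then show ?thesis by (simp add: power2_eq_iff_nonneg)
qed

lemma pythagoras:
  assumes "cinner x (y :: 'h::complex_hilbert_space) = 0"
  shows "(norm (x + y))\<^sup>2 = (norm x)\<^sup>2 + (norm y)\<^sup>2"
proof -
  have "cinner y x = 0" using hilbert.s_sym_zero[OF assms] .
  then have "complex_of_real ((norm (x + y))\<^sup>2) = of_real ((norm x)\<^sup>2 + (norm y)\<^sup>2)"
    unfolding cinner_self[symmetric] of_real_add
    by (simp add: cinner_add_left cinner_add_right assms)
  then show ?thesis by (simp only: of_real_eq_iff)
qed

lemma cinner_bound: "cmod (cinner x y) \<le> norm x * norm (y :: 'h::complex_hilbert_space)"
proof (cases "x = 0")
  case True
  then show ?thesis by (simp add: hilbert.s_zero)
next
  case False
  define c where "c = cinner x y / cinner x x"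
  have nz: "cinner x x \<noteq> 0" using False by (simp add: cinner_self)
  have o: "cinner (c *\<^sub>C x) (y - c *\<^sub>C x) = 0"
    using nz by (simp add: hilbert.s_diff cinner_scaleC_left cinner_scaleC_right c_def)
  have "(norm (c *\<^sub>C x))\<^sup>2 \<le> (norm y)\<^sup>2"
    using pythagoras[OF o] by simp
  then have "cmod c * norm x \<le> norm y" by (simp add: norm_scaleC power2_le_iff_abs_le)
  moreover have "cmod (cinner x x) = norm x * norm x"
    by (simp add: cinner_self power2_eq_square norm_mult)
  then have "cmod c * norm x = cmod (cinner x y) / norm x"
    using False by (simp add: c_def norm_divide)
  ultimately show ?thesis using False by (simp add: divide_le_eq mult.commute)
qed

lemma bounded_linear_cinner: "bounded_linear (cinner (w :: 'h::complex_hilbert_space))"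
proof (rule bounded_linear_intro[of _ "norm w"])
  show "cmod (cinner w x) \<le> norm x * norm w" for x :: 'h
    unfolding mult.commute[of "norm x"] by (rule cinner_bound)
qed (simp_all add: cinner_add_right scaleR_scaleC cinner_scaleC_right scaleR_conv_of_real)

lemma continuous_cinner_right: "continuous_on A f \<Longrightarrow> continuous_on A (\<lambda>x. cinner (w :: 'h::complex_hilbert_space) (f x))"
  by (rule bounded_linear.continuous_on[OF bounded_linear_cinner])

lemma tendsto_scaleC:
  assumes "(f \<longlongrightarrow> c) F"
  shows "((\<lambda>i. f i *\<^sub>C (x :: 'h::complex_hilbert_space)) \<longlongrightarrow> c *\<^sub>C x) F"
proof -
  have "((\<lambda>i. norm (f i - c) * norm x) \<longlongrightarrow> 0) F"
    using tendsto_mult_left_zero[OF tendsto_norm_zero[OF LIM_zero[OF assms]]] by simp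
  moreover have "norm (f i *\<^sub>C x - c *\<^sub>C x) = norm (f i - c) * norm x" for i
    by (simp add: norm_scaleC[symmetric] cvec.scale_left_diff_distrib)
  ultimately have "((\<lambda>i. norm (f i *\<^sub>C x - c *\<^sub>C x)) \<longlongrightarrow> 0) F" by simp
  then show ?thesis by (simp add: tendsto_norm_zero_iff LIM_zero_iff)
qed

lemma subspace_closure:
  assumes S: "cvec.subspace (S :: 'h::complex_hilbert_space set)"
  shows "cvec.subspace (closure S)"
proof (rule cvec.subspaceI)
  show "0 \<in> closure S" using cvec.subspace_0[OF S] closure_subset by blast
  show "x + y \<in> closure S" if xy: "x \<in> closure S" "y \<in> closure S" for x y
  proof -
    obtain f g where "\<forall>i. f i \<in> S" "f \<longlonglongrightarrow> x" "\<forall>i. g i \<in> S" "g \<longlonglongrightarrow> y"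
      using xy unfolding closure_sequential by blast
    then show ?thesis
      unfolding closure_sequential using cvec.subspace_add[OF S]
      by (intro exI[of _ "\<lambda>i. f i + g i"]) (auto intro: tendsto_add)
  qed
  show "c *\<^sub>C x \<in> closure S" if x: "x \<in> closure S" for c x
  proof -
    obtain f where f: "\<forall>i. f i \<in> S" "f \<longlonglongrightarrow> x" using x unfolding closure_sequential by blast
    have "(\<lambda>i. c *\<^sub>C f i) \<longlonglongrightarrow> c *\<^sub>C x"
    proof -
      have "(\<lambda>i. cmod c * norm (f i - x)) \<longlonglongrightarrow> 0"
        using tendsto_mult_right_zero[OF tendsto_norm_zero[OF LIM_zero[OF f(2)]]] by simp
      then have "(\<lambda>i. norm (c *\<^sub>C f i - c *\<^sub>C x)) \<longlonglongrightarrow> 0"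
        by (simp add: norm_scaleC flip: cvec.scale_right_diff_distrib)
      then show ?thesis by (simp add: tendsto_norm_zero_iff LIM_zero_iff)
    qed
    then show ?thesis
      unfolding closure_sequential using f(1) cvec.subspace_scale[OF S]
      by (intro exI[of _ "\<lambda>i. c *\<^sub>C f i"]) auto
  qed
qed

text \<open>The argument is that of the open mapping theorem, applied to the surjection \<open>T \<oplus> \<complex>\<^sup>S \<rightarrow> H2\<close>: it shows that
  the coefficients with respect to a basis \<open>S\<close> of a complement of the range are bounded by the norm, so the range, on
  which they vanish, is closed.\<close>

lemma closed_range_if_finite_codimension:
  fixes T :: "('h::complex_hilbert_space \<times> 'h) set"
  assumes T: "closed T" and T0: "(0, 0) \<in> T"
    and T_add: "\<And>u v u' v'. (u, v) \<in> T \<Longrightarrow> (u', v') \<in> T \<Longrightarrow> (u + u', v + v') \<in> T"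
    and T_scale: "\<And>c u v. (u, v) \<in> T \<Longrightarrow> (c *\<^sub>C u, c *\<^sub>C v) \<in> T"
    and H: "closed H" "cvec.subspace H" and range: "Range T \<subseteq> H"
    and S: "finite S" "quotient_basis S H (Range T)"
  shows "closed (Range T)"
proof -
  have SH: "S \<subseteq> H" using S(2) by (simp add: quotient_basis_def)
  \<comment> \<open>\<open>W r\<close> consists of the elements \<open>t + \<Sum>\<^sub>s c\<^sub>s s\<close> with \<open>(u, t)\<close> in \<open>T\<close> and \<open>u\<close> and all \<open>c\<^sub>s\<close> bounded by \<open>r\<close>.\<close>
  define W where "W r = {v \<in> H. \<exists>u c. (u, v - (\<Sum>s\<in>S. c s *\<^sub>C s)) \<in> T \<and> norm u \<le> r \<and> (\<forall>s\<in>S. cmod (c s) \<le> r)}" for r :: real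
  have W_I: "v \<in> W r" if "v \<in> H" "(u, v - (\<Sum>s\<in>S. c s *\<^sub>C s)) \<in> T" "norm u \<le> r" "\<forall>s\<in>S. cmod (c s) \<le> r" for v u c r
    using that unfolding W_def by blast
  have W_D: "\<exists>u c. (u, v - (\<Sum>s\<in>S. c s *\<^sub>C s)) \<in> T \<and> norm u \<le> r \<and> (\<forall>s\<in>S. cmod (c s) \<le> r)" "v \<in> H"
    if "v \<in> W r" for v r using that unfolding W_def by blast+
  have W0: "0 \<in> W 0" by (rule W_I[of 0 0 "\<lambda>_. 0"]) (simp_all add: cvec.subspace_0[OF H(2)] T0)
  have W_mono: "v \<in> W r'" if "v \<in> W r" "r \<le> r'" for v r r'
    using that unfolding W_def by (auto intro: order_trans)
  have W_add: "v + v' \<in> W (r + r')" if v: "v \<in> W r" "v' \<in> W r'" for v v' r r'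
  proof -
    obtain u c where u: "(u, v - (\<Sum>s\<in>S. c s *\<^sub>C s)) \<in> T" "norm u \<le> r" "\<forall>s\<in>S. cmod (c s) \<le> r"
      using W_D(1)[OF v(1)] by (elim exE conjE)
    obtain u' c' where u': "(u', v' - (\<Sum>s\<in>S. c' s *\<^sub>C s)) \<in> T" "norm u' \<le> r'" "\<forall>s\<in>S. cmod (c' s) \<le> r'"
      using W_D(1)[OF v(2)] by (elim exE conjE)
    have "(u + u', (v + v') - (\<Sum>s\<in>S. (c s + c' s) *\<^sub>C s)) \<in> T"
      using T_add[OF u(1) u'(1)] by (simp add: scaleC_add_left sum.distrib algebra_simps)
    then show ?thesis
      by (rule W_I[rotated])
        (use u u' W_D(2)[OF v(1)] W_D(2)[OF v(2)] cvec.subspace_add[OF H(2)] in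
          \<open>auto intro: norm_triangle_mono\<close>)
  qed
  have W_scale: "k *\<^sub>C v \<in> W (cmod k * r)" if v: "v \<in> W r" for k v r
  proof -
    obtain u c where u: "(u, v - (\<Sum>s\<in>S. c s *\<^sub>C s)) \<in> T" "norm u \<le> r" "\<forall>s\<in>S. cmod (c s) \<le> r"
      using W_D(1)[OF v] by (elim exE conjE)
    have "(k *\<^sub>C u, k *\<^sub>C v - (\<Sum>s\<in>S. (k * c s) *\<^sub>C s)) \<in> T"
      using T_scale[OF u(1), of k] by (simp add: cvec.scale_right_diff_distrib cvec.scale_sum_right scaleC_scaleC)
    then show ?thesis
      by (rule W_I[rotated])
        (use u W_D(2)[OF v] cvec.subspace_scale[OF H(2)] in
          \<open>auto simp: norm_scaleC norm_mult intro: mult_left_mono\<close>)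
  qed
  have coef: "\<exists>c. v - (\<Sum>s\<in>S. c s *\<^sub>C s) \<in> Range T" if "v \<in> H" for v
  proof -
    obtain c where c: "\<forall>s. s \<notin> S \<longrightarrow> c s = 0" "finite {s. c s \<noteq> 0}" "v - (\<Sum>s | c s \<noteq> 0. c s *\<^sub>C s) \<in> Range T"
      using bspec[OF conjunct2[OF S(2)[unfolded quotient_basis_def]] \<open>v \<in> H\<close>] by (elim ex1E conjE)
    have eq: "(\<Sum>s | c s \<noteq> 0. c s *\<^sub>C s) = (\<Sum>s\<in>S. c s *\<^sub>C s)"
      using c(1) S(1) by (intro sum.mono_neutral_left) auto
    show ?thesis by (rule exI[of _ c]) (rule c(3)[unfolded eq])
  qed
  have coef_unique: "c s = c' s"
    if "v \<in> H" "v - (\<Sum>s\<in>S. c s *\<^sub>C s) \<in> Range T" "v - (\<Sum>s\<in>S. c' s *\<^sub>C s) \<in> Range T" "s \<in> S" for v c c' s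
  proof -
    define e where "e c s = (if s \<in> S then c s else (0::complex))" for c s
    have e: "(\<forall>s. s \<notin> S \<longrightarrow> e c s = 0) \<and> finite {s. e c s \<noteq> 0} \<and> v - (\<Sum>s | e c s \<noteq> 0. e c s *\<^sub>C s) \<in> Range T"
      if "v - (\<Sum>s\<in>S. c s *\<^sub>C s) \<in> Range T" for c
    proof (intro conjI)
      have "(\<Sum>s | e c s \<noteq> 0. e c s *\<^sub>C s) = (\<Sum>s\<in>S. c s *\<^sub>C s)"
        using S(1) by (intro sum.mono_neutral_cong_left) (auto simp: e_def)
      then show "v - (\<Sum>s | e c s \<noteq> 0. e c s *\<^sub>C s) \<in> Range T" using that by simp
      show "finite {s. e c s \<noteq> 0}" by (rule finite_subset[OF _ S(1)]) (auto simp: e_def)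
    qed (simp add: e_def)
    obtain g where g: "\<forall>h. (\<forall>s. s \<notin> S \<longrightarrow> h s = 0) \<and> finite {s. h s \<noteq> 0} \<and>
        v - (\<Sum>s | h s \<noteq> 0. h s *\<^sub>C s) \<in> Range T \<longrightarrow> h = g"
      using bspec[OF conjunct2[OF S(2)[unfolded quotient_basis_def]] \<open>v \<in> H\<close>] by (elim ex1E)
    have "e c = g" "e c' = g"
      by (rule mp[OF spec[OF g] e[OF that(2)]], rule mp[OF spec[OF g] e[OF that(3)]])
    then have "e c s = e c' s" by simp
    then show ?thesis using that(4) by (simp add: e_def)
  qed
  have cover: "\<exists>n::nat. v \<in> W (real n)" if v: "v \<in> H" for v
  proof -
    obtain c u where cu: "(u, v - (\<Sum>s\<in>S. c s *\<^sub>C s)) \<in> T" using coef[OF v] by blast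
    obtain n :: nat where n: "norm u + (\<Sum>s\<in>S. cmod (c s)) \<le> real n" using real_arch_simple by blast
    have le: "cmod (c s) \<le> (\<Sum>s\<in>S. cmod (c s))" if "s \<in> S" for s
      using S(1) that by (intro member_le_sum) auto
    have nonneg: "0 \<le> (\<Sum>s\<in>S. cmod (c s))" by (simp add: sum_nonneg)
    have "v \<in> W (real n)"
    proof (rule W_I[OF v cu])
      show "norm u \<le> real n" using n nonneg by linarith
      show "\<forall>s\<in>S. cmod (c s) \<le> real n"
      proof
        fix s assume "s \<in> S"
        from le[OF this] show "cmod (c s) \<le> real n" using n norm_ge_zero[of u] by linarith
      qed
    qed
    then show ?thesis by (rule exI)
  qed
  \<comment> \<open>By the Baire category theorem the closure of some \<open>W n\<close> contains a ball of \<open>H\<close>.\<close>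
  have "\<exists>n v0 e. e > 0 \<and> v0 \<in> H \<and> cball v0 e \<inter> H \<subseteq> closure (W (real n))"
  proof -
    define \<G> where "\<G> = range (\<lambda>n::nat. closure (W (real n)) \<inter> H)"
    have "(top_of_set H) interior_of \<Union>\<G> \<noteq> {}"
    proof -
      have "H \<subseteq> \<Union>\<G>"
      proof
        fix v assume "v \<in> H"
        from cover[OF this] obtain n where "v \<in> W (real n)" ..
        then have "v \<in> closure (W (real n)) \<inter> H"
          using \<open>v \<in> H\<close> subsetD[OF closure_subset] by simp
        then show "v \<in> \<Union>\<G>" by (rule UnionI[rotated]) (simp add: \<G>_def)
      qed
      then have "\<Union>\<G> = H" by (auto simp: \<G>_def)
      then have "(top_of_set H) interior_of \<Union>\<G> = H"
        using interior_of_topspace[of "top_of_set H"] by simp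
      moreover have "H \<noteq> {}" using cvec.subspace_0[OF H(2)] by auto
      ultimately show ?thesis by simp
    qed
    moreover have "completely_metrizable_space (top_of_set H)"
      using completely_metrizable_space_closedin[OF completely_metrizable_space_euclidean, of H] H(1) by simp
    moreover have "countable \<G>" by (simp add: \<G>_def)
    moreover have "closedin (top_of_set H) B" if B: "B \<in> \<G>" for B
    proof -
      obtain n :: nat where n: "B = closure (W (real n)) \<inter> H" using B unfolding \<G>_def by (elim rangeE)
      show ?thesis unfolding n Int_commute[of _ H] by (rule closedin_closed_Int) simp
    qed
    ultimately have "\<exists>B\<in>\<G>. (top_of_set H) interior_of B \<noteq> {}"
      using Baire_category_alt[of "top_of_set H" \<G>] by (metis (no_types, lifting))
    then obtain n :: nat where n: "(top_of_set H) interior_of (closure (W (real n)) \<inter> H) \<noteq> {}"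
      unfolding \<G>_def by (elim bexE rangeE) simp
    then obtain v0 where v0: "v0 \<in> (top_of_set H) interior_of (closure (W (real n)) \<inter> H)" by blast
    have "openin (top_of_set H) ((top_of_set H) interior_of (closure (W (real n)) \<inter> H))" by simp
    then obtain e where "e > 0" "cball v0 e \<inter> H \<subseteq> (top_of_set H) interior_of (closure (W (real n)) \<inter> H)"
      using v0 unfolding openin_contains_cball by blast
    moreover have "(top_of_set H) interior_of (closure (W (real n)) \<inter> H) \<subseteq> closure (W (real n)) \<inter> H"
      by (rule interior_of_subset)
    ultimately show ?thesis using v0 by blast
  qed
  then obtain n :: nat and v0 e where n: "e > 0" "v0 \<in> H" "cball v0 e \<inter> H \<subseteq> closure (W (real n))" by blast
  \<comment> \<open>Differences of elements of \<open>W n\<close> approximate a ball around zero.\<close>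
  have ball: "\<exists>w\<in>W (2 * real n). norm (v - w) < \<delta>" if v: "v \<in> H" "norm v \<le> e" and "\<delta> > 0" for v \<delta>
  proof -
    have "v0 + v \<in> closure (W (real n))" "v0 \<in> closure (W (real n))"
      using n v cvec.subspace_add[OF H(2)] by (auto simp: dist_norm subset_iff)
    then obtain x y where x: "x \<in> W (real n)" "dist x (v0 + v) < \<delta> / 2" and y: "y \<in> W (real n)" "dist y v0 < \<delta> / 2"
      using \<open>\<delta> > 0\<close> unfolding closure_approachable by (metis half_gt_zero)
    have "x + (-1) *\<^sub>C y \<in> W (real n + cmod (-1) * real n)" by (intro W_add W_scale x y)
    moreover have "norm (v - (x + (-1) *\<^sub>C y)) < \<delta>"
    proof -
      have "v - (x + (-1) *\<^sub>C y) = (y - v0) - (x - (v0 + v))" by simp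
      also have "norm \<dots> \<le> norm (y - v0) + norm (x - (v0 + v))" by (rule norm_triangle_ineq4)
      also have "\<dots> < \<delta>" using x(2) y(2) by (simp add: dist_norm)
      finally show ?thesis .
    qed
    ultimately show ?thesis by (intro bexI[of _ "x + (-1) *\<^sub>C y"]) auto
  qed
  define C where "C = 2 * real n / e"
  have C: "C \<ge> 0" using n(1) by (simp add: C_def)
  have approx: "\<exists>w\<in>W (C * norm v). norm (v - w) < \<delta>" if v: "v \<in> H" and d: "\<delta> > 0" for v \<delta>
  proof (cases "v = 0")
    case True
    then show ?thesis using W0 d by (intro bexI[of _ 0]) auto
  next
    case False
    define k where "k = norm v / e"
    have k: "k > 0" using False n(1) by (simp add: k_def)
    have e: "of_real (1 / k) *\<^sub>C v \<in> H" "norm (complex_of_real (1 / k) *\<^sub>C v) \<le> e"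
      using v k False n(1) cvec.subspace_scale[OF H(2)] by (auto simp: norm_scaleC k_def norm_divide)
    obtain w where w: "w \<in> W (2 * real n)" "norm (complex_of_real (1 / k) *\<^sub>C v - w) < \<delta> / k"
      using ball[OF e, of "\<delta> / k"] d k by auto
    have "of_real k *\<^sub>C w \<in> W (cmod (of_real k) * (2 * real n))" by (rule W_scale[OF w(1)])
    also have "cmod (of_real k) = k" using k by simp
    also have "k * (2 * real n) = C * norm v" by (simp add: C_def k_def)
    finally have "of_real k *\<^sub>C w \<in> W (C * norm v)" .
    moreover have "v - of_real k *\<^sub>C w = of_real k *\<^sub>C (complex_of_real (1 / k) *\<^sub>C v - w)"
      using k by (simp add: cvec.scale_right_diff_distrib scaleC_scaleC scaleC_one)
    then have "norm (v - of_real k *\<^sub>C w) = k * norm (complex_of_real (1 / k) *\<^sub>C v - w)"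
      using k by (simp only: norm_scaleC) simp
    then have "norm (v - of_real k *\<^sub>C w) < \<delta>" using w(2) k by (simp add: pos_less_divide_eq mult.commute)
    ultimately show ?thesis by blast
  qed
  \<comment> \<open>Successive approximation with errors halved at each step; the sum of the preimages converges, and \<open>T\<close> is closed.\<close>
  have bounded: "\<exists>u c. (u, v - (\<Sum>s\<in>S. c s *\<^sub>C s)) \<in> T \<and> (\<forall>s\<in>S. cmod (c s) \<le> 2 * C * norm v)"
    if v: "v \<in> H" for v
  proof (cases "v = 0")
    case True
    then show ?thesis using T0 by (intro exI[of _ 0] exI[of _ "\<lambda>_. 0"]) simp
  next
    case False
    define q where "q k = norm v * (1 / 2) ^ k" for k :: nat
    have "\<exists>f. \<forall>k. (f k \<in> H \<and> norm (f k) \<le> q k \<and> (k = 0 \<longrightarrow> f k = v)) \<and> f k - f (Suc k) \<in> W (C * q k)"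
    proof (rule dependent_nat_choice)
      show "\<exists>x. x \<in> H \<and> norm x \<le> q 0 \<and> ((0::nat) = 0 \<longrightarrow> x = v)" using v by (simp add: q_def)
    next
      fix x and k :: nat
      assume x: "x \<in> H \<and> norm x \<le> q k \<and> (k = 0 \<longrightarrow> x = v)"
      have "q (Suc k) > 0" using False by (simp add: q_def)
      then obtain w where w: "w \<in> W (C * norm x)" "norm (x - w) < q (Suc k)" using approx x by blast
      have "w \<in> W (C * q k)" using W_mono[OF w(1)] x C by (simp add: mult_left_mono)
      moreover have "x - w \<in> H" using x W_D(2)[OF w(1)] by (intro cvec.subspace_diff[OF H(2)]) auto
      ultimately show "\<exists>y. (y \<in> H \<and> norm y \<le> q (Suc k) \<and> (Suc k = 0 \<longrightarrow> y = v)) \<and> x - y \<in> W (C * q k)"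
        using w(2) by (intro exI[of _ "x - w"]) simp
    qed
    then obtain f where f: "\<And>k. norm (f k) \<le> q k" "f 0 = v" "\<And>k. f k - f (Suc k) \<in> W (C * q k)" by blast
    have "\<exists>p. \<forall>k. (fst (p k), f k - f (Suc k) - (\<Sum>s\<in>S. snd (p k) s *\<^sub>C s)) \<in> T \<and>
        norm (fst (p k)) \<le> C * q k \<and> (\<forall>s\<in>S. cmod (snd (p k) s) \<le> C * q k)"
    proof (intro choice allI)
      fix k
      from W_D(1)[OF f(3)[of k]] show "\<exists>p. (fst p, f k - f (Suc k) - (\<Sum>s\<in>S. snd p s *\<^sub>C s)) \<in> T \<and>
          norm (fst p) \<le> C * q k \<and> (\<forall>s\<in>S. cmod (snd p s) \<le> C * q k)" by simp
    qed
    then obtain p where p: "\<forall>k. (fst (p k), f k - f (Suc k) - (\<Sum>s\<in>S. snd (p k) s *\<^sub>C s)) \<in> T \<and>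
        norm (fst (p k)) \<le> C * q k \<and> (\<forall>s\<in>S. cmod (snd (p k) s) \<le> C * q k)" ..
    define u where "u k = fst (p k)" for k
    define c where "c k = snd (p k)" for k
    have uc: "(u k, f k - f (Suc k) - (\<Sum>s\<in>S. c k s *\<^sub>C s)) \<in> T"
      "norm (u k) \<le> C * q k" "s \<in> S \<Longrightarrow> cmod (c k s) \<le> C * q k" for k s
      using p unfolding u_def c_def by auto
    have partial: "((\<Sum>k<m. u k), v - f m - (\<Sum>s\<in>S. (\<Sum>k<m. c k s) *\<^sub>C s)) \<in> T" for m
    proof (induction m)
      case 0
      show ?case using T0 f(2) by simp
    next
      case (Suc m)
      from T_add[OF Suc uc(1)[of m]] show ?case
        by (simp add: scaleC_add_left sum.distrib algebra_simps)
    qed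
    have qs: "(\<lambda>k. C * q k) sums (2 * C * norm v)"
      using sums_mult[OF geometric_sums[of "1 / 2 :: real"], of "C * norm v"] by (simp add: q_def mult_ac)
    have su: "summable u"
      by (rule summable_comparison_test'[OF sums_summable[OF qs]]) (use uc(2) in auto)
    have sc: "summable (\<lambda>k. c k s)" and bc: "cmod (\<Sum>k. c k s) \<le> 2 * C * norm v" if "s \<in> S" for s
    proof -
      show "summable (\<lambda>k. c k s)"
        by (rule summable_comparison_test'[OF sums_summable[OF qs]]) (use uc(3)[OF that] in auto)
      have "cmod (\<Sum>k. c k s) \<le> (\<Sum>k. C * q k)"
        using uc(3)[OF that] by (intro norm_suminf_le sums_summable[OF qs]) auto
      then show "cmod (\<Sum>k. c k s) \<le> 2 * C * norm v" using sums_unique[OF qs] by simp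
    qed
    have "f \<longlonglongrightarrow> 0"
    proof (rule Lim_null_comparison[of _ q])
      show "\<forall>\<^sub>F k in sequentially. norm (f k) \<le> q k" using f(1) by simp
      show "q \<longlonglongrightarrow> 0" unfolding q_def by (intro tendsto_mult_right_zero LIMSEQ_realpow_zero) auto
    qed
    then have "(\<lambda>m. v - f m - (\<Sum>s\<in>S. (\<Sum>k<m. c k s) *\<^sub>C s)) \<longlonglongrightarrow> v - 0 - (\<Sum>s\<in>S. (\<Sum>k. c k s) *\<^sub>C s)"
      by (intro tendsto_diff tendsto_const tendsto_sum tendsto_scaleC summable_LIMSEQ sc)
    moreover have "(\<lambda>m. \<Sum>k<m. u k) \<longlonglongrightarrow> (\<Sum>k. u k)" by (rule summable_LIMSEQ[OF su])
    ultimately have lim: "(\<lambda>m. ((\<Sum>k<m. u k), v - f m - (\<Sum>s\<in>S. (\<Sum>k<m. c k s) *\<^sub>C s))) \<longlonglongrightarrow>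
        ((\<Sum>k. u k), v - 0 - (\<Sum>s\<in>S. (\<Sum>k. c k s) *\<^sub>C s))"
      by (intro tendsto_Pair)
    have "((\<Sum>k. u k), v - 0 - (\<Sum>s\<in>S. (\<Sum>k. c k s) *\<^sub>C s)) \<in> T"
      by (rule closed_sequentially[OF T _ lim]) (use partial in auto)
    then show ?thesis
      using bc by (intro exI[of _ "\<Sum>k. u k"] exI[of _ "\<lambda>s. \<Sum>k. c k s"]) simp
  qed
  have R_add: "x + y \<in> Range T" if "x \<in> Range T" "y \<in> Range T" for x y
    using that T_add by blast
  have "closure (Range T) \<subseteq> Range T"
  proof
    fix v assume v: "v \<in> closure (Range T)"
    have vH: "v \<in> H" using v closure_minimal[OF range H(1)] by blast
    obtain a where a: "v - (\<Sum>s\<in>S. a s *\<^sub>C s) \<in> Range T" using coef[OF vH] by blast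
    have "a s = 0" if s: "s \<in> S" for s
    proof (rule ccontr)
      assume "a s \<noteq> 0"
      \<comment> \<open>Elements \<open>r\<close> of the range near \<open>v\<close> would force the coefficients of \<open>v - r\<close>, which are those of \<open>v\<close>, to be small.\<close>
      define \<delta> where "\<delta> = cmod (a s) / (2 * C + 1)"
      have "\<delta> > 0" using \<open>a s \<noteq> 0\<close> C by (simp add: \<delta>_def)
      then obtain r where r: "r \<in> Range T" "dist r v < \<delta>" using v unfolding closure_approachable by blast
      have "v - r \<in> H" using vH r(1) range by (intro cvec.subspace_diff[OF H(2)]) auto
      from bounded[OF this] obtain u c where uc: "(u, v - r - (\<Sum>s\<in>S. c s *\<^sub>C s)) \<in> T"
        "\<forall>s\<in>S. cmod (c s) \<le> 2 * C * norm (v - r)" by (elim exE conjE)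
      have "(v - r - (\<Sum>s\<in>S. c s *\<^sub>C s)) + r \<in> Range T" using uc(1) r(1) by (intro R_add) auto
      then have "v - (\<Sum>s\<in>S. c s *\<^sub>C s) \<in> Range T" by (simp add: algebra_simps)
      from coef_unique[OF vH a this s] have "cmod (a s) \<le> 2 * C * norm (v - r)" using uc(2) s by simp
      also have "\<dots> \<le> 2 * C * \<delta>"
        using r(2) C by (intro mult_left_mono) (auto simp: dist_norm norm_minus_commute)
      also have "\<dots> < (2 * C + 1) * \<delta>" using \<open>\<delta> > 0\<close> by (simp add: distrib_right)
      also have "\<dots> = cmod (a s)" using C by (simp add: \<delta>_def)
      finally show False by simp
    qed
    then have "(\<Sum>s\<in>S. a s *\<^sub>C s) = 0" by (intro sum.neutral) auto
    then show "v \<in> Range T" using a by simp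
  qed
  then show ?thesis by (simp add: closure_subset_eq)
qed

section \<open>The index of the even part of the Dirac operator\<close>

lemma dim_injective_image:
  assumes f: "clinear f" and inj: "\<And>x. f x = 0 \<Longrightarrow> x = 0"
    and E: "cvec.subspace E" "finite_dimensional E"
  shows "cvec.dim (f ` E) = cvec.dim E"
proof -
  interpret fl: Vector_Spaces.linear scaleC scaleC f by (fact f)
  obtain B where B: "finite B" "cvec.independent B" "cvec.span B = E" "card B = cvec.dim E"
    by (rule finite_dimensional_basis[OF E])
  have i: "inj f" using inj fl.inj_iff_eq_0 by blast
  have "cvec.independent (f ` B)"
    by (rule fl.independent_injective_image[OF B(2)]) (rule inj_on_subset[OF i subset_UNIV])
  then have "cvec.dim (cvec.span (f ` B)) = card (f ` B)"
    by (rule cvec.dim_span_eq_card_independent)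
  also have "card (f ` B) = card B" by (rule card_image[OF inj_on_subset[OF i subset_UNIV]])
  finally show ?thesis using B(3,4) fl.span_image[of B] by simp
qed

locale represented_complex = graded_complex s d dadj V N
  for s :: "'t::complex_vector \<Rightarrow> 't \<Rightarrow> complex" and d dadj V N +
  fixes J :: "'t \<Rightarrow> 'h::complex_hilbert_space"
  assumes J_linear: "clinear J" and J_isometric: "cinner (J x) (J y) = s x y"
    and cohomology_finite: "finite_dimensional_quotient (cocyc k) (cob k)"
begin

definition dirac_graph where "dirac_graph = closure (range (\<lambda>x. (J x, J (D x))))"

lemma J_injective: "J x = 0 \<Longrightarrow> x = 0"
  using J_isometric[of x x] s_definite[of x] by (simp add: hilbert.s_zero)

text \<open>The closure of a symmetric operator is contained in its adjoint.\<close>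

lemma dirac_graph_symmetric:
  assumes "(u, v) \<in> dirac_graph"
  shows "cinner (J x) v = cinner (J (D x)) u"
proof -
  define A where "A = {p. cinner (J x) (snd p) = cinner (J (D x)) (fst p)}"
  have "closed A"
    unfolding A_def by (intro closed_Collect_eq continuous_cinner_right continuous_on_snd continuous_on_fst continuous_on_id)
  moreover have "range (\<lambda>x. (J x, J (D x))) \<subseteq> A"
    by (auto simp: A_def J_isometric D_symmetric)
  ultimately have "dirac_graph \<subseteq> A" unfolding dirac_graph_def by (intro closure_minimal)
  then show ?thesis using assms by (auto simp: A_def)
qed

lemma image_subspace: "cvec.subspace E \<Longrightarrow> cvec.subspace (J ` E)"
  by (rule subspace_image[OF J_linear])

text \<open>The algebraic decomposition \<open>G P = ker P \<oplus> D (G Q)\<close> is orthogonal with finite-dimensional first summand, so it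
  passes to closures.\<close>

lemma closure_decomposition:
  assumes PQ: "\<And>k. P k \<Longrightarrow> Q (Suc k)" "\<And>k. P (Suc k) \<Longrightarrow> Q k"
    and QP: "\<And>k. Q k \<Longrightarrow> P (Suc k)" "\<And>k. Q (Suc k) \<Longrightarrow> P k" and v: "v \<in> closure (J ` G P)"
  obtains k w where "k \<in> ker P" "w \<in> closure (J ` D ` G Q)" "v = J k + w"
proof -
  have K: "cvec.subspace (J ` ker P)" "finite_dimensional (J ` ker P)"
    by (rule image_subspace[OF ker_subspace],
        rule finite_dimensional_image[OF J_linear ker_finite_dimensional[OF cohomology_finite]])
  obtain p where p: "p \<in> J ` ker P" "\<And>x. x \<in> J ` ker P \<Longrightarrow> cinner x (v - p) = 0"
    by (rule hilbert.projection[OF K]) blast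
  then obtain k where k: "k \<in> ker P" "p = J k" by (elim imageE)
  have "v - p \<in> closure (J ` D ` G Q)"
    unfolding closure_approachable
  proof (intro allI impI)
    fix e :: real assume "e > 0"
    then obtain x where x: "x \<in> G P" "dist (J x) v < e" using v unfolding closure_approachable by blast
    obtain r y where ry: "r \<in> ker P" "y \<in> G Q" "x = r + D y"
      by (rule hodge_decomposition[where P = P and Q = Q, OF PQ QP x(1)])
    have o: "cinner (p - J r) ((v - p) - J (D y)) = 0"
    proof -
      have "p - J r = J (k - r)" by (simp add: k(2) clinear_diff[OF J_linear])
      moreover have kr: "k - r \<in> ker P" by (rule cvec.subspace_diff[OF ker_subspace k(1) ry(1)])
      ultimately have "cinner (p - J r) (v - p) = 0" using p(2)[of "J (k - r)"] by simp
      moreover have "cinner (J (k - r)) (J (D y)) = 0"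
        using kr by (simp add: J_isometric D_symmetric[symmetric] ker_def s_zero)
      ultimately show ?thesis using \<open>p - J r = J (k - r)\<close> by (simp add: hilbert.s_diff)
    qed
    have e: "(p - J r) + ((v - p) - J (D y)) = v - J x"
      by (simp add: ry(3) clinear_add[OF J_linear])
    have "(norm ((v - p) - J (D y)))\<^sup>2 \<le> (norm (v - J x))\<^sup>2"
      using pythagoras[OF o] zero_le_power2[of "norm (p - J r)"] unfolding e by linarith
    then have "norm ((v - p) - J (D y)) \<le> norm (v - J x)" by (rule power2_le_imp_le) simp
    also have "\<dots> < e" using x(2) by (simp add: dist_norm norm_minus_commute)
    finally have "dist (J (D y)) (v - p) < e" by (simp add: dist_norm norm_minus_commute)
    then show "\<exists>z\<in>J ` D ` G Q. dist z (v - p) < e" using ry(2) by blast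
  qed
  then show ?thesis using that[of k "v - p"] k by simp
qed

lemma parity: "even k \<Longrightarrow> odd (Suc k)" "even (Suc k) \<Longrightarrow> odd k" "odd k \<Longrightarrow> even (Suc k)" "odd (Suc k) \<Longrightarrow> even k"
  for k :: nat
  by simp_all

context
  fixes T H1 H2
  assumes T: "T = {(u, v) \<in> dirac_graph. u \<in> H1}" and H1: "H1 = closure (J ` G even)"
    and H2: "H2 = closure (J ` G odd)" and fred: "fredholm H1 H2 T"
begin

text \<open>An element of the kernel splits as \<open>J k + w\<close> with \<open>w\<close> in the closure of the image of \<open>D\<close>.  As the graph is
  symmetric, \<open>w\<close> is orthogonal to this image, so it vanishes.\<close>

lemma operator_kernel: "op_kernel T = J ` ker even"
proof
  show "J ` ker even \<subseteq> op_kernel T"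
  proof clarify
    fix k assume k: "k \<in> ker even"
    have "(J k, J (D k)) \<in> dirac_graph"
      unfolding dirac_graph_def by (rule subsetD[OF closure_subset]) blast
    moreover have "J k \<in> H1" unfolding H1 using k by (intro subsetD[OF closure_subset]) (auto simp: ker_def)
    ultimately show "J k \<in> op_kernel T"
      using k by (simp add: op_kernel_def T ker_def clinear_zero[OF J_linear])
  qed
  show "op_kernel T \<subseteq> J ` ker even"
  proof
    fix u assume "u \<in> op_kernel T"
    then have u: "(u, 0) \<in> dirac_graph" "u \<in> closure (J ` G even)" by (auto simp: op_kernel_def T H1)
    obtain k w where kw: "k \<in> ker even" "w \<in> closure (J ` D ` G odd)" "u = J k + w"
      by (rule closure_decomposition[where P = even and Q = odd, OF parity u(2)])
    have "cinner (J (D x)) w = 0" for x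
    proof -
      have "cinner (J (D x)) (J k) = 0"
        using kw(1) by (simp add: J_isometric D_symmetric ker_def s_zero)
      moreover have "cinner (J (D x)) u = 0"
        using dirac_graph_symmetric[OF u(1), of x] by (simp add: hilbert.s_zero)
      ultimately show ?thesis by (simp add: kw(3) cinner_add_right)
    qed
    then have "J ` D ` G odd \<subseteq> {z. cinner w z = 0}"
      using hilbert.s_sym_zero by blast
    moreover have "closed {z. cinner w z = 0}"
      by (intro closed_Collect_eq continuous_cinner_right continuous_on_const continuous_on_id)
    ultimately have "cinner w w = 0" using closure_minimal kw(2) by blast
    then have "w = 0" by (rule hilbert.s_definite)
    then show "u \<in> J ` ker even" using kw by simp
  qed
qed

lemma closed_operator:
  shows "T \<subseteq> H1 \<times> H2" "(0, 0) \<in> T" "closed T"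
    and "(u, v) \<in> T \<Longrightarrow> (u', v') \<in> T \<Longrightarrow> (u + u', v + v') \<in> T"
    and "(u, v) \<in> T \<Longrightarrow> (c *\<^sub>C u, c *\<^sub>C v) \<in> T"
    and "finite_dimensional_quotient H2 (Range T)"
  using fred unfolding fredholm_def closed_densely_defined_def by blast+

lemma H2_subspace: "cvec.subspace H2"
  unfolding H2 by (rule subspace_closure[OF image_subspace[OF G_subspace]])

lemma Range_subspace: "cvec.subspace (Range T)"
  by (rule cvec.subspaceI) (use closed_operator in blast)+

lemma Range_closed: "closed (Range T)"
proof -
  obtain S where "finite S" "quotient_basis S H2 (Range T)"
    using closed_operator(6) by (auto simp: finite_dimensional_quotient_def)
  moreover have "closed H2" by (simp add: H2)
  moreover have "Range T \<subseteq> H2" using closed_operator(1) by blast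
  ultimately show ?thesis
    using closed_operator H2_subspace by (intro closed_range_if_finite_codimension[of T H2 S]) auto
qed

text \<open>The range contains the image of \<open>D\<close> and is closed, so it contains the second summand of the closed decomposition.\<close>

lemma cokernel_decomposition: "H2 = {k + w |k w. k \<in> J ` ker odd \<and> w \<in> Range T}"
proof
  have R: "J ` D ` G even \<subseteq> Range T"
  proof clarify
    fix x assume x: "x \<in> G even"
    have "(J x, J (D x)) \<in> dirac_graph"
      unfolding dirac_graph_def by (rule subsetD[OF closure_subset]) blast
    moreover have "J x \<in> H1" unfolding H1 using x by (intro subsetD[OF closure_subset]) auto
    ultimately show "J (D x) \<in> Range T" by (auto simp: T)
  qed
  show "H2 \<subseteq> {k + w |k w. k \<in> J ` ker odd \<and> w \<in> Range T}"
  proof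
    fix v assume v: "v \<in> H2"
    obtain k w where "k \<in> ker odd" "w \<in> closure (J ` D ` G even)" "v = J k + w"
      by (rule closure_decomposition[where P = odd and Q = even, OF parity(3,4,1,2) v[unfolded H2]])
    moreover have "closure (J ` D ` G even) \<subseteq> Range T" by (rule closure_minimal[OF R Range_closed])
    ultimately show "v \<in> {k + w |k w. k \<in> J ` ker odd \<and> w \<in> Range T}" by blast
  qed
  have "J ` ker odd \<subseteq> H2"
    unfolding H2 by (rule subset_trans[OF _ closure_subset]) (auto simp: ker_def)
  then show "{k + w |k w. k \<in> J ` ker odd \<and> w \<in> Range T} \<subseteq> H2"
    using closed_operator(1) cvec.subspace_add[OF H2_subspace] by blast
qed

lemma kernel_cokernel_orthogonal: "J ` ker odd \<inter> Range T \<subseteq> {0}"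
proof clarify
  fix k u assume k: "k \<in> ker odd" and "(u, J k) \<in> T"
  then have "cinner (J k) (J k) = cinner (J (D k)) u"
    by (intro dirac_graph_symmetric) (simp add: T)
  also have "\<dots> = 0" using k by (simp add: ker_def clinear_zero[OF J_linear] hilbert.s_zero)
  finally show "J k = 0" by (rule hilbert.s_definite)
qed

lemma index_dim_ker: "fredholm_index H2 T = int (cvec.dim (ker even)) - int (cvec.dim (ker odd))"
proof -
  note fd = ker_finite_dimensional[OF cohomology_finite]
  have "quotient_dim H2 (Range T) = cvec.dim (J ` ker odd)"
    by (rule quotient_dim_complement(2)[OF image_subspace[OF ker_subspace] Range_subspace cokernel_decomposition
          kernel_cokernel_orthogonal closed_operator(6)])
  moreover have dims: "cvec.dim (J ` ker P) = cvec.dim (ker P)" for P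
    by (rule dim_injective_image[OF J_linear J_injective ker_subspace fd])
  ultimately show ?thesis unfolding fredholm_index_def operator_kernel by (simp only: dims)
qed

end

end

section \<open>Euler characteristics of covariant holomorphic modules\<close>

locale completed_module = cqh_module X F
  for X :: "('a::complex_star_algebra, 'b::complex_star_algebra, 'q::complex_star_algebra, 'w::complex_algebra_1) cqh_data"
    and F :: "('a, 'b, 'w, 'f::complex_vector, 't::complex_vector) module_data" +
  fixes J :: "'t \<Rightarrow> 'h::complex_hilbert_space"
  assumes completion: "is_L2_completion X F J"
begin

abbreviation ip where "ip \<equiv> module_inner X F"

lemma J_lin: "clinear J" and J_iso: "cinner (J x) (J y) = ip x y"
  using completion by (simp_all add: is_L2_completion_def)

text \<open>For \<open>x \<noteq> 0\<close> the element \<open>gT x x\<close> is a nonzero sum of terms \<open>b\<^sup>\<star> b\<close>, at which the Haar state is positive.\<close>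

lemma ip_definite_form: "definite_form ip"
proof
  show "cform ip" using inner_invariant by (simp add: invariant_form_def)
  show "ip x y = cnj (ip y x)" for x y
    unfolding J_iso[symmetric] by (rule cinner_commute)
  show "x = 0" if "ip x x = 0" for x
  proof (rule ccontr)
    assume "x \<noteq> 0"
    then have "gT x x \<in> positive_elements" by (rule weak_hermitian_form(4)[OF tensor_weak_hermitian])
    then obtain bs where bs: "gT x x \<noteq> 0" "gT x x = (\<Sum>b\<leftarrow>bs. b\<^sup>\<star> * b)" by (auto simp: positive_elements_def)
    have mult: "incl X (b * c) = incl X b * incl X c" for b c
      using incl_algebra_map by (simp add: algebra_map_def)
    have inc: "incl X (\<Sum>b\<leftarrow>bs. b\<^sup>\<star> * b) = (\<Sum>x\<leftarrow>map (incl X) bs. x\<^sup>\<star> * x)" for bs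
      by (induction bs) (simp_all add: clinear_zero[OF incl_linear] clinear_add[OF incl_linear] mult incl_star)
    have "Re (haar (hopf X) (\<Sum>x\<leftarrow>map (incl X) bs. x\<^sup>\<star> * x)) = 0"
      using that by (simp only: module_inner_def bs(2) inc) simp
    then have z: "incl X b = 0" if "b \<in> set bs" for b
      using haar_faithful_sum[of "map (incl X) bs" "incl X b"] that by simp
    have "b\<^sup>\<star> * b = 0" if "b \<in> set bs" for b
    proof -
      have "incl X b = incl X 0" using z[OF that] clinear_zero[OF incl_linear] by simp
      then have "b = 0" by (rule injD[OF incl_inj])
      then show ?thesis by simp
    qed
    then have m: "map (\<lambda>b. b\<^sup>\<star> * b) bs = map (\<lambda>b. 0) bs" by (intro map_cong HOL.refl)
    show False using bs unfolding m by (simp add: sum_list_0)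
  qed
qed

sublocale hm: hopf_module "hopf X" "incl X" "\<lambda>b. wd (emb X b)" \<delta>T
  by (rule tensor_hopf_module)

definition slices :: "('t \<Rightarrow> 't) set" where "slices = {\<lambda>x. slice \<phi> (\<delta>T x) |\<phi>. cfunctional \<phi>}"

sublocale op: commuting_operator ip slices dT
proof (intro commuting_operator.intro ip_definite_form commuting_operator_axioms.intro)
  show "clinear dT" by (rule delbarT_linear)
  show "(\<lambda>x. x) \<in> slices"
  proof -
    have "(\<lambda>x. x) = (\<lambda>x. slice (counit (hopf X)) (\<delta>T x))" by (simp add: left_comodule_counit[OF coactT_comodule])
    then show ?thesis unfolding slices_def using counit_linear by blast
  qed
  show "(\<lambda>x. p (r x)) \<in> slices" if p: "p \<in> slices" and r: "r \<in> slices" for p r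
  proof -
    obtain \<phi> \<psi> where f: "cfunctional \<phi>" "p = (\<lambda>x. slice \<phi> (\<delta>T x))" "cfunctional \<psi>" "r = (\<lambda>x. slice \<psi> (\<delta>T x))"
      using p r unfolding slices_def by blast
    have "(\<lambda>x. p (r x)) = (\<lambda>x. slice (convolution (hopf X) \<psi> \<phi>) (\<delta>T x))"
      unfolding f(2,4) by (rule ext, rule slice_slice[OF coactT_comodule comult_linear f(3,1)])
    then show ?thesis
      unfolding slices_def using convolution_functional[OF comult_linear f(3,1)] by blast
  qed
  show "clinear p" if "p \<in> slices" for p
    using that unfolding slices_def by (auto intro: clinear_compose[OF slice_linear coactT_linear])
  show "\<exists>p'\<in>slices. \<forall>x y. ip x (p y) = ip (p' x) y" if p: "p \<in> slices" for p
  proof -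
    obtain \<phi> where f: "cfunctional \<phi>" "p = (\<lambda>x. slice \<phi> (\<delta>T x))" using p unfolding slices_def by blast
    show ?thesis
    proof (rule bexI)
      show "\<forall>x y. ip x (p y) = ip (slice (adjoint_functional \<phi>) (\<delta>T x)) y"
        unfolding f(2) using invariant_form_slice[OF coactT_comodule inner_invariant f(1)] by blast
      show "(\<lambda>x. slice (adjoint_functional \<phi>) (\<delta>T x)) \<in> slices"
        unfolding slices_def using adjoint_functional[OF f(1)] by blast
    qed
  qed
  show "dT (p x) = p (dT x)" if "p \<in> slices" for p x
    using that unfolding slices_def by (auto simp: coactT_delbar slice_tmap[OF _ delbarT_linear])
  \<comment> \<open>The slices that kill all slices of \<open>Y\<close> include those along functionals vanishing on a certain finite set.\<close>
  show "finite_dimensional {y. \<forall>p\<in>slices. (\<forall>r\<in>slices. \<forall>x\<in>Y. p (r x) = 0) \<longrightarrow> p y = 0}" if Y: "finite Y" for Y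
  proof -
    have "\<forall>x. \<exists>S. finite S \<and> (\<forall>\<psi> \<phi>. cfunctional \<psi> \<longrightarrow> cfunctional \<phi> \<longrightarrow> (\<forall>s\<in>S. \<phi> s = 0) \<longrightarrow>
        slice (convolution (hopf X) \<psi> \<phi>) (\<delta>T x) = 0)"
    proof
      fix x
      obtain S where "finite S" "\<And>\<psi> \<phi>. cfunctional \<psi> \<Longrightarrow> cfunctional \<phi> \<Longrightarrow> (\<forall>s\<in>S. \<phi> s = 0) \<Longrightarrow>
          slice (convolution (hopf X) \<psi> \<phi>) (\<delta>T x) = 0"
        by (rule finite_coefficients[OF comult_linear, of "\<delta>T x"]) blast
      then show "\<exists>S. finite S \<and> (\<forall>\<psi> \<phi>. cfunctional \<psi> \<longrightarrow> cfunctional \<phi> \<longrightarrow> (\<forall>s\<in>S. \<phi> s = 0) \<longrightarrow>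
        slice (convolution (hopf X) \<psi> \<phi>) (\<delta>T x) = 0)" by blast
    qed
    from choice[OF this] obtain S where S: "\<forall>x. finite (S x) \<and> (\<forall>\<psi> \<phi>. cfunctional \<psi> \<longrightarrow> cfunctional \<phi> \<longrightarrow>
        (\<forall>s\<in>S x. \<phi> s = 0) \<longrightarrow> slice (convolution (hopf X) \<psi> \<phi>) (\<delta>T x) = 0)" ..
    have "finite (\<Union>x\<in>Y. S x)" using Y S by blast
    from hm.finite_dimensional_coefficients_in[OF this] show ?thesis
    proof (rule finite_dimensional_mono)
      show "{y. \<forall>p\<in>slices. (\<forall>r\<in>slices. \<forall>x\<in>Y. p (r x) = 0) \<longrightarrow> p y = 0} \<subseteq> hm.coefficients_in (\<Union>x\<in>Y. S x)"
        unfolding hm.coefficients_in_def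
      proof (intro subsetI CollectI allI impI)
        fix y and \<phi> :: "'a \<Rightarrow> complex"
        assume y: "y \<in> {y. \<forall>p\<in>slices. (\<forall>r\<in>slices. \<forall>x\<in>Y. p (r x) = 0) \<longrightarrow> p y = 0}"
          and \<phi>: "cfunctional \<phi>" "\<forall>s\<in>\<Union>x\<in>Y. S x. \<phi> s = 0"
        have p: "(\<lambda>x. slice \<phi> (\<delta>T x)) \<in> slices" unfolding slices_def using \<phi>(1) by blast
        have "slice \<phi> (\<delta>T (r x)) = 0" if r: "r \<in> slices" and x: "x \<in> Y" for r x
        proof -
          obtain \<psi> where \<psi>: "cfunctional \<psi>" "r = (\<lambda>x. slice \<psi> (\<delta>T x))" using r unfolding slices_def by blast
          show ?thesis
            unfolding \<psi>(2) slice_slice[OF coactT_comodule comult_linear \<psi>(1) \<phi>(1)]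
            using S[rule_format, THEN conjunct2, rule_format, OF \<psi>(1) \<phi>(1), of x] \<phi>(2) x by simp
        qed
        then have "\<forall>r\<in>slices. \<forall>x\<in>Y. slice \<phi> (\<delta>T (r x)) = 0" by simp
        from mp[OF bspec[OF CollectD[OF y] p] this] show "slice \<phi> (\<delta>T y) = 0" .
      qed
    qed
  qed
qed

lemma adj_delbar: "delbar_adjoint X F = op.adj"
  by (rule ext) (simp add: delbar_adjoint_def op.adj_def)

lemma TB_span_orthogonal:
  assumes "x \<in> cvec.span (\<Union>ab\<in>{ab. ab \<noteq> cd}. TB ab)" "y \<in> TB cd"
  shows "ip x y = 0"
  using assms(1)
proof (induction rule: cvec.span_induct_alt)
  case base
  show ?case by (rule op.s_zero)
next
  case (step c x z)
  then obtain ab where "ab \<noteq> cd" "x \<in> TB ab" by blast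
  then have "gT x y = 0" using metricT_orthogonal[of x "fst ab" "snd ab" y "fst cd" "snd cd"] assms(2) by auto
  then have "ip x y = 0" by (simp add: module_inner_def clinear_zero[OF incl_linear] cfunctional_zero[OF haar_linear])
  then show ?case using step(2) by (simp add: op.s_add_left op.s_scale_left)
qed

lemma delbar_TB_span:
  assumes "x \<in> cvec.span (\<Union>ab\<in>A. TB ab)" and "\<And>a b. (a, b) \<in> A \<Longrightarrow> (a, b + 1) \<noteq> cd"
  shows "dT x \<in> cvec.span (\<Union>ab\<in>{ab. ab \<noteq> cd}. TB ab)"
  using assms(1)
proof (induction rule: cvec.span_induct_alt)
  case base
  show ?case by (simp add: clinear_zero[OF delbarT_linear] cvec.span_zero)
next
  case (step c x z)
  then obtain a b where ab: "(a, b) \<in> A" "x \<in> TB (a, b)" by auto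
  have "dT x \<in> (\<Union>ab\<in>{ab. ab \<noteq> cd}. TB ab)"
    using delbarT_TB[OF ab(2)] assms(2)[OF ab(1)] by blast
  then have "dT x \<in> cvec.span (\<Union>ab\<in>{ab. ab \<noteq> cd}. TB ab)" by (rule cvec.span_base)
  then show ?case
    using step(2) unfolding delbarT_add clinear_scale[OF delbarT_linear] by (intro cvec.span_add cvec.span_scale)
qed

text \<open>The Dolbeault operator sends forms of other bidegrees than \<open>(0, k)\<close> to forms orthogonal to \<open>y\<close>; so the part \<open>u'\<close> of the
  adjoint at \<open>y\<close> in these bidegrees is orthogonal to itself.\<close>

lemma adj_TB:
  assumes y: "y \<in> TB (0, Suc k)"
  shows "op.adj y \<in> TB (0, k)"
proof -
  let ?W = "cvec.span (\<Union>ab\<in>{ab. ab \<noteq> (0, k)}. TB ab)"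
  have "op.adj y \<in> cvec.span (TB (0, k) \<union> (\<Union>ab\<in>{ab. ab \<noteq> (0, k)}. TB ab))"
  proof (rule subsetD[OF cvec.span_mono TB_total])
    show "(\<Union>ab. TB ab) \<subseteq> TB (0, k) \<union> (\<Union>ab\<in>{ab. ab \<noteq> (0, k)}. TB ab)"
    proof (rule UN_least)
      show "TB ab \<subseteq> TB (0, k) \<union> (\<Union>ab\<in>{ab. ab \<noteq> (0, k)}. TB ab)" for ab
        by (cases "ab = (0, k)") (simp_all, blast)
    qed
  qed
  then obtain u u' where u: "op.adj y = u + u'" "u \<in> TB (0, k)" "u' \<in> ?W"
    unfolding cvec.span_Un cvec.span_eq_iff[THEN iffD2, OF TB_subspace] by (elim CollectE exE conjE)
  have "ip u' (op.adj y) = ip (dT u') y" by (rule op.adj[symmetric])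
  also have "\<dots> = 0"
    by (rule TB_span_orthogonal[OF delbar_TB_span[OF u(3)] y]) auto
  finally have "ip u' u' = 0"
    using TB_span_orthogonal[OF u(3,2)] by (simp add: u(1) op.s_add_right)
  then have "u' = 0" by (rule op.s_definite)
  then have "op.adj y = u" using u(1) by simp
  then show ?thesis using u(2) by (simp only:)
qed

lemma adj_TB_0:
  assumes y: "y \<in> TB (0, 0)"
  shows "op.adj y = 0"
proof (rule op.adj_unique, rule allI)
  fix x
  have "dT x \<in> cvec.span (\<Union>ab\<in>{ab. ab \<noteq> (0, 0)}. TB ab)"
    by (rule delbar_TB_span[of x UNIV]) (use TB_total[of x] in auto)
  then show "ip (dT x) y = ip x 0" using TB_span_orthogonal[OF _ y] by (simp add: op.s_zero)
qed

lemma TB_graded_complex: "graded_complex ip dT op.adj (\<lambda>k. TB (0, k)) (2 * halfdeg X)"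
proof (intro graded_complex.intro ip_definite_form graded_complex_axioms.intro)
  show "clinear dT" by (rule delbarT_linear)
  show "ip (dT x) y = ip x (op.adj y)" for x y by (rule op.adj)
  show "dT (dT x) = 0" for x by (rule tensor_delbar_square)
  show "cvec.subspace (TB (0, k))" for k by (rule TB_subspace)
  show "dT x \<in> TB (0, Suc k)" if "x \<in> TB (0, k)" for x k using delbarT_TB[OF that] by simp
  show "op.adj x \<in> TB (0, k)" if "x \<in> TB (0, Suc k)" for x k by (rule adj_TB[OF that])
  show "op.adj x = 0" if "x \<in> TB (0, 0)" for x by (rule adj_TB_0[OF that])
  show "ip x y = 0" if "x \<in> TB (0, j)" "y \<in> TB (0, k)" "j \<noteq> k" for x y j k
  proof -
    have "x \<in> cvec.span (\<Union>ab\<in>{ab. ab \<noteq> (0, k)}. TB ab)"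
      by (rule cvec.span_base) (use that in auto)
    from TB_span_orthogonal[OF this that(2)] show ?thesis .
  qed
  show "x = 0" if "2 * halfdeg X < k" "x \<in> TB (0, k)" for x k by (rule TB_above[OF that])
  show "\<exists>E. cvec.subspace E \<and> finite_dimensional E \<and> x \<in> E \<and> (\<forall>y\<in>E. dT y \<in> E \<and> op.adj y \<in> E)" for x
    using op.env_subspace[of "{x}"] op.env_fd[of "{x}"] op.env_base[of x "{x}"] op.env_d[of _ "{x}"] op.adj_env[of "{x}"]
    by (intro exI[of _ "op.env {x}"]) auto
qed

sublocale gc: graded_complex ip dT op.adj "\<lambda>k. TB (0, k)" "2 * halfdeg X"
  by (rule TB_graded_complex)

lemma cocycles_eq: "cocycles X F = gc.cocyc"
  and coboundaries_eq: "coboundaries X F = gc.cob"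
  by (auto simp: fun_eq_iff cocycles_def gc.cocyc_def coboundaries_def gc.cob_def)

theorem index_eq_euler_characteristic:
  assumes fin: "\<And>k. finite_dimensional_quotient (cocycles X F k) (coboundaries X F k)"
    and fred: "fredholm (L2_even X F J) (L2_odd X F J) (dirac_plus X F J)"
  shows "fredholm_index (L2_odd X F J) (dirac_plus X F J) = euler_characteristic X F"
proof -
  interpret represented_complex ip dT op.adj "\<lambda>k. TB (0, k)" "2 * halfdeg X" J
    by (intro represented_complex.intro represented_complex_axioms.intro TB_graded_complex J_lin J_iso)
      (use fin in \<open>simp add: cocycles_eq coboundaries_eq\<close>)
  have T: "dirac_plus X F J = {(u, v) \<in> dirac_graph. u \<in> L2_even X F J}"
    by (simp add: dirac_plus_def dirac_def dirac_graph_def adj_delbar gc.D_def)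
  have H1: "L2_even X F J = closure (J ` gc.G even)" and H2: "L2_odd X F J = closure (J ` gc.G odd)"
    by (simp_all add: L2_even_def L2_odd_def gc.G_def)
  have "fredholm_index (L2_odd X F J) (dirac_plus X F J) =
      int (cvec.dim (gc.ker even)) - int (cvec.dim (gc.ker odd))"
    by (rule index_dim_ker[OF T H1 H2 fred])
  also have "\<dots> = euler_characteristic X F"
    unfolding euler_characteristic_def cocycles_eq coboundaries_eq
    by (rule gc.euler_ker[symmetric]) (use fin in \<open>simp add: cocycles_eq coboundaries_eq\<close>)
  finally show ?thesis .
qed

end

theorem proposition5p3:
  fixes X :: "('a::complex_star_algebra, 'b::complex_star_algebra, 'q::complex_star_algebra, 'w::complex_algebra_1) cqh_data"
    and F :: "('a, 'b, 'w, 'f::complex_vector, 't::complex_vector) module_data"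
    and J :: "'t \<Rightarrow> 'h::complex_hilbert_space"
  assumes "cqh_hermitian_space X"
    and "covariant_hermitian_holomorphic_module X F"
    and "is_L2_completion X F J"
    and "\<And>k. finite_dimensional_quotient (cocycles X F k) (coboundaries X F k)"
    and "fredholm (L2_even X F J) (L2_odd X F J) (dirac_plus X F J)"
  shows "fredholm_index (L2_odd X F J) (dirac_plus X F J) = euler_characteristic X F"
proof -
  interpret completed_module X F J
    using assms(1-3) by (intro completed_module.intro cqh_module.intro completed_module_axioms.intro)
  show ?thesis by (rule index_eq_euler_characteristic[OF assms(4,5)])
qed

end
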